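(* Suppose that $M$ is an $N\times N$ real symmetric random matrix satisfying the four spectral conditions (regularity of measure, rigidity of eigenvalues, linear statistics of the eigenvalues, Tracy--Widom limit of the largest eigenvalue) stated in the context, with limiting spectral measure $\nu$ supported on $[C_-,C_+]$ and edge constant $s_\nu$. Let $f:\mathbb R_+\to\mathbb R$ be a strongly convex $C^1$ function such that $f(x)/x\to\infty$ as $x\to\infty$. Set $\beta_c=\frac12\int_{C_-}^{C_+}\frac{d\nu(x)}{C_+-x}$. For $z\in\mathbb R$ let $\tau_z:=\operatorname{arg\,max}_{t\ge0}(tz-f(t))$ and $V(z):=z\tau_z-f(\tau_z)$. Let $\beta^*:=\beta_c/\tau_{C_+}$, with the convention $\beta^*=\infty$ when $\tau_{C_+}=0$. For $0<\beta\le\beta^*$ (with $\beta<\infty$) let $\widehat\gamma=\widehat\gamma(\beta)\ge C_+$ be the unique solution of $$\beta\tau_{\widehat\gamma}=\frac12\int_{C_-}^{C_+}\frac{d\nu(x)}{\widehat\gamma-x}.$$ For each $\beta>0$, assume moreover that $f$ admits a holomorphic extension to a complex neighborhood of the corresponding radial saddle point: a neighborhood of $\tau_{\widehat\gamma(\beta)}$ when $0<\beta<\beta^*$, and a neighborhood of $\tau_{C_+}$ when $\beta\ge\beta^*$. Let $$F_N(\beta)=\frac1N\log\int_{\mathbb R^N}\exp\Big\{\beta\sum_{i,j=1}^N M_{ij}v_iv_j-\beta Nf\Big(\frac1N\sum_{i=1}^N v_i^2\Big)\Big\}\prod_{i=1}^N dv_i .$$ Then the following hold as $N\to\infty$. (i)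 Define $$F(\beta)=\begin{cases}\beta V(\widehat\gamma)+\frac12\log\left(\frac{\pi}{\beta}\right)-\frac12\int_{C_-}^{C_+}\log(\widehat\gamma-x)\,d\nu(x), & 0<\beta\le\beta^*,\\[1ex] \beta V(C_+)+\frac12\log\left(\frac{\pi}{\beta}\right)-\frac12\int_{C_-}^{C_+}\log(C_+-x)\,d\nu(x), & \beta>\beta^*.\end{cases}$$ Then $F_N(\beta)\to F(\beta)$ in probability. (ii) If $0<\beta<\beta^*$, then $$N\bigl(F_N(\beta)-F(\beta)\bigr)\Rightarrow\mathcal N\bigl(\ell(\beta),\sigma^2(\beta)\bigr),$$ where $$\ell(\beta)=-\frac12\mathrm{Mean}(\varphi)-\frac12\log\left(1-\frac{f''(\tau_{\widehat\gamma})}{2\beta}\int_{C_-}^{C_+}\varphi''(x)\,d\nu(x)\right),\qquad \sigma^2(\beta)=\frac14\mathrm{Var}(\varphi),$$ and $\varphi$ is any compactly supported function that is analytic in a neighborhood of $[C_-,C_+]$ and agrees with $x\mapsto\log(\widehat\gamma-x)$ on that neighborhood. (iii) If $\beta>\beta^*$, then $$\frac{(s_\nu\pi N)^{2/3}}{\beta\tau_{C_+}-\beta_c}\bigl(F_N(\beta)-F(\beta)\bigr)\Rightarrow TW_1 .$$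
   Context: Notation. $\lambda_1\ge\cdots\ge\lambda_N$ are the eigenvalues of $M$. $\Rightarrow$ is convergence in distribution, $\mathcal N(m,s^2)$ the Gaussian law with mean $m$ and variance $s^2$, $TW_1$ the GOE Tracy--Widom distribution. $\mathbb R_+=[0,\infty)$. The letter $f$ also denotes its local holomorphic extension. Stochastic domination: for families $X=(X^{(N)}(u))$, $Y=(Y^{(N)}(u))$ of random variables, $u\in U^{(N)}$, $Y\ge0$, write $X\prec Y$ (uniformly in $u$) if for all small $\epsilon>0$ and large $D>0$ there is $N_0(\epsilon,D)$ with $\sup_{u}\mathbb P[|X^{(N)}(u)|>N^\epsilon Y^{(N)}(u)]\le N^{-D}$ for all $N\ge N_0(\epsilon,D)$. Spectral conditions on $M$: Regularity of measure. The empirical spectral measure $\nu_N=\frac1N\sum_{j}\delta_{\lambda_j}$ converges weakly in probability to a probability measure $\nu$ supported on an interval $[C_-,C_+]$, absolutely continuous, with density positive on $(C_-,C_+)$, and $\frac{d\nu}{dx}(x)=s_\nu\sqrt{C_+-x}\,(1+O(C_+-x))$ as $x\nearrow C_+$ for some $s_\nu>0$. Rigidity of eigenvalues. With $\widehat k=\min\{k,N+1-k\}$ and classical locations $\xi_k$ defined by $\int_{\xi_k}^\infty d\nu=\frac1N(k-\frac12)$, one has $|\lambda_k-\xi_k|\prec\widehat k^{-1/3}N^{-2/3}$ uniformly for $1\le k\le N$; moreover there is a constant $C>1$ independent of $N$ with $C^{-1}k^{2/3}N^{-2/3}\le C_+-\xi_k\le Ck^{2/3}N^{-2/3}$. Linear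 statistics of the eigenvalues. For every $\varphi:\mathbb R\to\mathbb R$ that is analytic in an open neighborhood of $[C_-,C_+]$ and has compact support, $\mathcal N_\varphi:=\sum_i\varphi(\lambda_i)-N\int_{C_-}^{C_+}\varphi\,d\nu$ converges in distribution to a Gaussian random variable, whose mean and variance are denoted $\mathrm{Mean}(\varphi)$ and $\mathrm{Var}(\varphi)$ and depend only on $\varphi$ restricted to the support of $\nu$. Tracy--Widom limit of the largest eigenvalue. $(s_\nu\pi)^{2/3}N^{2/3}(\lambda_1-C_+)$ converges in distribution to the GOE Tracy--Widom distribution. *)

theory Defs
  imports
    "HOL-Probability.Probability"
    "HOL-Complex_Analysis.Complex_Analysis"
    "HOL-Library.Landau_Symbols"
    "Jordan_Normal_Form.Char_Poly"
begin

section \<open>Modes of convergence\<close>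

text \<open>
  The size-$N$ objects live on a probability space \<^term>\<open>P N\<close> that may change with $N$.
  Convergence is understood for random variables and towards a probability law on the line, so
  measurability of the variables and \<^const>\<open>real_distribution\<close> for the limit are part of the
  definitions; without this the library's total measure operations would return junk values
  on non-measurable sets and functions.
\<close>

definition conv_in_prob :: "(nat \<Rightarrow> 'a measure) \<Rightarrow> (nat \<Rightarrow> 'a \<Rightarrow> real) \<Rightarrow> real \<Rightarrow> bool" where
  "conv_in_prob P X c \<longleftrightarrow>
     (\<forall>N. X N \<in> borel_measurable (P N)) \<and>
     (\<forall>\<epsilon>>0. (\<lambda>N. measure (P N) {\<omega> \<in> space (P N). \<bar>X N \<omega> - c\<bar> > \<epsilon>}) \<longlonglongrightarrow> 0)"

definition conv_in_distr :: "(nat \<Rightarrow> 'a measure) \<Rightarrow> (nat \<Rightarrow> 'a \<Rightarrow> real) \<Rightarrow> real measure \<Rightarrow> bool" where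
  "conv_in_distr P X \<mu> \<longleftrightarrow>
     (\<forall>N. X N \<in> borel_measurable (P N)) \<and> real_distribution \<mu> \<and>
     weak_conv_m (\<lambda>N. distr (P N) borel (X N)) \<mu>"

definition stoch_dom ::
    "(nat \<Rightarrow> 'a measure) \<Rightarrow> (nat \<Rightarrow> 'u set) \<Rightarrow> (nat \<Rightarrow> 'u \<Rightarrow> 'a \<Rightarrow> real) \<Rightarrow> (nat \<Rightarrow> 'u \<Rightarrow> 'a \<Rightarrow> real) \<Rightarrow> bool" where
  "stoch_dom P U X Y \<longleftrightarrow>
     (\<forall>N. \<forall>u\<in>U N. X N u \<in> borel_measurable (P N) \<and> Y N u \<in> borel_measurable (P N)) \<and>
     (\<forall>\<epsilon>>0. \<forall>D>0. \<exists>N0. \<forall>N\<ge>N0. \<forall>u\<in>U N.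
        measure (P N) {\<omega> \<in> space (P N). \<bar>X N u \<omega>\<bar> > real N powr \<epsilon> * Y N u \<omega>} \<le> real N powr (- D))"

section \<open>Limit laws\<close>

text \<open>As a law of $m + \sqrt{v}\,Z$, so that $v = 0$ gives the point mass at $m$.\<close>

definition gaussian :: "real \<Rightarrow> real \<Rightarrow> real measure" where
  "gaussian m v = distr std_normal_distribution borel (\<lambda>z. m + sqrt v * z)"

definition airy_Ai :: "real \<Rightarrow> real" where
  "airy_Ai x = Lim at_top (\<lambda>R. integral {0..R} (\<lambda>t. cos (t ^ 3 / 3 + x * t))) / pi"

text \<open>The Hastings--McLeod solution of the Painlev\'e II equation.\<close>

definition hastings_mcleod :: "real \<Rightarrow> real" where
  "hastings_mcleod = (THE q.
     (\<exists>q'. \<forall>x. (q has_real_derivative q' x) (at x) \<and>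
               (q' has_real_derivative x * q x + 2 * q x ^ 3) (at x)) \<and>
     q \<sim>[at_top] airy_Ai)"

definition TW1_cdf :: "real \<Rightarrow> real" where
  "TW1_cdf s = exp (- (LBINT x:{s..}. hastings_mcleod x + (x - s) * (hastings_mcleod x)\<^sup>2) / 2)"

definition TW1 :: "real measure" where
  "TW1 = interval_measure TW1_cdf"

section \<open>Random symmetric matrices and their spectra\<close>

definition random_symmetric_matrices :: "(nat \<Rightarrow> 'a measure) \<Rightarrow> (nat \<Rightarrow> 'a \<Rightarrow> real mat) \<Rightarrow> bool" where
  "random_symmetric_matrices P M \<longleftrightarrow>
     (\<forall>N. prob_space (P N) \<and>
          (\<forall>\<omega>\<in>space (P N). M N \<omega> \<in> carrier_mat N N \<and> transpose_mat (M N \<omega>) = M N \<omega>) \<and>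
          (\<forall>i<N. \<forall>j<N. (\<lambda>\<omega>. M N \<omega> $$ (i, j)) \<in> borel_measurable (P N)))"

text \<open>The $k$-th largest eigenvalue, with multiplicity, for $1 \le k \le N$.\<close>

definition eig :: "real mat \<Rightarrow> nat \<Rightarrow> real" where
  "eig A k = rev (sorted_list_of_multiset (proots (char_poly A))) ! (k - 1)"

definition emp_spec_measure :: "real mat \<Rightarrow> real measure" where
  "emp_spec_measure A = distr (uniform_count_measure {1..dim_row A}) borel (eig A)"

text \<open>
  The extension \<open>g\<close> has to agree with \<open>h\<close> only at real points of the domain \<open>D\<close> of \<open>h\<close>.
\<close>

definition holomorphic_extension_near :: "(real \<Rightarrow> real) \<Rightarrow> real set \<Rightarrow> real set \<Rightarrow> bool" where
  "holomorphic_extension_near h D S \<longleftrightarrow>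
     (\<exists>W g. open W \<and> complex_of_real ` S \<subseteq> W \<and> g holomorphic_on W \<and>
            (\<forall>x\<in>D. complex_of_real x \<in> W \<longrightarrow> g (complex_of_real x) = complex_of_real (h x)))"

text \<open>
  Compactly supported and analytic near $[C_-,C_+]$. Analyticity says nothing away from the
  interval, so Borel measurability is required for \<open>\<phi>\<close> of an eigenvalue to be a random variable.
\<close>

definition test_fun :: "real \<Rightarrow> real \<Rightarrow> (real \<Rightarrow> real) \<Rightarrow> bool" where
  "test_fun Cm Cp \<phi> \<longleftrightarrow>
     \<phi> \<in> borel_measurable borel \<and> compact (closure {x. \<phi> x \<noteq> 0}) \<and>
     holomorphic_extension_near \<phi> UNIV {Cm..Cp}"

section \<open>The spectral conditions\<close>

definition regular_limit_measure :: "real measure \<Rightarrow> real \<Rightarrow> real \<Rightarrow> real \<Rightarrow> bool" where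
  "regular_limit_measure \<nu> Cm Cp s \<longleftrightarrow>
     real_distribution \<nu> \<and> measure \<nu> {Cm..Cp} = 1 \<and> s > 0 \<and>
     (\<exists>\<rho>. \<rho> \<in> borel_measurable borel \<and> (\<forall>x. \<rho> x \<ge> 0) \<and>
          \<nu> = density lborel (\<lambda>x. ennreal (\<rho> x)) \<and>
          (\<forall>x\<in>{Cm<..<Cp}. \<rho> x > 0) \<and>
          (\<lambda>x. \<rho> x / (s * sqrt (Cp - x)) - 1) \<in> O[at_left Cp](\<lambda>x. Cp - x))"

definition regularity_of_measure ::
    "(nat \<Rightarrow> 'a measure) \<Rightarrow> (nat \<Rightarrow> 'a \<Rightarrow> real mat) \<Rightarrow> real measure \<Rightarrow> real \<Rightarrow> real \<Rightarrow> real \<Rightarrow> bool" where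
  "regularity_of_measure P M \<nu> Cm Cp s \<longleftrightarrow>
     regular_limit_measure \<nu> Cm Cp s \<and>
     (\<forall>g::real \<Rightarrow> real. continuous_on UNIV g \<and> bounded (range g) \<longrightarrow>
        conv_in_prob P (\<lambda>N \<omega>. LINT x|emp_spec_measure (M N \<omega>). g x) (LINT x|\<nu>. g x))"

definition classical_location :: "real measure \<Rightarrow> nat \<Rightarrow> nat \<Rightarrow> real" where
  "classical_location \<nu> N k = (THE \<xi>. measure \<nu> {\<xi>..} = (real k - 1 / 2) / real N)"

definition rigidity ::
    "(nat \<Rightarrow> 'a measure) \<Rightarrow> (nat \<Rightarrow> 'a \<Rightarrow> real mat) \<Rightarrow> real measure \<Rightarrow> real \<Rightarrow> bool" where
  "rigidity P M \<nu> Cp \<longleftrightarrow>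
     stoch_dom P (\<lambda>N. {1..N})
       (\<lambda>N k \<omega>. \<bar>eig (M N \<omega>) k - classical_location \<nu> N k\<bar>)
       (\<lambda>N k \<omega>. real (min k (N + 1 - k)) powr (- 1 / 3) * real N powr (- 2 / 3)) \<and>
     (\<exists>C>1. \<forall>N. \<forall>k\<in>{1..N}.
        inverse C * real k powr (2 / 3) * real N powr (- 2 / 3) \<le> Cp - classical_location \<nu> N k \<and>
        Cp - classical_location \<nu> N k \<le> C * real k powr (2 / 3) * real N powr (- 2 / 3))"

definition linear_statistics ::
    "(nat \<Rightarrow> 'a measure) \<Rightarrow> (nat \<Rightarrow> 'a \<Rightarrow> real mat) \<Rightarrow> real measure \<Rightarrow> real \<Rightarrow> real \<Rightarrow>
     ((real \<Rightarrow> real) \<Rightarrow> real) \<Rightarrow> ((real \<Rightarrow> real) \<Rightarrow> real) \<Rightarrow> bool" where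
  "linear_statistics P M \<nu> Cm Cp Mean Var \<longleftrightarrow>
     (\<forall>\<phi>. test_fun Cm Cp \<phi> \<longrightarrow> Var \<phi> \<ge> 0 \<and>
        conv_in_distr P
          (\<lambda>N \<omega>. (\<Sum>i=1..N. \<phi> (eig (M N \<omega>) i)) - real N * (LINT x:{Cm..Cp}|\<nu>. \<phi> x))
          (gaussian (Mean \<phi>) (Var \<phi>))) \<and>
     (\<forall>\<phi> \<psi>. test_fun Cm Cp \<phi> \<and> test_fun Cm Cp \<psi> \<and> (\<forall>x\<in>{Cm..Cp}. \<phi> x = \<psi> x) \<longrightarrow>
        Mean \<phi> = Mean \<psi> \<and> Var \<phi> = Var \<psi>)"

definition tracy_widom_limit ::
    "(nat \<Rightarrow> 'a measure) \<Rightarrow> (nat \<Rightarrow> 'a \<Rightarrow> real mat) \<Rightarrow> real \<Rightarrow> real \<Rightarrow> bool" where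
  "tracy_widom_limit P M Cp s \<longleftrightarrow>
     conv_in_distr P
       (\<lambda>N \<omega>. (s * pi) powr (2 / 3) * real N powr (2 / 3) * (eig (M N \<omega>) 1 - Cp)) TW1"

section \<open>The confining function and the free energy\<close>

definition C1_on_nonneg :: "(real \<Rightarrow> real) \<Rightarrow> bool" where
  "C1_on_nonneg f \<longleftrightarrow>
     (\<exists>f'. (\<forall>x\<ge>0. (f has_real_derivative f' x) (at x within {0..})) \<and> continuous_on {0..} f')"

definition strongly_convex_on :: "real set \<Rightarrow> (real \<Rightarrow> real) \<Rightarrow> bool" where
  "strongly_convex_on S f \<longleftrightarrow> (\<exists>m>0. convex_on S (\<lambda>x. f x - m / 2 * x\<^sup>2))"

definition tau :: "(real \<Rightarrow> real) \<Rightarrow> real \<Rightarrow> real" where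
  "tau f z = arg_max (\<lambda>t. t * z - f t) (\<lambda>t. 0 \<le> t)"

definition V :: "(real \<Rightarrow> real) \<Rightarrow> real \<Rightarrow> real" where
  "V f z = z * tau f z - f (tau f z)"

definition beta_c :: "real measure \<Rightarrow> real \<Rightarrow> real \<Rightarrow> real" where
  "beta_c \<nu> Cm Cp = 1 / 2 * (LINT x:{Cm..Cp}|\<nu>. 1 / (Cp - x))"

definition beta_star :: "(real \<Rightarrow> real) \<Rightarrow> real measure \<Rightarrow> real \<Rightarrow> real \<Rightarrow> ereal" where
  "beta_star f \<nu> Cm Cp =
     (if tau f Cp = 0 then \<infinity> else ereal (beta_c \<nu> Cm Cp / tau f Cp))"

definition gamma_hat :: "(real \<Rightarrow> real) \<Rightarrow> real measure \<Rightarrow> real \<Rightarrow> real \<Rightarrow> real \<Rightarrow> real" where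
  "gamma_hat f \<nu> Cm Cp \<beta> =
     (THE \<gamma>. \<gamma> \<ge> Cp \<and> \<beta> * tau f \<gamma> = 1 / 2 * (LINT x:{Cm..Cp}|\<nu>. 1 / (\<gamma> - x)))"

definition saddle :: "(real \<Rightarrow> real) \<Rightarrow> real measure \<Rightarrow> real \<Rightarrow> real \<Rightarrow> real \<Rightarrow> real" where
  "saddle f \<nu> Cm Cp \<beta> =
     (if ereal \<beta> < beta_star f \<nu> Cm Cp then tau f (gamma_hat f \<nu> Cm Cp \<beta>) else tau f Cp)"

text \<open>Matrix and vector indices run over \<open>{..<N}\<close>, where $N$ is the size of \<open>A\<close>.\<close>

definition free_energy :: "(real \<Rightarrow> real) \<Rightarrow> real \<Rightarrow> real mat \<Rightarrow> real" where
  "free_energy f \<beta> A = (let N = dim_row A in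
     1 / real N * ln (LINT v|(\<Pi>\<^sub>M i\<in>{..<N}. lborel).
        exp (\<beta> * (\<Sum>i<N. \<Sum>j<N. A $$ (i, j) * v i * v j)
             - \<beta> * real N * f (1 / real N * (\<Sum>i<N. (v i)\<^sup>2)))))"

definition limit_free_energy ::
    "(real \<Rightarrow> real) \<Rightarrow> real measure \<Rightarrow> real \<Rightarrow> real \<Rightarrow> real \<Rightarrow> real" where
  "limit_free_energy f \<nu> Cm Cp \<beta> =
     (if ereal \<beta> \<le> beta_star f \<nu> Cm Cp
      then \<beta> * V f (gamma_hat f \<nu> Cm Cp \<beta>) + 1 / 2 * ln (pi / \<beta>)
           - 1 / 2 * (LINT x:{Cm..Cp}|\<nu>. ln (gamma_hat f \<nu> Cm Cp \<beta> - x))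
      else \<beta> * V f Cp + 1 / 2 * ln (pi / \<beta>)
           - 1 / 2 * (LINT x:{Cm..Cp}|\<nu>. ln (Cp - x)))"

end

theory Submission
  imports Defs
begin

text \<open>
  The integral depends on \<open>M\<close> only through its eigenvalues. Since \<open>V z\<close> is the maximum of
  \<open>t z - f t\<close>, replacing \<open>f\<close> by its supporting line of slope \<open>z > \<lambda>\<^sub>1\<close> turns the integrand into a
  product of Gaussian weights \<open>exp (- \<beta> (z - \<lambda>\<^sub>k) v\<^sub>k\<^sup>2)\<close>; the error is the expectation under the
  corresponding product law of \<open>exp (- \<beta> N (V z - z R + f R))\<close>, where \<open>R\<close> is the average of
  the \<open>v\<^sub>k\<^sup>2\<close>.

  For \<open>\<beta> < \<beta>\<^sup>*\<close> take \<open>z\<close> to be the saddle point: then \<open>R\<close> has mean close to the maximiser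
  \<open>\<tau>\<^sub>z\<close> and Gaussian fluctuations, so the expectation converges to the Gaussian integral
  that produces the second logarithm in \<open>\<ell>\<close>, and the randomness comes from the linear
  statistic of \<open>ln (z - x)\<close>. For \<open>\<beta> \<ge> \<beta>\<^sup>*\<close> take \<open>z = \<lambda>\<^sub>1 + 1/N\<close>. The expectation is at most \<open>1\<close>;
  for the lower bound the top precisions are raised by a constant, so that by Markov's inequality
  the coordinates other than the first contribute at most their typical share to \<open>R\<close>, and the first
  coordinate supplies the deficit to \<open>\<tau>\<^sub>z\<close>. All estimates are deterministic on the event that the
  eigenvalues are rigid.
\<close>

section \<open>Quadratic forms and Gaussian integrals\<close>

text \<open>The top eigenvalue fluctuates on the scale N^(-2/3), so at low temperature the logarithm
  of the integral moves by N^(1/3) and errors only have to stay below that. This fixes the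
  exponents: rigidity is used with a loss of N^(1/20), and all errors are brought below N^(1/4). The
  obstacle is the edge. For \<open>z\<close> near \<open>Cp\<close> the sums of
  \<open>ln (z - l k)\<close> and \<open>1 / (z - l k)\<close> are singular, and rigidity does not
  separate the first few eigenvalues from one another. The shift by 1/N keeps every gap at least
  1/N, so each of the first N^(1/10) logarithms costs at most order ln N; beyond that index the
  displacement of an eigenvalue is small relative to its distance from the edge. The square root
  decay of the density makes the inverse distance to the edge integrable with room to spare, and
  this room gives the rates at which sums become integrals. At high temperature the singularity is
  absent, but the error must be o(1). This comes from a central limit theorem along deterministic
  sequences of rigid spectra, made uniform over spectra by contradiction.\<close>

lemma symmetric_eigenvalue_real:
  fixes A :: "real mat"
  assumes A: "A \<in> carrier_mat n n" and sym: "transpose_mat A = A"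
    and ev: "eigenvalue (map_mat complex_of_real A) e"
  shows "Im e = 0"
proof -
  let ?B = "map_mat complex_of_real A"
  obtain v where v: "v \<in> carrier_vec n" "v \<noteq> 0\<^sub>v n" "?B *\<^sub>v v = e \<cdot>\<^sub>v v"
    using ev A unfolding eigenvalue_def eigenvector_def by auto
  have row: "(\<Sum>j<n. complex_of_real (A $$ (i,j)) * vec_index v j) = e * vec_index v i" if "i < n" for i
  proof -
    have "(?B *\<^sub>v v) $ i = (e \<cdot>\<^sub>v v) $ i" using v by simp
    then show ?thesis using that A v(1)
      by (simp add: scalar_prod_def lessThan_atLeast0)
  qed
  have symij: "A $$ (i,j) = A $$ (j,i)" if "i < n" "j < n" for i j
    using sym A that by (metis carrier_matD index_transpose_mat(1))
  define S where "S = (\<Sum>i<n. \<Sum>j<n. cnj (vec_index v i) * (complex_of_real (A $$ (i,j)) * vec_index v j))"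
  define q where "q = (\<Sum>i<n. cnj (vec_index v i) * vec_index v i)"
  have S: "S = e * q"
    unfolding S_def q_def sum_distrib_left
  proof (rule sum.cong)
    fix i assume i: "i \<in> {..<n}"
    have "(\<Sum>j<n. cnj (vec_index v i) * (complex_of_real (A $$ (i,j)) * vec_index v j))
        = cnj (vec_index v i) * (\<Sum>j<n. complex_of_real (A $$ (i,j)) * vec_index v j)"
      by (simp add: sum_distrib_left)
    then show "(\<Sum>j<n. cnj (vec_index v i) * (complex_of_real (A $$ (i,j)) * vec_index v j)) = e * (cnj (vec_index v i) * vec_index v i)"
      using row i by simp
  qed simp
  have "cnj S = (\<Sum>i<n. \<Sum>j<n. vec_index v i * (complex_of_real (A $$ (i,j)) * cnj (vec_index v j)))"
    unfolding S_def by (simp add: cnj_sum)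
  also have "\<dots> = (\<Sum>j<n. \<Sum>i<n. vec_index v i * (complex_of_real (A $$ (i,j)) * cnj (vec_index v j)))"
    by (rule sum.swap)
  also have "\<dots> = S" unfolding S_def
    by (intro sum.cong refl) (simp add: symij algebra_simps)
  finally have "cnj S = S" .
  have q: "q = complex_of_real (\<Sum>i<n. (cmod (vec_index v i))\<^sup>2)"
    unfolding q_def of_real_sum
    by (intro sum.cong refl) (metis complex_norm_square mult.commute)
  have "(\<Sum>i<n. (cmod (vec_index v i))\<^sup>2) \<noteq> 0"
  proof
    assume "(\<Sum>i<n. (cmod (vec_index v i))\<^sup>2) = 0"
    then have "\<forall>i<n. vec_index v i = 0" by (subst (asm) sum_nonneg_eq_0_iff) auto
    then have "v = 0\<^sub>v n" using v(1) by (intro eq_vecI) auto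
    with v show False by simp
  qed
  moreover have "Im S = 0" using \<open>cnj S = S\<close> by (metis Reals_cnj_iff complex_is_Real_iff)
  ultimately show ?thesis unfolding S q by simp
qed

text \<open>The complex characteristic polynomial splits and its roots are real, so the real
  polynomial with these roots has the same image under \<open>complex_of_real\<close>, which is
  injective on coefficients.\<close>

lemma symmetric_char_poly:
  fixes A :: "real mat"
  assumes A: "A \<in> carrier_mat n n" and sym: "transpose_mat A = A"
  shows "\<exists>rs. char_poly A = (\<Prod>r\<leftarrow>rs. [:- r, 1:]) \<and> length rs = n"
proof -
  let ?B = "map_mat complex_of_real A"
  have B: "?B \<in> carrier_mat n n" using A by auto
  obtain as where as: "char_poly ?B = (\<Prod>a\<leftarrow>as. [:- a, 1:])" "length as = n"
    using char_poly_factorized[OF B] by auto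
  have re: "a = complex_of_real (Re a)" if "a \<in> set as" for a
  proof -
    have "poly (char_poly ?B) a = 0" unfolding as(1)
      using that by (auto simp: poly_prod_list prod_list_zero_iff)
    then have "eigenvalue ?B a" using eigenvalue_root_char_poly[OF B] by simp
    then show ?thesis using symmetric_eigenvalue_real[OF A sym] by (simp add: complex_eq_iff)
  qed
  have h: "map_poly complex_of_real (\<Prod>r\<leftarrow>map Re xs. [:- r, 1:]) = (\<Prod>a\<leftarrow>xs. [:- a, 1:])"
    if "set xs \<subseteq> set as" for xs
    using that
  proof (induction xs)
    case (Cons x xs)
    have "map_poly complex_of_real [:- Re x, 1:] = [:- x, 1:]"
      using re[of x] Cons by (simp add: map_poly_pCons)
    moreover have "map_poly complex_of_real (p * q) = map_poly complex_of_real p * map_poly complex_of_real q" for p q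
      by (intro poly_eqI) (simp add: coeff_map_poly coeff_mult)
    ultimately show ?case using Cons by (simp del: map_poly_pCons mult_pCons_left mult_pCons_right)
  qed simp
  have "map_poly complex_of_real (char_poly A) = char_poly ?B"
    by (rule of_real_hom.char_poly_hom[OF A, symmetric])
  also have "\<dots> = map_poly complex_of_real (\<Prod>r\<leftarrow>map Re as. [:- r, 1:])"
    using h[of as] as by simp
  finally have "char_poly A = (\<Prod>r\<leftarrow>map Re as. [:- r, 1:])"
    by (metis (no_types, lifting) coeff_map_poly of_real_0 of_real_eq_iff poly_eqI)
  then show ?thesis using as(2) by (intro exI[of _ "map Re as"]) simp
qed

text \<open>\<open>eig\<close> is defined through a sorted list of polynomial roots. These two facts
  give it the expected meaning: all roots are real and counted with multiplicity, and the index runs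
  from the largest down.\<close>

lemma char_poly_eig:
  fixes A :: "real mat"
  assumes A: "A \<in> carrier_mat n n" and sym: "transpose_mat A = A"
  shows "char_poly A = (\<Prod>k=1..n. [:- eig A k, 1:])"
    and "1 \<le> j \<Longrightarrow> j \<le> k \<Longrightarrow> k \<le> n \<Longrightarrow> eig A k \<le> eig A j"
proof -
  obtain rs where rs: "char_poly A = (\<Prod>r\<leftarrow>rs. [:- r, 1:])" "length rs = n"
    using symmetric_char_poly[OF A sym] by auto
  have "proots (\<Prod>r\<leftarrow>rs. [:- r, 1:]) = mset rs"
  proof (induction rs)
    case (Cons r rs)
    have "(\<Prod>r\<leftarrow>rs. [:- r, 1:]) \<noteq> 0" by (auto simp: prod_list_zero_iff)
    then show ?case using Cons by (simp add: proots_mult del: mult_pCons_left mult_pCons_right)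
  qed simp
  then have eig: "eig A k = rev (sort rs) ! (k - 1)" for k
    unfolding eig_def rs(1) by simp
  let ?ss = "rev (sort rs)"
  have "(\<Prod>r\<leftarrow>rs. [:- r, 1:]) = prod_mset (image_mset (\<lambda>r. [:- r, 1:]) (mset rs))"
    by (metis mset_map prod_mset_prod_list)
  also have "mset rs = mset ?ss" by simp
  also have "prod_mset (image_mset (\<lambda>r. [:- r, 1:]) (mset ?ss)) = (\<Prod>r\<leftarrow>?ss. [:- r, 1:])"
    by (metis mset_map prod_mset_prod_list)
  also have "\<dots> = (\<Prod>i<n. [:- (?ss ! i), 1:])"
    by (subst prod.list_conv_set_nth) (simp add: rs lessThan_atLeast0)
  also have "\<dots> = (\<Prod>k=1..n. [:- eig A k, 1:])"
    by (rule prod.reindex_bij_witness[of _ "\<lambda>k. k - 1" Suc]) (auto simp: eig)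
  finally show "char_poly A = (\<Prod>k=1..n. [:- eig A k, 1:])" using rs by simp
  show "eig A k \<le> eig A j" if "1 \<le> j" "j \<le> k" "k \<le> n"
  proof -
    have "sorted (sort rs)" by simp
    then show ?thesis unfolding eig using that rs(2)
      by (subst (1 2) rev_nth) (auto intro!: sorted_nth_mono)
  qed
qed

section \<open>Quadratic forms: positivity and coercivity\<close>

definition quad_form :: "real mat \<Rightarrow> (nat \<Rightarrow> real) \<Rightarrow> real" where
  "quad_form A v = (\<Sum>i<dim_row A. \<Sum>j<dim_row A. A $$ (i, j) * v i * v j)"

definition pos_def :: "nat \<Rightarrow> real mat \<Rightarrow> bool" where
  "pos_def n A \<longleftrightarrow> A \<in> carrier_mat n n \<and> transpose_mat A = A \<and>
     (\<forall>v. (\<exists>i<n. v i \<noteq> 0) \<longrightarrow> quad_form A v > 0)"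

lemma pos_def_sym:
  assumes "A \<in> carrier_mat n n" "transpose_mat A = A" "i < n" "j < n"
  shows "A $$ (i, j) = A $$ (j, i)"
  using assms by (metis carrier_matD index_transpose_mat(1))

lemma quad_form_add_scalar:
  assumes "A \<in> carrier_mat n n"
  shows "quad_form (A + t \<cdot>\<^sub>m 1\<^sub>m n) v = quad_form A v + t * (\<Sum>i<n. (v i)\<^sup>2)"
proof -
  have "quad_form (A + t \<cdot>\<^sub>m 1\<^sub>m n) v
      = (\<Sum>i<n. \<Sum>j<n. A $$ (i,j) * v i * v j + (if i = j then t * (v i)\<^sup>2 else 0))"
    unfolding quad_form_def using assms
    by (auto intro!: sum.cong simp: algebra_simps power2_eq_square)
  also have "\<dots> = quad_form A v + (\<Sum>i<n. \<Sum>j<n. (if i = j then t * (v i)\<^sup>2 else 0))"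
    unfolding quad_form_def using assms by (simp add: sum.distrib)
  also have "(\<Sum>i<n. \<Sum>j<n. (if i = j then t * (v i)\<^sup>2 else 0)) = t * (\<Sum>i<n. (v i)\<^sup>2)"
    by (simp add: sum.delta sum_distrib_left)
  finally show ?thesis .
qed

lemma sum_mult_square_bound:
  fixes C :: "nat \<Rightarrow> nat \<Rightarrow> real"
  shows "\<bar>\<Sum>i<n. \<Sum>j<n. C i j * v i * v j\<bar> \<le> (\<Sum>i<n. \<Sum>j<n. \<bar>C i j\<bar>) * (\<Sum>i<n. (v i)\<^sup>2)"
proof -
  have b: "\<bar>v i * v j\<bar> \<le> (\<Sum>i<n. (v i)\<^sup>2)" if "i < n" "j < n" for i j
  proof -
    have *: "(v k)\<^sup>2 \<le> (\<Sum>i<n. (v i)\<^sup>2)" if "k < n" for k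
      using that by (intro member_le_sum) auto
    have "\<bar>v i * v j\<bar> \<le> ((v i)\<^sup>2 + (v j)\<^sup>2) / 2"
      using sum_squares_bound[of "v i" "v j"] sum_squares_bound[of "v i" "- v j"] by (simp add: abs_le_iff)
    then show ?thesis using *[of i] *[of j] that by simp
  qed
  have "\<bar>\<Sum>i<n. \<Sum>j<n. C i j * v i * v j\<bar> \<le> (\<Sum>i<n. \<Sum>j<n. \<bar>C i j * v i * v j\<bar>)"
    by (intro order.trans[OF sum_abs] sum_mono sum_abs)
  also have "\<dots> \<le> (\<Sum>i<n. \<Sum>j<n. \<bar>C i j\<bar> * (\<Sum>i<n. (v i)\<^sup>2))"
    using b by (intro sum_mono) (auto simp: abs_mult mult.assoc intro!: mult_left_mono)
  finally show ?thesis by (simp add: sum_distrib_right)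
qed

lemma psd_cauchy_schwarz:
  fixes q b r :: real
  assumes "\<And>t. q + 2 * t * b + t\<^sup>2 * r \<ge> 0" and "r \<ge> 0"
  shows "b\<^sup>2 \<le> q * r"
proof (cases "r = 0")
  case True
  have "b = 0"
  proof (rule ccontr)
    assume "b \<noteq> 0"
    \<comment> \<open>With \<open>r = 0\<close> the expression is affine in \<open>t\<close>, and
      this \<open>t\<close> gives it the value -1.\<close>
    then show False using assms(1)[of "- (q + 1) / (2 * b)"] True by (simp add: field_simps)
  qed
  then show ?thesis using True by simp
next
  case False
  then have r: "r > 0" using assms(2) by simp
  have "0 \<le> r * (q + 2 * (- b / r) * b + (- b / r)\<^sup>2 * r)"
    using assms(1)[of "- b / r"] r by simp
  also have "\<dots> = q * r - b\<^sup>2" using r by (simp add: field_simps power2_eq_square)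
  finally show ?thesis by simp
qed

text \<open>For w = A v, Cauchy-Schwarz for the form q gives |w|^4 = <v, A w>^2 <= q(v) q(w) <= a
  q(v) |w|^2, so q(v) controls |A v|^2. Multiplying by the inverse matrix turns this into control of
  |v|^2; neither eigenvectors nor compactness of the sphere enter.\<close>

lemma psd_nonsingular_coercive:
  assumes A: "A \<in> carrier_mat n n" and sym: "transpose_mat A = A"
    and psd: "\<And>v. quad_form A v \<ge> 0" and det: "det A \<noteq> 0"
  shows "\<exists>c>0. \<forall>v. quad_form A v \<ge> c * (\<Sum>i<n. (v i)\<^sup>2)"
proof -
  obtain B where B: "B \<in> carrier_mat n n" "B * A = 1\<^sub>m n"
    using det_non_zero_imp_unit[OF A det] unfolding Units_def by (auto simp: ring_mat_def)
  define b where "b = (\<Sum>i<n. \<Sum>k<n. (B $$ (i,k))\<^sup>2)"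
  define a where "a = (\<Sum>i<n. \<Sum>j<n. \<bar>A $$ (i,j)\<bar>)"
  have a0: "a \<ge> 0" and b0: "b \<ge> 0" unfolding a_def b_def by (auto intro!: sum_nonneg)
  have main: "(\<Sum>i<n. (v i)\<^sup>2) \<le> b * (a * quad_form A v)" for v
  proof -
    define w where "w i = (\<Sum>j<n. A $$ (i,j) * v j)" for i
    define W where "W = (\<Sum>i<n. (w i)\<^sup>2)"
    have W0: "W \<ge> 0" unfolding W_def by (auto intro!: sum_nonneg)
    have vB: "v i = (\<Sum>k<n. B $$ (i,k) * w k)" if i: "i < n" for i
    proof -
      have "(\<Sum>k<n. B $$ (i,k) * w k) = (\<Sum>j<n. (\<Sum>k<n. B $$ (i,k) * A $$ (k,j)) * v j)"
        unfolding w_def sum_distrib_left sum_distrib_right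
        by (subst sum.swap) (simp add: mult.assoc)
      also have "\<dots> = (\<Sum>j<n. (if i = j then 1 else 0) * v j)"
      proof (rule sum.cong)
        fix j assume "j \<in> {..<n}"
        then have "(B * A) $$ (i,j) = (\<Sum>k<n. B $$ (i,k) * A $$ (k,j))"
          using A B(1) i by (simp add: scalar_prod_def lessThan_atLeast0)
        then show "(\<Sum>k<n. B $$ (i,k) * A $$ (k,j)) * v j = (if i = j then 1 else 0) * v j"
          using B(2) i \<open>j \<in> _\<close> by simp
      qed simp
      also have "\<dots> = (\<Sum>j<n. if i = j then v j else 0)" by (rule sum.cong) auto
      also have "\<dots> = v i" using i by (simp add: sum.delta)
      finally show ?thesis by simp
    qed
    have "(\<Sum>i<n. (v i)\<^sup>2) \<le> (\<Sum>i<n. (\<Sum>k<n. (B $$ (i,k))\<^sup>2) * W)"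
      unfolding W_def
    proof (rule sum_mono)
      fix i assume "i \<in> {..<n}"
      then show "(v i)\<^sup>2 \<le> (\<Sum>k<n. (B $$ (i,k))\<^sup>2) * (\<Sum>i<n. (w i)\<^sup>2)"
        using Cauchy_Schwarz_ineq_sum[of "\<lambda>k. B $$ (i,k)" w "{..<n}"] vB[of i] by simp
    qed
    also have "\<dots> = b * W" unfolding b_def by (simp add: sum_distrib_right)
    finally have 1: "(\<Sum>i<n. (v i)\<^sup>2) \<le> b * W" .
    have vAw: "(\<Sum>i<n. \<Sum>j<n. A $$ (i,j) * v i * w j) = W"
    proof -
      have "(\<Sum>i<n. \<Sum>j<n. A $$ (i,j) * v i * w j) = (\<Sum>j<n. \<Sum>i<n. A $$ (j,i) * v i * w j)"
        by (subst sum.swap) (intro sum.cong refl, auto simp: pos_def_sym[OF A sym])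
      also have "\<dots> = W" unfolding W_def
        by (intro sum.cong refl) (simp add: w_def power2_eq_square sum_distrib_right)
      finally show ?thesis .
    qed
    have wAv: "(\<Sum>i<n. \<Sum>j<n. A $$ (i,j) * w i * v j) = W"
    proof -
      have "(\<Sum>j<n. A $$ (i,j) * w i * v j) = w i * (\<Sum>j<n. A $$ (i,j) * v j)" for i
        unfolding sum_distrib_left by (intro sum.cong refl) simp
      then show ?thesis unfolding W_def w_def[symmetric] by (simp add: power2_eq_square)
    qed
    have dim: "dim_row A = n" using A by simp
    have "quad_form A v + 2 * t * W + t\<^sup>2 * quad_form A w = quad_form A (\<lambda>i. v i + t * w i)" for t
    proof -
      have "quad_form A (\<lambda>i. v i + t * w i) = (\<Sum>i<n. \<Sum>j<n. A $$ (i,j) * v i * v j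
          + t * (A $$ (i,j) * v i * w j) + t * (A $$ (i,j) * w i * v j) + t\<^sup>2 * (A $$ (i,j) * w i * w j))"
        unfolding quad_form_def dim
        by (intro sum.cong refl) (simp add: algebra_simps power2_eq_square)
      also have "\<dots> = quad_form A v + t * W + t * W + t\<^sup>2 * quad_form A w"
        unfolding sum.distrib sum_distrib_left[symmetric] vAw wAv quad_form_def dim by simp
      finally show ?thesis by simp
    qed
    then have "W\<^sup>2 \<le> quad_form A v * quad_form A w"
      by (intro psd_cauchy_schwarz) (auto simp: psd)
    also have "\<dots> \<le> quad_form A v * (a * W)"
    proof (intro mult_left_mono psd)
      show "quad_form A w \<le> a * W"
        using sum_mult_square_bound[of "\<lambda>i j. A $$ (i,j)" w n]
        unfolding quad_form_def dim a_def W_def by linarith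
    qed
    finally have "W * W \<le> (a * quad_form A v) * W" by (simp add: power2_eq_square algebra_simps)
    then have "W \<le> a * quad_form A v"
      using W0 a0 psd[of v] by (cases "W = 0") (auto simp: mult_le_cancel_right)
    then have "b * W \<le> b * (a * quad_form A v)" using b0 by (rule mult_left_mono)
    with 1 show ?thesis by simp
  qed
  show ?thesis
  \<comment> \<open>The summand 1 keeps the constant positive in dimension 0, where \<open>a\<close>
    and \<open>b\<close> vanish.\<close>
  proof (intro exI[of _ "1 / (b * a + 1)"] conjI allI)
    show "1 / (b * a + 1) > 0" using a0 b0 by (simp add: add_nonneg_pos)
    fix v
    have ba: "b * a + 1 > 0" using a0 b0 by (simp add: add_nonneg_pos)
    have "(\<Sum>i<n. (v i)\<^sup>2) \<le> quad_form A v * (b * a + 1)"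
      using main[of v] psd[of v] by (simp add: algebra_simps)
    then show "1 / (b * a + 1) * (\<Sum>i<n. (v i)\<^sup>2) \<le> quad_form A v"
      using pos_divide_le_eq[OF ba] by simp
  qed
qed

text \<open>The infimum of the shifts making the form nonnegative cannot be positive: there the form
  would be nonnegative and nonsingular, hence coercive, and could be shifted further down.\<close>

lemma pos_def_if_det_nonzero:
  assumes A: "A \<in> carrier_mat n n" and sym: "transpose_mat A = A"
    and det: "\<And>t. t \<ge> 0 \<Longrightarrow> det (A + t \<cdot>\<^sub>m 1\<^sub>m n) \<noteq> 0"
  shows "pos_def n A"
proof -
  define T where "T = {t. t \<ge> 0 \<and> (\<forall>v. quad_form A v + t * (\<Sum>i<n. (v i)\<^sup>2) \<ge> 0)}"
  define t0 where "t0 = Inf T"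
  have "(\<Sum>i<n. \<Sum>j<n. \<bar>A $$ (i,j)\<bar>) \<in> T"
    unfolding T_def
  proof (intro CollectI conjI allI)
    fix v show "quad_form A v + (\<Sum>i<n. \<Sum>j<n. \<bar>A $$ (i,j)\<bar>) * (\<Sum>i<n. (v i)\<^sup>2) \<ge> 0"
      using sum_mult_square_bound[of "\<lambda>i j. A $$ (i,j)" v n] A unfolding quad_form_def
      by (simp add: abs_le_iff)
  qed (auto intro!: sum_nonneg)
  then have ne: "T \<noteq> {}" by auto
  have bdd: "bdd_below T" by (rule bdd_belowI[of _ 0]) (auto simp: T_def)
  have t0: "t0 \<ge> 0" unfolding t0_def by (rule cInf_greatest[OF ne]) (auto simp: T_def)
  have psd: "quad_form A v + t0 * (\<Sum>i<n. (v i)\<^sup>2) \<ge> 0" for v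
  proof (cases "(\<Sum>i<n. (v i)\<^sup>2) = 0")
    case True
    obtain x where "x \<in> T" using ne by auto
    then have "quad_form A v + x * (\<Sum>i<n. (v i)\<^sup>2) \<ge> 0" by (auto simp: T_def)
    then show ?thesis unfolding True by simp
  next
    case False
    then have S: "(\<Sum>i<n. (v i)\<^sup>2) > 0" by (simp add: order.strict_iff_order sum_nonneg)
    have "- quad_form A v / (\<Sum>i<n. (v i)\<^sup>2) \<le> t0" unfolding t0_def
    proof (rule cInf_greatest[OF ne])
      fix x assume "x \<in> T"
      then have "quad_form A v + x * (\<Sum>i<n. (v i)\<^sup>2) \<ge> 0" by (auto simp: T_def)
      then show "- quad_form A v / (\<Sum>i<n. (v i)\<^sup>2) \<le> x" by (subst pos_divide_le_eq[OF S]) simp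
    qed
    then show ?thesis using S by (simp add: field_simps)
  qed
  let ?B = "A + t0 \<cdot>\<^sub>m 1\<^sub>m n"
  have B: "?B \<in> carrier_mat n n" using A by simp
  have symB: "transpose_mat ?B = ?B" using A sym
    by (intro eq_matI) (auto simp: pos_def_sym[OF A sym])
  obtain c where c: "c > 0" "\<And>v. quad_form ?B v \<ge> c * (\<Sum>i<n. (v i)\<^sup>2)"
    using psd_nonsingular_coercive[OF B symB _ det[OF t0]] psd
    unfolding quad_form_add_scalar[OF A] by auto
  have c': "quad_form A v + (t0 - c) * (\<Sum>i<n. (v i)\<^sup>2) \<ge> 0" for v
    using c(2)[of v] unfolding quad_form_add_scalar[OF A] by (simp add: algebra_simps)
  have "max 0 (t0 - c) \<in> T"
    unfolding T_def
  proof (intro CollectI conjI allI)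
    fix v
    have "(t0 - c) * (\<Sum>i<n. (v i)\<^sup>2) \<le> max 0 (t0 - c) * (\<Sum>i<n. (v i)\<^sup>2)"
      by (intro mult_right_mono) (auto intro!: sum_nonneg)
    then show "quad_form A v + max 0 (t0 - c) * (\<Sum>i<n. (v i)\<^sup>2) \<ge> 0" using c'[of v] by linarith
  qed simp
  then have "t0 \<le> max 0 (t0 - c)"
    using cInf_lower[OF _ bdd] unfolding t0_def by blast
  then have "t0 = 0" using c(1) t0 by auto
  show ?thesis unfolding pos_def_def
  proof (intro conjI A sym allI impI)
    fix v :: "nat \<Rightarrow> real" assume "\<exists>i<n. v i \<noteq> 0"
    then obtain i where "i < n" "v i \<noteq> 0" by auto
    then have "0 < (\<Sum>i<n. (v i)\<^sup>2)" by (intro sum_pos2[of _ i]) auto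
    then have "0 < c * (\<Sum>i<n. (v i)\<^sup>2)" using c(1) by simp
    also have "\<dots> \<le> quad_form A v" using c'[of v] \<open>t0 = 0\<close> by (simp add: algebra_simps)
    finally show "quad_form A v > 0" .
  qed
qed

section \<open>Gaussian integrals by elimination of the last variable\<close>

lemma nn_integral_gaussian:
  fixes a m :: real assumes a: "a > 0"
  shows "(\<integral>\<^sup>+y. ennreal (exp (- a * (y - m)\<^sup>2)) \<partial>lborel) = ennreal (sqrt (pi / a))"
proof -
  define \<sigma> where "\<sigma> = 1 / sqrt (2 * a)"
  have s: "\<sigma> > 0" "\<sigma>\<^sup>2 = 1 / (2 * a)" using a unfolding \<sigma>_def by (auto simp: power_divide)
  have eq: "exp (- a * (y - m)\<^sup>2) = sqrt (pi / a) * normal_density m \<sigma> y" for y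
    using a unfolding normal_density_def s(2) by (simp add: real_sqrt_divide)
  interpret prob_space "density lborel (normal_density m \<sigma>)" by (rule prob_space_normal_density[OF s(1)])
  have "(\<integral>\<^sup>+y. ennreal (normal_density m \<sigma> y) \<partial>lborel) = 1"
    using emeasure_space_1 by (simp add: emeasure_density)
  then show ?thesis unfolding eq using a
    by (simp add: ennreal_mult nn_integral_cmult)
qed

abbreviation lebN :: "nat \<Rightarrow> (nat \<Rightarrow> real) measure" where
  "lebN n \<equiv> \<Pi>\<^sub>M i\<in>{..<n}. lborel"

interpretation lborel_product: product_sigma_finite "\<lambda>i::nat. lborel :: real measure" ..

lemma measurable_quad_form [measurable]:
  assumes "A \<in> carrier_mat n n"
  shows "quad_form A \<in> borel_measurable (lebN n)"
proof -
  have "dim_row A = n" using assms by simp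
  then show ?thesis unfolding quad_form_def[abs_def] by simp
qed

text \<open>The last index is eliminated, so that the remaining indices are again
  \<open>{..<n}\<close> and the induction matches \<open>product_nn_integral_insert\<close>.\<close>

definition schur :: "nat \<Rightarrow> real mat \<Rightarrow> real mat" where
  "schur n A = mat n n (\<lambda>(i, j). A $$ (i, j) - A $$ (i, n) * A $$ (j, n) / A $$ (n, n))"

lemma schur_carrier [simp]: "schur n A \<in> carrier_mat n n"
  by (simp add: schur_def)

lemma quad_form_cong:
  assumes "A \<in> carrier_mat n n" "\<And>i. i < n \<Longrightarrow> v i = w i"
  shows "quad_form A v = quad_form A w"
  unfolding quad_form_def using assms by (auto intro!: sum.cong)

lemma quad_form_schur:
  assumes A: "A \<in> carrier_mat (Suc n) (Suc n)" and sym: "transpose_mat A = A"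
    and a: "A $$ (n, n) \<noteq> 0"
  shows "quad_form A v = quad_form (schur n A) v
    + A $$ (n, n) * (v n + (\<Sum>i<n. A $$ (i, n) * v i) / A $$ (n, n))\<^sup>2"
proof -
  define a where "a = A $$ (n, n)"
  define B where "B = (\<Sum>i<n. A $$ (i, n) * v i)"
  have B2: "(\<Sum>j<n. A $$ (n, j) * v n * v j) = v n * B"
    unfolding B_def sum_distrib_left
    by (intro sum.cong refl) (use pos_def_sym[OF A sym] in auto)
  have B1: "(\<Sum>i<n. A $$ (i, n) * v i * v n) = v n * B"
    unfolding B_def sum_distrib_left by (intro sum.cong refl) simp
  have BB: "(\<Sum>i<n. \<Sum>j<n. A $$ (i, n) * A $$ (j, n) / a * v i * v j) = B\<^sup>2 / a"
    unfolding B_def power2_eq_square sum_product sum_divide_distrib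
    by (intro sum.cong refl) simp
  have "quad_form A v = (\<Sum>i<n. \<Sum>j<n. A $$ (i, j) * v i * v j) + 2 * (v n * B) + a * (v n)\<^sup>2"
    unfolding quad_form_def using A B1 B2
    by (simp add: sum.distrib a_def power2_eq_square)
  also have "(\<Sum>i<n. \<Sum>j<n. A $$ (i, j) * v i * v j) = quad_form (schur n A) v + B\<^sup>2 / a"
  proof -
    have "A $$ (i, j) * v i * v j = schur n A $$ (i, j) * v i * v j
        + A $$ (i, n) * A $$ (j, n) / a * v i * v j" if "i < n" "j < n" for i j
      using that by (simp add: schur_def a_def algebra_simps)
    then have "(\<Sum>i<n. \<Sum>j<n. A $$ (i, j) * v i * v j) = (\<Sum>i<n. \<Sum>j<n. schur n A $$ (i, j) * v i * v j
        + A $$ (i, n) * A $$ (j, n) / a * v i * v j)" by (intro sum.cong refl) auto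
    then show ?thesis
      unfolding sum.distrib BB quad_form_def by (simp add: schur_def)
  qed
  also have "quad_form (schur n A) v + B\<^sup>2 / a + 2 * (v n * B) + a * (v n)\<^sup>2
      = quad_form (schur n A) v + a * (v n + B / a)\<^sup>2"
    using assms(3) unfolding a_def[symmetric] by (simp add: field_simps power2_eq_square)
  finally show ?thesis unfolding a_def B_def .
qed

text \<open>Block elimination writes \<open>A\<close> as a unipotent block matrix times a block
  lower triangular one, whose diagonal blocks are the Schur complement and the last diagonal
  entry.\<close>

lemma det_schur:
  assumes A: "A \<in> carrier_mat (Suc n) (Suc n)" and sym: "transpose_mat A = A"
    and a: "A $$ (n, n) \<noteq> 0"
  shows "det A = A $$ (n, n) * det (schur n A)"
proof -
  define b where "b = mat n 1 (\<lambda>(i, j). A $$ (i, n) / A $$ (n, n))"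
  define c where "c = mat 1 n (\<lambda>(i, j). A $$ (j, n))"
  define d where "d = mat 1 1 (\<lambda>(i, j). A $$ (n, n))"
  let ?L = "four_block_mat (1\<^sub>m n) b (0\<^sub>m 1 n) (1\<^sub>m 1)"
  let ?T = "four_block_mat (schur n A) (0\<^sub>m n 1) c d"
  have car: "b \<in> carrier_mat n 1" "c \<in> carrier_mat 1 n" "d \<in> carrier_mat 1 1"
    by (auto simp: b_def c_def d_def)
  have "?L * ?T = four_block_mat (schur n A + b * c) (b * d) c d"
    using car by (subst mult_four_block_mat[of _ n n _ 1 _ 1])
      (auto simp: left_mult_one_mat[OF schur_carrier] left_mult_zero_mat[OF schur_carrier]
        left_add_zero_mat[OF car(2)[unfolded One_nat_def]])
  also have "\<dots> = A"
  proof (rule eq_matI)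
    fix i j assume "i < dim_row A" "j < dim_col A"
    then have ij: "i \<le> n" "j \<le> n" using A by auto
    have "A $$ (n, j) = A $$ (j, n)" if "j < n" using pos_def_sym[OF A sym] that by auto
    then show "four_block_mat (schur n A + b * c) (b * d) c d $$ (i, j) = A $$ (i, j)"
      using ij A a by (auto simp: b_def c_def d_def schur_def scalar_prod_def not_less le_antisym)
  qed (use A in \<open>auto simp: b_def c_def d_def schur_def\<close>)
  finally have LT: "?L * ?T = A" .
  have L: "?L \<in> carrier_mat (Suc n) (Suc n)" and T: "?T \<in> carrier_mat (Suc n) (Suc n)"
    using car four_block_carrier_mat[of "1\<^sub>m n" n n "1\<^sub>m 1" 1 1]
      four_block_carrier_mat[of "schur n A" n n d 1 1] by auto
  have "det A = det ?L * det ?T" using det_mult[OF L T] LT by simp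
  also have "det ?L = 1"
    using car by (subst det_four_block_mat_lower_left_zero[of _ n _ 1]) auto
  also have "det ?T = det (schur n A) * det d"
    using car by (subst det_four_block_mat_upper_right_zero[of _ n _ 1]) auto
  also have "det d = A $$ (n, n)" by (simp add: d_def det_single)
  finally show ?thesis by simp
qed

lemma pos_def_schur:
  assumes "pos_def (Suc n) A"
  shows "A $$ (n, n) > 0" and "pos_def n (schur n A)"
proof -
  have A: "A \<in> carrier_mat (Suc n) (Suc n)" and sym: "transpose_mat A = A"
    and pd: "\<And>v. \<exists>i<Suc n. v i \<noteq> 0 \<Longrightarrow> quad_form A v > 0"
    using assms unfolding pos_def_def by auto
  have "quad_form A (\<lambda>i. if i = n then 1 else 0) = A $$ (n, n)"
    unfolding quad_form_def using A by (simp add: if_distrib[of "\<lambda>x. _ * x"] sum.delta cong: if_cong)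
  then show a: "A $$ (n, n) > 0"
    using pd[of "\<lambda>i. if i = n then 1 else 0"] by (metis lessI zero_neq_one)
  show "pos_def n (schur n A)"
    unfolding pos_def_def
  proof (intro conjI allI impI)
    show "transpose_mat (schur n A) = schur n A"
      by (intro eq_matI) (auto simp: schur_def pos_def_sym[OF A sym])
    fix v :: "nat \<Rightarrow> real" assume v: "\<exists>i<n. v i \<noteq> 0"
    \<comment> \<open>The last coordinate is the minimiser for given \<open>v\<close>, which makes
      the completed square vanish.\<close>
    define w where "w i = (if i < n then v i else - (\<Sum>i<n. A $$ (i, n) * v i) / A $$ (n, n))" for i
    have "\<exists>i<Suc n. w i \<noteq> 0" using v unfolding w_def by (metis less_Suc_eq)
    then have "0 < quad_form A w" by (rule pd)
    also have "\<dots> = quad_form (schur n A) w"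
      using a by (subst quad_form_schur[OF A sym]) (auto simp: w_def)
    also have "\<dots> = quad_form (schur n A) v"
      by (rule quad_form_cong[OF schur_carrier]) (simp add: w_def)
    finally show "quad_form (schur n A) v > 0" .
  qed simp
qed

text \<open>With the other coordinates fixed, the last one contributes a Gaussian integral whose
  value does not depend on its centre. What remains is the form of the Schur complement, and
  \<open>det_schur\<close> splits the determinant in the same way.\<close>

lemma gaussian_integral:
  assumes "pos_def n A"
  shows "det A > 0"
    and "(\<integral>\<^sup>+v. ennreal (exp (- quad_form A v)) \<partial>lebN n) = ennreal (sqrt (pi ^ n / det A))"
proof -
  have "det A > 0 \<and> (\<integral>\<^sup>+v. ennreal (exp (- quad_form A v)) \<partial>lebN n) = ennreal (sqrt (pi ^ n / det A))"
    using assms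
  proof (induction n arbitrary: A)
    case 0
    then have "A \<in> carrier_mat 0 0" by (auto simp: pos_def_def)
    then show ?case by (simp add: quad_form_def PiM_empty nn_integral_count_space_finite)
  next
    case (Suc n)
    note a = pos_def_schur(1)[OF Suc.prems] and S = Suc.IH[OF pos_def_schur(2)[OF Suc.prems]]
    have A: "A \<in> carrier_mat (Suc n) (Suc n)" and sym: "transpose_mat A = A"
      using Suc.prems unfolding pos_def_def by auto
    let ?a = "A $$ (n, n)" and ?S = "schur n A"
    have det: "det A = ?a * det ?S" using det_schur[OF A sym] a by simp
    note [measurable] = measurable_quad_form[OF A, unfolded lessThan_Suc]
    have meas: "(\<lambda>v. ennreal (exp (- quad_form A v))) \<in> borel_measurable (\<Pi>\<^sub>M i\<in>insert n {..<n}. lborel)"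
      by measurable
    have "(\<integral>\<^sup>+v. ennreal (exp (- quad_form A v)) \<partial>lebN (Suc n))
        = (\<integral>\<^sup>+x. \<integral>\<^sup>+y. ennreal (exp (- quad_form A (x(n := y)))) \<partial>lborel \<partial>lebN n)"
      unfolding lessThan_Suc
      by (rule lborel_product.product_nn_integral_insert) (auto intro: meas)
    also have "\<dots> = (\<integral>\<^sup>+x. ennreal (exp (- quad_form ?S x)) * ennreal (sqrt (pi / ?a)) \<partial>lebN n)"
    proof (rule nn_integral_cong)
      fix x :: "nat \<Rightarrow> real"
      let ?m = "- (\<Sum>i<n. A $$ (i, n) * x i) / ?a"
      have "exp (- quad_form A (x(n := y))) = exp (- quad_form ?S x) * exp (- ?a * (y - ?m)\<^sup>2)" for y
      proof -
        have "quad_form ?S (x(n := y)) = quad_form ?S x"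
          by (rule quad_form_cong[OF schur_carrier]) simp
        then show ?thesis using a unfolding exp_add[symmetric]
          by (subst quad_form_schur[OF A sym]) auto
      qed
      then show "(\<integral>\<^sup>+y. ennreal (exp (- quad_form A (x(n := y)))) \<partial>lborel)
          = ennreal (exp (- quad_form ?S x)) * ennreal (sqrt (pi / ?a))"
        by (simp add: ennreal_mult nn_integral_cmult nn_integral_gaussian[OF a, of ?m, simplified])
    qed
    also have "\<dots> = ennreal (sqrt (pi ^ n / det ?S)) * ennreal (sqrt (pi / ?a))"
      using S measurable_quad_form[OF schur_carrier[of n A]] by (simp add: nn_integral_multc)
    also have "\<dots> = ennreal (sqrt (pi ^ Suc n / det A))"
      using S a unfolding det
      by (simp add: ennreal_mult[symmetric] real_sqrt_mult[symmetric] mult.commute)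
    finally show ?case using S a det by simp
  qed
  then show "det A > 0"
    "(\<integral>\<^sup>+v. ennreal (exp (- quad_form A v)) \<partial>lebN n) = ennreal (sqrt (pi ^ n / det A))" by auto
qed

text \<open>On a bounded interval the characteristic function is the limit of its Taylor sums, by
  domination with \<open>exp \<bar>t\<bar>\<close>, and these sums are determined by the
  moments.\<close>

lemma real_distribution_eqI_moments:
  fixes M1 M2 :: "real measure"
  assumes M1: "real_distribution M1" "AE x in M1. x \<in> {0..1}"
    and M2: "real_distribution M2" "AE x in M2. x \<in> {0..1}"
    and eq: "\<And>k::nat. (LINT x|M1. x ^ k) = (LINT x|M2. x ^ k)"
  shows "M1 = M2"
proof (rule Levy_uniqueness[OF M1(1) M2(1)])
  have lim: "(\<lambda>n. \<Sum>k\<le>n. (\<i> * t) ^ k / fact k * complex_of_real (LINT x|M. x ^ k)) \<longlonglongrightarrow> char M t"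
    if M: "real_distribution M" "AE x in M. x \<in> {0..1}" for M and t :: real
  proof -
    interpret real_distribution M by (rule M(1))
    have int: "integrable M (\<lambda>x. complex_of_real (x ^ k))" for k :: nat
    proof (rule integrable_const_bound[where B = 1])
      show "AE x in M. norm (complex_of_real (x ^ k)) \<le> 1"
        using M(2) by eventually_elim (simp add: norm_power power_le_one)
    qed simp
    have "(\<lambda>n. LINT x|M. (\<Sum>k\<le>n. (\<i> * t * x) ^ k /\<^sub>R fact k)) \<longlonglongrightarrow> (LINT x|M. exp (\<i> * t * x))"
    proof (rule integral_dominated_convergence[where w = "\<lambda>x. exp \<bar>t\<bar>"])
      show "AE x in M. (\<lambda>n. \<Sum>k\<le>n. (\<i> * t * x) ^ k /\<^sub>R fact k) \<longlonglongrightarrow> exp (\<i> * t * x)"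
        by (intro AE_I2) (use exp_converges in \<open>auto simp: sums_def_le\<close>)
      show "AE x in M. norm (\<Sum>k\<le>n. (\<i> * t * x) ^ k /\<^sub>R fact k) \<le> exp \<bar>t\<bar>" for n
        using M(2)
      proof eventually_elim
        case (elim x)
        have "norm (\<Sum>k\<le>n. (\<i> * t * x) ^ k /\<^sub>R fact k) \<le> (\<Sum>k\<le>n. \<bar>t\<bar> ^ k /\<^sub>R fact k)"
        proof (intro order.trans[OF norm_sum] sum_mono)
          fix k
          have "norm (\<i> * t * x) \<le> \<bar>t\<bar>" using elim by (auto simp: norm_mult intro: mult_left_le)
          then show "norm ((\<i> * t * x) ^ k /\<^sub>R fact k) \<le> \<bar>t\<bar> ^ k /\<^sub>R fact k"
            by (auto simp: norm_power intro!: mult_left_mono power_mono)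
        qed
        also have "\<dots> \<le> (\<Sum>k. \<bar>t\<bar> ^ k /\<^sub>R fact k)"
          by (intro sum_le_suminf summable_exp_generic) auto
        finally show ?case by (simp add: exp_def)
      qed
    qed auto
    moreover have "(LINT x|M. (\<Sum>k\<le>n. (\<i> * t * x) ^ k /\<^sub>R fact k))
        = (\<Sum>k\<le>n. (\<i> * t) ^ k / fact k * complex_of_real (LINT x|M. x ^ k))" for n
    proof -
      have "(LINT x|M. (\<Sum>k\<le>n. (\<i> * t * x) ^ k /\<^sub>R fact k))
          = (LINT x|M. (\<Sum>k\<le>n. (\<i> * t) ^ k / fact k * complex_of_real (x ^ k)))"
        by (intro Bochner_Integration.integral_cong refl sum.cong)
           (simp add: power_mult_distrib scaleR_conv_of_real field_simps)
      also have "\<dots> = (\<Sum>k\<le>n. LINT x|M. (\<i> * t) ^ k / fact k * complex_of_real (x ^ k))"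
        by (intro Bochner_Integration.integral_sum integrable_mult_right int)
      finally show ?thesis
        by (simp add: Bochner_Integration.integral_mult_right_zero integral_complex_of_real del: of_real_power)
    qed
    ultimately show ?thesis unfolding char_def by (simp add: mult.assoc)
  qed
  show "char M1 = char M2"
  proof
    fix t show "char M1 t = char M2 t"
      using LIMSEQ_unique[OF lim[OF M1, of t, unfolded eq] lim[OF M2, of t]] .
  qed
qed

lemma pos_def_add_scalar:
  assumes "pos_def n A" "t \<ge> 0"
  shows "pos_def n (A + t \<cdot>\<^sub>m 1\<^sub>m n)"
proof -
  have A: "A \<in> carrier_mat n n" and sym: "transpose_mat A = A"
    and pd: "\<And>v. \<exists>i<n. v i \<noteq> 0 \<Longrightarrow> quad_form A v > 0"
    using assms(1) unfolding pos_def_def by auto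
  show ?thesis unfolding pos_def_def
  proof (intro conjI allI impI)
    show "transpose_mat (A + t \<cdot>\<^sub>m 1\<^sub>m n) = A + t \<cdot>\<^sub>m 1\<^sub>m n"
      using A by (intro eq_matI) (auto simp: pos_def_sym[OF A sym])
    fix v :: "nat \<Rightarrow> real" assume "\<exists>i<n. v i \<noteq> 0"
    then show "quad_form (A + t \<cdot>\<^sub>m 1\<^sub>m n) v > 0"
      unfolding quad_form_add_scalar[OF A] using assms(2) pd
      by (intro add_pos_nonneg) (auto intro!: mult_nonneg_nonneg sum_nonneg)
  qed (use A in auto)
qed

section \<open>The law of the squared length under a Gaussian measure\<close>

abbreviation sqn :: "nat \<Rightarrow> (nat \<Rightarrow> real) \<Rightarrow> real" where
  "sqn n v \<equiv> (\<Sum>i<n. (v i)\<^sup>2)"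

text \<open>The law of exp (- |v|^2) rather than of |v|^2: it lives on [0,1], where moments
  determine a law, and its k-th moment is a Gaussian integral with \<open>A\<close> shifted by k,
  hence the square root of a ratio of determinants.\<close>

definition gauss_radial :: "nat \<Rightarrow> real mat \<Rightarrow> real measure" where
  "gauss_radial n A = distr (density (lebN n)
     (\<lambda>v. ennreal (exp (- quad_form A v) / sqrt (pi ^ n / det A)))) borel (\<lambda>v. exp (- sqn n v))"

lemma gauss_radial:
  assumes pd: "pos_def n A"
  shows "real_distribution (gauss_radial n A)" and "AE x in gauss_radial n A. x \<in> {0..1}"
    and "(LINT x|gauss_radial n A. x ^ k) = sqrt (det A / det (A + real k \<cdot>\<^sub>m 1\<^sub>m n))"
proof -
  have A: "A \<in> carrier_mat n n" using pd unfolding pos_def_def by auto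
  note [measurable] = measurable_quad_form[OF A]
  note g = gaussian_integral[OF pd]
  define c where "c = sqrt (pi ^ n / det A)"
  have c: "c > 0" unfolding c_def using g(1) by simp
  define D where "D = density (lebN n) (\<lambda>v. ennreal (exp (- quad_form A v) / c))"
  have D: "gauss_radial n A = distr D borel (\<lambda>v. exp (- sqn n v))"
    unfolding gauss_radial_def D_def c_def ..
  have "(\<integral>\<^sup>+v. ennreal (exp (- quad_form A v) / c) \<partial>lebN n)
      = (\<integral>\<^sup>+v. ennreal (exp (- quad_form A v)) * ennreal (1 / c) \<partial>lebN n)"
    using c by (intro nn_integral_cong) (simp add: ennreal_mult[symmetric])
  also have "\<dots> = ennreal c * ennreal (1 / c)"
    by (subst nn_integral_multc) (auto simp: g(2) c_def[symmetric])
  also have "\<dots> = 1" using c by (simp add: ennreal_mult[symmetric])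
  finally have "prob_space D"
    unfolding D_def by (intro prob_spaceI) (simp add: emeasure_density)
  then interpret D: prob_space D .
  have [measurable]: "(\<lambda>v. exp (- sqn n v)) \<in> borel_measurable D"
    unfolding D_def by measurable
  interpret G: prob_space "gauss_radial n A"
    unfolding D by (intro D.prob_space_distr) measurable
  show "real_distribution (gauss_radial n A)"
    by standard (simp_all add: D)
  show "AE x in gauss_radial n A. x \<in> {0..1}"
    unfolding D by (subst AE_distr_iff) (auto intro!: AE_I2 sum_nonneg)
  note pdk = pos_def_add_scalar[OF pd, of "real k"]
  have pos: "det (A + real k \<cdot>\<^sub>m 1\<^sub>m n) > 0" using gaussian_integral(1)[OF pdk] by simp
  have "(LINT x|gauss_radial n A. x ^ k) = (LINT v|D. exp (- sqn n v) ^ k)"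
    unfolding D by (subst integral_distr) auto
  also have "\<dots> = enn2real (\<integral>\<^sup>+v. ennreal (exp (- sqn n v) ^ k) \<partial>D)"
    by (intro integral_eq_nn_integral) auto
  also have "(\<integral>\<^sup>+v. ennreal (exp (- sqn n v) ^ k) \<partial>D)
     = (\<integral>\<^sup>+v. ennreal (exp (- quad_form A v) / c) * ennreal (exp (- sqn n v) ^ k) \<partial>lebN n)"
    unfolding D_def by (subst nn_integral_density) auto
  also have "\<dots> = (\<integral>\<^sup>+v. ennreal (exp (- quad_form (A + real k \<cdot>\<^sub>m 1\<^sub>m n) v)) * ennreal (1 / c) \<partial>lebN n)"
  proof (rule nn_integral_cong)
    fix v
    have "exp (- sqn n v) ^ k = exp (- (real k * sqn n v))"
      by (metis exp_of_nat_mult mult_minus_right)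
    then have "exp (- quad_form A v) / c * exp (- sqn n v) ^ k
        = exp (- quad_form (A + real k \<cdot>\<^sub>m 1\<^sub>m n) v) * (1 / c)"
      unfolding quad_form_add_scalar[OF A] by (simp add: exp_add[symmetric])
    then show "ennreal (exp (- quad_form A v) / c) * ennreal (exp (- sqn n v) ^ k)
        = ennreal (exp (- quad_form (A + real k \<cdot>\<^sub>m 1\<^sub>m n) v)) * ennreal (1 / c)"
      using c by (simp only: ennreal_mult[symmetric] exp_ge_zero zero_le_power divide_nonneg_pos zero_le_divide_1_iff less_imp_le)
  qed
  also have "\<dots> = ennreal (sqrt (pi ^ n / det (A + real k \<cdot>\<^sub>m 1\<^sub>m n))) * ennreal (1 / c)"
    using measurable_quad_form[of "A + real k \<cdot>\<^sub>m 1\<^sub>m n" n] A gaussian_integral(2)[OF pdk]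
    by (subst nn_integral_multc) auto
  also have "\<dots> = ennreal (sqrt (det A / det (A + real k \<cdot>\<^sub>m 1\<^sub>m n)))"
    using c g(1) pos unfolding c_def
    by (simp add: ennreal_mult[symmetric] real_sqrt_divide)
  finally show "(LINT x|gauss_radial n A. x ^ k) = sqrt (det A / det (A + real k \<cdot>\<^sub>m 1\<^sub>m n))"
    using g(1) pos by simp
qed

text \<open>The determinants at integer shifts give exactly the moments of
  \<open>gauss_radial\<close>. A function of the squared length is recovered from this law by
  substituting \<open>- ln y\<close>.\<close>

lemma radial_integral_eq_of_det:
  assumes A: "pos_def n A" and B: "pos_def n B"
    and eq: "\<And>t. t \<ge> 0 \<Longrightarrow> det (A + t \<cdot>\<^sub>m 1\<^sub>m n) = det (B + t \<cdot>\<^sub>m 1\<^sub>m n)"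
    and G[measurable]: "G \<in> borel_measurable borel"
  shows "(\<integral>\<^sup>+v. G (sqn n v) * ennreal (exp (- quad_form A v)) \<partial>lebN n)
       = (\<integral>\<^sup>+v. G (sqn n v) * ennreal (exp (- quad_form B v)) \<partial>lebN n)"
proof -
  have carA: "A \<in> carrier_mat n n" and carB: "B \<in> carrier_mat n n"
    using A B unfolding pos_def_def by auto
  have det: "det A = det B"
  proof -
    have "X + 0 \<cdot>\<^sub>m 1\<^sub>m n = X" if "X \<in> carrier_mat n n" for X :: "real mat"
      using that by (intro eq_matI) auto
    then show ?thesis using eq[of 0] carA carB by simp
  qed
  have "gauss_radial n A = gauss_radial n B"
    using gauss_radial[OF A] gauss_radial[OF B] eq det
    by (intro real_distribution_eqI_moments) simp_all
  moreover have "(\<integral>\<^sup>+v. G (sqn n v) * ennreal (exp (- quad_form X v)) \<partial>lebN n)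
      = ennreal (sqrt (pi ^ n / det X)) * (\<integral>\<^sup>+y. G (- ln y) \<partial>gauss_radial n X)"
    if X: "pos_def n X" for X
  proof -
    have carX: "X \<in> carrier_mat n n" using X unfolding pos_def_def by auto
    note [measurable] = measurable_quad_form[OF carX]
    define c where "c = sqrt (pi ^ n / det X)"
    have c: "c > 0" unfolding c_def using gaussian_integral(1)[OF X] by simp
    have "(\<integral>\<^sup>+y. G (- ln y) \<partial>gauss_radial n X)
        = (\<integral>\<^sup>+v. ennreal (exp (- quad_form X v) / c) * G (sqn n v) \<partial>lebN n)"
      unfolding gauss_radial_def c_def by (simp add: nn_integral_distr nn_integral_density)
    also have "ennreal c * \<dots> = (\<integral>\<^sup>+v. ennreal c * (ennreal (exp (- quad_form X v) / c) * G (sqn n v)) \<partial>lebN n)"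
      by (subst nn_integral_cmult) auto
    also have "\<dots> = (\<integral>\<^sup>+v. G (sqn n v) * ennreal (exp (- quad_form X v)) \<partial>lebN n)"
      using c by (intro nn_integral_cong)
        (simp add: mult.assoc[symmetric] ennreal_mult[symmetric], simp add: mult.commute)
    finally show ?thesis unfolding c_def by simp
  qed
  ultimately show ?thesis using A B det by simp
qed

lemma det_scalar_minus:
  fixes M :: "real mat"
  assumes M: "M \<in> carrier_mat n n" and cp: "char_poly M = (\<Prod>k=1..n. [:- l k, 1:])"
    and "b > 0"
  shows "det ((b * z) \<cdot>\<^sub>m 1\<^sub>m n - b \<cdot>\<^sub>m M + t \<cdot>\<^sub>m 1\<^sub>m n) = (\<Prod>k=1..n. b * (z - l k) + t)"
proof -
  let ?x = "z + t / b"
  have "(b * z) \<cdot>\<^sub>m 1\<^sub>m n - b \<cdot>\<^sub>m M + t \<cdot>\<^sub>m 1\<^sub>m n = b \<cdot>\<^sub>m (- char_matrix M ?x)"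
    using M \<open>b > 0\<close> by (intro eq_matI) (auto simp: char_matrix_def field_simps)
  then have "det ((b * z) \<cdot>\<^sub>m 1\<^sub>m n - b \<cdot>\<^sub>m M + t \<cdot>\<^sub>m 1\<^sub>m n) = b ^ n * poly (char_poly M) ?x"
    using M by (simp add: char_poly_matrix[OF M] char_matrix_def)
  also have "poly (char_poly M) ?x = (\<Prod>k=1..n. ?x - l k)"
    unfolding cp by (simp add: poly_prod)
  also have "b ^ n * \<dots> = (\<Prod>k=1..n. b * (?x - l k))"
    by (simp add: prod.distrib)
  also have "\<dots> = (\<Prod>k=1..n. b * (z - l k) + t)"
    using \<open>b > 0\<close> by (intro prod.cong) (auto simp: field_simps)
  finally show ?thesis .
qed

text \<open>Both sides are radial moments of Gaussian measures whose covariances have the same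
  spectrum, so no orthogonal change of variables is required.\<close>

lemma radial_integral_diagonalize:
  fixes M :: "real mat"
  assumes M: "M \<in> carrier_mat n n" and sym: "transpose_mat M = M" and b: "b > 0"
    and G[measurable]: "G \<in> borel_measurable borel"
  shows "(\<integral>\<^sup>+v. G (sqn n v) * ennreal (exp (b * quad_form M v)) \<partial>lebN n)
       = (\<integral>\<^sup>+v. G (sqn n v) * ennreal (exp (b * (\<Sum>i<n. eig M (Suc i) * (v i)\<^sup>2))) \<partial>lebN n)"
proof -
  \<comment> \<open>At least 1 above the whole spectrum, so that both shifted matrices become
    positive definite; in dimension 0 there is no eigenvalue to refer to.\<close>
  define z where "z = (if n = 0 then 0 else eig M 1) + 1"
  have z: "z - eig M k \<ge> 1" if "1 \<le> k" "k \<le> n" for k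
    using char_poly_eig(2)[OF M sym order.refl that] that unfolding z_def by simp
  define A where "A = (b * z) \<cdot>\<^sub>m 1\<^sub>m n - b \<cdot>\<^sub>m M"
  define B where "B = mat n n (\<lambda>(i, j). if i = j then b * (z - eig M (Suc i)) else 0)"
  have A: "A \<in> carrier_mat n n" and B: "B \<in> carrier_mat n n" using M by (auto simp: A_def B_def)
  have symA: "transpose_mat A = A" using M unfolding A_def
    by (intro eq_matI) (auto simp: pos_def_sym[OF M sym])
  have symB: "transpose_mat B = B" unfolding B_def by (intro eq_matI) auto
  have detA: "det (A + t \<cdot>\<^sub>m 1\<^sub>m n) = (\<Prod>k=1..n. b * (z - eig M k) + t)" for t
    unfolding A_def by (rule det_scalar_minus[OF M char_poly_eig(1)[OF M sym] b])
  have detB: "det (B + t \<cdot>\<^sub>m 1\<^sub>m n) = (\<Prod>k=1..n. b * (z - eig M k) + t)" for t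
  proof -
    have "det (B + t \<cdot>\<^sub>m 1\<^sub>m n) = prod_list (diag_mat (B + t \<cdot>\<^sub>m 1\<^sub>m n))"
      by (rule det_upper_triangular[of _ n]) (auto simp: B_def)
    also have "diag_mat (B + t \<cdot>\<^sub>m 1\<^sub>m n) = map (\<lambda>i. b * (z - eig M (Suc i)) + t) [0..<n]"
      by (auto simp: diag_mat_def B_def)
    also have "prod_list \<dots> = (\<Prod>i<n. b * (z - eig M (Suc i)) + t)"
      using prod.distinct_set_conv_list[of "[0..<n]" "\<lambda>i. b * (z - eig M (Suc i)) + t"]
      by (simp add: lessThan_atLeast0)
    also have "\<dots> = (\<Prod>k=1..n. b * (z - eig M k) + t)"
      by (rule prod.reindex_bij_witness[of _ "\<lambda>k. k - 1" Suc]) auto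
    finally show ?thesis .
  qed
  have pos: "(\<Prod>k=1..n. b * (z - eig M k) + t) > 0" if "t \<ge> 0" for t
    using z b that by (intro prod_pos) (smt (verit) atLeastAtMost_iff mult_pos_pos)
  have pdA: "pos_def n A"
    by (rule pos_def_if_det_nonzero[OF A symA]) (use pos detA in \<open>metis less_irrefl\<close>)
  have pdB: "pos_def n B"
    by (rule pos_def_if_det_nonzero[OF B symB]) (use pos detB in \<open>metis less_irrefl\<close>)
  have qA: "quad_form A v = b * z * sqn n v - b * quad_form M v" for v
  proof -
    have "quad_form A v = (\<Sum>i<n. \<Sum>j<n. (if i = j then b * z * (v i)\<^sup>2 else 0) - b * (M $$ (i, j) * v i * v j))"
      unfolding quad_form_def using M A
      by (auto intro!: sum.cong simp: A_def algebra_simps power2_eq_square)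
    then show ?thesis unfolding quad_form_def using M
      by (simp add: sum_subtractf sum.delta sum_distrib_left)
  qed
  have qB: "quad_form B v = b * z * sqn n v - b * (\<Sum>i<n. eig M (Suc i) * (v i)\<^sup>2)" for v
  proof -
    have "quad_form B v = (\<Sum>i<n. \<Sum>j<n. (if i = j then b * (z - eig M (Suc i)) * (v i)\<^sup>2 else 0))"
      unfolding quad_form_def carrier_matD(1)[OF B]
      by (intro sum.cong refl) (auto simp: B_def power2_eq_square)
    then show ?thesis
      by (simp add: sum.delta sum_subtractf[symmetric] sum_distrib_left algebra_simps)
  qed
  \<comment> \<open>The factor compensates for the shift by \<open>b * z\<close> in the two forms.
    It is itself radial and can be moved into \<open>G\<close>.\<close>
  let ?G = "\<lambda>r. G r * ennreal (exp (b * z * r))"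
  have *: "G r * ennreal (exp (b * q)) = ?G r * ennreal (exp (- (b * z * r - b * q)))" for r q
    by (simp add: mult.assoc ennreal_mult[symmetric] exp_add[symmetric])
  have "(\<integral>\<^sup>+v. G (sqn n v) * ennreal (exp (b * quad_form M v)) \<partial>lebN n)
      = (\<integral>\<^sup>+v. ?G (sqn n v) * ennreal (exp (- quad_form A v)) \<partial>lebN n)"
    unfolding qA by (intro nn_integral_cong *)
  also have "\<dots> = (\<integral>\<^sup>+v. ?G (sqn n v) * ennreal (exp (- quad_form B v)) \<partial>lebN n)"
    by (rule radial_integral_eq_of_det[OF pdA pdB]) (auto simp: detA detB)
  also have "\<dots> = (\<integral>\<^sup>+v. G (sqn n v) * ennreal (exp (b * (\<Sum>i<n. eig M (Suc i) * (v i)\<^sup>2))) \<partial>lebN n)"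
    unfolding qB by (intro nn_integral_cong *[symmetric])
  finally show ?thesis .
qed

section \<open>The limiting law and the classical locations\<close>

locale edge_law =
  fixes \<nu> :: "real measure" and Cm Cp s :: real
  assumes regular: "regular_limit_measure \<nu> Cm Cp s"
begin

sublocale real_distribution \<nu>
  using regular unfolding regular_limit_measure_def by simp

lemma density_ex:
  obtains \<rho> where "\<rho> \<in> borel_measurable borel" "\<And>x. \<rho> x \<ge> 0" "\<nu> = density lborel (\<lambda>x. ennreal (\<rho> x))"
    "\<And>x. Cm < x \<Longrightarrow> x < Cp \<Longrightarrow> \<rho> x > 0"
    "(\<lambda>x. \<rho> x / (s * sqrt (Cp - x)) - 1) \<in> O[at_left Cp](\<lambda>x. Cp - x)"
  using regular unfolding regular_limit_measure_def by auto

lemma s_pos: "s > 0" and mass: "measure \<nu> {Cm..Cp} = 1"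
  using regular unfolding regular_limit_measure_def by auto

lemma null_lborel: "N \<in> null_sets lborel \<Longrightarrow> N \<in> null_sets \<nu>"
proof -
  obtain \<rho> where r: "\<rho> \<in> borel_measurable borel" "\<nu> = density lborel (\<lambda>x. ennreal (\<rho> x))"
    using density_ex by metis
  show "N \<in> null_sets lborel \<Longrightarrow> N \<in> null_sets \<nu>"
    unfolding r(2) using r(1) by (subst null_sets_density_iff) (auto dest: AE_not_in simp: null_setsD2)
qed

lemma measure_singleton: "measure \<nu> {x} = 0"
  using null_lborel[of "{x}"] countable_imp_null_set_lborel[of "{x}"]
  by (simp add: measure_eq_0_null_sets)

lemma Cm_less_Cp: "Cm < Cp"
proof (rule ccontr)
  assume "\<not> Cm < Cp"
  then have "{Cm..Cp} = {} \<or> {Cm..Cp} = {Cm}" by auto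
  then have "measure \<nu> {Cm..Cp} = 0" using measure_singleton by auto
  then show False using mass by simp
qed

lemma AE_support: "AE x in \<nu>. Cm < x \<and> x < Cp"
proof -
  have "AE x in \<nu>. x \<in> {Cm..Cp}" using mass by (subst AE_in_set_eq_1) simp_all
  moreover have "AE x in \<nu>. x \<noteq> c" for c
    using null_lborel[of "{c}"] AE_not_in[of "{c}" \<nu>] countable_imp_null_set_lborel[of "{c}"] by simp
  ultimately show ?thesis
    using \<open>\<And>c. AE x in \<nu>. x \<noteq> c\<close>[of Cm] \<open>\<And>c. AE x in \<nu>. x \<noteq> c\<close>[of Cp]
    by eventually_elim auto
qed

lemma set_integral_support: "(LINT x:{Cm..Cp}|\<nu>. h x) = (LINT x|\<nu>. (h x :: real))"
  if "h \<in> borel_measurable borel"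
  unfolding set_lebesgue_integral_def
proof (rule integral_cong_AE)
  show "AE x in \<nu>. indicator {Cm..Cp} x *\<^sub>R h x = h x"
    using AE_support by eventually_elim auto
qed (use that in auto)

lemma integrable_bounded_support:
  assumes "h \<in> borel_measurable borel" "\<And>x. Cm < x \<Longrightarrow> x < Cp \<Longrightarrow> \<bar>h x\<bar> \<le> B"
  shows "integrable \<nu> (h :: real \<Rightarrow> real)"
proof (rule integrable_const_bound[where B = B])
  show "AE x in \<nu>. norm (h x) \<le> B" using AE_support by eventually_elim (simp add: assms)
qed (simp add: assms)

lemma interval_mass_pos:
  assumes "Cm \<le> x" "x < y" "y \<le> Cp"
  shows "measure \<nu> {x..<y} > 0"
proof (rule ccontr)
  obtain \<rho> where r[measurable]: "\<rho> \<in> borel_measurable borel"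
    and "\<And>x. \<rho> x \<ge> 0" and nu: "\<nu> = density lborel (\<lambda>x. ennreal (\<rho> x))"
    and pos: "\<And>x. Cm < x \<Longrightarrow> x < Cp \<Longrightarrow> \<rho> x > 0"
    and "(\<lambda>x. \<rho> x / (s * sqrt (Cp - x)) - 1) \<in> O[at_left Cp](\<lambda>x. Cp - x)"
    by (rule density_ex) blast
  assume "\<not> measure \<nu> {x..<y} > 0"
  then have "measure \<nu> {x..<y} = 0" using measure_nonneg[of \<nu> "{x..<y}"] by linarith
  then have "{x..<y} \<in> null_sets \<nu>" by (simp add: emeasure_eq_measure null_setsI)
  then have "AE z in lborel. z \<in> {x..<y} \<longrightarrow> ennreal (\<rho> z) = 0"
    unfolding nu by (subst (asm) null_sets_density_iff) auto
  then have "AE z in lborel. z \<notin> {x<..<y}"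
  proof eventually_elim
    case (elim z)
    then show ?case using pos[of z] assms by (auto simp: ennreal_eq_0_iff)
  qed
  then have "{x<..<y} \<in> null_sets lborel" by (simp add: AE_iff_null_sets)
  then show False using assms by auto
qed

section \<open>Quantiles and classical locations\<close>

definition tail :: "real \<Rightarrow> real" where "tail x = measure \<nu> {x..}"

lemma tail_diff: "x \<le> y \<Longrightarrow> measure \<nu> {x..<y} = tail x - tail y"
proof -
  assume "x \<le> y"
  then have "{x..<y} = {x..} - {y..}" by auto
  then show ?thesis unfolding tail_def using \<open>x \<le> y\<close> by (simp add: finite_measure_Diff)
qed

lemma tail_cdf: "tail x = 1 - cdf \<nu> x"
proof -
  have "{x..} = (UNIV - {..x}) \<union> {x}" by auto
  then have "tail x = measure \<nu> (UNIV - {..x}) + measure \<nu> {x}"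
    unfolding tail_def by (simp only:) (subst finite_measure_Union, auto)
  then show ?thesis using prob_compl[of "{..x}"] measure_singleton by (simp add: cdf_def)
qed

lemma tail_le_Cm: "x \<le> Cm \<Longrightarrow> tail x = 1"
  unfolding tail_def
proof (subst prob_eq_1)
  assume "x \<le> Cm"
  show "AE y in \<nu>. y \<in> {x..}" using AE_support
    by eventually_elim (use \<open>x \<le> Cm\<close> in auto)
qed simp

lemma tail_ge_Cp: "x \<ge> Cp \<Longrightarrow> tail x = 0"
  unfolding tail_def
proof (subst prob_eq_0)
  assume "x \<ge> Cp"
  show "AE y in \<nu>. y \<notin> {x..}" using AE_support
    by eventually_elim (use \<open>x \<ge> Cp\<close> in auto)
qed simp

lemma tail_strict: "Cm \<le> x \<Longrightarrow> x < y \<Longrightarrow> y \<le> Cp \<Longrightarrow> tail y < tail x"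
  using interval_mass_pos[of x y] tail_diff[of x y] by simp

text \<open>Without atoms the tail is continuous, which gives existence. Strict decrease on the
  support gives uniqueness, and with it the definite description in
  \<open>classical_location\<close> denotes.\<close>

lemma tail_quantile: "0 < p \<Longrightarrow> p < 1 \<Longrightarrow> \<exists>!x. tail x = p"
proof -
  assume p: "0 < p" "p < 1"
  have cont: "continuous_on {Cm..Cp} (\<lambda>x. - tail x)"
    unfolding tail_cdf
    by (intro continuous_at_imp_continuous_on ballI continuous_intros)
       (simp add: isCont_cdf measure_singleton)
  have "\<exists>x. Cm \<le> x \<and> x \<le> Cp \<and> - tail x = - p"
    by (rule IVT') (use p Cm_less_Cp tail_le_Cm[of Cm] tail_ge_Cp[of Cp] cont in auto)
  moreover have "x = y" if "tail x = p" "tail y = p" for x y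
  proof -
    have in_supp: "Cm < z \<and> z < Cp" if "tail z = p" for z
      using tail_le_Cm[of z] tail_ge_Cp[of z] that p by (metis less_irrefl not_less)
    show ?thesis
      using in_supp[OF that(1)] in_supp[OF that(2)] tail_strict[of x y] tail_strict[of y x] that
      by (metis less_eq_real_def less_irrefl linorder_neqE_linordered_idom)
  qed
  ultimately show ?thesis by (metis add.inverse_inverse)
qed

abbreviation \<xi> :: "nat \<Rightarrow> nat \<Rightarrow> real" where "\<xi> N k \<equiv> classical_location \<nu> N k"

lemma tail_location:
  assumes "1 \<le> k" "k \<le> N"
  shows "tail (\<xi> N k) = (real k - 1 / 2) / real N"
proof -
  have "\<exists>!x. tail x = (real k - 1 / 2) / real N"
    by (rule tail_quantile) (use assms in \<open>auto simp: field_simps\<close>)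
  then show ?thesis unfolding classical_location_def tail_def by (rule theI')
qed

lemma location_bounds:
  assumes "1 \<le> k" "k \<le> N"
  shows "Cm < \<xi> N k" "\<xi> N k < Cp"
proof -
  have "0 < (real k - 1 / 2) / real N" "(real k - 1 / 2) / real N < 1"
    using assms by (auto simp: field_simps)
  then show "Cm < \<xi> N k" "\<xi> N k < Cp"
    using tail_le_Cm[of "\<xi> N k"] tail_ge_Cp[of "\<xi> N k"] tail_location[OF assms]
    by (metis less_irrefl not_less)+
qed

lemma tail_antimono: "x \<le> y \<Longrightarrow> tail y \<le> tail x"
  unfolding tail_def by (intro finite_measure_mono) auto

lemma location_antimono:
  assumes "1 \<le> j" "j \<le> k" "k \<le> N"
  shows "\<xi> N k \<le> \<xi> N j"
proof (cases "j = k")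
  case False
  then have "tail (\<xi> N j) < tail (\<xi> N k)"
    using assms by (subst (1 2) tail_location) (auto simp: field_simps)
  then show ?thesis using tail_antimono[of "\<xi> N j" "\<xi> N k"] by linarith
qed simp

section \<open>Sums over classical locations against integrals\<close>

lemma integral_over_bounds:
  fixes h :: "real \<Rightarrow> real"
  assumes h: "integrable \<nu> h" and A: "A \<in> sets borel"
    and b: "\<And>x. x \<in> A \<Longrightarrow> Cm < x \<Longrightarrow> x < Cp \<Longrightarrow> lo \<le> h x \<and> h x \<le> hi"
  shows "lo * measure \<nu> A \<le> (LINT x|\<nu>. indicator A x * h x)"
    and "(LINT x|\<nu>. indicator A x * h x) \<le> hi * measure \<nu> A"
proof -
  have hA: "integrable \<nu> (\<lambda>x. indicator A x * h x)"
    using integrable_mult_indicator[OF _ h, of A] A by simp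
  have iA: "integrable \<nu> (\<lambda>x. c * indicator A x)" for c :: real
    using A by (intro integrable_mult_right) (simp add: emeasure_eq_measure)
  have m: "(LINT x|\<nu>. c * indicator A x) = c * measure \<nu> A" for c :: real
    using A by simp
  show "lo * measure \<nu> A \<le> (LINT x|\<nu>. indicator A x * h x)"
    unfolding m[symmetric]
    by (rule integral_mono_AE[OF iA hA]) (rule AE_mp[OF AE_support], rule AE_I2, use b in \<open>auto split: split_indicator\<close>)
  show "(LINT x|\<nu>. indicator A x * h x) \<le> hi * measure \<nu> A"
    unfolding m[symmetric]
    by (rule integral_mono_AE[OF hA iA]) (rule AE_mp[OF AE_support], rule AE_I2, use b in \<open>auto split: split_indicator\<close>)
qed

text \<open>Consecutive locations enclose mass 1/N, so by monotonicity N times the integral over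
  such a cell lies between the values of \<open>h\<close> at its ends, and upper and lower sums
  differ by end terms only. Half cells remain at both ends: the lower one costs values of
  \<open>h\<close>, the upper one stays an integral because \<open>h\<close> may blow up at
  \<open>Cp\<close>.\<close>

lemma sum_locations_vs_integral:
  fixes h :: "real \<Rightarrow> real"
  assumes mono: "\<And>x y. Cm \<le> x \<Longrightarrow> x \<le> y \<Longrightarrow> y < Cp \<Longrightarrow> h x \<le> h y"
    and h: "integrable \<nu> h" and N: "N \<ge> 1"
  shows "\<bar>real N * (LINT x|\<nu>. h x) - (\<Sum>k=1..N. h (\<xi> N k))\<bar>
    \<le> \<bar>h Cm\<bar> + \<bar>h (\<xi> N 1)\<bar> + real N * (LINT x|\<nu>. indicator {\<xi> N 1..} x * \<bar>h x\<bar>)"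
proof -
  define I where "I A = (LINT x|\<nu>. indicator A x * h x)" for A
  have int: "integrable \<nu> (\<lambda>x. indicator A x * h x)" if "A \<in> sets borel" for A
    using integrable_mult_indicator[OF _ h, of A] that by simp
  have add: "I (A \<union> B) = I A + I B" if "A \<inter> B = {}" "A \<in> sets borel" "B \<in> sets borel" for A B
  proof -
    have "I (A \<union> B) = (LINT x|\<nu>. indicator A x * h x + indicator B x * h x)"
      unfolding I_def using that(1)
      by (intro Bochner_Integration.integral_cong refl) (auto split: split_indicator)
    then show ?thesis unfolding I_def using that
      by (simp add: Bochner_Integration.integral_add int)
  qed
  define T where "T = real N * I {\<xi> N 1..}"
  have step: "1 \<le> n \<Longrightarrow> n \<le> N \<Longrightarrow> real N * I {\<xi> N n..} \<le> T + (\<Sum>k=1..<n. h (\<xi> N k))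
      \<and> T + (\<Sum>k=1..<n. h (\<xi> N (Suc k))) \<le> real N * I {\<xi> N n..}" for n
  proof (induction n)
    case (Suc n)
    show ?case
    proof (cases "n = 0")
      case True then show ?thesis by (simp add: T_def)
    next
      case False
      then have n: "1 \<le> n" "n \<le> N" "Suc n \<le> N" using Suc.prems by auto
      have le: "\<xi> N (Suc n) \<le> \<xi> N n" using location_antimono[of n "Suc n" N] n by auto
      have "{\<xi> N (Suc n)..} = {\<xi> N (Suc n)..<\<xi> N n} \<union> {\<xi> N n..}" using le by auto
      then have I: "I {\<xi> N (Suc n)..} = I {\<xi> N (Suc n)..<\<xi> N n} + I {\<xi> N n..}"
        by (simp only:) (rule add, auto)
      have m: "measure \<nu> {\<xi> N (Suc n)..<\<xi> N n} = 1 / real N"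
        using tail_diff[OF le] tail_location[of n N] tail_location[of "Suc n" N] n
        by (simp add: diff_divide_distrib[symmetric])
      have b: "h (\<xi> N (Suc n)) \<le> h x \<and> h x \<le> h (\<xi> N n)"
        if "x \<in> {\<xi> N (Suc n)..<\<xi> N n}" "Cm < x" "x < Cp" for x
        using that location_bounds[of "Suc n" N] location_bounds[of n N] n by (auto intro!: mono)
      note ob = integral_over_bounds[OF h _ b, of "{\<xi> N (Suc n)..<\<xi> N n}", simplified,
        folded I_def, unfolded m]
      have "h (\<xi> N (Suc n)) \<le> real N * I {\<xi> N (Suc n)..<\<xi> N n}"
        "real N * I {\<xi> N (Suc n)..<\<xi> N n} \<le> h (\<xi> N n)"
        using ob N by (auto simp: field_simps)
      then show ?thesis using Suc.IH[OF n(1,2)] n(1) unfolding I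
        by (simp add: sum.atLeastLessThan_Suc distrib_left)
    qed
  qed simp
  have "(\<Sum>k=1..N. h (\<xi> N k)) = (\<Sum>k=1..<N. h (\<xi> N k)) + h (\<xi> N N)"
    using N by (simp add: sum.last_plus atLeastLessThanSuc_atLeastAtMost[symmetric] del: sum.op_ivl_Suc) (metis Suc_pred' le_add_diff_inverse sum.atLeastLessThan_Suc)
  then have s1: "(\<Sum>k=1..<N. h (\<xi> N k)) = (\<Sum>k=1..N. h (\<xi> N k)) - h (\<xi> N N)" by simp
  have s2: "(\<Sum>k=1..<N. h (\<xi> N (Suc k))) = (\<Sum>k=1..N. h (\<xi> N k)) - h (\<xi> N 1)"
  proof -
    have "(\<Sum>k=1..<N. h (\<xi> N (Suc k))) = (\<Sum>k=Suc 1..<Suc N. h (\<xi> N k))"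
      by (rule sum.shift_bounds_Suc_ivl[symmetric])
    then show ?thesis using N by (simp add: sum.atLeast_Suc_atMost atLeastLessThanSuc_atLeastAtMost del: sum.op_ivl_Suc)
  qed
  have "I ({..<\<xi> N N} \<union> {\<xi> N N..}) = I {..<\<xi> N N} + I {\<xi> N N..}"
    by (rule add) auto
  moreover have "{..<\<xi> N N} \<union> {\<xi> N N..} = UNIV" by auto
  ultimately have "I UNIV = I {..<\<xi> N N} + I {\<xi> N N..}" by simp
  then have tot: "(LINT x|\<nu>. h x) = I {..<\<xi> N N} + I {\<xi> N N..}" by (simp add: I_def)
  have m: "measure \<nu> {..<\<xi> N N} = 1 / (2 * real N)"
  proof -
    have "{..<\<xi> N N} = UNIV - {\<xi> N N..}" by auto
    then have "measure \<nu> {..<\<xi> N N} = 1 - tail (\<xi> N N)"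
      using prob_compl[of "{\<xi> N N..}"] by (simp add: tail_def)
    then show ?thesis using tail_location[of N N] N by (simp add: field_simps)
  qed
  have b: "h Cm \<le> h x \<and> h x \<le> h (\<xi> N N)" if "x \<in> {..<\<xi> N N}" "Cm < x" "x < Cp" for x
    using that location_bounds[of N N] N by (auto intro!: mono)
  note ob = integral_over_bounds[OF h _ b, of "{..<\<xi> N N}", simplified, folded I_def, unfolded m]
  have e: "h Cm / 2 \<le> real N * I {..<\<xi> N N}" "real N * I {..<\<xi> N N} \<le> h (\<xi> N N) / 2"
    using ob N by (auto simp: field_simps)
  have T: "\<bar>T\<bar> \<le> real N * (LINT x|\<nu>. indicator {\<xi> N 1..} x * \<bar>h x\<bar>)"
  proof -
    have "\<bar>I {\<xi> N 1..}\<bar> \<le> (LINT x|\<nu>. \<bar>indicator {\<xi> N 1..} x * h x\<bar>)"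
      unfolding I_def by (rule integral_abs_bound)
    then show ?thesis unfolding T_def by (simp add: abs_mult mult_left_mono)
  qed
  have hN: "h Cm \<le> h (\<xi> N N)" "h Cm \<le> h (\<xi> N 1)"
    using location_bounds[of N N] location_bounds[of 1 N] N by (auto intro!: mono)
  show ?thesis
    using step[of N] N e T hN unfolding s1 s2 tot distrib_left abs_le_iff by linarith
qed

text \<open>Of the bound \<open>3 * B\<close> the two end values take \<open>B\<close> each, and the
  upper half cell, of mass 1 / (2 N), takes \<open>B / 2\<close>.\<close>

lemma sum_locations_bounded:
  fixes h :: "real \<Rightarrow> real"
  assumes mono: "\<And>x y. Cm \<le> x \<Longrightarrow> x \<le> y \<Longrightarrow> y < Cp \<Longrightarrow> h x \<le> h y"
    and meas: "h \<in> borel_measurable borel" and N: "N \<ge> 1"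
    and B: "\<And>x. Cm \<le> x \<Longrightarrow> x < Cp \<Longrightarrow> \<bar>h x\<bar> \<le> B"
  shows "\<bar>real N * (LINT x|\<nu>. h x) - (\<Sum>k=1..N. h (\<xi> N k))\<bar> \<le> 3 * B"
proof -
  have h: "integrable \<nu> h" by (rule integrable_bounded_support[OF meas, of B]) (use B in auto)
  have m: "measure \<nu> {\<xi> N 1..} = 1 / (2 * real N)"
    using tail_location[of 1 N] N unfolding tail_def by simp
  have "(LINT x|\<nu>. indicator {\<xi> N 1..} x * \<bar>h x\<bar>) \<le> B * (1 / (2 * real N))"
    unfolding m[symmetric]
    by (rule integral_over_bounds(2)[where lo = 0]) (use h B in auto)
  then have "real N * (LINT x|\<nu>. indicator {\<xi> N 1..} x * \<bar>h x\<bar>) \<le> B / 2"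
    using N by (simp add: field_simps)
  moreover have "\<bar>h Cm\<bar> \<le> B" "\<bar>h (\<xi> N 1)\<bar> \<le> B"
    using B[of Cm] B[of "\<xi> N 1"] Cm_less_Cp location_bounds[of 1 N] N by auto
  ultimately show ?thesis
    using sum_locations_vs_integral[OF mono h N] by linarith
qed

text \<open>Near the edge the density is at most a multiple of sqrt (Cp - x), which leaves (Cp -
  x)^(-3/4) against Lebesgue measure. The exponent -5/4 is more singular than the -1 of the inverse
  distance; the surplus 1/4 becomes a convergence rate.\<close>

lemma integrable_edge_powr: "integrable \<nu> (\<lambda>x. (Cp - x) powr (- 5 / 4))"
proof -
  obtain \<rho> where r[measurable]: "\<rho> \<in> borel_measurable borel" and r0: "\<And>x. \<rho> x \<ge> 0"
    and nu: "\<nu> = density lborel (\<lambda>x. ennreal (\<rho> x))"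
    and big: "(\<lambda>x. \<rho> x / (s * sqrt (Cp - x)) - 1) \<in> O[at_left Cp](\<lambda>x. Cp - x)"
    by (rule density_ex) blast
  obtain c where c: "c > 0" "eventually (\<lambda>x. \<bar>\<rho> x / (s * sqrt (Cp - x)) - 1\<bar> \<le> c * \<bar>Cp - x\<bar>) (at_left Cp)"
    using big by (auto elim!: landau_o.bigE)
  then obtain b where b: "b < Cp" "\<And>x. b < x \<Longrightarrow> x < Cp \<Longrightarrow> \<bar>\<rho> x / (s * sqrt (Cp - x)) - 1\<bar> \<le> c * \<bar>Cp - x\<bar>"
    unfolding eventually_at_left_field by auto
  define d where "d = Cp - b"
  define K where "K = (1 + c * d) * s"
  have d: "d > 0" using b by (simp add: d_def)
  have bound: "\<rho> x \<le> K * sqrt (Cp - x)" if "b < x" "x < Cp" for x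
  proof -
    have "\<rho> x / (s * sqrt (Cp - x)) \<le> 1 + c * (Cp - x)" using b(2)[OF that] that by auto
    also have "\<dots> \<le> 1 + c * d" using c(1) that by (auto simp: d_def intro!: mult_left_mono)
    finally show ?thesis using that s_pos unfolding K_def by (simp add: field_simps)
  qed
  have lt: "(\<lambda>y. y powr (- 3 / 4)) absolutely_integrable_on {0..d}"
    by (rule nonnegative_absolutely_integrable_1) (use integrable_on_powr_from_0[of "-3/4" d] d in auto)
  have fin: "(\<integral>\<^sup>+x. ennreal ((Cp - x) powr (- 3 / 4)) * indicator {b<..<Cp} x \<partial>lborel) < \<infinity>"
  proof -
    have "(\<integral>\<^sup>+x. ennreal ((Cp - x) powr (- 3 / 4)) * indicator {b<..<Cp} x \<partial>lborel)
        = (\<integral>\<^sup>+y. ennreal (y powr (- 3 / 4)) * indicator {0<..<d} y \<partial>lborel)"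
      by (subst nn_integral_real_affine[of _ "-1" Cp])
         (auto simp: d_def intro!: nn_integral_cong split: split_indicator)
    also have "\<dots> \<le> (\<integral>\<^sup>+y. ennreal (norm (indicator {0..d} y *\<^sub>R y powr (- 3 / 4))) \<partial>lborel)"
      by (intro nn_integral_mono) (auto split: split_indicator)
    also have "\<dots> < \<infinity>"
      using lt unfolding set_integrable_def integrable_iff_bounded
      by (simp add: nn_integral_completion)
    finally show ?thesis .
  qed
  have "(\<integral>\<^sup>+x. ennreal ((Cp - x) powr (- 5 / 4)) \<partial>\<nu>)
      \<le> (\<integral>\<^sup>+x. ennreal (d powr (- 5 / 4)) + ennreal ((Cp - x) powr (- 5 / 4)) * indicator {b<..<Cp} x \<partial>\<nu>)"
  proof (rule nn_integral_mono_AE)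
    show "AE x in \<nu>. ennreal ((Cp - x) powr (- 5 / 4))
      \<le> ennreal (d powr (- 5 / 4)) + ennreal ((Cp - x) powr (- 5 / 4)) * indicator {b<..<Cp} x"
      using AE_support
    proof eventually_elim
      case (elim x)
      show ?case
      proof (cases "b < x")
        case False
        then have "(Cp - x) powr (- 5 / 4) \<le> d powr (- 5 / 4)"
          using d elim by (intro powr_mono2') (auto simp: d_def)
        then show ?thesis by (simp add: add_increasing2)
      qed (use elim in simp)
    qed
  qed
  also have "\<dots> = ennreal (d powr (- 5 / 4)) + (\<integral>\<^sup>+x. ennreal ((Cp - x) powr (- 5 / 4)) * indicator {b<..<Cp} x \<partial>\<nu>)"
    by (subst nn_integral_add) (auto simp: emeasure_space_1[simplified])
  also have "(\<integral>\<^sup>+x. ennreal ((Cp - x) powr (- 5 / 4)) * indicator {b<..<Cp} x \<partial>\<nu>)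
      = (\<integral>\<^sup>+x. ennreal (\<rho> x) * (ennreal ((Cp - x) powr (- 5 / 4)) * indicator {b<..<Cp} x) \<partial>lborel)"
    unfolding nu by (subst nn_integral_density) auto
  also have "\<dots> \<le> (\<integral>\<^sup>+x. ennreal K * (ennreal ((Cp - x) powr (- 3 / 4)) * indicator {b<..<Cp} x) \<partial>lborel)"
  proof (intro nn_integral_mono)
    fix x
    show "ennreal (\<rho> x) * (ennreal ((Cp - x) powr (- 5 / 4)) * indicator {b<..<Cp} x)
      \<le> ennreal K * (ennreal ((Cp - x) powr (- 3 / 4)) * indicator {b<..<Cp} x)"
    proof (cases "b < x \<and> x < Cp")
      case True
      have "\<rho> x * (Cp - x) powr (- 5 / 4) \<le> K * sqrt (Cp - x) * (Cp - x) powr (- 5 / 4)"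
        using bound True by (intro mult_right_mono) auto
      also have "\<dots> = K * ((Cp - x) powr (1/2) * (Cp - x) powr (- 5 / 4))"
        using True by (simp add: powr_half_sqrt)
      also have "\<dots> = K * (Cp - x) powr (- 3 / 4)" by (simp add: powr_add[symmetric])
      finally show ?thesis using True r0 c(1) d s_pos
        by (simp add: ennreal_mult[symmetric] K_def)
    qed auto
  qed
  also have "\<dots> = ennreal K * (\<integral>\<^sup>+x. ennreal ((Cp - x) powr (- 3 / 4)) * indicator {b<..<Cp} x \<partial>lborel)"
    by (subst nn_integral_cmult) auto
  finally have "(\<integral>\<^sup>+x. ennreal ((Cp - x) powr (- 5 / 4)) \<partial>\<nu>)
     \<le> ennreal (d powr (- 5 / 4)) + ennreal K * (\<integral>\<^sup>+x. ennreal ((Cp - x) powr (- 3 / 4)) * indicator {b<..<Cp} x \<partial>lborel)"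
    by simp
  also have "\<dots> < \<infinity>" using fin by (simp add: ennreal_mult_less_top)
  finally show ?thesis by (intro integrableI_bounded) auto
qed

end

text \<open>Brings the logarithm into the form taken by \<open>edge_tail_integral\<close>: with p =
  9/8 the exponent p - 5/4 is -1/8.\<close>

lemma abs_ln_le_powr:
  fixes y L :: real
  assumes "0 < y" "y \<le> L"
  shows "\<bar>ln y\<bar> \<le> (8 + L * L powr (1/8)) * y powr (- 1/8)"
proof (cases "y \<le> 1")
  case True
  have "y powr (- 1/8) \<ge> 0" by simp
  have "ln (y powr (- 1/8)) \<le> y powr (- 1/8)"
    using ln_less_self[of "y powr (- 1/8)"] assms by simp
  then have "- ln y \<le> 8 * y powr (- 1/8)" using assms by (simp add: ln_powr)
  also have "\<dots> \<le> (8 + L * L powr (1/8)) * y powr (- 1/8)"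
    using assms by (intro mult_right_mono) auto
  finally show ?thesis using True assms by simp
next
  case False
  have "1 = L powr (1/8) * L powr (- 1/8)" using assms by (simp add: powr_add[symmetric])
  also have "\<dots> \<le> L powr (1/8) * y powr (- 1/8)"
    using assms by (intro mult_left_mono powr_mono2') auto
  finally have 1: "1 \<le> L powr (1/8) * y powr (- 1/8)" .
  have "ln y \<le> L" using ln_less_self[of y] assms by linarith
  also have "\<dots> \<le> L * (L powr (1/8) * y powr (- 1/8))"
    using mult_left_mono[OF 1, of L] assms by simp
  also have "\<dots> \<le> (8 + L * L powr (1/8)) * y powr (- 1/8)"
    by (simp add: algebra_simps)
  finally show ?thesis using False by simp
qed

lemma ln_one_plus_minus_self:
  fixes u :: real assumes "\<bar>u\<bar> \<le> 1/2"
  shows "\<bar>ln (1 + u) - u\<bar> \<le> 2 * u\<^sup>2"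
  using abs_ln_one_plus_x_minus_x_bound[of u] assms by simp

text \<open>Absorbs logarithms into a factor N^(1/20), the loss already present in
  \<open>rigid\<close>.\<close>

lemma ln_one_plus_le_powr:
  fixes x :: real assumes "x \<ge> 1"
  shows "1 + ln x \<le> 21 * x powr (1/20)"
proof -
  have "ln (x powr (1/20)) \<le> x powr (1/20)"
    using ln_less_self[of "x powr (1/20)"] assms by simp
  moreover have "1 \<le> x powr (1/20)" using assms by (simp add: ge_one_powr_ge_zero)
  ultimately show ?thesis using assms by (simp add: ln_powr)
qed

text \<open>The reversed sum comes from the lower end of the spectrum, where the rigidity bound
  counts indices from the other side.\<close>

lemma sum_inverse_le:
  assumes "N \<ge> 1"
  shows "(\<Sum>k=1..N. 1 / real k) \<le> 1 + ln (real N)"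
    and "(\<Sum>k=1..N. 1 / real (N + 1 - k)) \<le> 1 + ln (real N)"
proof -
  show 1: "(\<Sum>k=1..N. 1 / real k) \<le> 1 + ln (real N)"
    using euler_mascheroni_sequence_decreasing[of 1 N] assms by (simp add: harm_def inverse_eq_divide)
  have "(\<Sum>k=1..N. 1 / real (N + 1 - k)) = (\<Sum>k=1..N. 1 / real k)"
    by (rule sum.reindex_bij_witness[of _ "\<lambda>k. N + 1 - k" "\<lambda>k. N + 1 - k"]) auto
  then show "(\<Sum>k=1..N. 1 / real (N + 1 - k)) \<le> 1 + ln (real N)" using 1 by simp
qed

section \<open>Edge asymptotics from the spacing of the locations\<close>

locale edge_locations = edge_law +
  fixes C :: real
  assumes C_gt_1: "C > 1"
    and location_gap: "\<And>N k. 1 \<le> k \<Longrightarrow> k \<le> N \<Longrightarrow>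
        inverse C * real k powr (2/3) * real N powr (- 2/3) \<le> Cp - \<xi> N k \<and>
        Cp - \<xi> N k \<le> C * real k powr (2/3) * real N powr (- 2/3)"
begin

definition edge_moment :: real where "edge_moment = (LINT x|\<nu>. (Cp - x) powr (- 5/4))"

lemma edge_moment_nonneg: "edge_moment \<ge> 0" unfolding edge_moment_def by (intro integral_nonneg_AE) simp

text \<open>Above the first location \<open>Cp - x\<close> is at most C N^(-2/3), so a factor (Cp -
  x)^p split off from the fixed integrable weight yields the rate N^(-2p/3). This handles the upper
  half cell left over in \<open>sum_locations_vs_integral\<close>.\<close>

lemma edge_tail_integral:
  fixes h :: "real \<Rightarrow> real"
  assumes meas[measurable]: "h \<in> borel_measurable borel" and N: "N \<ge> 1" and c: "c \<ge> 0" and p: "p \<ge> 0"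
    and h: "\<And>x. Cm < x \<Longrightarrow> x < Cp \<Longrightarrow> \<bar>h x\<bar> \<le> c * (Cp - x) powr (p - 5/4)"
  shows "(LINT x|\<nu>. indicator {\<xi> N 1..} x * \<bar>h x\<bar>) \<le> c * (C powr p * real N powr (- 2/3 * p)) * edge_moment"
proof -
  have gap: "Cp - \<xi> N 1 \<le> C * real N powr (- 2/3)" "0 \<le> Cp - \<xi> N 1"
    using location_gap[of 1 N] location_bounds[of 1 N] N by auto
  have pw: "(Cp - \<xi> N 1) powr p \<le> C powr p * real N powr (- 2/3 * p)"
  proof -
    have "(Cp - \<xi> N 1) powr p \<le> (C * real N powr (- 2/3)) powr p"
      using gap p by (intro powr_mono2) auto
    also have "\<dots> = C powr p * real N powr (- 2/3 * p)"
      using C_gt_1 by (simp add: powr_mult powr_powr)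
    finally show ?thesis .
  qed
  have "(LINT x|\<nu>. indicator {\<xi> N 1..} x * \<bar>h x\<bar>)
      \<le> (LINT x|\<nu>. c * (C powr p * real N powr (- 2/3 * p)) * (Cp - x) powr (- 5/4))"
  proof (rule integral_mono_AE')
    show "integrable \<nu> (\<lambda>x. c * (C powr p * real N powr (- 2/3 * p)) * (Cp - x) powr (- 5/4))"
      using integrable_edge_powr by (intro integrable_mult_right) simp
    show "AE x in \<nu>. indicator {\<xi> N 1..} x * \<bar>h x\<bar> \<le> c * (C powr p * real N powr (- 2/3 * p)) * (Cp - x) powr (- 5/4)"
      using AE_support
    proof eventually_elim
      case (elim x)
      show ?case
      proof (cases "\<xi> N 1 \<le> x")
        case True
        have "\<bar>h x\<bar> \<le> c * (Cp - x) powr (p - 5/4)" using h elim by auto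
        also have "\<dots> = c * (Cp - x) powr p * (Cp - x) powr (- 5/4)"
          by (simp add: powr_add[symmetric])
        also have "\<dots> \<le> c * (C powr p * real N powr (- 2/3 * p)) * (Cp - x) powr (- 5/4)"
        proof (intro mult_right_mono mult_left_mono c)
          have "(Cp - x) powr p \<le> (Cp - \<xi> N 1) powr p"
            using True elim p by (intro powr_mono2) auto
          then show "(Cp - x) powr p \<le> C powr p * real N powr (- 2/3 * p)" using pw by linarith
        qed auto
        finally show ?thesis using True by simp
      qed (use c in simp)
    qed
    show "AE x in \<nu>. 0 \<le> c * (C powr p * real N powr (- 2/3 * p)) * (Cp - x) powr (- 5/4)"
      using c by simp
  qed
  also have "\<dots> = c * (C powr p * real N powr (- 2/3 * p)) * edge_moment"
    unfolding edge_moment_def by simp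
  finally show ?thesis .
qed

lemma integrable_edge:
  assumes meas[measurable]: "h \<in> borel_measurable borel"
    and h: "\<And>x. Cm < x \<Longrightarrow> x < Cp \<Longrightarrow> \<bar>h x\<bar> \<le> c * (Cp - x) powr (- 5/4)"
  shows "integrable \<nu> (h :: real \<Rightarrow> real)"
proof (rule Bochner_Integration.integrable_bound)
  show "integrable \<nu> (\<lambda>x. c * (Cp - x) powr (- 5/4))"
    using integrable_edge_powr by simp
  show "AE x in \<nu>. norm (h x) \<le> norm (c * (Cp - x) powr (- 5/4))"
    using AE_support
  proof eventually_elim
    case (elim x) then show ?case using h[of x] by (metis abs_ge_self order.trans real_norm_def)
  qed
qed simp

lemma inverse_edge_bound:
  assumes "Cm < x" "x < Cp"
  shows "\<bar>1 / (Cp - x)\<bar> \<le> 1 * (Cp - x) powr (1/4 - 5/4)"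
  using assms by (simp add: powr_minus_divide)

lemma ln_edge_bound:
  assumes "Cm < x" "x < Cp"
  shows "\<bar>- ln (Cp - x)\<bar> \<le> (8 + (Cp - Cm) * (Cp - Cm) powr (1/8)) * (Cp - x) powr (9/8 - 5/4)"
  using abs_ln_le_powr[of "Cp - x" "Cp - Cm"] assms by simp

lemma powr_edge_le:
  assumes "Cm < x" "x < Cp" "p \<ge> 0"
  shows "(Cp - x) powr (p - 5/4) \<le> (Cp - Cm) powr p * (Cp - x) powr (- 5/4)"
proof -
  have "(Cp - x) powr (p - 5/4) = (Cp - x) powr p * (Cp - x) powr (- 5/4)"
    by (simp add: powr_add[symmetric])
  then show ?thesis using assms by (auto intro!: mult_right_mono powr_mono2)
qed

lemma integrable_inverse_edge: "integrable \<nu> (\<lambda>x. 1 / (Cp - x))"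
  by (rule integrable_edge[where c = "(Cp - Cm) powr (1/4)"])
     (use inverse_edge_bound powr_edge_le[where p = "1/4"] in \<open>auto intro: order.trans\<close>)

lemma integrable_ln_edge: "integrable \<nu> (\<lambda>x. - ln (Cp - x))"
proof (rule integrable_edge)
  fix x assume x: "Cm < x" "x < Cp"
  show "\<bar>- ln (Cp - x)\<bar> \<le> ((8 + (Cp - Cm) * (Cp - Cm) powr (1/8)) * (Cp - Cm) powr (9/8)) * (Cp - x) powr (- 5/4)"
    using ln_edge_bound[OF x] mult_left_mono[OF powr_edge_le[OF x, of "9/8"],
        of "8 + (Cp - Cm) * (Cp - Cm) powr (1/8)"] Cm_less_Cp
    by (simp add: mult.assoc)
qed simp

text \<open>With p = 1/4 the upper half cell contributes N times N^(-1/6); the value at the first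
  location is at most of order N^(2/3).\<close>

lemma sum_inverse_edge:
  obtains K where "K \<ge> 0" "\<And>N. N \<ge> 1 \<Longrightarrow>
    \<bar>real N * (LINT x|\<nu>. 1 / (Cp - x)) - (\<Sum>k=1..N. 1 / (Cp - \<xi> N k))\<bar> \<le> K * real N powr (5/6)"
proof (rule that[of "1 / (Cp - Cm) + C + C powr (1/4) * edge_moment"])
  show "0 \<le> 1 / (Cp - Cm) + C + C powr (1/4) * edge_moment"
    using Cm_less_Cp C_gt_1 edge_moment_nonneg by auto
  fix N :: nat assume N: "N \<ge> 1"
  have a: "\<bar>real N * (LINT x|\<nu>. 1 / (Cp - x)) - (\<Sum>k=1..N. 1 / (Cp - \<xi> N k))\<bar>
      \<le> \<bar>1 / (Cp - Cm)\<bar> + \<bar>1 / (Cp - \<xi> N 1)\<bar> + real N * (LINT x|\<nu>. indicator {\<xi> N 1..} x * \<bar>1 / (Cp - x)\<bar>)"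
    by (rule sum_locations_vs_integral[OF _ integrable_inverse_edge N]) (simp add: frac_le)
  have b: "(LINT x|\<nu>. indicator {\<xi> N 1..} x * \<bar>1 / (Cp - x)\<bar>) \<le> 1 * (C powr (1/4) * real N powr (- 2/3 * (1/4))) * edge_moment"
    by (rule edge_tail_integral[OF _ N]) (use inverse_edge_bound in auto)
  have N1: "1 \<le> real N powr (5/6)" using N by (simp add: ge_one_powr_ge_zero)
  have "inverse C * real N powr (- 2/3) \<le> Cp - \<xi> N 1"
    using location_gap[of 1 N] N by auto
  then have "1 / (Cp - \<xi> N 1) \<le> 1 / (inverse C * real N powr (- 2/3))"
    using C_gt_1 N location_bounds[of 1 N] by (intro frac_le) auto
  also have "\<dots> = C * real N powr (2/3)" using C_gt_1 by (simp add: powr_minus field_simps)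
  also have "\<dots> \<le> C * real N powr (5/6)" using C_gt_1 N by (intro mult_left_mono powr_mono) auto
  finally have c: "\<bar>1 / (Cp - \<xi> N 1)\<bar> \<le> C * real N powr (5/6)"
    using location_bounds[of 1 N] N by simp
  have "real N * (LINT x|\<nu>. indicator {\<xi> N 1..} x * \<bar>1 / (Cp - x)\<bar>)
      \<le> real N powr 1 * (C powr (1/4) * real N powr (- 1/6) * edge_moment)"
    using b N by (auto intro!: mult_left_mono)
  also have "\<dots> = C powr (1/4) * edge_moment * (real N powr 1 * real N powr (- 1/6))" by (simp add: mult_ac)
  also have "\<dots> = C powr (1/4) * edge_moment * real N powr (5/6)" by (simp only: powr_add[symmetric]) simp
  finally have d: "real N * (LINT x|\<nu>. indicator {\<xi> N 1..} x * \<bar>1 / (Cp - x)\<bar>) \<le> C powr (1/4) * edge_moment * real N powr (5/6)" .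
  have "\<bar>1 / (Cp - Cm)\<bar> \<le> 1 / (Cp - Cm) * real N powr (5/6)"
    using mult_left_mono[OF N1, of "1 / (Cp - Cm)"] Cm_less_Cp by simp
  then show "\<bar>real N * (LINT x|\<nu>. 1 / (Cp - x)) - (\<Sum>k=1..N. 1 / (Cp - \<xi> N k))\<bar>
      \<le> (1 / (Cp - Cm) + C + C powr (1/4) * edge_moment) * real N powr (5/6)"
    using a c d unfolding distrib_right by linarith
qed

text \<open>With p = 9/8 the upper half cell contributes N times N^(-3/4). The logarithm carries a
  minus sign in the proof because the comparison is for increasing functions.\<close>

lemma sum_ln_edge:
  obtains K where "K \<ge> 0" "\<And>N. N \<ge> 1 \<Longrightarrow>
    \<bar>real N * (LINT x|\<nu>. ln (Cp - x)) - (\<Sum>k=1..N. ln (Cp - \<xi> N k))\<bar> \<le> K * real N powr (1/4)"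
proof -
  define c where "c = 8 + (Cp - Cm) * (Cp - Cm) powr (1/8)"
  have c0: "c \<ge> 0" unfolding c_def using Cm_less_Cp by simp
  show ?thesis
  proof (rule that[of "\<bar>ln (Cp - Cm)\<bar> + c * C powr (1/8) + c * C powr (9/8) * edge_moment"])
    show "0 \<le> \<bar>ln (Cp - Cm)\<bar> + c * C powr (1/8) + c * C powr (9/8) * edge_moment"
      using c0 edge_moment_nonneg by auto
    fix N :: nat assume N: "N \<ge> 1"
    have a: "\<bar>real N * (LINT x|\<nu>. - ln (Cp - x)) - (\<Sum>k=1..N. - ln (Cp - \<xi> N k))\<bar>
        \<le> \<bar>- ln (Cp - Cm)\<bar> + \<bar>- ln (Cp - \<xi> N 1)\<bar> + real N * (LINT x|\<nu>. indicator {\<xi> N 1..} x * \<bar>- ln (Cp - x)\<bar>)"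
      by (rule sum_locations_vs_integral[OF _ integrable_ln_edge N]) simp
    have b: "(LINT x|\<nu>. indicator {\<xi> N 1..} x * \<bar>- ln (Cp - x)\<bar>) \<le> c * (C powr (9/8) * real N powr (- 2/3 * (9/8))) * edge_moment"
      by (rule edge_tail_integral[OF _ N c0]) (use ln_edge_bound in \<open>auto simp: c_def\<close>)
    have N1: "1 \<le> real N powr (1/4)" using N by (simp add: ge_one_powr_ge_zero)
    have gap: "inverse C * real N powr (- 2/3) \<le> Cp - \<xi> N 1"
      using location_gap[of 1 N] N by auto
    have "\<bar>- ln (Cp - \<xi> N 1)\<bar> \<le> c * (Cp - \<xi> N 1) powr (- 1/8)"
      using ln_edge_bound[of "\<xi> N 1"] location_bounds[of 1 N] N by (simp add: c_def)
    also have "\<dots> \<le> c * (inverse C * real N powr (- 2/3)) powr (- 1/8)"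
      using gap C_gt_1 N c0 by (intro mult_left_mono powr_mono2') auto
    also have "\<dots> = c * C powr (1/8) * real N powr (1/12)"
      using C_gt_1 by (simp add: powr_mult powr_powr inverse_powr powr_minus)
    also have "\<dots> \<le> c * C powr (1/8) * real N powr (1/4)"
      using c0 N by (intro mult_left_mono powr_mono) auto
    finally have e: "\<bar>- ln (Cp - \<xi> N 1)\<bar> \<le> c * C powr (1/8) * real N powr (1/4)" .
    have "real N * (LINT x|\<nu>. indicator {\<xi> N 1..} x * \<bar>- ln (Cp - x)\<bar>)
        \<le> real N powr 1 * (c * (C powr (9/8) * real N powr (- 3/4)) * edge_moment)"
      using b N by (auto intro!: mult_left_mono)
    also have "\<dots> = c * C powr (9/8) * edge_moment * (real N powr 1 * real N powr (- 3/4))" by (simp add: mult_ac)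
    also have "\<dots> = c * C powr (9/8) * edge_moment * real N powr (1/4)" by (simp only: powr_add[symmetric]) simp
    finally have d: "real N * (LINT x|\<nu>. indicator {\<xi> N 1..} x * \<bar>- ln (Cp - x)\<bar>) \<le> c * C powr (9/8) * edge_moment * real N powr (1/4)" .
    have "\<bar>- ln (Cp - Cm)\<bar> \<le> \<bar>ln (Cp - Cm)\<bar> * real N powr (1/4)"
      using mult_left_mono[OF N1, of "\<bar>ln (Cp - Cm)\<bar>"] by simp
    moreover have "real N * (LINT x|\<nu>. - ln (Cp - x)) - (\<Sum>k=1..N. - ln (Cp - \<xi> N k))
       = - (real N * (LINT x|\<nu>. ln (Cp - x)) - (\<Sum>k=1..N. ln (Cp - \<xi> N k)))"
      by (simp add: sum_negf)
    ultimately show "\<bar>real N * (LINT x|\<nu>. ln (Cp - x)) - (\<Sum>k=1..N. ln (Cp - \<xi> N k))\<bar>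
      \<le> (\<bar>ln (Cp - Cm)\<bar> + c * C powr (1/8) + c * C powr (9/8) * edge_moment) * real N powr (1/4)"
      using a d e unfolding distrib_right by (simp only: abs_minus_cancel)
  qed
qed

text \<open>A predicate on an arbitrary sequence, so that later estimates hold for all such spectra
  at once. The exponent 1/20 is a choice: small enough for the errors in the top gaps to remain
  below N^(1/4).\<close>

definition rigid :: "nat \<Rightarrow> (nat \<Rightarrow> real) \<Rightarrow> bool" where
  "rigid N l \<longleftrightarrow> (\<forall>k\<in>{1..N}. \<bar>l k - \<xi> N k\<bar>
     \<le> real N powr (1/20) * (real (min k (N + 1 - k)) powr (- 1/3) * real N powr (- 2/3)))"

text \<open>The exponent -37/60 is 1/20 - 2/3, the accuracy at the two ends of the spectrum, where
  rigidity is weakest.\<close>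

lemma rigid_bound:
  assumes "rigid N l" "1 \<le> k" "k \<le> N"
  shows "\<bar>l k - \<xi> N k\<bar> \<le> real N powr (- 37/60)"
proof -
  have "1 \<le> real (min k (N + 1 - k))" using assms by auto
  from powr_mono2'[OF _ _ this, of "- 1/3"]
  have "real (min k (N + 1 - k)) powr (- 1/3) \<le> 1" by simp
  then have "real N powr (1/20) * (real (min k (N + 1 - k)) powr (- 1/3) * real N powr (- 2/3))
      \<le> real N powr (1/20) * (1 * real N powr (- 2/3))"
    by (intro mult_left_mono mult_right_mono) auto
  also have "\<dots> = real N powr (- 37/60)" by (simp add: powr_add[symmetric])
  finally show ?thesis
    using order.trans[OF bspec[OF assms(1)[unfolded rigid_def], of k]] assms by simp
qed

lemma rigid_range:
  assumes "rigid N l" "1 \<le> k" "k \<le> N"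
  shows "Cm - real N powr (- 37/60) < l k" "l k < Cp + real N powr (- 37/60)"
  using rigid_bound[OF assms] location_bounds[OF assms(2,3)] by linarith+

text \<open>Monotonicity compares locations with the integral, the Lipschitz bound compares
  eigenvalues with locations, and 23/60 is 1 - 37/60. The margin \<open>d\<close> is there because
  eigenvalues may lie outside the support.\<close>

lemma rigid_sum_lipschitz:
  assumes mono: "\<And>x y. Cm \<le> x \<Longrightarrow> x \<le> y \<Longrightarrow> y < Cp \<Longrightarrow> h x \<le> h y"
    and meas: "h \<in> borel_measurable borel"
    and B: "\<And>x. Cm \<le> x \<Longrightarrow> x < Cp \<Longrightarrow> \<bar>h x\<bar> \<le> B"
    and lip: "L-lipschitz_on {Cm - d..Cp + d} h" and d: "real N powr (- 37/60) \<le> d" and N: "N \<ge> 1"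
    and r: "rigid N l"
  shows "\<bar>(\<Sum>k=1..N. h (l k)) - real N * (LINT x|\<nu>. h x)\<bar> \<le> 3 * B + L * real N powr (23/60)"
proof -
  have "\<bar>(\<Sum>k=1..N. h (l k)) - (\<Sum>k=1..N. h (\<xi> N k))\<bar> \<le> (\<Sum>k=1..N. \<bar>h (l k) - h (\<xi> N k)\<bar>)"
    unfolding sum_subtractf[symmetric] by (rule sum_abs)
  also have "\<dots> \<le> (\<Sum>k=1..N. L * real N powr (- 37/60))"
  proof (rule sum_mono)
    fix k assume k: "k \<in> {1..N}"
    have "\<bar>h (l k) - h (\<xi> N k)\<bar> \<le> L * \<bar>l k - \<xi> N k\<bar>"
    proof -
      have "l k \<in> {Cm - d..Cp + d}" "\<xi> N k \<in> {Cm - d..Cp + d}"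
        using rigid_range[OF r, of k] location_bounds[of k N] k d order.trans[OF powr_ge_zero d]
        by auto
      then show ?thesis using lipschitz_onD[OF lip] unfolding dist_real_def by blast
    qed
    also have "\<dots> \<le> L * real N powr (- 37/60)"
      using rigid_bound[OF r, of k] k lipschitz_on_nonneg[OF lip] by (intro mult_left_mono) auto
    finally show "\<bar>h (l k) - h (\<xi> N k)\<bar> \<le> L * real N powr (- 37/60)" .
  qed
  also have "\<dots> = L * (real N powr 1 * real N powr (- 37/60))" using N by simp
  also have "\<dots> = L * real N powr (23/60)" by (simp only: powr_add[symmetric]) simp
  finally show ?thesis
    using sum_locations_bounded[OF mono meas N B] by linarith
qed

end

lemma card_le_real:
  assumes "x \<ge> 0"
  shows "real (card {k \<in> {1..N}. real k \<le> x}) \<le> x"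
proof -
  have "{k \<in> {1..N}. real k \<le> x} \<subseteq> {1..nat \<lfloor>x\<rfloor>}" by (auto simp: le_nat_floor)
  then have "card {k \<in> {1..N}. real k \<le> x} \<le> card {1..nat \<lfloor>x\<rfloor>}" by (intro card_mono) auto
  then show ?thesis using assms by (simp add: of_nat_floor le_floor_iff) linarith
qed

section \<open>Sums over the gaps below the shifted top eigenvalue\<close>

context edge_locations begin

context
  fixes N :: nat and l :: "nat \<Rightarrow> real"
  assumes N: "N \<ge> 1" and r: "rigid N l" and top: "\<And>k. k \<in> {1..N} \<Longrightarrow> l k \<le> l 1"
begin

abbreviation "zt \<equiv> l 1 + 1 / real N"

lemma N_ge_1: "real N \<ge> 1" using N by simp

lemma N_powr_ge_1: "p \<ge> 0 \<Longrightarrow> 1 \<le> real N powr p" using N_ge_1 by (simp add: ge_one_powr_ge_zero)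

lemma N_powr_le_1: "p \<le> 0 \<Longrightarrow> real N powr p \<le> 1" using powr_mono[of p 0 "real N"] N_ge_1 by simp

text \<open>In the constant, \<open>C\<close> accounts for the first location and the other 2 for
  rigidity and the shift 1/N.\<close>

lemma z_minus_edge: "\<bar>zt - Cp\<bar> \<le> (C + 2) * real N powr (- 37/60)"
proof -
  have 1: "\<bar>l 1 - \<xi> N 1\<bar> \<le> real N powr (- 37/60)" using rigid_bound[OF r, of 1] N by simp
  have "\<bar>\<xi> N 1 - Cp\<bar> \<le> C * real N powr (- 2/3)"
    using location_gap[of 1 N] location_bounds[of 1 N] N by auto
  also have "\<dots> \<le> C * real N powr (- 37/60)"
    using C_gt_1 N_ge_1 by (intro mult_left_mono powr_mono) auto
  finally have 2: "\<bar>\<xi> N 1 - Cp\<bar> \<le> C * real N powr (- 37/60)" .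
  have "1 / real N = real N powr (- 1)" using N by (simp add: powr_minus_divide)
  also have "\<dots> \<le> real N powr (- 37/60)" using N_ge_1 by (intro powr_mono) auto
  finally have 3: "1 / real N \<le> real N powr (- 37/60)" .
  have "0 < 1 / real N" using N by simp
  then show ?thesis using 1 2 3 unfolding distrib_right by linarith
qed

lemma gap_pos: "k \<in> {1..N} \<Longrightarrow> zt - l k \<ge> 1 / real N"
  using top by fastforce

lemma gap_gt_0: "k \<in> {1..N} \<Longrightarrow> zt - l k > 0"
  by (rule less_le_trans[OF _ gap_pos]) (use N in simp_all)

lemma gap_upper: "k \<in> {1..N} \<Longrightarrow> zt - l k \<le> Cp - Cm + 3"
proof -
  assume k: "k \<in> {1..N}"
  have "1 / real N \<le> 1" using N by simp
  moreover have "real N powr (- 37/60) \<le> 1" by (rule N_powr_le_1) simp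
  moreover have "l 1 < Cp + real N powr (- 37/60)" "Cm - real N powr (- 37/60) < l k"
    using rigid_range[OF r, of 1] rigid_range[OF r, of k] k N by auto
  ultimately show ?thesis by linarith
qed

lemma inverse_location_gap:
  assumes "k \<in> {1..N}"
  shows "1 / (Cp - \<xi> N k) \<le> C * real N powr (2/3) * real k powr (- 2/3)"
proof -
  have "inverse C * real k powr (2/3) * real N powr (- 2/3) \<le> Cp - \<xi> N k"
    using location_gap[of k N] assms by auto
  then have "1 / (Cp - \<xi> N k) \<le> 1 / (inverse C * real k powr (2/3) * real N powr (- 2/3))"
    using C_gt_1 N assms location_bounds[of k N] by (intro frac_le) auto
  also have "\<dots> = C * real N powr (2/3) * real k powr (- 2/3)"
    using C_gt_1 by (simp add: powr_minus field_simps)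
  finally show ?thesis .
qed

text \<open>The gap to \<open>zt\<close> is the deterministic gap \<open>Cp - \<xi> N k\<close>
  times \<open>1 + rel_shift k\<close>; the logarithms and inverses of gaps are expanded in this
  quantity.\<close>

definition rel_shift :: "nat \<Rightarrow> real" where "rel_shift k = ((zt - Cp) - (l k - \<xi> N k)) / (Cp - \<xi> N k)"

lemma gap_eq: "k \<in> {1..N} \<Longrightarrow> zt - l k = (Cp - \<xi> N k) * (1 + rel_shift k)"
  unfolding rel_shift_def using location_bounds[of k N] by (simp add: field_simps)

lemma rel_shift_bound:
  assumes k: "k \<in> {1..N}"
  shows "\<bar>rel_shift k\<bar> \<le> C * (C + 3) * real N powr (1/20) * real k powr (- 2/3)"
proof -
  have pos: "Cp - \<xi> N k > 0" using location_bounds[of k N] k by auto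
  have "\<bar>(zt - Cp) - (l k - \<xi> N k)\<bar> \<le> (C + 3) * real N powr (- 37/60)"
    using z_minus_edge rigid_bound[OF r, of k] k by (auto simp: algebra_simps)
  then have "\<bar>rel_shift k\<bar> \<le> (C + 3) * real N powr (- 37/60) * (1 / (Cp - \<xi> N k))"
    unfolding rel_shift_def abs_divide using pos by (simp add: divide_right_mono)
  also have "\<dots> \<le> (C + 3) * real N powr (- 37/60) * (C * real N powr (2/3) * real k powr (- 2/3))"
    using inverse_location_gap[OF k] C_gt_1 by (intro mult_left_mono) auto
  also have "\<dots> = C * (C + 3) * (real N powr (- 37/60) * real N powr (2/3)) * real k powr (- 2/3)"
    by (simp only: mult_ac)
  also have "real N powr (- 37/60) * real N powr (2/3) = real N powr (1/20)"
    by (simp add: powr_add[symmetric])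
  finally show ?thesis .
qed

text \<open>The bound N^(1/20) k^(-2/3) becomes small once k exceeds N^(3/40). The cutoff N^(1/10)
  leaves N^(1/20 - 1/15).\<close>

lemma rel_shift_bound_bulk:
  assumes k: "k \<in> {1..N}" "real k > real N powr (1/10)"
  shows "\<bar>rel_shift k\<bar> \<le> C * (C + 3) * real N powr (- 1/60)"
proof -
  have "real k powr (- 2/3) \<le> (real N powr (1/10)) powr (- 2/3)"
    using k N by (intro powr_mono2') auto
  then have "C * (C + 3) * real N powr (1/20) * real k powr (- 2/3)
      \<le> C * (C + 3) * real N powr (1/20) * (real N powr (1/10)) powr (- 2/3)"
    using C_gt_1 by (intro mult_left_mono) auto
  also have "\<dots> = C * (C + 3) * (real N powr (1/20) * real N powr (- 1/15))"
    by (simp add: powr_powr)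
  also have "\<dots> = C * (C + 3) * real N powr (- 1/60)" by (simp add: powr_add[symmetric])
  finally show ?thesis using rel_shift_bound[OF k(1)] by linarith
qed

text \<open>The common shift \<open>zt - Cp\<close> is kept to first order because it carries the
  fluctuation of the top eigenvalue; the individual displacements count as error.\<close>

definition log_err :: "nat \<Rightarrow> real" where
  "log_err k = ln (zt - l k) - ln (Cp - \<xi> N k) - (zt - Cp) / (Cp - \<xi> N k)"

text \<open>Two errors: the quadratic Taylor term, of order N^(1/10) k^(-4/3), and the displacement
  of \<open>l k\<close> relative to the distance from the edge, of order N^(1/20) divided by
  \<open>min k (N + 1 - k)\<close>. Each sums to a small power of N times a logarithm.\<close>

lemma log_err_bulk:
  assumes k: "k \<in> {1..N}" "real k > real N powr (1/10)"
    and small: "C * (C + 3) * real N powr (- 1/60) \<le> 1/2"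
  shows "\<bar>log_err k\<bar> \<le> 2 * (C * (C + 3))\<^sup>2 * real N powr (1/10) * (1 / real k)
    + C * real N powr (1/20) * (1 / real k + 1 / real (N + 1 - k))"
proof -
  define m where "m = min k (N + 1 - k)"
  have m: "m \<ge> 1" "m \<le> k" using k unfolding m_def by auto
  have pos: "Cp - \<xi> N k > 0" using location_bounds[of k N] k by auto
  have rel_shift: "\<bar>rel_shift k\<bar> \<le> 1/2" using rel_shift_bound_bulk[OF k] small by linarith
  have eq: "log_err k = (ln (1 + rel_shift k) - rel_shift k) - (l k - \<xi> N k) / (Cp - \<xi> N k)"
  proof -
    have "1 + rel_shift k > 0" using rel_shift by linarith
    then have "ln ((Cp - \<xi> N k) * (1 + rel_shift k)) = ln (Cp - \<xi> N k) + ln (1 + rel_shift k)"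
      using pos by (intro ln_mult_pos)
    moreover have "rel_shift k = (zt - Cp) / (Cp - \<xi> N k) - (l k - \<xi> N k) / (Cp - \<xi> N k)"
      unfolding rel_shift_def by (rule diff_divide_distrib)
    ultimately show ?thesis unfolding log_err_def gap_eq[OF k(1)] by linarith
  qed
  have "\<bar>ln (1 + rel_shift k) - rel_shift k\<bar> \<le> 2 * (rel_shift k)\<^sup>2" by (rule ln_one_plus_minus_self[OF rel_shift])
  also have "(rel_shift k)\<^sup>2 \<le> (C * (C + 3) * real N powr (1/20) * real k powr (- 2/3))\<^sup>2"
    using rel_shift_bound[OF k(1)] by (metis abs_ge_zero power2_abs power_mono)
  also have "\<dots> = (C * (C + 3))\<^sup>2 * real N powr (1/10) * real k powr (- 4/3)"
  proof -
    have sq: "(x powr a)\<^sup>2 = x powr (2 * a)" for x a :: real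
      by (simp add: power2_eq_square powr_add[symmetric])
    show ?thesis by (simp add: power_mult_distrib sq)
  qed
  also have "\<dots> \<le> (C * (C + 3))\<^sup>2 * real N powr (1/10) * real k powr (- 1)"
    using k by (intro mult_left_mono powr_mono) auto
  also have "real k powr (- 1) = 1 / real k" using k by (simp add: powr_minus_divide)
  finally have 1: "\<bar>ln (1 + rel_shift k) - rel_shift k\<bar> \<le> 2 * ((C * (C + 3))\<^sup>2 * real N powr (1/10) * (1 / real k))"
    by linarith
  have "\<bar>(l k - \<xi> N k) / (Cp - \<xi> N k)\<bar> = \<bar>l k - \<xi> N k\<bar> * (1 / (Cp - \<xi> N k))"
    using pos by simp
  also have "\<dots> \<le> real N powr (1/20) * (real m powr (- 1/3) * real N powr (- 2/3))
      * (C * real N powr (2/3) * real k powr (- 2/3))"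
    using r k(1) inverse_location_gap[OF k(1)] pos unfolding rigid_def m_def
    by (intro mult_mono) auto
  also have "\<dots> = C * real N powr (1/20) * (real N powr (- 2/3) * real N powr (2/3)) * (real m powr (- 1/3) * real k powr (- 2/3))"
    by (simp only: mult_ac)
  also have "real N powr (- 2/3) * real N powr (2/3) = 1"
    using N by (simp add: powr_add[symmetric])
  also have "real m powr (- 1/3) * real k powr (- 2/3) \<le> real m powr (- 1/3) * real m powr (- 2/3)"
    using m by (intro mult_left_mono powr_mono2') auto
  also have "\<dots> = 1 / real m" using m by (simp add: powr_add[symmetric] powr_minus_divide)
  also have "1 / real m \<le> 1 / real k + 1 / real (N + 1 - k)" unfolding m_def by (auto simp: min_def)
  finally have 2: "\<bar>(l k - \<xi> N k) / (Cp - \<xi> N k)\<bar> \<le> C * real N powr (1/20) * (1 / real k + 1 / real (N + 1 - k))"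
    using C_gt_1 by (simp add: mult_left_mono)
  show ?thesis using 1 2 unfolding eq mult.assoc by linarith
qed

lemma ln_gap_lower: "k \<in> {1..N} \<Longrightarrow> - ln (real N) \<le> ln (zt - l k)"
proof -
  assume k: "k \<in> {1..N}"
  have "ln (1 / real N) \<le> ln (zt - l k)"
    using gap_pos[OF k] gap_gt_0[OF k] N ln_le_cancel_iff[of "1 / real N" "zt - l k"] by simp
  then show ?thesis using N by (simp add: ln_div)
qed

lemma ln_gap_upper: "k \<in> {1..N} \<Longrightarrow> ln (zt - l k) \<le> Cp - Cm + 3"
proof -
  assume k: "k \<in> {1..N}"
  have "0 < zt - l k" by (rule gap_gt_0[OF k])
  then show ?thesis using ln_less_self[of "zt - l k"] gap_upper[OF k] by linarith
qed

text \<open>Below the cutoff no expansion is available, but the gap is at least 1/N and each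
  logarithm is at most of order ln N. The 42 is twice the 21 of
  \<open>ln_one_plus_le_powr\<close>.\<close>

lemma log_err_crude:
  assumes k: "k \<in> {1..N}"
  shows "\<bar>log_err k\<bar> \<le> (42 + (Cp - Cm + 3) + ln C + (Cp - Cm) + (C + 2) * C) * real N powr (1/20)"
proof -
  let ?x = "real N powr (1/20)"
  have pos: "Cp - \<xi> N k > 0" "Cp - \<xi> N k < Cp - Cm" using location_bounds[of k N] k by auto
  have L: "0 \<le> ln (real N)" "1 + ln (real N) \<le> 21 * ?x" "1 \<le> ?x"
    using N_ge_1 ln_one_plus_le_powr[of "real N"] N_powr_ge_1 by auto
  have lnC: "ln C > 0" using C_gt_1 by simp
  have 1: "\<bar>ln (zt - l k)\<bar> \<le> ln (real N) + (Cp - Cm + 3)"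
    using ln_gap_lower[OF k] ln_gap_upper[OF k] L Cm_less_Cp by linarith
  have "inverse C * real k powr (2/3) * real N powr (- 2/3) \<le> Cp - \<xi> N k"
    using location_gap[of k N] k by auto
  moreover have "inverse C * 1 * real N powr (- 1) \<le> inverse C * real k powr (2/3) * real N powr (- 2/3)"
    using C_gt_1 N_ge_1 k by (intro mult_mono powr_mono mult_left_mono ge_one_powr_ge_zero) auto
  ultimately have "ln (inverse C * real N powr (- 1)) \<le> ln (Cp - \<xi> N k)"
    using C_gt_1 N pos by (subst ln_le_cancel_iff) auto
  then have "- ln C - ln (real N) \<le> ln (Cp - \<xi> N k)"
  proof -
    have "ln (inverse C * real N powr (- 1)) = ln (inverse C) + ln (real N powr (- 1))"
      using C_gt_1 N by (intro ln_mult_pos) auto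
    moreover have "ln (real N powr (- 1)) = - ln (real N)" using N by (subst ln_powr) auto
    ultimately have "ln (inverse C * real N powr (- 1)) = - ln C - ln (real N)"
      using C_gt_1 by (simp only: ln_inverse)
    then show ?thesis using \<open>ln (inverse C * real N powr (- 1)) \<le> ln (Cp - \<xi> N k)\<close> by simp
  qed
  moreover have "ln (Cp - \<xi> N k) \<le> Cp - Cm" using ln_less_self[OF pos(1)] pos(2) by linarith
  ultimately have 2: "\<bar>ln (Cp - \<xi> N k)\<bar> \<le> ln C + ln (real N) + (Cp - Cm)"
    using lnC L Cm_less_Cp by linarith
  have "\<bar>(zt - Cp) / (Cp - \<xi> N k)\<bar> = \<bar>zt - Cp\<bar> * (1 / (Cp - \<xi> N k))" using pos by simp
  also have "\<dots> \<le> (C + 2) * real N powr (- 37/60) * (C * real N powr (2/3) * real k powr (- 2/3))"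
    using z_minus_edge inverse_location_gap[OF k] pos C_gt_1 by (intro mult_mono) auto
  also have "\<dots> \<le> (C + 2) * real N powr (- 37/60) * (C * real N powr (2/3) * 1)"
    using k C_gt_1 powr_mono2'[of "-2/3" 1 "real k"] by (intro mult_left_mono) auto
  also have "\<dots> = (C + 2) * C * (real N powr (- 37/60) * real N powr (2/3))" by (simp only: mult_ac mult_1_right)
  also have "real N powr (- 37/60) * real N powr (2/3) = ?x" by (simp add: powr_add[symmetric])
  finally have 3: "\<bar>(zt - Cp) / (Cp - \<xi> N k)\<bar> \<le> (C + 2) * C * ?x" .
  have a: "c \<le> c * ?x" if "c \<ge> 0" for c using mult_left_mono[OF L(3) that] by simp
  have "\<bar>log_err k\<bar> \<le> 2 * ln (real N) + (Cp - Cm + 3) + ln C + (Cp - Cm) + (C + 2) * C * ?x"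
    unfolding log_err_def using 1 2 3 by linarith
  also have "\<dots> \<le> 42 * ?x + (Cp - Cm + 3) * ?x + ln C * ?x + (Cp - Cm) * ?x + (C + 2) * C * ?x"
    using L a[of "Cp - Cm + 3"] a[of "ln C"] a[of "Cp - Cm"] lnC Cm_less_Cp by linarith
  finally show ?thesis by (simp add: algebra_simps)
qed

definition log_err_const :: real where
  "log_err_const = 42 * (C * (C + 3))\<^sup>2 + 42 * C + (42 + (Cp - Cm + 3) + ln C + (Cp - Cm) + (C + 2) * C)"

text \<open>The harmonic sums give at most N^(1/10) N^(1/20), and at most N^(1/10) crude terms give
  N^(1/20) each: order N^(3/20) in all, rounded up to the N^(1/4) of
  \<open>sum_ln_edge\<close>.\<close>

lemma sum_log_err:
  assumes small: "C * (C + 3) * real N powr (- 1/60) \<le> 1/2"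
  shows "\<bar>\<Sum>k=1..N. log_err k\<bar> \<le> log_err_const * real N powr (1/4)"
proof -
  define c3 where "c3 = 42 + (Cp - Cm + 3) + ln C + (Cp - Cm) + (C + 2) * C"
  define a where "a = 2 * (C * (C + 3))\<^sup>2 * real N powr (1/10)"
  define b where "b = C * real N powr (1/20)"
  let ?x = "real N powr (1/20)"
  have c3: "c3 \<ge> 0" unfolding c3_def using C_gt_1 Cm_less_Cp by (intro add_nonneg_nonneg) auto
  have ab: "a \<ge> 0" "b \<ge> 0" unfolding a_def b_def using C_gt_1 by auto
  have H: "1 + ln (real N) \<le> 21 * ?x" using ln_one_plus_le_powr N_ge_1 by blast
  have "\<bar>\<Sum>k=1..N. log_err k\<bar> \<le> (\<Sum>k=1..N. \<bar>log_err k\<bar>)" by (rule sum_abs)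
  also have "\<dots> \<le> (\<Sum>k=1..N. a * (1 / real k) + b * (1 / real k + 1 / real (N + 1 - k))
      + (if real k \<le> real N powr (1/10) then c3 * ?x else 0))"
  proof (rule sum_mono)
    fix k assume k: "k \<in> {1..N}"
    show "\<bar>log_err k\<bar> \<le> a * (1 / real k) + b * (1 / real k + 1 / real (N + 1 - k))
      + (if real k \<le> real N powr (1/10) then c3 * ?x else 0)"
    proof (cases "real k \<le> real N powr (1/10)")
      case True
      have "0 \<le> a * (1 / real k) + b * (1 / real k + 1 / real (N + 1 - k))"
        using ab by (intro add_nonneg_nonneg mult_nonneg_nonneg) auto
      then show ?thesis using log_err_crude[OF k] True unfolding c3_def by simp
    next
      case False
      then show ?thesis using log_err_bulk[OF k _ small] unfolding a_def b_def by simp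
    qed
  qed
  also have "\<dots> = a * (\<Sum>k=1..N. 1 / real k) + b * ((\<Sum>k=1..N. 1 / real k) + (\<Sum>k=1..N. 1 / real (N + 1 - k)))
      + c3 * ?x * real (card {k \<in> {1..N}. real k \<le> real N powr (1/10)})"
    by (simp add: sum.distrib sum_distrib_left sum.If_cases Int_def conj_commute distrib_left)
  also have "\<dots> \<le> a * (21 * ?x) + b * (21 * ?x + 21 * ?x) + c3 * ?x * real N powr (1/10)"
    using sum_inverse_le[OF N] H ab c3 card_le_real[of "real N powr (1/10)" N]
    by (intro add_mono mult_left_mono) auto
  also have "\<dots> = 42 * (C * (C + 3))\<^sup>2 * (real N powr (1/10) * ?x) + 42 * C * (?x * ?x) + c3 * (?x * real N powr (1/10))"
    unfolding a_def b_def by simp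
  also have "\<dots> = 42 * (C * (C + 3))\<^sup>2 * real N powr (3/20) + 42 * C * real N powr (1/10) + c3 * real N powr (3/20)"
    by (simp add: powr_add[symmetric])
  also have "\<dots> \<le> 42 * (C * (C + 3))\<^sup>2 * real N powr (1/4) + 42 * C * real N powr (1/4) + c3 * real N powr (1/4)"
    using C_gt_1 c3 N_ge_1 by (intro add_mono mult_left_mono powr_mono) auto
  also have "\<dots> = log_err_const * real N powr (1/4)"
    unfolding log_err_const_def c3_def by (simp add: algebra_simps)
  finally show ?thesis .
qed

text \<open>The poor rate 5/6 for the inverse sum suffices because that sum is multiplied by the
  shift of \<open>zt\<close>: -37/60 + 5/6 = 13/60 < 1/4.\<close>

lemma sum_ln_gap:
  assumes small: "C * (C + 3) * real N powr (- 1/60) \<le> 1/2"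
    and K1: "\<bar>real N * (LINT x|\<nu>. ln (Cp - x)) - (\<Sum>k=1..N. ln (Cp - \<xi> N k))\<bar> \<le> K1 * real N powr (1/4)"
    and K2: "\<bar>real N * (LINT x|\<nu>. 1 / (Cp - x)) - (\<Sum>k=1..N. 1 / (Cp - \<xi> N k))\<bar> \<le> K2 * real N powr (5/6)"
      "K2 \<ge> 0"
  shows "\<bar>(\<Sum>k=1..N. ln (zt - l k)) - real N * (LINT x|\<nu>. ln (Cp - x))
      - (zt - Cp) * (real N * (LINT x|\<nu>. 1 / (Cp - x)))\<bar>
    \<le> (log_err_const + K1 + (C + 2) * K2) * real N powr (1/4)"
proof -
  have eq: "(\<Sum>k=1..N. log_err k) = (\<Sum>k=1..N. ln (zt - l k)) - (\<Sum>k=1..N. ln (Cp - \<xi> N k))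
      - (zt - Cp) * (\<Sum>k=1..N. 1 / (Cp - \<xi> N k))"
    unfolding log_err_def sum_subtractf sum_distrib_left by simp
  have "\<bar>(zt - Cp) * (real N * (LINT x|\<nu>. 1 / (Cp - x)) - (\<Sum>k=1..N. 1 / (Cp - \<xi> N k)))\<bar>
      \<le> (C + 2) * real N powr (- 37/60) * (K2 * real N powr (5/6))"
    unfolding abs_mult using z_minus_edge K2 C_gt_1 by (intro mult_mono) auto
  also have "\<dots> = (C + 2) * K2 * (real N powr (- 37/60) * real N powr (5/6))" by (simp only: mult_ac)
  also have "\<dots> = (C + 2) * K2 * real N powr (13/60)" by (simp add: powr_add[symmetric])
  also have "\<dots> \<le> (C + 2) * K2 * real N powr (1/4)"
    using C_gt_1 K2 N_ge_1 by (intro mult_left_mono powr_mono) auto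
  finally show ?thesis
    using sum_log_err[OF small] K1 unfolding eq distrib_right right_diff_distrib by linarith
qed

text \<open>A uniformly small relative shift \<eta> changes each inverse gap by a factor at most 1 /
  (1 - \<eta>), which is at most 1 + 2 \<eta> for \<eta> up to 1/2.\<close>

lemma sum_inverse_gap_bulk:
  assumes small: "C * (C + 3) * real N powr (- 1/60) \<le> 1/2"
    and K2: "\<bar>real N * (LINT x|\<nu>. 1 / (Cp - x)) - (\<Sum>k=1..N. 1 / (Cp - \<xi> N k))\<bar> \<le> K2 * real N powr (5/6)"
  shows "(\<Sum>k | k \<in> {1..N} \<and> real k > real N powr (1/10). 1 / (zt - l k))
    \<le> (1 + 2 * (C * (C + 3) * real N powr (- 1/60)))
       * (real N * (LINT x|\<nu>. 1 / (Cp - x)) + K2 * real N powr (5/6))"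
proof -
  define \<eta> where "\<eta> = C * (C + 3) * real N powr (- 1/60)"
  have eta: "0 \<le> \<eta>" "\<eta> \<le> 1/2" unfolding \<eta>_def using C_gt_1 small by auto
  have "(\<Sum>k | k \<in> {1..N} \<and> real k > real N powr (1/10). 1 / (zt - l k))
      \<le> (\<Sum>k | k \<in> {1..N} \<and> real k > real N powr (1/10). (1 + 2 * \<eta>) * (1 / (Cp - \<xi> N k)))"
  proof (rule sum_mono)
    fix k assume "k \<in> {k. k \<in> {1..N} \<and> real k > real N powr (1/10)}"
    then have k: "k \<in> {1..N}" "real k > real N powr (1/10)" by auto
    have pos: "Cp - \<xi> N k > 0" using location_bounds[of k N] k by auto
    have "1 / (1 + rel_shift k) \<le> 1 / (1 - \<eta>)"
      using rel_shift_bound_bulk[OF k] eta unfolding \<eta>_def by (intro frac_le) auto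
    also have "\<dots> \<le> 1 + 2 * \<eta>"
    proof -
      have "1 \<le> (1 + 2 * \<eta>) * (1 - \<eta>)"
        using mult_nonneg_nonneg[of \<eta> "1 - 2 * \<eta>"] eta by (simp add: algebra_simps)
      then show ?thesis using eta by (simp add: divide_le_eq)
    qed
    finally have "1 / (Cp - \<xi> N k) * (1 / (1 + rel_shift k)) \<le> 1 / (Cp - \<xi> N k) * (1 + 2 * \<eta>)"
      using pos by (intro mult_left_mono) auto
    then show "1 / (zt - l k) \<le> (1 + 2 * \<eta>) * (1 / (Cp - \<xi> N k))"
      unfolding gap_eq[OF k(1)] by (simp add: mult.commute)
  qed
  also have "\<dots> \<le> (\<Sum>k=1..N. (1 + 2 * \<eta>) * (1 / (Cp - \<xi> N k)))"
    using eta location_bounds by (intro sum_mono2) (auto simp: less_imp_le)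
  also have "\<dots> = (1 + 2 * \<eta>) * (\<Sum>k=1..N. 1 / (Cp - \<xi> N k))" by (simp add: sum_distrib_left)
  also have "\<dots> \<le> (1 + 2 * \<eta>) * (real N * (LINT x|\<nu>. 1 / (Cp - x)) + K2 * real N powr (5/6))"
    using K2 eta by (intro mult_left_mono) auto
  finally show ?thesis unfolding \<eta>_def .
qed

text \<open>Rigidity does not separate the second eigenvalue from the first, so
  \<open>1 / (zt - l 2)\<close> may be as large as N and spoil the mean of the other squared
  coordinates. Raising the first N^(1/10) gaps by 1 bounds their inverses by 1 and costs only
  logarithms in the determinant.\<close>

definition soft_gap :: "nat \<Rightarrow> real" where
  "soft_gap k = zt - l k + (if real k \<le> real N powr (1/10) then 1 else 0)"

lemma soft_gap_pos: "k \<in> {1..N} \<Longrightarrow> soft_gap k > 0"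
proof -
  assume "k \<in> {1..N}"
  from gap_gt_0[OF this] show ?thesis unfolding soft_gap_def by (cases "real k \<le> real N powr (1/10)") simp_all
qed

lemma soft_gap_ge: "soft_gap k \<ge> zt - l k" unfolding soft_gap_def by simp

lemma sum_ln_soft_gap:
  "(\<Sum>k=2..N. ln (soft_gap k)) \<le> (\<Sum>k=1..N. ln (zt - l k)) + (42 + (Cp - Cm + 4)) * real N powr (1/4)"
proof -
  let ?x = "real N powr (1/20)"
  define c where "c = Cp - Cm + 4 + ln (real N)"
  have L: "0 \<le> ln (real N)" "1 + ln (real N) \<le> 21 * ?x" "1 \<le> ?x"
    using N_ge_1 ln_one_plus_le_powr[of "real N"] N_powr_ge_1 by auto
  have c: "c \<ge> 0" unfolding c_def using L Cm_less_Cp by linarith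
  have "(\<Sum>k=2..N. ln (soft_gap k)) \<le> (\<Sum>k=2..N. ln (zt - l k) + (if real k \<le> real N powr (1/10) then c else 0))"
  proof (rule sum_mono)
    fix k assume "k \<in> {2..N}"
    then have k: "k \<in> {1..N}" by auto
    show "ln (soft_gap k) \<le> ln (zt - l k) + (if real k \<le> real N powr (1/10) then c else 0)"
    proof (cases "real k \<le> real N powr (1/10)")
      case True
      have "ln (soft_gap k) \<le> soft_gap k" using ln_less_self[OF soft_gap_pos[OF k]] by linarith
      also have "\<dots> \<le> Cp - Cm + 4" using gap_upper[OF k] True unfolding soft_gap_def by simp
      finally show ?thesis using ln_gap_lower[OF k] True unfolding c_def by simp
    qed (simp add: soft_gap_def)
  qed
  also have "\<dots> = (\<Sum>k=2..N. ln (zt - l k)) + c * real (card {k \<in> {2..N}. real k \<le> real N powr (1/10)})"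
    by (simp add: sum.distrib sum.If_cases Int_def conj_commute)
  also have "\<dots> \<le> (\<Sum>k=2..N. ln (zt - l k)) + c * real (card {k \<in> {1..N}. real k \<le> real N powr (1/10)})"
    using c by (intro add_left_mono mult_left_mono of_nat_mono card_mono) auto
  also have "\<dots> \<le> (\<Sum>k=2..N. ln (zt - l k)) + c * real N powr (1/10)"
    using c card_le_real[of "real N powr (1/10)" N] by (intro add_left_mono mult_left_mono) auto
  \<comment> \<open>The first gap is exactly 1/N, so leaving it out of the sum costs ln N.\<close>
  also have "(\<Sum>k=2..N. ln (zt - l k)) = (\<Sum>k=1..N. ln (zt - l k)) + ln (real N)"
  proof -
    have "(\<Sum>k=1..N. ln (zt - l k)) = ln (zt - l 1) + (\<Sum>k=2..N. ln (zt - l k))"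
      using N by (simp add: sum.atLeast_Suc_atMost numeral_2_eq_2)
    moreover have "ln (zt - l 1) = - ln (real N)" using N by (simp add: ln_div)
    ultimately show ?thesis by simp
  qed
  also have "c * real N powr (1/10) \<le> (Cp - Cm + 4 + 21) * (?x * real N powr (1/10))"
  proof -
    have "Cp - Cm + 4 \<le> (Cp - Cm + 4) * ?x" using mult_left_mono[OF L(3), of "Cp - Cm + 4"] Cm_less_Cp by simp
    then have "c \<le> (Cp - Cm + 4 + 21) * ?x" unfolding c_def distrib_right using L by linarith
    from mult_right_mono[OF this, of "real N powr (1/10)"]
    show ?thesis unfolding mult.assoc by simp
  qed
  also have "?x * real N powr (1/10) = real N powr (3/20)" by (simp add: powr_add[symmetric])
  also have "(Cp - Cm + 4 + 21) * real N powr (3/20) \<le> (Cp - Cm + 4 + 21) * real N powr (1/4)"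
    using Cm_less_Cp N_ge_1 by (intro mult_left_mono powr_mono) auto
  finally have "(\<Sum>k=2..N. ln (soft_gap k)) \<le> (\<Sum>k=1..N. ln (zt - l k)) + ln (real N)
     + (Cp - Cm + 4 + 21) * real N powr (1/4)" by simp
  moreover have "ln (real N) \<le> 21 * real N powr (1/4)"
    using L powr_mono[of "1/20" "1/4" "real N"] N_ge_1 by simp
  ultimately show ?thesis by (simp add: distrib_right)
qed

lemma sum_inverse_soft_gap:
  "(\<Sum>k=2..N. 1 / soft_gap k)
    \<le> real N powr (1/10) + (\<Sum>k | k \<in> {1..N} \<and> real k > real N powr (1/10). 1 / (zt - l k))"
proof -
  note pos = gap_gt_0
  have "(\<Sum>k=2..N. 1 / soft_gap k) \<le> (\<Sum>k=1..N. 1 / soft_gap k)"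
    using soft_gap_pos by (intro sum_mono2) (auto simp: less_imp_le)
  also have "\<dots> \<le> (\<Sum>k=1..N. if real k \<le> real N powr (1/10) then 1 else 1 / (zt - l k))"
  proof (rule sum_mono)
    fix k assume k: "k \<in> {1..N}"
    have "1 / (zt - l k + 1) \<le> 1" using pos[OF k] by (subst divide_le_eq_1_pos) auto
    then show "1 / soft_gap k \<le> (if real k \<le> real N powr (1/10) then 1 else 1 / (zt - l k))"
      unfolding soft_gap_def by simp
  qed
  also have "\<dots> = real (card {k \<in> {1..N}. real k \<le> real N powr (1/10)})
      + (\<Sum>k | k \<in> {1..N} \<and> real k > real N powr (1/10). 1 / (zt - l k))"
    by (simp add: sum.If_cases Int_def conj_commute Collect_neg_eq[symmetric] not_le)
  finally show ?thesis using card_le_real[of "real N powr (1/10)" N] by simp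
qed

end
end

section \<open>The confining function and the saddle point\<close>

locale confining =
  fixes f :: "real \<Rightarrow> real"
  assumes strongly_convex: "strongly_convex_on {0..} f"
    and C1: "C1_on_nonneg f"
    and superlinear: "filterlim (\<lambda>x. f x / x) at_top at_top"
begin

lemma continuous_f: "continuous_on {0..} f"
proof -
  obtain f' where "\<And>x. x \<ge> 0 \<Longrightarrow> (f has_real_derivative f' x) (at x within {0..})"
    using C1 unfolding C1_on_nonneg_def by auto
  then show ?thesis
    by (intro DERIV_continuous_on) auto
qed

lemma f_lipschitz_on_compact:
  assumes "B \<ge> 0"
  obtains L where "L \<ge> 0" "\<And>x y. 0 \<le> x \<Longrightarrow> x \<le> B \<Longrightarrow> 0 \<le> y \<Longrightarrow> y \<le> B \<Longrightarrow> \<bar>f x - f y\<bar> \<le> L * \<bar>x - y\<bar>"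
proof -
  obtain f' where d: "\<And>x. x \<ge> 0 \<Longrightarrow> (f has_real_derivative f' x) (at x within {0..})"
    and c: "continuous_on {0..} f'"
    using C1 unfolding C1_on_nonneg_def by auto
  have "compact (f' ` {0..B})"
    by (intro compact_continuous_image continuous_on_subset[OF c]) auto
  then obtain L where L: "\<And>x. x \<in> {0..B} \<Longrightarrow> norm (f' x) \<le> L"
    by (metis bounded_iff compact_imp_bounded image_eqI)
  have "L \<ge> 0" using order.trans[OF norm_ge_zero L[of 0]] assms by simp
  moreover have "\<bar>f x - f y\<bar> \<le> L * \<bar>x - y\<bar>" if "0 \<le> x" "x \<le> B" "0 \<le> y" "y \<le> B" for x y
  proof -
    have "norm (f x - f y) \<le> L * norm (x - y)"
    proof (rule field_differentiable_bound[of "{0..B}" f f' L])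
      fix z assume z: "z \<in> {0..B}"
      then show "(f has_field_derivative f' z) (at z within {0..B})"
        using DERIV_subset[OF d[of z], of "{0..B}"] by auto
      show "norm (f' z) \<le> L" using L z by auto
    qed (use that in auto)
    then show ?thesis by simp
  qed
  ultimately show ?thesis by (rule that)
qed

definition modulus :: real where
  "modulus = (SOME m. m > 0 \<and> convex_on {0..} (\<lambda>x. f x - m / 2 * x\<^sup>2))"

lemma modulus: "modulus > 0" "convex_on {0..} (\<lambda>x. f x - modulus / 2 * x\<^sup>2)"
proof -
  have "\<exists>m. m > 0 \<and> convex_on {0..} (\<lambda>x. f x - m / 2 * x\<^sup>2)"
    using strongly_convex unfolding strongly_convex_on_def by auto
  from someI_ex[OF this] show "modulus > 0" "convex_on {0..} (\<lambda>x. f x - modulus / 2 * x\<^sup>2)"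
    unfolding modulus_def by auto
qed

text \<open>Superlinear growth makes the objective smaller than its value at 0 outside a compact
  interval, so the maximum is attained and \<open>arg_max\<close> picks a genuine maximiser.\<close>

lemma tau_max:
  shows "tau f z \<ge> 0" and "t \<ge> 0 \<Longrightarrow> t * z - f t \<le> V f z"
proof -
  have "eventually (\<lambda>x. f x / x \<ge> z + \<bar>f 0\<bar> + 1) at_top"
    using superlinear unfolding filterlim_at_top by blast
  then obtain B where B: "\<And>x. x \<ge> B \<Longrightarrow> f x / x \<ge> z + \<bar>f 0\<bar> + 1"
    unfolding eventually_at_top_linorder by auto
  define B' where "B' = max B 1"
  have large: "t * z - f t < 0 * z - f 0" if "t \<ge> B'" for t
  proof -
    have t: "t \<ge> 1" "t \<ge> B" using that by (auto simp: B'_def)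
    then have "f t \<ge> (z + \<bar>f 0\<bar> + 1) * t"
      using B[of t] by (simp add: pos_le_divide_eq)
    moreover have "(\<bar>f 0\<bar> + 1) * 1 \<le> (\<bar>f 0\<bar> + 1) * t" using t by (intro mult_left_mono) auto
    ultimately show ?thesis by (simp add: algebra_simps)
  qed
  have cont: "continuous_on {0..B'} (\<lambda>t. t * z - f t)"
    by (intro continuous_intros continuous_on_subset[OF continuous_f]) auto
  obtain t0 where t0: "t0 \<in> {0..B'}" "\<And>t. t \<in> {0..B'} \<Longrightarrow> t * z - f t \<le> t0 * z - f t0"
  proof -
    have "{0..B'} \<noteq> {}" by (simp add: B'_def)
    from continuous_attains_sup[OF compact_Icc this cont] show ?thesis using that by blast
  qed
  have all: "t * z - f t \<le> t0 * z - f t0" if "t \<ge> 0" for t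
  proof (cases "t \<le> B'")
    case False
    have "0 \<in> {0..B'}" by (simp add: B'_def)
    then have "0 * z - f 0 \<le> t0 * z - f t0" by (rule t0(2))
    then show ?thesis using large[of t] False by linarith
  qed (use t0(2)[of t] that in simp)
  have "0 \<le> tau f z \<and> (\<forall>y. 0 \<le> y \<longrightarrow> \<not> y * z - f y > tau f z * z - f (tau f z))"
    unfolding tau_def
    by (rule arg_maxI[where x = t0]) (use t0(1) all in \<open>auto simp: not_less\<close>)
  then show "tau f z \<ge> 0" "t \<ge> 0 \<Longrightarrow> t * z - f t \<le> V f z"
    unfolding V_def by (auto simp: not_less mult.commute)
qed

text \<open>Strong convexity, tested on the segment from the maximiser to \<open>t\<close>, gives
  the gap up to a factor 1 - s after division by s; letting s tend to 0 removes the factor.\<close>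

lemma V_gap:
  assumes t: "t \<ge> 0"
  shows "t * z - f t \<le> V f z - modulus / 2 * (t - tau f z)\<^sup>2"
proof -
  define \<tau> where "\<tau> = tau f z"
  have tau: "\<tau> \<ge> 0" unfolding \<tau>_def by (rule tau_max)
  have V: "V f z = \<tau> * z - f \<tau>" unfolding V_def \<tau>_def by (simp add: mult.commute)
  have "t * z - f t + modulus / 2 * (1 - s) * (t - \<tau>)\<^sup>2 \<le> V f z" if s: "0 < s" "s < 1" for s
  proof -
    define x where "x = (1 - s) * \<tau> + s * t"
    have x: "x \<ge> 0" unfolding x_def using s tau t by (intro add_nonneg_nonneg mult_nonneg_nonneg) auto
    have sq: "(1 - s) * \<tau>\<^sup>2 + s * t\<^sup>2 - x\<^sup>2 = s * (1 - s) * (t - \<tau>)\<^sup>2"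
      unfolding x_def by (simp add: power2_eq_square algebra_simps)
    have "f x - modulus / 2 * x\<^sup>2 \<le> (1 - s) * (f \<tau> - modulus / 2 * \<tau>\<^sup>2) + s * (f t - modulus / 2 * t\<^sup>2)"
      using convex_onD[OF modulus(2), of s \<tau> t] s tau t unfolding x_def by simp
    then have "f x \<le> (1 - s) * (f \<tau> - modulus / 2 * \<tau>\<^sup>2) + s * (f t - modulus / 2 * t\<^sup>2) + modulus / 2 * x\<^sup>2"
      by linarith
    also have "\<dots> = (1 - s) * f \<tau> + s * f t - modulus / 2 * ((1 - s) * \<tau>\<^sup>2 + s * t\<^sup>2 - x\<^sup>2)"
      by (simp only: right_diff_distrib distrib_left mult.left_commute)
    finally have fx: "f x \<le> (1 - s) * f \<tau> + s * f t - modulus / 2 * (s * (1 - s) * (t - \<tau>)\<^sup>2)"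
      unfolding sq .
    have "x * z - f x \<le> V f z" using tau_max(2)[OF x] .
    moreover have "x * z - f x \<ge> (1 - s) * V f z + s * (t * z - f t) + modulus / 2 * (s * (1 - s) * (t - \<tau>)\<^sup>2)"
    proof -
      have "(1 - s) * V f z + s * (t * z - f t) = x * z - ((1 - s) * f \<tau> + s * f t)"
        unfolding V x_def by (simp add: algebra_simps)
      then show ?thesis using fx by linarith
    qed
    moreover have "s * (A + c * (1 - s) * Y) - s * W = (1 - s) * W + s * A + c * (s * (1 - s) * Y) - W"
      for A c Y W :: real by (simp add: algebra_simps)
    note this[of "t * z - f t" "modulus / 2" "(t - \<tau>)\<^sup>2" "V f z"]
    ultimately have "s * (t * z - f t + modulus / 2 * (1 - s) * (t - \<tau>)\<^sup>2) \<le> s * V f z"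
      by linarith
    then show ?thesis using s by simp
  qed
  then have "\<forall>\<^sub>F s in at_right 0. t * z - f t + modulus / 2 * (1 - s) * (t - \<tau>)\<^sup>2 \<le> V f z"
    unfolding eventually_at_right_field by (intro exI[of _ 1]) auto
  moreover have "((\<lambda>s. t * z - f t + modulus / 2 * (1 - s) * (t - \<tau>)\<^sup>2) \<longlongrightarrow> t * z - f t + modulus / 2 * (1 - 0) * (t - \<tau>)\<^sup>2) (at_right 0)"
    by (intro tendsto_intros)
  ultimately have "t * z - f t + modulus / 2 * (1 - 0) * (t - \<tau>)\<^sup>2 \<le> V f z"
    by (intro tendsto_upperbound) auto
  then show ?thesis unfolding \<tau>_def by simp
qed

text \<open>The sum of two gap inequalities, each evaluated at the maximiser of the other. Both the
  Lipschitz bound and the monotonicity of the maximiser follow from it.\<close>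

lemma tau_monotone_ineq: "modulus * (tau f w - tau f z)\<^sup>2 \<le> (tau f w - tau f z) * (w - z)"
proof -
  have 1: "tau f w * z - f (tau f w) \<le> V f z - modulus / 2 * (tau f w - tau f z)\<^sup>2"
    by (rule V_gap[OF tau_max(1)])
  have 2: "tau f z * w - f (tau f z) \<le> V f w - modulus / 2 * (tau f z - tau f w)\<^sup>2"
    by (rule V_gap[OF tau_max(1)])
  show ?thesis using 1 2 unfolding V_def power2_commute[of "tau f z" "tau f w"]
    by (simp add: algebra_simps)
qed

lemma tau_lipschitz: "\<bar>tau f w - tau f z\<bar> \<le> \<bar>w - z\<bar> / modulus"
proof (cases "tau f w = tau f z")
  case False
  have "modulus * \<bar>tau f w - tau f z\<bar> * \<bar>tau f w - tau f z\<bar> \<le> \<bar>w - z\<bar> * \<bar>tau f w - tau f z\<bar>"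
    using tau_monotone_ineq[of w z] abs_ge_self[of "(tau f w - tau f z) * (w - z)"]
    by (simp add: power2_eq_square abs_mult mult.assoc mult.commute[of "\<bar>w - z\<bar>"])
  then have "modulus * \<bar>tau f w - tau f z\<bar> \<le> \<bar>w - z\<bar>"
    using False by (simp add: mult_le_cancel_right)
  then show ?thesis using modulus(1) by (simp add: field_simps)
qed (use modulus(1) in simp)

lemma tau_mono: "z \<le> w \<Longrightarrow> tau f z \<le> tau f w"
proof (rule ccontr)
  assume "z \<le> w" "\<not> tau f z \<le> tau f w"
  then have "(tau f w - tau f z) * (w - z) \<le> 0" by (intro mult_nonpos_nonneg) auto
  moreover have "modulus * (tau f w - tau f z)\<^sup>2 > 0"
    using modulus(1) \<open>\<not> tau f z \<le> tau f w\<close> by simp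
  ultimately show False using tau_monotone_ineq[of w z] by linarith
qed

lemma continuous_tau: "continuous_on S (tau f)"
proof -
  have "(1 / modulus)-lipschitz_on S (tau f)"
    using tau_lipschitz modulus(1) by (intro lipschitz_onI) (auto simp: dist_real_def)
  then show ?thesis by (rule lipschitz_on_continuous_on)
qed

text \<open>\<open>V\<close> is a supremum of affine functions of \<open>z\<close> with slopes t, so
  \<open>tau f z\<close> is a subgradient at \<open>z\<close>. Exchanging the two points and using
  the Lipschitz bound of \<open>tau\<close> gives the matching quadratic upper bound.\<close>

lemma V_first_order:
  "V f z + tau f z * (w - z) \<le> V f w"
  "V f w \<le> V f z + tau f z * (w - z) + (w - z)\<^sup>2 / modulus"
proof -
  have 1: "V f y + tau f y * (x - y) \<le> V f x" for x y
    using tau_max(2)[OF tau_max(1), of y x] unfolding V_def by (simp add: algebra_simps)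
  show "V f z + tau f z * (w - z) \<le> V f w" by (rule 1)
  have "(tau f w - tau f z) * (w - z) \<le> \<bar>w - z\<bar> / modulus * \<bar>w - z\<bar>"
    using mult_right_mono[OF tau_lipschitz[of w z], of "\<bar>w - z\<bar>"]
      abs_ge_self[of "(tau f w - tau f z) * (w - z)"] by (simp add: abs_mult)
  also have "\<dots> = (w - z)\<^sup>2 / modulus" by (simp add: power2_eq_square)
  finally show "V f w \<le> V f z + tau f z * (w - z) + (w - z)\<^sup>2 / modulus"
    using 1[of w z] by (simp add: algebra_simps)
qed

text \<open>If the maximiser stayed below \<open>T\<close>, then \<open>V\<close> would grow at most
  like \<open>T * z\<close>, but the competitor \<open>T + 1\<close> alone forces growth
  \<open>(T + 1) * z\<close>.\<close>

lemma tau_unbounded: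
  assumes "T \<ge> 0"
  shows "\<exists>z0. \<forall>z\<ge>z0. tau f z \<ge> T"
proof -
  have "compact (f ` {0..T})"
    by (intro compact_continuous_image continuous_on_subset[OF continuous_f]) auto
  then obtain B where B: "\<And>x. x \<in> {0..T} \<Longrightarrow> norm (f x) \<le> B"
    by (metis bounded_iff compact_imp_bounded image_eqI)
  show ?thesis
  proof (intro exI[of _ "max 0 (B + f (T + 1) + 1)"] allI impI, rule ccontr)
    fix z assume z: "z \<ge> max 0 (B + f (T + 1) + 1)" and "\<not> tau f z \<ge> T"
    then have t: "tau f z \<in> {0..T}" using tau_max(1)[of z] by auto
    have "V f z \<le> T * z + B"
      using B[OF t] t z mult_right_mono[of "tau f z" T z] unfolding V_def by (auto simp: mult.commute)
    moreover have "(T + 1) * z - f (T + 1) \<le> V f z" using assms by (intro tau_max(2)) auto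
    ultimately show False using z by (auto simp: algebra_simps)
  qed
qed

lemma derivative_at_tau:
  assumes "tau f z > 0"
  shows "(f has_real_derivative z) (at (tau f z))"
proof -
  obtain f' where d: "\<And>x. x \<ge> 0 \<Longrightarrow> (f has_real_derivative f' x) (at x within {0..})"
    using C1 unfolding C1_on_nonneg_def by auto
  have "(f has_real_derivative f' (tau f z)) (at (tau f z) within {0<..})"
    by (rule DERIV_subset[OF d]) (use assms in auto)
  then have D: "(f has_real_derivative f' (tau f z)) (at (tau f z))"
    using assms by (subst (asm) at_within_open) auto
  have "((\<lambda>t. t * z - f t) has_real_derivative (1 * z - f' (tau f z))) (at (tau f z))"
    by (rule derivative_eq_intros D refl | simp)+
  moreover have "\<forall>y. \<bar>tau f z - y\<bar> < tau f z \<longrightarrow> y * z - f y \<le> tau f z * z - f (tau f z)"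
    using tau_max(2)[of _ z] unfolding V_def by (auto simp: mult.commute abs_if split: if_splits)
  ultimately have "1 * z - f' (tau f z) = 0"
    using assms by (intro DERIV_local_max)
  then show ?thesis using D by simp
qed

end

section \<open>The saddle point equation\<close>

locale spherical_model = edge_locations + confining +
  fixes \<beta> :: real
  assumes \<beta>_pos: "\<beta> > 0"
begin

definition stieltjes :: "real \<Rightarrow> real" where "stieltjes \<gamma> = (LINT x|\<nu>. 1 / (\<gamma> - x))"

lemma integrable_stieltjes: "\<gamma> \<ge> Cp \<Longrightarrow> integrable \<nu> (\<lambda>x. 1 / (\<gamma> - x))"
proof (rule Bochner_Integration.integrable_bound[OF integrable_inverse_edge])
  assume g: "\<gamma> \<ge> Cp"
  show "AE x in \<nu>. norm (1 / (\<gamma> - x)) \<le> norm (1 / (Cp - x))"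
    using AE_support
  proof eventually_elim
    case (elim x)
    have "1 / (\<gamma> - x) \<le> 1 / (Cp - x)" using elim g by (intro divide_left_mono mult_pos_pos) auto
    then show ?case using elim g by simp
  qed
qed simp

lemma stieltjes_eq: "(LINT x:{Cm..Cp}|\<nu>. 1 / (\<gamma> - x)) = stieltjes \<gamma>"
  unfolding stieltjes_def by (rule set_integral_support) simp

lemma stieltjes_strict_antimono:
  assumes "Cp \<le> \<gamma>" "\<gamma> < \<delta>" shows "stieltjes \<delta> < stieltjes \<gamma>"
proof -
  have "0 < (\<delta> - \<gamma>) / ((\<gamma> - Cm) * (\<delta> - Cm))"
    using assms Cm_less_Cp by (intro divide_pos_pos mult_pos_pos) auto
  also have "\<dots> \<le> (LINT x|\<nu>. 1 / (\<gamma> - x) - 1 / (\<delta> - x))"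
  proof (rule integral_ge_const)
    show "integrable \<nu> (\<lambda>x. 1 / (\<gamma> - x) - 1 / (\<delta> - x))"
      using assms by (intro Bochner_Integration.integrable_diff integrable_stieltjes) auto
    show "AE x in \<nu>. (\<delta> - \<gamma>) / ((\<gamma> - Cm) * (\<delta> - Cm)) \<le> 1 / (\<gamma> - x) - 1 / (\<delta> - x)"
      using AE_support
    proof eventually_elim
      case (elim x)
      then have "1 / (\<gamma> - x) - 1 / (\<delta> - x) = (\<delta> - \<gamma>) / ((\<gamma> - x) * (\<delta> - x))"
        using assms by (subst diff_frac_eq) auto
      also have "\<dots> \<ge> (\<delta> - \<gamma>) / ((\<gamma> - Cm) * (\<delta> - Cm))"
        using elim assms by (intro divide_left_mono mult_mono mult_pos_pos) auto
      finally show ?case .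
    qed
  qed
  also have "\<dots> = stieltjes \<gamma> - stieltjes \<delta>"
    unfolding stieltjes_def using assms
    by (intro Bochner_Integration.integral_diff integrable_stieltjes) auto
  finally show ?thesis by simp
qed

lemma stieltjes_pos:
  assumes "\<gamma> \<ge> Cp" shows "stieltjes \<gamma> > 0"
proof -
  have "0 < 1 / (\<gamma> - Cm)" using assms Cm_less_Cp by simp
  also have "\<dots> \<le> stieltjes \<gamma>" unfolding stieltjes_def
  proof (rule integral_ge_const[OF integrable_stieltjes[OF assms]])
    show "AE x in \<nu>. 1 / (\<gamma> - Cm) \<le> 1 / (\<gamma> - x)"
      using AE_support
    proof eventually_elim
      case (elim x)
      then show ?case using assms by (intro divide_left_mono mult_pos_pos) auto
    qed
  qed
  finally show ?thesis .
qed

lemma stieltjes_le: "\<gamma> \<ge> Cp + 1 \<Longrightarrow> stieltjes \<gamma> \<le> 1"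
  unfolding stieltjes_def
proof (rule integral_le_const[OF integrable_stieltjes])
  assume g: "\<gamma> \<ge> Cp + 1"
  show "AE x in \<nu>. 1 / (\<gamma> - x) \<le> 1"
    using AE_support by eventually_elim (use g in simp)
qed simp

text \<open>The inverse distance to the edge dominates uniformly, so continuity extends down to
  \<open>Cp\<close> itself, where the intermediate value argument starts.\<close>

lemma continuous_stieltjes: "continuous_on {Cp..} stieltjes"
  unfolding continuous_on_sequentially
proof (intro allI ballI impI, elim conjE)
  fix a x assume a: "a \<in> {Cp..}" "\<forall>n. x n \<in> {Cp..}" "x \<longlonglongrightarrow> a"
  show "(stieltjes \<circ> x) \<longlonglongrightarrow> stieltjes a"
    unfolding stieltjes_def comp_def
  proof (rule integral_dominated_convergence[where w = "\<lambda>y. 1 / (Cp - y)"])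
    show "AE y in \<nu>. (\<lambda>n. 1 / (x n - y)) \<longlonglongrightarrow> 1 / (a - y)"
      using AE_support
    proof eventually_elim
      case (elim y)
      have "a - y \<noteq> 0" using elim a(1) by auto
      then show ?case by (intro tendsto_intros a(3))
    qed
    show "AE y in \<nu>. norm (1 / (x n - y)) \<le> 1 / (Cp - y)" for n
      using AE_support
    proof eventually_elim
      case (elim y)
      have "x n \<ge> Cp" using a(2) by auto
      then have "1 / (x n - y) \<le> 1 / (Cp - y)" using elim by (intro divide_left_mono mult_pos_pos) auto
      then show ?case using elim \<open>x n \<ge> Cp\<close> by simp
    qed
  qed (use integrable_inverse_edge in auto)
qed

abbreviation \<gamma>h :: real where "\<gamma>h \<equiv> gamma_hat f \<nu> Cm Cp \<beta>"

lemma beta_c_eq: "beta_c \<nu> Cm Cp = stieltjes Cp / 2"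
  unfolding beta_c_def stieltjes_eq by simp

text \<open>The left side of the equation is nondecreasing in \<gamma> and the right side strictly
  decreasing.\<close>

lemma gamma_hat_unique:
  assumes "Cp \<le> \<gamma>" "Cp \<le> \<delta>" "\<beta> * tau f \<gamma> = stieltjes \<gamma> / 2" "\<beta> * tau f \<delta> = stieltjes \<delta> / 2"
  shows "\<gamma> = \<delta>"
proof -
  have "\<not> x < y" if "Cp \<le> x" "\<beta> * tau f x = stieltjes x / 2" "\<beta> * tau f y = stieltjes y / 2" for x y
  proof
    assume "x < y"
    then have "\<beta> * tau f x \<le> \<beta> * tau f y" using \<beta>_pos tau_mono by (intro mult_left_mono) auto
    then show False using stieltjes_strict_antimono[OF that(1) \<open>x < y\<close>] that by linarith
  qed
  from this[OF assms(1,3,4)] this[OF assms(2,4,3)] show ?thesis by simp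
qed

lemma gamma_hat_props:
  assumes "\<beta> * tau f Cp \<le> beta_c \<nu> Cm Cp"
  shows "\<gamma>h \<ge> Cp" "\<beta> * tau f \<gamma>h = stieltjes \<gamma>h / 2"
proof -
  obtain z0 where z0: "\<And>z. z \<ge> z0 \<Longrightarrow> tau f z \<ge> 1 / \<beta>"
    using tau_unbounded[of "1 / \<beta>"] \<beta>_pos by auto
  \<comment> \<open>At \<open>b\<close> the transform is at most 1 while
    \<open>\<beta> * tau f b\<close> is at least 1, so the difference of the two sides has become
    nonnegative.\<close>
  define b where "b = max z0 (Cp + 1)"
  define g where "g \<gamma> = \<beta> * tau f \<gamma> - stieltjes \<gamma> / 2" for \<gamma>
  have "\<beta> * tau f b \<ge> \<beta> * (1 / \<beta>)" using z0[of b] \<beta>_pos by (intro mult_left_mono) (auto simp: b_def)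
  then have gb: "g b \<ge> 0" using stieltjes_le[of b] \<beta>_pos unfolding g_def by (simp add: b_def)
  have ga: "g Cp \<le> 0" using assms unfolding g_def beta_c_eq by simp
  have cont: "continuous_on {Cp..b} g"
    unfolding g_def by (intro continuous_intros continuous_tau continuous_on_subset[OF continuous_stieltjes]) auto
  obtain \<gamma> where "Cp \<le> \<gamma>" "g \<gamma> = 0"
  proof -
    have "Cp \<le> b" by (simp add: b_def)
    from IVT'[of g Cp 0 b, OF ga gb this cont] show ?thesis using that by blast
  qed
  then have g1: "Cp \<le> \<gamma>" "\<beta> * tau f \<gamma> = stieltjes \<gamma> / 2" by (auto simp: g_def)
  have ex1: "\<exists>!\<gamma>. \<gamma> \<ge> Cp \<and> \<beta> * tau f \<gamma> = 1 / 2 * (LINT x:{Cm..Cp}|\<nu>. 1 / (\<gamma> - x))"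
    unfolding stieltjes_eq using g1 gamma_hat_unique by (intro ex1I[of _ \<gamma>]) auto
  from theI'[OF ex1] show "\<gamma>h \<ge> Cp" "\<beta> * tau f \<gamma>h = stieltjes \<gamma>h / 2"
    unfolding gamma_hat_def stieltjes_eq by auto
qed

text \<open>Replaces the extended real threshold by a real inequality. The convention of an infinite
  threshold is consistent with it: for \<open>tau f Cp = 0\<close> both inequalities hold because
  \<open>beta_c\<close> is positive.\<close>

lemma beta_star_cases:
  shows "ereal \<beta> < beta_star f \<nu> Cm Cp \<longleftrightarrow> \<beta> * tau f Cp < beta_c \<nu> Cm Cp" (is ?lt)
    and "ereal \<beta> \<le> beta_star f \<nu> Cm Cp \<longleftrightarrow> \<beta> * tau f Cp \<le> beta_c \<nu> Cm Cp" (is ?le)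
proof -
  have pos: "beta_c \<nu> Cm Cp > 0" using stieltjes_pos[of Cp] by (simp add: beta_c_eq)
  have "?lt \<and> ?le"
  proof (cases "tau f Cp = 0")
    case True
    then show ?thesis using pos by (simp add: beta_star_def)
  next
    case False
    then have t: "tau f Cp > 0" using tau_max(1)[of Cp] by simp
    have eq: "beta_star f \<nu> Cm Cp = ereal (beta_c \<nu> Cm Cp / tau f Cp)"
      using False by (simp add: beta_star_def)
    show ?thesis unfolding eq less_ereal.simps ereal_less_eq
      using pos_less_divide_eq[OF t, of \<beta>] pos_le_divide_eq[OF t, of \<beta>] by blast
  qed
  then show ?lt ?le by auto
qed

lemma gamma_hat_gt:
  assumes "\<beta> * tau f Cp < beta_c \<nu> Cm Cp"
  shows "\<gamma>h > Cp"
proof -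
  obtain \<gamma> where g: "\<gamma> = \<gamma>h" "\<gamma> \<ge> Cp" "\<beta> * tau f \<gamma> = stieltjes \<gamma> / 2"
    using gamma_hat_props[OF less_imp_le[OF assms]] by blast
  have "\<gamma> \<noteq> Cp"
    using g(3) assms unfolding beta_c_eq by (metis less_irrefl)
  then show ?thesis using g by linarith
qed

lemma gamma_hat_critical:
  assumes "\<beta> * tau f Cp = beta_c \<nu> Cm Cp"
  shows "\<gamma>h = Cp"
  by (rule gamma_hat_unique[OF gamma_hat_props(1) order.refl gamma_hat_props(2)])
     (use assms in \<open>simp_all add: beta_c_eq\<close>)

end

section \<open>Gaussian product laws and the tilted partition function\<close>

text \<open>The parameter is the coefficient in exp (- a y^2), so the variance is 1 / (2 a).\<close>

definition gauss_dens :: "real \<Rightarrow> real \<Rightarrow> real" where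
  "gauss_dens a y = exp (- a * y\<^sup>2) / sqrt (pi / a)"

lemma measurable_gauss_dens [measurable]: "gauss_dens a \<in> borel_measurable borel"
  unfolding gauss_dens_def[abs_def] by measurable

lemma gauss_dens_nonneg: "a > 0 \<Longrightarrow> gauss_dens a y \<ge> 0"
  unfolding gauss_dens_def by simp

lemma gauss_dens_eq_normal:
  assumes "a > 0" shows "gauss_dens a y = normal_density 0 (1 / sqrt (2 * a)) y"
proof -
  have "(1 / sqrt (2 * a))\<^sup>2 = 1 / (2 * a)" using assms by (simp add: power_divide)
  then show ?thesis unfolding gauss_dens_def normal_density_def by simp
qed

lemma nn_integral_gauss_dens:
  assumes "a > 0" shows "(\<integral>\<^sup>+y. ennreal (gauss_dens a y) \<partial>lborel) = 1"
proof -
  have "prob_space (density lborel (normal_density 0 (1 / sqrt (2 * a))))"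
    using assms by (intro prob_space_normal_density) simp
  from prob_space.emeasure_space_1[OF this] show ?thesis
    using assms by (simp add: emeasure_density gauss_dens_eq_normal)
qed

lemma gauss_dens_moment:
  assumes "a > 0"
  shows "integrable lborel (\<lambda>y. gauss_dens a y * y ^ (2 * k))"
    and "(LINT y|lborel. gauss_dens a y * y ^ (2 * k)) = fact (2 * k) / ((4 * a) ^ k * fact k)"
proof -
  have p: "1 / sqrt (2 * a) > 0" using assms by simp
  have sq: "(1 / sqrt (2 * a))\<^sup>2 = 1 / (2 * a)" using assms by (simp add: power_divide)
  have "has_bochner_integral lborel (\<lambda>y. gauss_dens a y * y ^ (2 * k)) (fact (2 * k) / ((4 * a) ^ k * fact k))"
    using normal_moment_even[OF p, of 0 k] assms
    unfolding gauss_dens_eq_normal[OF assms] sq by (simp add: mult.assoc[symmetric])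
  then show "integrable lborel (\<lambda>y. gauss_dens a y * y ^ (2 * k))"
    "(LINT y|lborel. gauss_dens a y * y ^ (2 * k)) = fact (2 * k) / ((4 * a) ^ k * fact k)"
    by (auto simp: has_bochner_integral_iff)
qed

lemma nn_integral_gauss_dens_square:
  assumes "a > 0"
  shows "(\<integral>\<^sup>+y. ennreal (y\<^sup>2) * ennreal (gauss_dens a y) \<partial>lborel) = ennreal (1 / (2 * a))"
proof -
  have "(\<integral>\<^sup>+y. ennreal (y\<^sup>2) * ennreal (gauss_dens a y) \<partial>lborel) = (\<integral>\<^sup>+y. ennreal (gauss_dens a y * y ^ (2 * 1)) \<partial>lborel)"
    using assms by (intro nn_integral_cong) (simp add: ennreal_mult[symmetric] gauss_dens_nonneg mult.commute)
  also have "\<dots> = ennreal (LINT y|lborel. gauss_dens a y * y ^ (2 * 1))"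
    using assms by (intro nn_integral_eq_integral gauss_dens_moment) (auto simp: gauss_dens_nonneg)
  also have "(LINT y|lborel. gauss_dens a y * y ^ (2 * 1)) = 1 / (2 * a)"
    unfolding gauss_dens_moment(2)[OF assms] using assms by simp
  finally show ?thesis .
qed

definition gprod :: "nat set \<Rightarrow> (nat \<Rightarrow> real) \<Rightarrow> (nat \<Rightarrow> real) measure" where
  "gprod I a = density (\<Pi>\<^sub>M i\<in>I. lborel) (\<lambda>v. ennreal (\<Prod>i\<in>I. gauss_dens (a i) (v i)))"

lemma sets_gprod [measurable_cong]: "sets (gprod I a) = sets (\<Pi>\<^sub>M i\<in>I. lborel)"
  by (simp add: gprod_def)

context
  fixes I :: "nat set" and a :: "nat \<Rightarrow> real"
  assumes fin: "finite I" and pos: "\<And>i. i \<in> I \<Longrightarrow> a i > 0"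
begin

lemma ennreal_prod_gauss: "ennreal (\<Prod>i\<in>I. gauss_dens (a i) (v i)) = (\<Prod>i\<in>I. ennreal (gauss_dens (a i) (v i)))"
  by (simp add: prod_ennreal gauss_dens_nonneg pos)

lemma nn_integral_gprod_prod:
  assumes [measurable]: "\<And>i. i \<in> I \<Longrightarrow> g i \<in> borel_measurable borel"
  shows "(\<integral>\<^sup>+v. (\<Prod>i\<in>I. g i (v i)) \<partial>gprod I a) = (\<Prod>i\<in>I. \<integral>\<^sup>+y. g i y * ennreal (gauss_dens (a i) y) \<partial>lborel)"
proof -
  have "(\<integral>\<^sup>+v. (\<Prod>i\<in>I. g i (v i)) \<partial>gprod I a)
      = (\<integral>\<^sup>+v. (\<Prod>i\<in>I. g i (v i) * ennreal (gauss_dens (a i) (v i))) \<partial>(\<Pi>\<^sub>M i\<in>I. lborel))"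
    unfolding gprod_def by (subst nn_integral_density) (auto simp: ennreal_prod_gauss prod.distrib mult.commute)
  also have "\<dots> = (\<Prod>i\<in>I. \<integral>\<^sup>+y. g i y * ennreal (gauss_dens (a i) y) \<partial>lborel)"
    by (rule lborel_product.product_nn_integral_prod[OF fin]) auto
  finally show ?thesis .
qed

lemma prob_space_gprod: "prob_space (gprod I a)"
proof (rule prob_spaceI)
  have "emeasure (gprod I a) (space (gprod I a)) = (\<integral>\<^sup>+v. (\<Prod>i\<in>I. 1) \<partial>gprod I a)"
    by simp
  also have "\<dots> = (\<Prod>i\<in>I. \<integral>\<^sup>+y. 1 * ennreal (gauss_dens (a i) y) \<partial>lborel)"
    by (rule nn_integral_gprod_prod) simp
  also have "\<dots> = 1" using pos by (simp add: nn_integral_gauss_dens)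
  finally show "emeasure (gprod I a) (space (gprod I a)) = 1" .
qed

lemma nn_integral_gprod_square:
  assumes "j \<in> I"
  shows "(\<integral>\<^sup>+v. ennreal ((v j)\<^sup>2) \<partial>gprod I a) = ennreal (1 / (2 * a j))"
proof -
  have "(\<integral>\<^sup>+v. ennreal ((v j)\<^sup>2) \<partial>gprod I a) = (\<integral>\<^sup>+v. (\<Prod>i\<in>I. if i = j then ennreal ((v i)\<^sup>2) else 1) \<partial>gprod I a)"
    using assms fin by (simp add: prod.delta)
  also have "\<dots> = (\<Prod>i\<in>I. \<integral>\<^sup>+y. (if i = j then ennreal (y\<^sup>2) else 1) * ennreal (gauss_dens (a i) y) \<partial>lborel)"
    by (rule nn_integral_gprod_prod) simp
  also have "\<dots> = (\<Prod>i\<in>I. if i = j then ennreal (1 / (2 * a i)) else 1)"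
    using pos by (intro prod.cong) (auto simp: nn_integral_gauss_dens_square nn_integral_gauss_dens)
  also have "\<dots> = ennreal (1 / (2 * a j))" using assms fin by (simp add: prod.delta)
  finally show ?thesis .
qed

lemma nn_integral_gprod_square_sum:
  "(\<integral>\<^sup>+v. ennreal (\<Sum>i\<in>I. (v i)\<^sup>2) \<partial>gprod I a) = ennreal (\<Sum>i\<in>I. 1 / (2 * a i))"
proof -
  have "(\<integral>\<^sup>+v. ennreal (\<Sum>i\<in>I. (v i)\<^sup>2) \<partial>gprod I a) = (\<integral>\<^sup>+v. (\<Sum>i\<in>I. ennreal ((v i)\<^sup>2)) \<partial>gprod I a)"
    by (simp add: sum_ennreal)
  also have "\<dots> = (\<Sum>i\<in>I. \<integral>\<^sup>+v. ennreal ((v i)\<^sup>2) \<partial>gprod I a)"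
    by (rule nn_integral_sum) simp
  also have "\<dots> = ennreal (\<Sum>i\<in>I. 1 / (2 * a i))"
    using pos by (simp add: nn_integral_gprod_square sum_ennreal less_imp_le)
  finally show ?thesis .
qed

lemma nn_integral_gaussian_weight:
  assumes [measurable]: "F \<in> borel_measurable (\<Pi>\<^sub>M i\<in>I. lborel)"
  shows "(\<integral>\<^sup>+v. F v * ennreal (exp (- (\<Sum>i\<in>I. a i * (v i)\<^sup>2))) \<partial>(\<Pi>\<^sub>M i\<in>I. lborel))
    = ennreal (\<Prod>i\<in>I. sqrt (pi / a i)) * (\<integral>\<^sup>+v. F v \<partial>gprod I a)"
proof -
  have W: "(\<Prod>i\<in>I. sqrt (pi / a i)) > 0" using pos by (intro prod_pos) auto
  have *: "(\<Prod>i\<in>I. sqrt (pi / a i)) * (\<Prod>i\<in>I. gauss_dens (a i) (v i)) = exp (- (\<Sum>i\<in>I. a i * (v i)\<^sup>2))" for v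
    unfolding prod.distrib[symmetric] sum_negf[symmetric] exp_sum[OF fin]
  proof (rule prod.cong)
    fix i assume "i \<in> I"
    then show "sqrt (pi / a i) * gauss_dens (a i) (v i) = exp (- (a i * (v i)\<^sup>2))"
      using pos[of i] by (simp add: gauss_dens_def)
  qed simp
  have "ennreal (\<Prod>i\<in>I. sqrt (pi / a i)) * (\<integral>\<^sup>+v. F v \<partial>gprod I a)
      = ennreal (\<Prod>i\<in>I. sqrt (pi / a i)) * (\<integral>\<^sup>+v. ennreal (\<Prod>i\<in>I. gauss_dens (a i) (v i)) * F v \<partial>(\<Pi>\<^sub>M i\<in>I. lborel))"
    unfolding gprod_def by (subst nn_integral_density) auto
  also have "\<dots> = (\<integral>\<^sup>+v. ennreal (\<Prod>i\<in>I. sqrt (pi / a i)) * (ennreal (\<Prod>i\<in>I. gauss_dens (a i) (v i)) * F v) \<partial>(\<Pi>\<^sub>M i\<in>I. lborel))"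
    by (rule nn_integral_cmult[symmetric]) measurable
  also have "\<dots> = (\<integral>\<^sup>+v. F v * ennreal (exp (- (\<Sum>i\<in>I. a i * (v i)\<^sup>2))) \<partial>(\<Pi>\<^sub>M i\<in>I. lborel))"
  proof (rule nn_integral_cong)
    fix v
    have "ennreal (\<Prod>i\<in>I. sqrt (pi / a i)) * (ennreal (\<Prod>i\<in>I. gauss_dens (a i) (v i)) * F v)
        = ennreal ((\<Prod>i\<in>I. sqrt (pi / a i)) * (\<Prod>i\<in>I. gauss_dens (a i) (v i))) * F v"
      using W by (subst ennreal_mult) (auto simp: mult.assoc intro!: prod_nonneg gauss_dens_nonneg pos)
    then show "ennreal (\<Prod>i\<in>I. sqrt (pi / a i)) * (ennreal (\<Prod>i\<in>I. gauss_dens (a i) (v i)) * F v)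
        = F v * ennreal (exp (- (\<Sum>i\<in>I. a i * (v i)\<^sup>2)))"
      unfolding * by (simp add: mult.commute)
  qed
  finally show ?thesis by simp
qed

lemma gprod_square_sum_tail:
  assumes c: "c > 0"
  shows "measure (gprod I a) {v \<in> space (gprod I a). (\<Sum>i\<in>I. (v i)\<^sup>2) \<le> c} \<ge> 1 - (\<Sum>i\<in>I. 1 / (2 * a i)) / c"
proof -
  interpret prob_space "gprod I a" by (rule prob_space_gprod)
  have int: "integrable (gprod I a) (\<lambda>v. \<Sum>i\<in>I. (v i)\<^sup>2)"
    by (rule integrableI_bounded) (auto simp: nn_integral_gprod_square_sum abs_of_nonneg sum_nonneg)
  have nn: "(\<Sum>i\<in>I. 1 / (2 * a i)) \<ge> 0" by (intro sum_nonneg) (simp add: less_imp_le[OF pos])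
  have E: "(LINT v|gprod I a. (\<Sum>i\<in>I. (v i)\<^sup>2)) = (\<Sum>i\<in>I. 1 / (2 * a i))"
    using nn_integral_gprod_square_sum nn
    by (subst integral_eq_nn_integral) (auto intro!: sum_nonneg)
  have "prob {v \<in> space (gprod I a). (\<Sum>i\<in>I. (v i)\<^sup>2) \<ge> c} \<le> (\<Sum>i\<in>I. 1 / (2 * a i)) / c"
  proof -
    have "AE v in gprod I a. 0 \<le> (\<Sum>i\<in>I. (v i)\<^sup>2)" by (intro AE_I2 sum_nonneg) auto
    from integral_Markov_inequality_measure[OF int _ this c, of "{}"] show ?thesis
      unfolding E by simp
  qed
  moreover have "space (gprod I a) - {v \<in> space (gprod I a). (\<Sum>i\<in>I. (v i)\<^sup>2) \<ge> c}
      \<subseteq> {v \<in> space (gprod I a). (\<Sum>i\<in>I. (v i)\<^sup>2) \<le> c}" by auto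
  moreover have "prob (space (gprod I a) - {v \<in> space (gprod I a). (\<Sum>i\<in>I. (v i)\<^sup>2) \<ge> c})
      = 1 - prob {v \<in> space (gprod I a). (\<Sum>i\<in>I. (v i)\<^sup>2) \<ge> c}"
    by (rule prob_compl) measurable
  moreover have "prob (space (gprod I a) - {v \<in> space (gprod I a). (\<Sum>i\<in>I. (v i)\<^sup>2) \<ge> c})
      \<le> prob {v \<in> space (gprod I a). (\<Sum>i\<in>I. (v i)\<^sup>2) \<le> c}"
    by (rule finite_measure_mono) auto
  ultimately show ?thesis by linarith
qed

end

section \<open>The partition function in spectral coordinates\<close>

context spherical_model begin

text \<open>Agrees with \<open>f\<close> at radii, which are nonnegative, and is continuous on the
  whole line; this supplies measurability.\<close>

definition f_ext :: "real \<Rightarrow> real" where "f_ext r = f (max 0 r)"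

lemma continuous_f_ext: "continuous_on UNIV f_ext"
  unfolding f_ext_def
  by (rule continuous_on_compose2[OF continuous_f]) (auto intro!: continuous_intros)

lemma measurable_f_ext [measurable]: "f_ext \<in> borel_measurable borel"
  by (rule borel_measurable_continuous_onI[OF continuous_f_ext])

lemma f_ext_eq: "r \<ge> 0 \<Longrightarrow> f_ext r = f r" by (simp add: f_ext_def)

definition sphere_radius :: "nat \<Rightarrow> (nat \<Rightarrow> real) \<Rightarrow> real" where
  "sphere_radius n v = 1 / real n * (\<Sum>i<n. (v i)\<^sup>2)"

lemma sphere_radius_nonneg: "sphere_radius n v \<ge> 0"
  unfolding sphere_radius_def by (intro mult_nonneg_nonneg sum_nonneg) auto

lemma measurable_f_radius [measurable]:
  "(\<lambda>v. f (sphere_radius n v)) \<in> borel_measurable (lebN n)"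
proof -
  have "(\<lambda>v. f (sphere_radius n v)) = (\<lambda>v. f_ext (sphere_radius n v))"
    using f_ext_eq sphere_radius_nonneg by auto
  then show ?thesis unfolding sphere_radius_def by simp
qed

lemma measurable_sphere_radius [measurable]: "sphere_radius n \<in> borel_measurable (lebN n)"
  unfolding sphere_radius_def[abs_def] by measurable

text \<open>Taken in \<open>ennreal\<close>, so that no finiteness is presupposed; it comes out of
  \<open>logZ_tilt\<close>.\<close>

definition Zd :: "nat \<Rightarrow> (nat \<Rightarrow> real) \<Rightarrow> ennreal" where
  "Zd n l = (\<integral>\<^sup>+v. ennreal (exp (\<beta> * (\<Sum>i<n. l (Suc i) * (v i)\<^sup>2)
     - \<beta> * real n * f (sphere_radius n v))) \<partial>lebN n)"

definition logZ :: "nat \<Rightarrow> (nat \<Rightarrow> real) \<Rightarrow> real" where "logZ n l = ln (enn2real (Zd n l))"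

lemma free_energy_diagonal:
  assumes A: "A \<in> carrier_mat n n" and sym: "transpose_mat A = A"
  shows "free_energy f \<beta> A = 1 / real n * logZ n (eig A)"
proof -
  note [measurable] = measurable_quad_form[OF A]
  let ?G = "\<lambda>r. ennreal (exp (- (\<beta> * real n * f_ext (1 / real n * r))))"
  have R: "f_ext (1 / real n * sqn n v) = f (sphere_radius n v)" for v
    using f_ext_eq[OF sphere_radius_nonneg[of n v]] by (simp add: sphere_radius_def)
  have dim: "dim_row A = n" using A by simp
  have "(LINT v|lebN n. exp (\<beta> * quad_form A v - \<beta> * real n * f (sphere_radius n v)))
      = enn2real (\<integral>\<^sup>+v. ennreal (exp (\<beta> * quad_form A v - \<beta> * real n * f (sphere_radius n v))) \<partial>lebN n)"
    by (intro integral_eq_nn_integral) auto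
  also have "(\<integral>\<^sup>+v. ennreal (exp (\<beta> * quad_form A v - \<beta> * real n * f (sphere_radius n v))) \<partial>lebN n)
      = (\<integral>\<^sup>+v. ?G (sqn n v) * ennreal (exp (\<beta> * quad_form A v)) \<partial>lebN n)"
    unfolding R by (intro nn_integral_cong) (simp add: ennreal_mult[symmetric] exp_add[symmetric])
  also have "\<dots> = (\<integral>\<^sup>+v. ?G (sqn n v) * ennreal (exp (\<beta> * (\<Sum>i<n. eig A (Suc i) * (v i)\<^sup>2))) \<partial>lebN n)"
    by (rule radial_integral_diagonalize[OF A sym \<beta>_pos]) measurable
  also have "\<dots> = Zd n (eig A)"
    unfolding Zd_def R by (intro nn_integral_cong) (simp add: ennreal_mult[symmetric] exp_add[symmetric])
  finally show ?thesis
    unfolding free_energy_def Let_def dim logZ_def quad_form_def sphere_radius_def by simp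
qed

text \<open>The deficit in the Fenchel-Young inequality, \<open>V\<close> being the convex conjugate
  of \<open>f\<close> on the half line.\<close>

definition gap_fun :: "real \<Rightarrow> real \<Rightarrow> real" where "gap_fun z r = V f z - (r * z - f r)"

lemma gap_fun_nonneg: "r \<ge> 0 \<Longrightarrow> gap_fun z r \<ge> 0"
  using tau_max(2)[of r z] unfolding gap_fun_def by simp

lemma gap_fun_tau: "gap_fun z (tau f z) = 0"
  unfolding gap_fun_def V_def by (simp add: mult.commute)

text \<open>Isolates all non-Gaussian dependence in the deficit and leaves a quadratic form with
  precisions \<beta> (z - l k).\<close>

lemma exponent_eq:
  assumes "n \<ge> 1"
  shows "\<beta> * (\<Sum>i<n. l (Suc i) * (v i)\<^sup>2) - \<beta> * real n * f (sphere_radius n v)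
    = \<beta> * real n * V f z - \<beta> * real n * gap_fun z (sphere_radius n v) - (\<Sum>i<n. \<beta> * (z - l (Suc i)) * (v i)\<^sup>2)"
proof -
  have "real n * sphere_radius n v = (\<Sum>i<n. (v i)\<^sup>2)" using assms by (simp add: sphere_radius_def)
  then have "\<beta> * real n * gap_fun z (sphere_radius n v)
      = \<beta> * real n * V f z - \<beta> * z * (\<Sum>i<n. (v i)\<^sup>2) + \<beta> * real n * f (sphere_radius n v)"
  proof -
    have "\<beta> * real n * (r * z) = \<beta> * z * (real n * r)" for r by simp
    then show ?thesis using \<open>real n * sphere_radius n v = (\<Sum>i<n. (v i)\<^sup>2)\<close>
      unfolding gap_fun_def by (simp add: right_diff_distrib)
  qed
  moreover have "(\<Sum>i<n. \<beta> * (z - l (Suc i)) * (v i)\<^sup>2)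
      = \<beta> * z * (\<Sum>i<n. (v i)\<^sup>2) - \<beta> * (\<Sum>i<n. l (Suc i) * (v i)\<^sup>2)"
    unfolding sum_distrib_left sum_subtractf[symmetric] by (intro sum.cong) (auto simp: algebra_simps)
  ultimately show ?thesis by simp
qed

definition tiltE :: "nat \<Rightarrow> real \<Rightarrow> (nat \<Rightarrow> real) \<Rightarrow> real" where
  "tiltE n z l = (LINT v|gprod {..<n} (\<lambda>i. \<beta> * (z - l (Suc i))).
     exp (- (\<beta> * real n * gap_fun z (sphere_radius n v))))"

lemma sum_shift_Suc: "(\<Sum>i<n. g (Suc i)) = (\<Sum>k=1..n. g k)"
  for g :: "nat \<Rightarrow> real"
  by (rule sum.reindex_bij_witness[of _ "\<lambda>k. k - 1" Suc]) auto

lemma prod_sqrt_eq: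
  assumes "finite I" "\<And>i. i \<in> I \<Longrightarrow> d i > 0"
  shows "(\<Prod>i\<in>I. sqrt (pi / (\<beta> * d i))) = exp (real (card I) / 2 * ln (pi / \<beta>) - 1/2 * (\<Sum>i\<in>I. ln (d i)))"
proof -
  have "sqrt (pi / (\<beta> * d i)) = exp (1/2 * ln (pi / \<beta>) - 1/2 * ln (d i))" if "i \<in> I" for i
  proof -
    have d: "d i > 0" using assms that by auto
    have X: "pi / (\<beta> * d i) > 0" using d \<beta>_pos by simp
    have "sqrt (pi / (\<beta> * d i)) = exp (ln (pi / (\<beta> * d i)) / 2)"
      using exp_ln[of "sqrt (pi / (\<beta> * d i))"] X ln_sqrt[OF less_imp_le[OF X]] by simp
    moreover have "ln (pi / (\<beta> * d i)) = ln (pi / \<beta>) - ln (d i)"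
      using ln_div[of "pi / \<beta>" "d i"] d \<beta>_pos by simp
    ultimately show ?thesis by (simp add: diff_divide_distrib)
  qed
  then have "(\<Prod>i\<in>I. sqrt (pi / (\<beta> * d i))) = (\<Prod>i\<in>I. exp (1/2 * ln (pi / \<beta>) - 1/2 * ln (d i)))"
    by (intro prod.cong) auto
  also have "\<dots> = exp (\<Sum>i\<in>I. 1/2 * ln (pi / \<beta>) - 1/2 * ln (d i))"
    by (rule exp_sum[OF assms(1), symmetric])
  finally show ?thesis by (simp add: sum_subtractf sum_distrib_left)
qed

text \<open>The deficit is nonnegative and finite everywhere, so the expectation lies in (0,1]; the
  same identity shows that the integral is finite and positive, so that its logarithm is
  meaningful.\<close>

lemma logZ_tilt:
  assumes n: "n \<ge> 1" and l: "\<And>k. k \<in> {1..n} \<Longrightarrow> l k < z"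
  shows "0 < tiltE n z l" "tiltE n z l \<le> 1"
    and "logZ n l = \<beta> * real n * V f z + real n / 2 * ln (pi / \<beta>) - 1/2 * (\<Sum>k=1..n. ln (z - l k)) + ln (tiltE n z l)"
    and "Zd n l = ennreal (exp (\<beta> * real n * V f z + real n / 2 * ln (pi / \<beta>) - 1/2 * (\<Sum>k=1..n. ln (z - l k))) * tiltE n z l)"
proof -
  define a where "a i = \<beta> * (z - l (Suc i))" for i
  have a: "a i > 0" if "i \<in> {..<n}" for i
    using that l[of "Suc i"] \<beta>_pos unfolding a_def by auto
  interpret P: prob_space "gprod {..<n} a" by (rule prob_space_gprod) (use a in auto)
  let ?F = "\<lambda>v. exp (- (\<beta> * real n * gap_fun z (sphere_radius n v)))"
  have meas[measurable]: "?F \<in> borel_measurable (lebN n)"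
    unfolding gap_fun_def by measurable
  have F1: "?F v \<le> 1" for v
    using \<beta>_pos gap_fun_nonneg[OF sphere_radius_nonneg] by (simp add: mult_nonneg_nonneg)
  have int: "integrable (gprod {..<n} a) ?F"
    by (rule P.integrable_const_bound[where B = 1]) (use F1 in auto)
  have E: "(\<integral>\<^sup>+v. ennreal (?F v) \<partial>gprod {..<n} a) = ennreal (tiltE n z l)"
    unfolding tiltE_def a_def[symmetric] by (rule nn_integral_eq_integral[OF int]) auto
  show "tiltE n z l \<le> 1"
    unfolding tiltE_def a_def[symmetric] by (rule P.integral_le_const[OF int]) (use F1 in auto)
  show pos: "0 < tiltE n z l"
  proof (rule ccontr)
    assume "\<not> 0 < tiltE n z l"
    then have "(\<integral>\<^sup>+v. ennreal (?F v) \<partial>gprod {..<n} a) = 0" unfolding E by (simp add: ennreal_eq_0_iff)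
    then have "AE v in gprod {..<n} a. ennreal (?F v) = 0"
      by (subst (asm) nn_integral_0_iff_AE) auto
    then have "AE v in gprod {..<n} a. False" by eventually_elim simp
    then show False by simp
  qed
  let ?c = "\<beta> * real n * V f z + real n / 2 * ln (pi / \<beta>) - 1/2 * (\<Sum>k=1..n. ln (z - l k))"
  have "Zd n l = (\<integral>\<^sup>+v. (ennreal (exp (\<beta> * real n * V f z)) * ennreal (?F v)) * ennreal (exp (- (\<Sum>i<n. a i * (v i)\<^sup>2))) \<partial>lebN n)"
    unfolding Zd_def exponent_eq[OF n, of l _ z] a_def
    by (intro nn_integral_cong) (simp add: ennreal_mult[symmetric] exp_add[symmetric])
  also have "\<dots> = ennreal (\<Prod>i<n. sqrt (pi / a i)) * (\<integral>\<^sup>+v. ennreal (exp (\<beta> * real n * V f z)) * ennreal (?F v) \<partial>gprod {..<n} a)"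
    by (rule nn_integral_gaussian_weight) (use a in auto)
  also have "(\<integral>\<^sup>+v. ennreal (exp (\<beta> * real n * V f z)) * ennreal (?F v) \<partial>gprod {..<n} a)
      = ennreal (exp (\<beta> * real n * V f z)) * ennreal (tiltE n z l)"
    unfolding E[symmetric] by (rule nn_integral_cmult) measurable
  also have "(\<Prod>i<n. sqrt (pi / a i)) = exp (real n / 2 * ln (pi / \<beta>) - 1/2 * (\<Sum>k=1..n. ln (z - l k)))"
    unfolding a_def using prod_sqrt_eq[of "{..<n}" "\<lambda>i. z - l (Suc i)"] l
    by (simp add: sum_shift_Suc[of "\<lambda>k. ln (z - l k)"])
  also have "ennreal (exp (real n / 2 * ln (pi / \<beta>) - 1/2 * (\<Sum>k=1..n. ln (z - l k))))
      * (ennreal (exp (\<beta> * real n * V f z)) * ennreal (tiltE n z l)) = ennreal (exp ?c * tiltE n z l)"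
  proof -
    have "ennreal (exp A) * (ennreal (exp B) * ennreal t) = ennreal (exp (B + A) * t)" if "t > 0" for A B t :: real
      using that by (simp add: ennreal_mult[symmetric] exp_add mult_ac)
    from this[OF pos] show ?thesis by (simp add: add_diff_eq)
  qed
  finally show Z: "Zd n l = ennreal (exp ?c * tiltE n z l)" .
  show "logZ n l = ?c + ln (tiltE n z l)"
    unfolding logZ_def Z using pos by (simp add: ln_mult)
qed

text \<open>The integral is restricted to a set where the deficit is small: the coordinates other
  than the first have square sum at most \<open>n * b\<close>, and the first lies in a window that
  puts the radius between \<open>tau f z\<close> and \<open>tau f z + \<eta> + 1 / n\<close>. Since
  the first gap is 1/n, the window costs at most \<open>\<beta> * (tau f z + 1)\<close> in the
  exponent. The slack \<eta> serves the critical case, where the other coordinates on average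
  already fill the radius.\<close>

lemma logZ_lower:
  assumes n: "n \<ge> 1" and z: "z = l 1 + 1 / real n" and l: "\<And>k. k \<in> {1..n} \<Longrightarrow> l k < z"
    and d: "\<And>k. k \<in> {2..n} \<Longrightarrow> z - l k \<le> d k" "\<And>k. k \<in> {2..n} \<Longrightarrow> d k > 0"
    and \<eta>: "\<eta> \<ge> 0" and b: "b = tau f z + \<eta>" "b > 0"
    and m: "(\<Sum>k=2..n. 1 / d k) \<le> 2 * \<beta> * real n * m" "m < b"
    and L: "L \<ge> 0" "\<And>r. tau f z \<le> r \<Longrightarrow> r \<le> tau f z + \<eta> + 1 \<Longrightarrow> gap_fun z r \<le> L * (r - tau f z)"
  shows "logZ n l \<ge> \<beta> * real n * V f z + real (n - 1) / 2 * ln (pi / \<beta>) - 1/2 * (\<Sum>k=2..n. ln (d k))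
    - \<beta> * real n * (L * (\<eta> + 1 / real n)) - \<beta> * (tau f z + 1)
    - ln (2 * sqrt (real n * (tau f z + 1))) + ln (1 - m / b)"
proof -
  define \<tau> where "\<tau> = tau f z"
  have tau0: "\<tau> \<ge> 0" unfolding \<tau>_def by (rule tau_max(1))
  define I where "I = {1..<n}"
  define a where "a i = \<beta> * d (Suc i)" for i
  have a: "a i > 0" if "i \<in> I" for i using that d(2)[of "Suc i"] \<beta>_pos unfolding a_def I_def by auto
  have finI: "finite I" and I: "{..<n} = insert 0 I" "0 \<notin> I" unfolding I_def using n by auto
  define K where "K = exp (\<beta> * real n * V f z - \<beta> * real n * (L * (\<eta> + 1 / real n)) - \<beta> * (\<tau> + 1)
      - ln (2 * sqrt (real n * (\<tau> + 1))))"
  define S where "S x = (\<Sum>i\<in>I. (x i)\<^sup>2)" for x :: "nat \<Rightarrow> real"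
  let ?g = "\<lambda>v. ennreal (exp (\<beta> * (\<Sum>i<n. l (Suc i) * (v i)\<^sup>2) - \<beta> * real n * f (sphere_radius n v)))"
  have meas: "?g \<in> borel_measurable (\<Pi>\<^sub>M i\<in>insert 0 I. lborel)"
    unfolding I(1)[symmetric] by measurable
  have S_meas[measurable]: "S \<in> borel_measurable (\<Pi>\<^sub>M i\<in>I. lborel)"
    unfolding S_def[abs_def] by measurable
  have inner: "ennreal K * (indicator {x. S x \<le> real n * b} x * ennreal (exp (- (\<Sum>i\<in>I. a i * (x i)\<^sup>2))))
      \<le> (\<integral>\<^sup>+y. ?g (x(0 := y)) \<partial>lborel)" for x
  proof (cases "S x \<le> real n * b")
    case True
    define R' where "R' = S x / real n"
    \<comment> \<open>The missing part of the radius, zero if the other coordinates already exceed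
      the target.\<close>
    define x0 where "x0 = max 0 (\<tau> - R')"
    have R': "0 \<le> R'" "R' \<le> \<tau> + \<eta>"
      using True n unfolding R'_def S_def b(1) \<tau>_def by (auto intro!: divide_nonneg_nonneg sum_nonneg simp: divide_le_eq mult.commute)
    have x0: "0 \<le> x0" "x0 \<le> \<tau>" "\<tau> \<le> R' + x0" "R' + x0 \<le> \<tau> + \<eta>"
      using R' tau0 \<eta> unfolding x0_def by auto
    \<comment> \<open>The window consists of squares between \<open>n * x0\<close> and
      \<open>n * x0 + 1\<close>, so the first coordinate supplies the missing part with an excess of
      at most 1/n.\<close>
    define y1 where "y1 = sqrt (real n * x0)"
    define y2 where "y2 = sqrt (real n * x0 + 1)"
    have y12: "0 \<le> y1" "y1 \<le> y2" "0 < y2" unfolding y1_def y2_def using x0 by (auto intro: add_nonneg_pos)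
    let ?e = "\<beta> * real n * V f z - \<beta> * real n * (L * (\<eta> + 1 / real n)) - \<beta> * (\<tau> + 1) - (\<Sum>i\<in>I. a i * (x i)\<^sup>2)"
    have pt: "ennreal (exp ?e) * indicator {y1..y2} y \<le> ?g (x(0 := y))" for y
    proof (cases "y \<in> {y1..y2}")
      case True
      then have "0 \<le> y" using y12 by auto
      with True have ysq: "real n * x0 \<le> y\<^sup>2" "y\<^sup>2 \<le> real n * x0 + 1"
        using y12 x0 power_mono[of y1 y 2] power_mono[of y y2 2, OF _ \<open>0 \<le> y\<close>] unfolding y1_def y2_def by auto
      define v where "v = x(0 := y)"
      have sum_v: "(\<Sum>i<n. (v i)\<^sup>2) = y\<^sup>2 + S x"
        unfolding I(1) S_def v_def using finI I(2) by (simp add: sum.insert) (intro sum.cong, auto)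
      have R: "sphere_radius n v = R' + y\<^sup>2 / real n"
        unfolding sphere_radius_def sum_v R'_def by (simp add: add_divide_distrib)
      have yn: "x0 \<le> y\<^sup>2 / real n" "y\<^sup>2 / real n \<le> x0 + 1 / real n"
        using ysq n by (auto simp: le_divide_eq divide_le_eq mult.commute distrib_left)
      have n1: "1 / real n \<le> 1" using n by simp
      have "gap_fun z (sphere_radius n v) \<le> L * (sphere_radius n v - \<tau>)"
        unfolding \<tau>_def by (rule L(2)) (use R yn x0 n1 in \<open>auto simp: \<tau>_def[symmetric]\<close>)
      also have "\<dots> \<le> L * (\<eta> + 1 / real n)"
        using R yn x0 L(1) by (intro mult_left_mono) auto
      finally have g: "\<beta> * real n * gap_fun z (sphere_radius n v) \<le> \<beta> * real n * (L * (\<eta> + 1 / real n))"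
        using \<beta>_pos by (intro mult_left_mono) auto
      have "(\<Sum>i<n. \<beta> * (z - l (Suc i)) * (v i)\<^sup>2) = \<beta> * (z - l 1) * y\<^sup>2 + (\<Sum>i\<in>I. \<beta> * (z - l (Suc i)) * (x i)\<^sup>2)"
        unfolding I(1) v_def using finI I(2) by (simp add: sum.insert) (intro sum.cong, auto)
      also have "\<beta> * (z - l 1) * y\<^sup>2 = \<beta> * (y\<^sup>2 / real n)" using z by simp
      also have "\<beta> * (y\<^sup>2 / real n) \<le> \<beta> * (\<tau> + 1)" using yn x0 n1 \<beta>_pos by (intro mult_left_mono) auto
      also have "(\<Sum>i\<in>I. \<beta> * (z - l (Suc i)) * (x i)\<^sup>2) \<le> (\<Sum>i\<in>I. a i * (x i)\<^sup>2)"
        unfolding a_def using d(1) \<beta>_pos by (intro sum_mono mult_right_mono mult_left_mono) (auto simp: I_def)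
      finally have "?e \<le> \<beta> * (\<Sum>i<n. l (Suc i) * (v i)\<^sup>2) - \<beta> * real n * f (sphere_radius n v)"
        unfolding exponent_eq[OF n, of l v z] using g by linarith
      then show ?thesis using True unfolding v_def by (simp add: ennreal_leI)
    qed simp
    \<comment> \<open>The squares of the end points differ by 1, so the length is the inverse of
      their sum.\<close>
    have len: "1 / (2 * sqrt (real n * (\<tau> + 1))) \<le> y2 - y1"
    proof -
      have "(y2 - y1) * (y2 + y1) = y2\<^sup>2 - y1\<^sup>2" by (simp add: power2_eq_square algebra_simps)
      also have "\<dots> = 1" unfolding y1_def y2_def using x0 by (simp add: add_nonneg_nonneg)
      finally have "y2 - y1 = 1 / (y2 + y1)" using y12 by (subst eq_divide_eq) auto
      moreover have "y2 + y1 \<le> 2 * sqrt (real n * (\<tau> + 1))"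
      proof -
        have "real n * x0 + 1 \<le> real n * (\<tau> + 1)"
        proof -
          have "real n * x0 \<le> real n * \<tau>" by (rule mult_left_mono[OF x0(2)]) simp
          moreover have "1 \<le> real n" using n by simp
          ultimately show ?thesis unfolding distrib_left by linarith
        qed
        then have "y2 \<le> sqrt (real n * (\<tau> + 1))" unfolding y2_def by simp
        then show ?thesis using y12 by linarith
      qed
      ultimately show ?thesis using y12 by (simp add: frac_le)
    qed
    have pos: "0 < 2 * sqrt (real n * (\<tau> + 1))" using n tau0 by simp
    have "ennreal K * (indicator {x. S x \<le> real n * b} x * ennreal (exp (- (\<Sum>i\<in>I. a i * (x i)\<^sup>2))))
        = ennreal (exp ?e * (1 / (2 * sqrt (real n * (\<tau> + 1)))))"
    proof -
      define e0 where "e0 = ?e"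
      define T0 where "T0 = (\<Sum>i\<in>I. a i * (x i)\<^sup>2)"
      define c0 where "c0 = 1 / (2 * sqrt (real n * (\<tau> + 1)))"
      have "exp (ln (2 * sqrt (real n * (\<tau> + 1)))) = 2 * sqrt (real n * (\<tau> + 1))"
        using pos by (rule exp_ln)
      then have K: "K = exp (e0 + T0) * c0"
        unfolding K_def e0_def T0_def c0_def exp_diff[of _ "ln _"] by simp
      have "exp (e0 + T0) * exp (- T0) = exp e0" by (simp add: exp_add[symmetric])
      then have "K * exp (- T0) = exp e0 * c0" unfolding K by (metis mult.assoc mult.commute)
      then have "K * exp (- (\<Sum>i\<in>I. a i * (x i)\<^sup>2)) = exp ?e * (1 / (2 * sqrt (real n * (\<tau> + 1))))"
        unfolding T0_def e0_def c0_def .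
      moreover have "K \<ge> 0" unfolding K_def by simp
      ultimately show ?thesis using True by (simp add: ennreal_mult[symmetric])
    qed
    also have "\<dots> \<le> ennreal (exp ?e * (y2 - y1))" using len by (intro ennreal_leI mult_left_mono) auto
    also have "\<dots> = ennreal (exp ?e) * emeasure lborel {y1..y2}" using y12 by (simp add: ennreal_mult)
    also have "\<dots> = (\<integral>\<^sup>+y. ennreal (exp ?e) * indicator {y1..y2} y \<partial>lborel)"
      by (subst nn_integral_cmult_indicator) auto
    also have "\<dots> \<le> (\<integral>\<^sup>+y. ?g (x(0 := y)) \<partial>lborel)" by (intro nn_integral_mono pt)
    finally show ?thesis .
  qed simp
  interpret P: prob_space "gprod I a" by (rule prob_space_gprod) (use a finI in auto)
  define W where "W = exp (real (n - 1) / 2 * ln (pi / \<beta>) - 1/2 * (\<Sum>k=2..n. ln (d k)))"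
  have W: "(\<Prod>i\<in>I. sqrt (pi / a i)) = W"
  proof -
    have "(\<Sum>i\<in>I. ln (d (Suc i))) = (\<Sum>k=2..n. ln (d k))"
      unfolding I_def by (rule sum.reindex_bij_witness[of _ "\<lambda>k. k - 1" Suc]) auto
    then show ?thesis unfolding W_def a_def
      using prod_sqrt_eq[OF finI, of "\<lambda>i. d (Suc i)"] d(2) by (auto simp: I_def)
  qed
  define p where "p = 1 - m / b"
  have p: "p > 0" unfolding p_def using m b(2) by simp
  have "p \<le> P.prob {v \<in> space (gprod I a). (\<Sum>i\<in>I. (v i)\<^sup>2) \<le> real n * b}"
  proof -
    have "(\<Sum>i\<in>I. 1 / (2 * a i)) = (\<Sum>k=2..n. 1 / d k) / (2 * \<beta>)"
      unfolding I_def a_def sum_divide_distrib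
      by (rule sum.reindex_bij_witness[of _ "\<lambda>k. k - 1" Suc]) auto
    also have "\<dots> \<le> real n * m" using m \<beta>_pos by (simp add: divide_le_eq mult.commute mult.left_commute)
    finally have "(\<Sum>i\<in>I. 1 / (2 * a i)) / (real n * b) \<le> real n * m / (real n * b)"
      using n b by (intro divide_right_mono) auto
    then have "1 - (\<Sum>i\<in>I. 1 / (2 * a i)) / (real n * b) \<ge> p" using n unfolding p_def by simp
    moreover have "real n * b > 0" using n b by simp
    ultimately show ?thesis
      using order.trans[OF _ gprod_square_sum_tail[OF finI, of a "real n * b", OF a]] by blast
  qed
  then have "ennreal p \<le> emeasure (gprod I a) {v \<in> space (gprod I a). S v \<le> real n * b}"
    unfolding S_def P.emeasure_eq_measure by (rule ennreal_leI)
  also have "\<dots> = (\<integral>\<^sup>+v. indicator {v. S v \<le> real n * b} v \<partial>gprod I a)"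
  proof -
    have "{v \<in> space (gprod I a). S v \<le> real n * b} \<in> sets (gprod I a)" by measurable
    from nn_integral_indicator[OF this, symmetric] show ?thesis
      by (simp only:) (intro nn_integral_cong, auto split: split_indicator)
  qed
  finally have pn: "ennreal p \<le> (\<integral>\<^sup>+v. indicator {v. S v \<le> real n * b} v \<partial>gprod I a)" .
  have ind[measurable]: "(\<lambda>x. indicator {x. S x \<le> real n * b} x :: ennreal) \<in> borel_measurable (\<Pi>\<^sub>M i\<in>I. lborel)"
    by (rule borel_measurable_indicator') measurable
  have "ennreal (K * W * p) = ennreal K * (ennreal W * ennreal p)"
    using p unfolding K_def W_def by (simp add: ennreal_mult mult.assoc)
  also have "\<dots> \<le> ennreal K * (ennreal W * (\<integral>\<^sup>+v. indicator {v. S v \<le> real n * b} v \<partial>gprod I a))"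
    by (intro mult_left_mono pn) auto
  also have "\<dots> = ennreal K * (\<integral>\<^sup>+x. indicator {x. S x \<le> real n * b} x * ennreal (exp (- (\<Sum>i\<in>I. a i * (x i)\<^sup>2))) \<partial>(\<Pi>\<^sub>M i\<in>I. lborel))"
    unfolding W[symmetric] by (subst nn_integral_gaussian_weight[OF finI a]) auto
  also have "\<dots> = (\<integral>\<^sup>+x. ennreal K * (indicator {x. S x \<le> real n * b} x * ennreal (exp (- (\<Sum>i\<in>I. a i * (x i)\<^sup>2)))) \<partial>(\<Pi>\<^sub>M i\<in>I. lborel))"
    by (rule nn_integral_cmult[symmetric]) measurable
  also have "\<dots> \<le> (\<integral>\<^sup>+x. \<integral>\<^sup>+y. ?g (x(0 := y)) \<partial>lborel \<partial>(\<Pi>\<^sub>M i\<in>I. lborel))"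
    by (intro nn_integral_mono inner)
  also have "\<dots> = (\<integral>\<^sup>+v. ?g v \<partial>(\<Pi>\<^sub>M i\<in>insert 0 I. lborel))"
    by (rule lborel_product.product_nn_integral_insert[symmetric]) (use finI I meas in auto)
  also have "\<dots> = Zd n l" unfolding Zd_def I(1) ..
  finally have "ennreal (K * W * p) \<le> Zd n l" .
  moreover have "Zd n l < \<infinity>"
  proof -
    obtain x where "Zd n l = ennreal x" using logZ_tilt(4)[of n l z, OF n l] by blast
    then show ?thesis by simp
  qed
  ultimately have "K * W * p \<le> enn2real (Zd n l)"
    using p enn2real_mono[of "ennreal (K * W * p)" "Zd n l"] by (simp add: K_def W_def)
  moreover have "0 < K * W * p" unfolding K_def W_def using p by simp
  ultimately have "ln (K * W * p) \<le> logZ n l" unfolding logZ_def by simp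
  moreover have "ln (K * W * p) = ln K + ln W + ln p"
    unfolding K_def W_def using p by (simp add: ln_mult)
  ultimately show ?thesis unfolding K_def W_def p_def \<tau>_def by simp
qed

end

lemma powr_neg_tendsto_0: "p > 0 \<Longrightarrow> (\<lambda>N. real N powr (- p)) \<longlonglongrightarrow> 0"
  by (rule tendsto_neg_powr[OF _ filterlim_real_sequentially]) simp

section \<open>The low temperature regime\<close>

context spherical_model begin

definition good :: "nat \<Rightarrow> (nat \<Rightarrow> real) \<Rightarrow> bool" where
  "good N l \<longleftrightarrow> rigid N l \<and> (\<forall>k\<in>{1..N}. l k \<le> l 1)"

definition edge_energy :: real where
  "edge_energy = \<beta> * V f Cp + 1/2 * ln (pi / \<beta>) - 1/2 * (LINT x|\<nu>. ln (Cp - x))"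

abbreviation \<tau>c :: real where "\<tau>c \<equiv> tau f Cp"

text \<open>The derivative at z = Cp of \<beta> V(z) minus half the integral of ln (z - x): the rate
  at which moving the top eigenvalue changes the energy. It equals
  \<open>\<beta> * \<tau>c - beta_c \<nu> Cm Cp\<close> and is positive exactly in the low
  temperature phase.\<close>

definition edge_slope :: real where "edge_slope = \<beta> * \<tau>c - stieltjes Cp / 2"

text \<open>Collects the constants of the preceding estimates into one that depends neither on N nor
  on the spectrum.\<close>

lemma sum_ln_top_gap:
  obtains K where "K \<ge> 0" and "\<And>N l. N \<ge> 1 \<Longrightarrow> good N l \<Longrightarrow> C * (C + 3) * real N powr (- 1/60) \<le> 1/2 \<Longrightarrow>
      \<bar>(\<Sum>k=1..N. ln (l 1 + 1 / real N - l k)) - real N * (LINT x|\<nu>. ln (Cp - x))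
        - (l 1 + 1 / real N - Cp) * (real N * stieltjes Cp)\<bar> \<le> K * real N powr (1/4)"
proof -
  obtain K1 where K1: "K1 \<ge> 0" "\<And>N. N \<ge> 1 \<Longrightarrow>
    \<bar>real N * (LINT x|\<nu>. ln (Cp - x)) - (\<Sum>k=1..N. ln (Cp - \<xi> N k))\<bar> \<le> K1 * real N powr (1/4)"
    using sum_ln_edge by metis
  obtain K2 where K2: "K2 \<ge> 0" "\<And>N. N \<ge> 1 \<Longrightarrow>
    \<bar>real N * (LINT x|\<nu>. 1 / (Cp - x)) - (\<Sum>k=1..N. 1 / (Cp - \<xi> N k))\<bar> \<le> K2 * real N powr (5/6)"
    using sum_inverse_edge by metis
  define K where "K = max 0 (log_err_const + K1 + (C + 2) * K2)"
  have "\<bar>(\<Sum>k=1..N. ln (l 1 + 1 / real N - l k)) - real N * (LINT x|\<nu>. ln (Cp - x))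
        - (l 1 + 1 / real N - Cp) * (real N * stieltjes Cp)\<bar> \<le> K * real N powr (1/4)"
    if N: "N \<ge> 1" and g: "good N l" and small: "C * (C + 3) * real N powr (- 1/60) \<le> 1/2" for N l
  proof -
    have r: "rigid N l" and top: "\<And>k. k \<in> {1..N} \<Longrightarrow> l k \<le> l 1"
      using g unfolding good_def by auto
    have "\<bar>(\<Sum>k=1..N. ln (l 1 + 1 / real N - l k)) - real N * (LINT x|\<nu>. ln (Cp - x))
        - (l 1 + 1 / real N - Cp) * (real N * stieltjes Cp)\<bar> \<le> (log_err_const + K1 + (C + 2) * K2) * real N powr (1/4)"
      unfolding stieltjes_def by (rule sum_ln_gap[OF N r top small K1(2)[OF N] K2(2)[OF N] K2(1)])
    also have "\<dots> \<le> K * real N powr (1/4)" unfolding K_def by (intro mult_right_mono) auto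
    finally show ?thesis .
  qed
  moreover have "K \<ge> 0" by (simp add: K_def)
  ultimately show ?thesis using that by blast
qed

lemma sum_soft_gap:
  obtains K2 where "\<And>N l. N \<ge> 1 \<Longrightarrow> good N l \<Longrightarrow> C * (C + 3) * real N powr (- 1/60) \<le> 1/2 \<Longrightarrow>
      (\<Sum>k=2..N. 1 / soft_gap N l k) \<le> real N powr (1/10)
        + (1 + 2 * (C * (C + 3) * real N powr (- 1/60))) * (real N * stieltjes Cp + K2 * real N powr (5/6))"
proof -
  obtain K2 where K2: "K2 \<ge> 0" "\<And>N. N \<ge> 1 \<Longrightarrow>
    \<bar>real N * (LINT x|\<nu>. 1 / (Cp - x)) - (\<Sum>k=1..N. 1 / (Cp - \<xi> N k))\<bar> \<le> K2 * real N powr (5/6)"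
    using sum_inverse_edge by metis
  have "(\<Sum>k=2..N. 1 / soft_gap N l k) \<le> real N powr (1/10)
        + (1 + 2 * (C * (C + 3) * real N powr (- 1/60))) * (real N * stieltjes Cp + K2 * real N powr (5/6))"
    if N: "N \<ge> 1" and g: "good N l" and small: "C * (C + 3) * real N powr (- 1/60) \<le> 1/2" for N l
  proof -
    have r: "rigid N l" and top: "\<And>k. k \<in> {1..N} \<Longrightarrow> l k \<le> l 1"
      using g unfolding good_def by auto
    show ?thesis
      using sum_inverse_soft_gap[OF N r top] sum_inverse_gap_bulk[OF N r top small K2(2)[OF N]]
      unfolding stieltjes_def by linarith
  qed
  then show ?thesis using that by blast
qed

lemma shift_eventually_small:
  assumes "\<delta> > 0"
  shows "\<forall>\<^sub>F N in sequentially. (C + 2) * real N powr (- 37/60) \<le> \<delta>"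
    and "\<forall>\<^sub>F N in sequentially. C * (C + 3) * real N powr (- 1/60) \<le> \<delta>"
proof -
  have "(\<lambda>N. (C + 2) * real N powr (- (37/60))) \<longlonglongrightarrow> (C + 2) * 0"
    by (intro tendsto_mult tendsto_const powr_neg_tendsto_0) simp
  then have "(\<lambda>N. (C + 2) * real N powr (- (37/60))) \<longlonglongrightarrow> 0" by simp
  from order_tendstoD(2)[OF this assms]
  show "\<forall>\<^sub>F N in sequentially. (C + 2) * real N powr (- 37/60) \<le> \<delta>"
    by (rule eventually_mono) simp
  have "(\<lambda>N. C * (C + 3) * real N powr (- (1/60))) \<longlonglongrightarrow> C * (C + 3) * 0"
    by (intro tendsto_mult tendsto_const powr_neg_tendsto_0) simp
  then have "(\<lambda>N. C * (C + 3) * real N powr (- (1/60))) \<longlonglongrightarrow> 0" by simp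
  from order_tendstoD(2)[OF this assms]
  show "\<forall>\<^sub>F N in sequentially. C * (C + 3) * real N powr (- 1/60) \<le> \<delta>"
    by (rule eventually_mono) simp
qed

lemma soft_mean_eventually:
  assumes "stieltjes Cp < M"
  shows "\<forall>\<^sub>F N in sequentially. real N powr (1/10)
        + (1 + 2 * (C * (C + 3) * real N powr (- 1/60))) * (real N * stieltjes Cp + K2 * real N powr (5/6)) \<le> real N * M"
proof -
  have "(\<lambda>N. real N powr (- (9/10)) + (1 + 2 * (C * (C + 3) * real N powr (- (1/60)))) * (stieltjes Cp + K2 * real N powr (- (1/6))))
      \<longlonglongrightarrow> 0 + (1 + 2 * (C * (C + 3) * 0)) * (stieltjes Cp + K2 * 0)"
    by (intro tendsto_add tendsto_mult tendsto_const powr_neg_tendsto_0) simp_all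
  then have "\<forall>\<^sub>F N in sequentially. real N powr (- (9/10))
      + (1 + 2 * (C * (C + 3) * real N powr (- (1/60)))) * (stieltjes Cp + K2 * real N powr (- (1/6))) < M"
    using assms by (intro order_tendstoD) auto
  then show ?thesis
    using eventually_ge_at_top[of 1]
  proof eventually_elim
    case (elim N)
    have p: "real N * real N powr a = real N powr (1 + a)" for a
      using elim by (simp add: powr_add)
    have "real N * (real N powr (- (9/10))
      + (1 + 2 * (C * (C + 3) * real N powr (- (1/60)))) * (stieltjes Cp + K2 * real N powr (- (1/6)))) \<le> real N * M"
      using elim by (intro mult_left_mono) auto
    also have "real N * (real N powr (- (9/10))
      + (1 + 2 * (C * (C + 3) * real N powr (- (1/60)))) * (stieltjes Cp + K2 * real N powr (- (1/6))))
      = real N * real N powr (- (9/10)) + (1 + 2 * (C * (C + 3) * real N powr (- (1/60))))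
         * (real N * stieltjes Cp + K2 * (real N * real N powr (- (1/6))))"
      by (simp only: distrib_left mult.assoc mult.left_commute)
    finally show ?case unfolding p by simp
  qed
qed

lemma edge_energy_expand:
  "real N * edge_energy + real N * edge_slope * d
    = \<beta> * real N * V f Cp + real N / 2 * ln (pi / \<beta>) - 1/2 * (real N * (LINT x|\<nu>. ln (Cp - x)))
      + \<beta> * real N * \<tau>c * d - 1/2 * (d * (real N * stieltjes Cp))"
proof -
  have "n * (b * v + 1/2 * q - 1/2 * j) + n * (b * t - S / 2) * d
      = b * n * v + n / 2 * q - 1/2 * (n * j) + b * n * t * d - 1/2 * (d * (n * S))"
    for n b v q j t S :: real by (simp add: field_simps)
  then show ?thesis unfolding edge_energy_def edge_slope_def by blast
qed

text \<open>Dropping the expectation is affordable at this precision. The distance of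
  \<open>z\<close> from the edge is at most of order N^(-37/60), so N times the quadratic remainder
  of \<open>V\<close> is negligible and the term linear in that distance is what survives.\<close>

lemma logZ_edge_upper:
  "\<exists>K. \<forall>\<^sub>F N in sequentially. \<forall>l. good N l \<longrightarrow>
    logZ N l \<le> real N * edge_energy + real N * edge_slope * (l 1 - Cp) + K * real N powr (1/4)"
proof -
  obtain K where K: "K \<ge> 0"
    and ln_sum: "\<And>N l. N \<ge> 1 \<Longrightarrow> good N l \<Longrightarrow> C * (C + 3) * real N powr (- 1/60) \<le> 1/2 \<Longrightarrow>
      \<bar>(\<Sum>k=1..N. ln (l 1 + 1 / real N - l k)) - real N * (LINT x|\<nu>. ln (Cp - x))
        - (l 1 + 1 / real N - Cp) * (real N * stieltjes Cp)\<bar> \<le> K * real N powr (1/4)"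
    using sum_ln_top_gap by metis
  define es where "es = \<bar>edge_slope\<bar>"
  have half: "0 < (1/2 :: real)" by simp
  have es: "edge_slope \<le> es" "- edge_slope \<le> es" "0 \<le> es" unfolding es_def by auto
  define K' where "K' = K / 2 + es + \<beta> * (C + 2)\<^sup>2 / modulus"
  have "\<forall>\<^sub>F N in sequentially. \<forall>l. good N l \<longrightarrow>
    logZ N l \<le> real N * edge_energy + real N * edge_slope * (l 1 - Cp) + K' * real N powr (1/4)"
    using shift_eventually_small(2)[of "1/2", OF half] eventually_ge_at_top[of 1]
  proof eventually_elim
    case (elim N)
    show ?case
    proof (intro allI impI)
      fix l assume g: "good N l"
      note N = elim(2) and small = elim(1)
      have r: "rigid N l" and top: "\<And>k. k \<in> {1..N} \<Longrightarrow> l k \<le> l 1" using g unfolding good_def by auto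
      define z where "z = l 1 + 1 / real N"
      have lz: "l k < z" if "k \<in> {1..N}" for k
        using gap_gt_0[OF N r top that] unfolding z_def by linarith
      note Z = logZ_tilt[of N l z, OF N lz]
      have N1: "1 \<le> real N powr (1/4)" by (rule N_powr_ge_1[OF N r top]) auto
      have "ln (tiltE N z l) \<le> 0" using Z(1,2) by simp
      then have 1: "logZ N l \<le> \<beta> * real N * V f z + real N / 2 * ln (pi / \<beta>) - 1/2 * (\<Sum>k=1..N. ln (z - l k))"
        using Z(3) by linarith
      have 2: "(\<Sum>k=1..N. ln (z - l k)) \<ge> real N * (LINT x|\<nu>. ln (Cp - x)) + (z - Cp) * (real N * stieltjes Cp) - K * real N powr (1/4)"
        using ln_sum[OF N g small] unfolding z_def by linarith
      have d: "\<bar>z - Cp\<bar> \<le> (C + 2) * real N powr (- 37/60)"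
        using z_minus_edge[OF N r top] unfolding z_def .
      have "(z - Cp)\<^sup>2 \<le> ((C + 2) * real N powr (- 37/60))\<^sup>2"
        using d by (metis abs_ge_zero power2_abs power_mono)
      also have "\<dots> = (C + 2)\<^sup>2 * real N powr (- 37/30)"
        by (simp add: power_mult_distrib power2_eq_square[of "_ powr _"] powr_add[symmetric])
      finally have "real N * (z - Cp)\<^sup>2 \<le> real N * ((C + 2)\<^sup>2 * real N powr (- 37/30))"
        by (intro mult_left_mono) auto
      also have "\<dots> = (C + 2)\<^sup>2 * (real N powr 1 * real N powr (- 37/30))" using N by simp
      also have "\<dots> = (C + 2)\<^sup>2 * real N powr (- 7/30)" by (simp only: powr_add[symmetric]) simp
      also have "\<dots> \<le> (C + 2)\<^sup>2 * real N powr (1/4)" using N by (intro mult_left_mono powr_mono) auto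
      finally have sq: "real N * (z - Cp)\<^sup>2 \<le> (C + 2)\<^sup>2 * real N powr (1/4)" .
      have "\<beta> * real N * V f z \<le> \<beta> * real N * (V f Cp + \<tau>c * (z - Cp) + (z - Cp)\<^sup>2 / modulus)"
        using V_first_order(2)[of z Cp] \<beta>_pos by (intro mult_left_mono) auto
      also have "\<dots> = \<beta> * real N * V f Cp + \<beta> * real N * \<tau>c * (z - Cp) + \<beta> / modulus * (real N * (z - Cp)\<^sup>2)"
        by (simp add: distrib_left)
      also have "\<dots> \<le> \<beta> * real N * V f Cp + \<beta> * real N * \<tau>c * (z - Cp) + \<beta> / modulus * ((C + 2)\<^sup>2 * real N powr (1/4))"
        using sq \<beta>_pos modulus(1) by (intro add_left_mono mult_left_mono) auto
      finally have 3: "\<beta> * real N * V f z \<le> \<beta> * real N * V f Cp + \<beta> * real N * \<tau>c * (z - Cp) + \<beta> * (C + 2)\<^sup>2 / modulus * real N powr (1/4)"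
        by simp
      note e = edge_energy_expand[of N "z - Cp"]
      \<comment> \<open>The offset 1/N of \<open>z\<close> from \<open>l 1\<close>, multiplied by N,
        leaves one bounded term.\<close>
      have "real N * edge_slope * (z - Cp) = real N * edge_slope * (l 1 - Cp) + edge_slope"
        unfolding z_def using N by (simp add: algebra_simps)
      moreover have "edge_slope \<le> es * real N powr (1/4)"
        using mult_left_mono[OF N1 es(3)] es(1) by simp
      ultimately show "logZ N l \<le> real N * edge_energy + real N * edge_slope * (l 1 - Cp) + K' * real N powr (1/4)"
        using 1 2 3 e unfolding K'_def distrib_right by linarith
    qed
  qed
  then show ?thesis by blast
qed

text \<open>\<open>L0\<close> is chosen before \<eta>. At the critical temperature the other
  coordinates fill the radius on average, so a positive \<eta> is required, and its cost per site
  \<open>L0 * \<eta>\<close> can then be made arbitrarily small. At lower temperature \<eta> = 0 is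
  allowed and the cost disappears.\<close>

lemma logZ_edge_lower:
  "\<exists>L0\<ge>0. \<forall>\<eta>\<in>{0..1}. stieltjes Cp / (2 * \<beta>) < \<tau>c + \<eta> \<longrightarrow>
    (\<exists>K. \<forall>\<^sub>F N in sequentially. \<forall>l. good N l \<longrightarrow>
      logZ N l \<ge> real N * edge_energy + real N * edge_slope * (l 1 - Cp) - K * real N powr (1/4) - L0 * \<eta> * real N)"
proof -
  have tau0: "\<tau>c \<ge> 0" by (rule tau_max(1))
  obtain Lf where Lf: "Lf \<ge> 0" "\<And>x y. 0 \<le> x \<Longrightarrow> x \<le> \<tau>c + 3 \<Longrightarrow> 0 \<le> y \<Longrightarrow> y \<le> \<tau>c + 3 \<Longrightarrow> \<bar>f x - f y\<bar> \<le> Lf * \<bar>x - y\<bar>"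
    by (rule f_lipschitz_on_compact[of "\<tau>c + 3"]) (use tau0 in auto)
  define L where "L = Lf + \<bar>Cp\<bar> + 1"
  have L: "L \<ge> 0" unfolding L_def using Lf by simp
  obtain K where K: "K \<ge> 0"
    and ln_sum: "\<And>N l. N \<ge> 1 \<Longrightarrow> good N l \<Longrightarrow> C * (C + 3) * real N powr (- 1/60) \<le> 1/2 \<Longrightarrow>
      \<bar>(\<Sum>k=1..N. ln (l 1 + 1 / real N - l k)) - real N * (LINT x|\<nu>. ln (Cp - x))
        - (l 1 + 1 / real N - Cp) * (real N * stieltjes Cp)\<bar> \<le> K * real N powr (1/4)"
    using sum_ln_top_gap by metis
  obtain K2 where soft: "\<And>N l. N \<ge> 1 \<Longrightarrow> good N l \<Longrightarrow> C * (C + 3) * real N powr (- 1/60) \<le> 1/2 \<Longrightarrow>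
      (\<Sum>k=2..N. 1 / soft_gap N l k) \<le> real N powr (1/10)
        + (1 + 2 * (C * (C + 3) * real N powr (- 1/60))) * (real N * stieltjes Cp + K2 * real N powr (5/6))"
    using sum_soft_gap by metis
  show ?thesis
  proof (rule exI[of _ "\<beta> * L"], intro conjI ballI impI)
    show "\<beta> * L \<ge> 0" using \<beta>_pos L by simp
    fix \<eta> :: real assume eta: "\<eta> \<in> {0..1}" and gap: "stieltjes Cp / (2 * \<beta>) < \<tau>c + \<eta>"
    \<comment> \<open>The room between the radius aimed at and the average share of the other
      coordinates. One third goes into the excess of \<open>m\<close> over that average, one third
      into the variation of \<open>tau f z\<close>, and one third remains for the Markov bound
      \<open>p\<close>.\<close>
    define g where "g = \<tau>c + \<eta> - stieltjes Cp / (2 * \<beta>)"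
    define m where "m = stieltjes Cp / (2 * \<beta>) + g / 3"
    define p where "p = (g / 3) / (\<tau>c + \<eta> + 1)"
    have g: "g > 0" using gap unfolding g_def by simp
    have p: "p > 0" unfolding p_def using g tau0 eta by simp
    \<comment> \<open>Closeness of \<open>z\<close> to the edge that keeps \<open>tau f z\<close>
      within \<open>min 1 (g / 3)\<close> of its edge value, by the Lipschitz constant
      \<open>1 / modulus\<close>.\<close>
    define \<delta> where "\<delta> = min 1 (modulus * min 1 (g / 3))"
    have "\<delta> / modulus \<le> min 1 (g / 3)"
      unfolding pos_divide_le_eq[OF modulus(1)] \<delta>_def mult.commute[of modulus] by (rule min.cobounded2)
    moreover have "\<delta> > 0" "\<delta> \<le> 1" unfolding \<delta>_def using g modulus(1) by auto
    ultimately have \<delta>: "\<delta> > 0" "\<delta> \<le> 1" "\<delta> / modulus \<le> 1" "\<delta> / modulus \<le> g / 3" by auto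
    have mS: "stieltjes Cp < 2 * \<beta> * m"
      unfolding m_def using \<beta>_pos g by (simp add: distrib_left)
    define a1 where "a1 = \<bar>1/2 * ln (pi / \<beta>)\<bar>"
    define a2 where "a2 = \<bar>ln p\<bar>"
    define a3 where "a3 = \<bar>edge_slope\<bar>"
    have half: "0 < (1/2 :: real)" by simp
    have a3: "- a3 \<le> edge_slope" unfolding a3_def by linarith
    define c where "c = a1 + \<beta> * L + \<beta> * (\<tau>c + 2) + ln (2 * sqrt (\<tau>c + 2)) + a2 + a3"
    define K' where "K' = K / 2 + (42 + (Cp - Cm + 4)) / 2 + c + 21"
    have c0: "c \<ge> 0"
    proof -
      have "1 \<le> 2 * sqrt (\<tau>c + 2)" using tau0 real_sqrt_ge_one[of "\<tau>c + 2"] by linarith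
      then have "0 \<le> ln (2 * sqrt (\<tau>c + 2))" by simp
      then show ?thesis unfolding c_def a1_def a2_def a3_def using \<beta>_pos L tau0 by (intro add_nonneg_nonneg mult_nonneg_nonneg) auto
    qed
    have "\<forall>\<^sub>F N in sequentially. \<forall>l. good N l \<longrightarrow>
      logZ N l \<ge> real N * edge_energy + real N * edge_slope * (l 1 - Cp) - K' * real N powr (1/4) - \<beta> * L * \<eta> * real N"
      using shift_eventually_small(2)[of "1/2", OF half] shift_eventually_small(1)[OF \<delta>(1)]
        soft_mean_eventually[OF mS, of K2] eventually_ge_at_top[of 1]
    proof eventually_elim
      case (elim N)
      note N = elim(4) and small = elim(1)
      show ?case
      proof (intro allI impI)
        fix l assume gl: "good N l"
        have r: "rigid N l" and top: "\<And>k. k \<in> {1..N} \<Longrightarrow> l k \<le> l 1" using gl unfolding good_def by auto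
        define z where "z = l 1 + 1 / real N"
        have lz: "l k < z" if "k \<in> {1..N}" for k
          using gap_gt_0[OF N r top that] unfolding z_def by linarith
        have N1: "1 \<le> real N powr (1/4)" by (rule N_powr_ge_1[OF N r top]) auto
        have zC: "\<bar>z - Cp\<bar> \<le> \<delta>"
          using z_minus_edge[OF N r top] elim(2) unfolding z_def by linarith
        have "\<bar>tau f z - \<tau>c\<bar> \<le> \<bar>z - Cp\<bar> / modulus" by (rule tau_lipschitz)
        also have "\<dots> \<le> \<delta> / modulus" using zC modulus(1) by (intro divide_right_mono) auto
        finally have tz: "\<bar>tau f z - \<tau>c\<bar> \<le> 1" "\<bar>tau f z - \<tau>c\<bar> \<le> g / 3" using \<delta> by linarith+
        define b where "b = tau f z + \<eta>"
        have b: "m + g / 3 \<le> b" "b \<le> \<tau>c + \<eta> + 1" proof -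
          define q where "q = stieltjes Cp / (2 * \<beta>)"
          have "\<tau>c + \<eta> = q + g" "m = q + g / 3" unfolding m_def g_def q_def by simp_all
          then show "m + g / 3 \<le> b" "b \<le> \<tau>c + \<eta> + 1"
            using tz unfolding b_def by linarith+
        qed
        have m0: "m > 0" unfolding m_def using stieltjes_pos[of Cp] \<beta>_pos g by (intro add_pos_pos) auto
        have b0: "b > 0" "m < b" using b m0 g by linarith+
        have tz0: "tau f z \<ge> 0" by (rule tau_max(1))
        have gap_lip: "gap_fun z x \<le> L * (x - tau f z)" if "tau f z \<le> x" "x \<le> tau f z + \<eta> + 1" for x
        proof -
          have "\<bar>f x - f (tau f z)\<bar> \<le> Lf * \<bar>x - tau f z\<bar>"
            by (rule Lf(2)) (use that tz tz0 eta in auto)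
          moreover have "- z * (x - tau f z) \<le> (\<bar>Cp\<bar> + 1) * (x - tau f z)"
            using that zC \<delta>(2) by (intro mult_right_mono) auto
          moreover have "gap_fun z x = (f x - f (tau f z)) + (- z * (x - tau f z))"
            unfolding gap_fun_def V_def by (simp add: algebra_simps)
          moreover have "L * (x - tau f z) = Lf * \<bar>x - tau f z\<bar> + (\<bar>Cp\<bar> + 1) * (x - tau f z)"
            unfolding L_def using that by (simp add: algebra_simps)
          ultimately show ?thesis by linarith
        qed
        have dm: "(\<Sum>k=2..N. 1 / soft_gap N l k) \<le> 2 * \<beta> * real N * m"
          using soft[OF N gl small] elim(3) by (simp add: mult_ac)
        have low: "logZ N l \<ge> \<beta> * real N * V f z + real (N - 1) / 2 * ln (pi / \<beta>) - 1/2 * (\<Sum>k=2..N. ln (soft_gap N l k))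
          - \<beta> * real N * (L * (\<eta> + 1 / real N)) - \<beta> * (tau f z + 1)
          - ln (2 * sqrt (real N * (tau f z + 1))) + ln (1 - m / b)"
        proof (rule logZ_lower[where l = l and z = z and d = "soft_gap N l" and \<eta> = \<eta> and m = m and L = L and b = b, OF N z_def lz])
          show "z - l k \<le> soft_gap N l k" for k using soft_gap_ge[OF N r top] unfolding z_def .
          show "k \<in> {2..N} \<Longrightarrow> soft_gap N l k > 0" for k using soft_gap_pos[OF N r top, of k] by auto
        qed (use eta b_def b0 dm L gap_lip in auto)
        have t1: "\<beta> * real N * V f z \<ge> \<beta> * real N * V f Cp + \<beta> * real N * \<tau>c * (z - Cp)"
          using mult_left_mono[OF V_first_order(1)[of Cp z], of "\<beta> * real N"] \<beta>_pos by (simp add: distrib_left)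
        have t2: "real (N - 1) / 2 * ln (pi / \<beta>) \<ge> real N / 2 * ln (pi / \<beta>) - a1"
        proof -
          have "real (N - 1) / 2 * ln (pi / \<beta>) = real N / 2 * ln (pi / \<beta>) - 1/2 * ln (pi / \<beta>)"
            using N by (simp add: of_nat_diff left_diff_distrib diff_divide_distrib)
          then show ?thesis unfolding a1_def by linarith
        qed
        have t3: "(\<Sum>k=2..N. ln (soft_gap N l k)) \<le> (\<Sum>k=1..N. ln (z - l k)) + (42 + (Cp - Cm + 4)) * real N powr (1/4)"
          unfolding z_def by (rule sum_ln_soft_gap[OF N r top])
        have t4: "(\<Sum>k=1..N. ln (z - l k)) \<le> real N * (LINT x|\<nu>. ln (Cp - x)) + (z - Cp) * (real N * stieltjes Cp) + K * real N powr (1/4)"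
          using ln_sum[OF N gl small] unfolding z_def by linarith
        have t5: "\<beta> * real N * (L * (\<eta> + 1 / real N)) = \<beta> * L * \<eta> * real N + \<beta> * L"
          using N by (simp add: distrib_left)
        have t6: "\<beta> * (tau f z + 1) \<le> \<beta> * (\<tau>c + 2)" using tz \<beta>_pos by (intro mult_left_mono) auto
        have t7: "ln (2 * sqrt (real N * (tau f z + 1))) \<le> ln (2 * sqrt (\<tau>c + 2)) + 21 * real N powr (1/4)"
        proof -
          have "ln (2 * sqrt (real N * (tau f z + 1))) \<le> ln (real N * (2 * sqrt (\<tau>c + 2)))"
          proof (subst ln_le_cancel_iff)
            have "sqrt (real N * (tau f z + 1)) \<le> real N * sqrt (\<tau>c + 2)"
            proof -
              have "sqrt (real N) \<le> real N" using N by (simp add: real_sqrt_le_iff' power2_eq_square) 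
              moreover have "sqrt (tau f z + 1) \<le> sqrt (\<tau>c + 2)" using tz by simp
              ultimately show ?thesis unfolding real_sqrt_mult using tz0 by (intro mult_mono) auto
            qed
            then show "2 * sqrt (real N * (tau f z + 1)) \<le> real N * (2 * sqrt (\<tau>c + 2))" by simp
          qed (use N tz0 tau0 in auto)
          also have "\<dots> = ln (real N) + ln (2 * sqrt (\<tau>c + 2))" using N tau0 by (intro ln_mult_pos) auto
          also have "ln (real N) \<le> 21 * real N powr (1/20)" using ln_one_plus_le_powr[of "real N"] N by simp
          also have "\<dots> \<le> 21 * real N powr (1/4)" using N by (intro mult_left_mono powr_mono) auto
          finally show ?thesis by simp
        qed
        have t8: "ln (1 - m / b) \<ge> - a2"
        proof -
          have "p \<le> (b - m) / b" unfolding p_def using b b0 g tau0 eta by (intro frac_le) auto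
          also have "\<dots> = 1 - m / b" using b0 by (simp add: diff_divide_distrib)
          finally have "ln p \<le> ln (1 - m / b)" using p by simp
          then show ?thesis unfolding a2_def by linarith
        qed
        note e = edge_energy_expand[of N "z - Cp"]
        have s: "real N * edge_slope * (z - Cp) = real N * edge_slope * (l 1 - Cp) + edge_slope"
          unfolding z_def using N by (simp add: algebra_simps)
        have "c \<le> c * real N powr (1/4)" using mult_left_mono[OF N1 c0] by simp
        then have k: "K' * real N powr (1/4) \<ge> K / 2 * real N powr (1/4) + (42 + (Cp - Cm + 4)) / 2 * real N powr (1/4) + c + 21 * real N powr (1/4)"
          unfolding K'_def distrib_right by linarith
        define D where "D = real N powr (1/4)"
        have "logZ N l \<ge> \<beta> * real N * V f Cp + \<beta> * real N * \<tau>c * (z - Cp) + (real N / 2 * ln (pi / \<beta>) - a1)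
            - 1/2 * ((\<Sum>k=1..N. ln (z - l k)) + (42 + (Cp - Cm + 4)) * D)
            - (\<beta> * L * \<eta> * real N + \<beta> * L) - \<beta> * (\<tau>c + 2) - (ln (2 * sqrt (\<tau>c + 2)) + 21 * D) - a2"
        proof -
          have "Y + B' - 1/2 * S' - c5 - c6' - c7' - c8' \<le> X"
            if "Y' + B - 1/2 * S - c5 - c6 - c7 + c8 \<le> X" "Y \<le> Y'" "B' \<le> B" "S \<le> S'"
              "c6 \<le> c6'" "c7 \<le> c7'" "- c8' \<le> c8"
            for X Y Y' B B' S S' c5 c6 c6' c7 c7' c8 c8' :: real
            using that by linarith
          from this[OF low[unfolded t5] t1 t2 t3 t6 t7 t8] show ?thesis unfolding D_def .
        qed
        note low' = this
        have "E - e1 - c * D / 2 - K * D / 2 - x1 - x2 - x3 - x4 \<le> X"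
          if "A + B + (H - e1) - 1/2 * (S + c * D) - x1 - x2 - x3 - x4 \<le> X"
            "S \<le> J + P + K * D" "E = A + H - 1/2 * J + B - 1/2 * P"
          for E e1 c K D x1 x2 x3 x4 X A B H S J P :: real
          using that unfolding distrib_left[of "1/2"] by linarith
        from this[OF low' t4[folded D_def] e]
        have "real N * edge_energy + real N * edge_slope * (z - Cp) - a1
            - (42 + (Cp - Cm + 4)) * D / 2 - K * D / 2 - (\<beta> * L * \<eta> * real N + \<beta> * L) - \<beta> * (\<tau>c + 2)
            - (ln (2 * sqrt (\<tau>c + 2)) + 21 * D) - a2 \<le> logZ N l" .
        then show "real N * edge_energy + real N * edge_slope * (l 1 - Cp) - K' * real N powr (1/4) - \<beta> * L * \<eta> * real N \<le> logZ N l"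
          using s k a3 unfolding c_def D_def[symmetric] by linarith
      qed
    qed
    then show "\<exists>K. \<forall>\<^sub>F N in sequentially. \<forall>l. good N l \<longrightarrow>
      logZ N l \<ge> real N * edge_energy + real N * edge_slope * (l 1 - Cp) - K * real N powr (1/4) - \<beta> * L * \<eta> * real N"
      by blast
  qed
qed

end

section \<open>Weighted sums of squared Gaussians\<close>

definition gmeas :: "real \<Rightarrow> real measure" where "gmeas a = density lborel (\<lambda>y. ennreal (gauss_dens a y))"

lemma sets_gmeas [measurable_cong]: "sets (gmeas a) = sets borel"
  by (simp add: gmeas_def)

lemma prob_space_gmeas: "a > 0 \<Longrightarrow> prob_space (gmeas a)"
  by (intro prob_spaceI) (simp add: gmeas_def emeasure_density nn_integral_gauss_dens)

lemma gmeas_moment: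
  assumes "a > 0"
  shows "integrable (gmeas a) (\<lambda>y. y ^ (2 * k))"
    and "(LINT y|gmeas a. y ^ (2 * k)) = fact (2 * k) / ((4 * a) ^ k * fact k)"
  using gauss_dens_moment[OF assms, of k] gauss_dens_nonneg[OF assms]
  by (simp_all add: gmeas_def integrable_density integral_density)

lemma integral_gprod_prod:
  fixes g :: "nat \<Rightarrow> real \<Rightarrow> complex"
  assumes fin: "finite I" and pos: "\<And>i. i \<in> I \<Longrightarrow> a i > 0"
    and meas[measurable]: "\<And>i. g i \<in> borel_measurable borel" and bd: "\<And>i y. norm (g i y) \<le> 1"
  shows "(LINT v|gprod I a. (\<Prod>i\<in>I. g i (v i))) = (\<Prod>i\<in>I. LINT y|gmeas (a i). g i y)"
proof -
  have int: "integrable lborel (\<lambda>y. gauss_dens (a i) y *\<^sub>R g i y)" if "i \<in> I" for i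
  proof -
    interpret prob_space "gmeas (a i)" by (rule prob_space_gmeas[OF pos[OF that]])
    have "integrable (gmeas (a i)) (g i)"
      by (rule integrable_const_bound[where B = 1]) (auto simp: bd)
    then show ?thesis unfolding gmeas_def
      by (subst (asm) integrable_density) (auto simp: gauss_dens_nonneg[OF pos[OF that]])
  qed
  have "(LINT v|gprod I a. (\<Prod>i\<in>I. g i (v i)))
      = (LINT v|(\<Pi>\<^sub>M i\<in>I. lborel). (\<Prod>i\<in>I. gauss_dens (a i) (v i)) *\<^sub>R (\<Prod>i\<in>I. g i (v i)))"
    unfolding gprod_def
    by (rule integral_density) (auto intro!: AE_I2 prod_nonneg gauss_dens_nonneg pos)
  also have "\<dots> = (LINT v|(\<Pi>\<^sub>M i\<in>I. lborel). (\<Prod>i\<in>I. gauss_dens (a i) (v i) *\<^sub>R g i (v i)))"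
    by (simp add: scaleR_conv_of_real prod.distrib)
  also have "\<dots> = (\<Prod>i\<in>I. LINT y|lborel. gauss_dens (a i) y *\<^sub>R g i y)"
    by (rule lborel_product.product_integral_prod[OF fin int])
  also have "\<dots> = (\<Prod>i\<in>I. LINT y|gmeas (a i). g i y)"
    unfolding gmeas_def
    by (intro prod.cong refl integral_density[symmetric]) (auto intro!: AE_I2 gauss_dens_nonneg pos)
  finally show ?thesis .
qed

text \<open>With \<sigma> = 1 / (2 a) the centred square has variance 2 \<sigma>^2 and third
  absolute moment at most 64 \<sigma>^3, to which the third order Taylor bound for characteristic
  functions applies.\<close>

lemma char_centered_square:
  assumes a: "a > 0"
  shows "cmod ((LINT y|gmeas a. iexp (s * (y\<^sup>2 - 1 / (2 * a)))) - (1 - s\<^sup>2 / (4 * a\<^sup>2))) \<le> 4 / 3 * \<bar>s\<bar> ^ 3 / a ^ 3"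
    and "cmod (LINT y|gmeas a. iexp (s * (y\<^sup>2 - 1 / (2 * a)))) \<le> 1"
proof -
  interpret prob_space "gmeas a" by (rule prob_space_gmeas[OF a])
  define \<sigma> where "\<sigma> = 1 / (2 * a)"
  have sig: "\<sigma> > 0" unfolding \<sigma>_def using a by simp
  define X where "X y = y\<^sup>2 - \<sigma>" for y :: real
  have m1: "integrable (gmeas a) (\<lambda>y. y\<^sup>2)" "expectation (\<lambda>y. y\<^sup>2) = \<sigma>"
    using gmeas_moment[OF a, of 1] a unfolding \<sigma>_def by simp_all
  have m2: "integrable (gmeas a) (\<lambda>y. y ^ 4)" "expectation (\<lambda>y. y ^ 4) = 3 * \<sigma>\<^sup>2"
    using gmeas_moment[OF a, of 2] unfolding \<sigma>_def using a
    by (simp_all add: fact_numeral power2_eq_square field_simps)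
  have m3: "integrable (gmeas a) (\<lambda>y. y ^ 6)" "expectation (\<lambda>y. y ^ 6) = 15 * \<sigma> ^ 3"
    using gmeas_moment[OF a, of 3] unfolding \<sigma>_def using a
    by (simp_all add: fact_numeral power3_eq_cube field_simps)
  have X2: "(X y)\<^sup>2 = y ^ 4 - 2 * \<sigma> * y\<^sup>2 + \<sigma>\<^sup>2" for y
    unfolding X_def by (simp add: power2_eq_square power4_eq_xxxx algebra_simps)
  have [simp]: "prob (space (gmeas a)) = 1" by (rule prob_space)
  have i2: "integrable (gmeas a) (\<lambda>y. (X y)\<^sup>2)"
    unfolding X2 using m1 m2 by (intro Bochner_Integration.integrable_add Bochner_Integration.integrable_diff integrable_mult_right) auto
  have e2: "expectation (\<lambda>y. (X y)\<^sup>2) = 2 * \<sigma>\<^sup>2"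
  proof -
    have "expectation (\<lambda>y. (X y)\<^sup>2) = expectation (\<lambda>y. y ^ 4 - 2 * \<sigma> * y\<^sup>2) + \<sigma>\<^sup>2"
      unfolding X2 using m1 m2 by (subst Bochner_Integration.integral_add) auto
    also have "expectation (\<lambda>y. y ^ 4 - 2 * \<sigma> * y\<^sup>2) = 3 * \<sigma>\<^sup>2 - 2 * \<sigma> * \<sigma>"
      using m1 m2 by (subst Bochner_Integration.integral_diff) auto
    finally show ?thesis by (simp add: power2_eq_square)
  qed
  have i1: "integrable (gmeas a) X" and e1: "expectation X = 0"
    unfolding X_def using m1 by (simp_all add: X_def)
  have rv: "random_variable borel X" unfolding X_def by measurable
  have var: "variance X = 2 * \<sigma>\<^sup>2" using e1 e2 by simp
  have cube: "\<bar>X y\<bar> ^ 3 \<le> 4 * y ^ 6 + 4 * \<sigma> ^ 3" for y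
  proof -
    have "\<bar>X y\<bar> \<le> y\<^sup>2 + \<sigma>" unfolding X_def using sig by (simp add: abs_le_iff)
    then have "\<bar>X y\<bar> ^ 3 \<le> (y\<^sup>2 + \<sigma>) ^ 3" by (intro power_mono) auto
    \<comment> \<open>Convexity of the cube on nonnegative numbers; the difference is an explicit
      nonnegative multiple of a square.\<close>
    also have "\<dots> \<le> 4 * ((y\<^sup>2) ^ 3 + \<sigma> ^ 3)"
    proof -
      have "0 \<le> 3 * (y\<^sup>2 + \<sigma>) * (y\<^sup>2 - \<sigma>)\<^sup>2" using sig by simp
      also have "\<dots> = 4 * ((y\<^sup>2) ^ 3 + \<sigma> ^ 3) - (y\<^sup>2 + \<sigma>) ^ 3"
        by (simp add: power2_eq_square power3_eq_cube algebra_simps)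
      finally show ?thesis by simp
    qed
    finally show ?thesis by (simp add: power_mult[symmetric])
  qed
  have "cmod (char (distr (gmeas a) borel X) s - (1 - s\<^sup>2 * (2 * \<sigma>\<^sup>2) / 2))
      \<le> s\<^sup>2 / 6 * expectation (\<lambda>x. min (6 * (X x)\<^sup>2) (\<bar>s\<bar> * \<bar>X x\<bar> ^ 3))"
    by (rule char_approx3'[OF rv i1 i2 e1 var refl])
  also have "expectation (\<lambda>x. min (6 * (X x)\<^sup>2) (\<bar>s\<bar> * \<bar>X x\<bar> ^ 3)) \<le> expectation (\<lambda>y. \<bar>s\<bar> * (4 * y ^ 6 + 4 * \<sigma> ^ 3))"
  proof (rule integral_mono')
    show "integrable (gmeas a) (\<lambda>y. \<bar>s\<bar> * (4 * y ^ 6 + 4 * \<sigma> ^ 3))"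
      using m3 by (intro integrable_mult_right Bochner_Integration.integrable_add) auto
    fix y
    show "min (6 * (X y)\<^sup>2) (\<bar>s\<bar> * \<bar>X y\<bar> ^ 3) \<le> \<bar>s\<bar> * (4 * y ^ 6 + 4 * \<sigma> ^ 3)"
      using mult_left_mono[OF cube[of y], of "\<bar>s\<bar>"] by linarith
    show "0 \<le> \<bar>s\<bar> * (4 * y ^ 6 + 4 * \<sigma> ^ 3)" using sig by simp
  qed
  also have "expectation (\<lambda>y. \<bar>s\<bar> * (4 * y ^ 6 + 4 * \<sigma> ^ 3)) = \<bar>s\<bar> * (64 * \<sigma> ^ 3)"
    using m3 by (simp add: Bochner_Integration.integral_add)
  also have "s\<^sup>2 / 6 * (\<bar>s\<bar> * (64 * \<sigma> ^ 3)) = 4 / 3 * \<bar>s\<bar> ^ 3 / a ^ 3"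
  proof -
    have "64 * \<sigma> ^ 3 = 8 / a ^ 3" unfolding \<sigma>_def by (simp add: power_divide power_mult_distrib)
    moreover have "s\<^sup>2 * \<bar>s\<bar> = \<bar>s\<bar> ^ 3" by (metis power2_abs power_Suc2 numeral_3_eq_3 numeral_2_eq_2)
    moreover have "s\<^sup>2 / 6 * (\<bar>s\<bar> * (64 * \<sigma> ^ 3)) = (s\<^sup>2 * \<bar>s\<bar>) * (64 * \<sigma> ^ 3) / 6" by simp
    ultimately show ?thesis by simp
  qed
  finally have main: "cmod (char (distr (gmeas a) borel X) s - (1 - s\<^sup>2 * (2 * \<sigma>\<^sup>2) / 2)) \<le> 4 / 3 * \<bar>s\<bar> ^ 3 / a ^ 3"
    by (simp add: mult_left_mono)
  have ch: "char (distr (gmeas a) borel X) s = (LINT y|gmeas a. iexp (s * (y\<^sup>2 - 1 / (2 * a))))"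
    unfolding char_def using rv by (subst integral_distr) (auto simp: X_def \<sigma>_def)
  have "s\<^sup>2 * (2 * \<sigma>\<^sup>2) / 2 = s\<^sup>2 / (4 * a\<^sup>2)" unfolding \<sigma>_def by (simp add: power_divide power_mult_distrib)
  then show "cmod ((LINT y|gmeas a. iexp (s * (y\<^sup>2 - 1 / (2 * a)))) - (1 - s\<^sup>2 / (4 * a\<^sup>2))) \<le> 4 / 3 * \<bar>s\<bar> ^ 3 / a ^ 3"
    using main unfolding ch by simp
  interpret D: real_distribution "distr (gmeas a) borel X" using rv by (rule real_distribution_distr)
  show "cmod (LINT y|gmeas a. iexp (s * (y\<^sup>2 - 1 / (2 * a)))) \<le> 1"
    unfolding ch[symmetric] by (rule D.cmod_char_le_1)
qed

lemma exp_minus_approx: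
  fixes x :: real assumes "x \<ge> 0"
  shows "\<bar>exp (- x) - (1 - x)\<bar> \<le> x\<^sup>2"
proof -
  have 1: "1 - x \<le> exp (- x)" using exp_ge_add_one_self[of "- x"] by simp
  have "exp (- x) \<le> 1 / (1 + x)"
    using exp_ge_add_one_self[of x] assms by (simp add: exp_minus field_simps)
  also have "\<dots> \<le> 1 - x + x\<^sup>2"
  proof -
    have "1 \<le> (1 - x + x\<^sup>2) * (1 + x)" using assms by (simp add: power2_eq_square algebra_simps)
    then show ?thesis using assms by (subst pos_divide_le_eq) auto
  qed
  finally show ?thesis using 1 by (simp add: abs_le_iff)
qed

definition centered_normal :: "real \<Rightarrow> real measure" where
  "centered_normal w = distr std_normal_distribution borel (\<lambda>x. sqrt w * x)"

lemma char_centered_normal: "w \<ge> 0 \<Longrightarrow> char (centered_normal w) t = exp (- (t\<^sup>2 * w / 2))"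
proof -
  assume w: "w \<ge> 0"
  have "char (centered_normal w) t = char std_normal_distribution (t * sqrt w)"
    unfolding centered_normal_def char_def by (subst integral_distr) (auto simp: mult_ac)
  then show ?thesis using w by (simp add: char_std_normal_distribution power_mult_distrib exp_of_real)
qed

lemma real_distribution_centered_normal: "real_distribution (centered_normal w)"
proof -
  interpret real_distribution std_normal_distribution by (rule real_dist_normal_dist)
  show ?thesis unfolding centered_normal_def by (rule real_distribution_distr) simp
qed

text \<open>The characteristic function factorises. In dimension d each factor is within O(d^(-3/2))
  of a Gaussian one, because the precisions are bounded below, and d factors of modulus at most 1
  merely add their errors. The dimensions run along an arbitrary sequence tending to infinity, so
  that subsequences are covered.\<close>

lemma gprod_clt:
  fixes a :: "nat \<Rightarrow> nat \<Rightarrow> real" and Nn :: "nat \<Rightarrow> nat" and c w \<tau> :: real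
  assumes c: "c > 0" and a: "\<And>n i. i < Nn n \<Longrightarrow> c \<le> a n i"
    and Nn: "\<And>n. Nn n \<ge> 1" "filterlim Nn at_top sequentially"
    and mean: "(\<lambda>n. sqrt (real (Nn n)) * ((\<Sum>i<Nn n. 1 / (2 * a n i)) / real (Nn n) - \<tau>)) \<longlonglongrightarrow> 0"
    and var: "(\<lambda>n. (\<Sum>i<Nn n. 1 / (2 * (a n i)\<^sup>2)) / real (Nn n)) \<longlonglongrightarrow> w" and w: "w \<ge> 0"
  shows "weak_conv_m (\<lambda>n. distr (gprod {..<Nn n} (a n)) borel
      (\<lambda>v. sqrt (real (Nn n)) * ((\<Sum>i<Nn n. (v i)\<^sup>2) / real (Nn n) - \<tau>))) (centered_normal w)"
proof (rule levy_continuity[OF _ real_distribution_centered_normal])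
  let ?Y = "\<lambda>n v. sqrt (real (Nn n)) * ((\<Sum>i<Nn n. (v i)\<^sup>2) / real (Nn n) - \<tau>)"
  have apos: "a n i > 0" if "i < Nn n" for n i using a[OF that] c by linarith
  have P: "prob_space (gprod {..<Nn n} (a n))" for n by (rule prob_space_gprod) (auto simp: apos)
  have Ym[measurable]: "?Y n \<in> borel_measurable (gprod {..<Nn n} (a n))" for n by measurable
  show "real_distribution (distr (gprod {..<Nn n} (a n)) borel (?Y n))" for n
    by (rule prob_space.real_distribution_distr[OF P]) measurable
  fix t
  define s where "s n = t / sqrt (real (Nn n))" for n
  \<comment> \<open>The bias from centring at \<tau> instead of at the exact mean; hypothesis
    \<open>mean\<close> makes it vanish in the limit.\<close>
  define \<delta> where "\<delta> n = sqrt (real (Nn n)) * ((\<Sum>i<Nn n. 1 / (2 * a n i)) / real (Nn n) - \<tau>)" for n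
  define \<phi> where "\<phi> n i = (LINT y|gmeas (a n i). iexp (s n * (y\<^sup>2 - 1 / (2 * a n i))))" for n i
  define e where "e n i = complex_of_real (exp (- ((s n)\<^sup>2 / (4 * (a n i)\<^sup>2))))" for n i
  have Npos: "real (Nn n) > 0" for n using Nn(1)[of n] by simp
  have ch: "char (distr (gprod {..<Nn n} (a n)) borel (?Y n)) t = iexp (t * \<delta> n) * (\<Prod>i<Nn n. \<phi> n i)" for n
  proof -
    have Y: "t * ?Y n v = t * \<delta> n + (\<Sum>i<Nn n. s n * ((v i)\<^sup>2 - 1 / (2 * a n i)))" for v
    proof -
      have "(\<Sum>i<Nn n. s n * ((v i)\<^sup>2 - 1 / (2 * a n i))) = s n * ((\<Sum>i<Nn n. (v i)\<^sup>2) - (\<Sum>i<Nn n. 1 / (2 * a n i)))"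
        by (simp only: sum_distrib_left[symmetric] sum_subtractf)
      moreover have "s n = t * sqrt (real (Nn n)) / real (Nn n)"
        unfolding s_def using Npos[of n] by (simp add: field_simps)
      ultimately show ?thesis unfolding \<delta>_def by (simp add: algebra_simps diff_divide_distrib)
    qed
    have "char (distr (gprod {..<Nn n} (a n)) borel (?Y n)) t = (LINT v|gprod {..<Nn n} (a n). iexp (t * ?Y n v))"
      unfolding char_def by (subst integral_distr) auto
    also have "\<dots> = (LINT v|gprod {..<Nn n} (a n). iexp (t * \<delta> n) * (\<Prod>i<Nn n. iexp (s n * ((v i)\<^sup>2 - 1 / (2 * a n i)))))"
      unfolding Y by (intro Bochner_Integration.integral_cong refl)
        (simp add: exp_add distrib_left sum_distrib_left exp_sum)
    also have "\<dots> = iexp (t * \<delta> n) * (LINT v|gprod {..<Nn n} (a n). (\<Prod>i<Nn n. iexp (s n * ((v i)\<^sup>2 - 1 / (2 * a n i)))))"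
      by (rule Bochner_Integration.integral_mult_right_zero)
    also have "(LINT v|gprod {..<Nn n} (a n). (\<Prod>i<Nn n. iexp (s n * ((v i)\<^sup>2 - 1 / (2 * a n i))))) = (\<Prod>i<Nn n. \<phi> n i)"
      unfolding \<phi>_def by (rule integral_gprod_prod) (auto simp: apos)
    finally show ?thesis .
  qed
  have diff: "cmod ((\<Prod>i<Nn n. \<phi> n i) - (\<Prod>i<Nn n. e n i))
      \<le> 4 / 3 * \<bar>t\<bar> ^ 3 / c ^ 3 / sqrt (real (Nn n)) + (t\<^sup>2 / (4 * c\<^sup>2))\<^sup>2 / real (Nn n)" for n
  proof -
    have sabs: "\<bar>s n\<bar> ^ 3 = \<bar>t\<bar> ^ 3 / (real (Nn n) * sqrt (real (Nn n)))"
      unfolding s_def using Npos[of n] by (simp add: abs_divide power_divide power3_eq_cube)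
    have ssq: "(s n)\<^sup>2 = t\<^sup>2 / real (Nn n)"
      unfolding s_def using Npos[of n] by (simp add: power_divide)
    have "cmod ((\<Prod>i<Nn n. \<phi> n i) - (\<Prod>i<Nn n. e n i)) \<le> (\<Sum>i<Nn n. cmod (\<phi> n i - e n i))"
    proof (rule norm_prod_diff)
      fix i assume "i \<in> {..<Nn n}"
      then show "cmod (\<phi> n i) \<le> 1" unfolding \<phi>_def by (intro char_centered_square(2) apos) auto
      show "cmod (e n i) \<le> 1" unfolding e_def norm_of_real by simp
    qed
    also have "\<dots> \<le> (\<Sum>i<Nn n. 4 / 3 * \<bar>s n\<bar> ^ 3 / c ^ 3 + ((s n)\<^sup>2 / (4 * c\<^sup>2))\<^sup>2)"
    proof (rule sum_mono)
      fix i assume "i \<in> {..<Nn n}"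
      then have i: "a n i > 0" "c \<le> a n i" using a apos by auto
      let ?x = "(s n)\<^sup>2 / (4 * (a n i)\<^sup>2)"
      have x: "0 \<le> ?x" "?x \<le> (s n)\<^sup>2 / (4 * c\<^sup>2)" using i c by (auto intro!: divide_left_mono mult_left_mono power_mono mult_pos_pos)
      have "cmod (\<phi> n i - (1 - (s n)\<^sup>2 / (4 * (a n i)\<^sup>2))) \<le> 4 / 3 * \<bar>s n\<bar> ^ 3 / (a n i) ^ 3"
        unfolding \<phi>_def using char_centered_square(1)[OF i(1), of "s n"] by simp
      also have "\<dots> \<le> 4 / 3 * \<bar>s n\<bar> ^ 3 / c ^ 3" using i c by (intro divide_left_mono power_mono mult_pos_pos) auto
      finally have 1: "cmod (\<phi> n i - complex_of_real (1 - ?x)) \<le> 4 / 3 * \<bar>s n\<bar> ^ 3 / c ^ 3" by simp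
      have "cmod (complex_of_real (1 - ?x) - e n i) = \<bar>exp (- ?x) - (1 - ?x)\<bar>"
        unfolding e_def of_real_diff[symmetric] norm_of_real by (simp add: abs_minus_commute)
      also have "\<dots> \<le> ?x\<^sup>2" by (rule exp_minus_approx[OF x(1)])
      also have "\<dots> \<le> ((s n)\<^sup>2 / (4 * c\<^sup>2))\<^sup>2" using x by (intro power_mono) auto
      finally have 2: "cmod (complex_of_real (1 - ?x) - e n i) \<le> ((s n)\<^sup>2 / (4 * c\<^sup>2))\<^sup>2" .
      show "cmod (\<phi> n i - e n i) \<le> 4 / 3 * \<bar>s n\<bar> ^ 3 / c ^ 3 + ((s n)\<^sup>2 / (4 * c\<^sup>2))\<^sup>2"
        by (rule norm_diff_triangle_le[OF 1 2])
    qed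
    also have "\<dots> = real (Nn n) * (4 / 3 * \<bar>s n\<bar> ^ 3 / c ^ 3 + ((s n)\<^sup>2 / (4 * c\<^sup>2))\<^sup>2)" by simp
    also have "\<dots> = 4 / 3 * \<bar>t\<bar> ^ 3 / c ^ 3 / sqrt (real (Nn n)) + (t\<^sup>2 / (4 * c\<^sup>2))\<^sup>2 / real (Nn n)"
    proof -
      have r1: "x * (4 / 3 * (T / (x * r)) / D) = 4 / 3 * T / D / r" if "x > 0" for x T r D :: real
        using that by simp
      have r2: "x * (A / x / B)\<^sup>2 = (A / B)\<^sup>2 / x" if "x > 0" for x A B :: real
        using that by (cases "B = 0") (simp_all add: power2_eq_square)
      show ?thesis unfolding sabs ssq distrib_left r1[OF Npos[of n]] r2[OF Npos[of n]] ..
    qed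
    finally show ?thesis .
  qed
  have Nlim: "filterlim (\<lambda>n. real (Nn n)) at_top sequentially"
    by (rule filterlim_compose[OF filterlim_real_sequentially Nn(2)])
  have Slim: "filterlim (\<lambda>n. sqrt (real (Nn n))) at_top sequentially"
    by (rule filterlim_compose[OF sqrt_at_top Nlim])
  have "(\<lambda>n. 4 / 3 * \<bar>t\<bar> ^ 3 / c ^ 3 / sqrt (real (Nn n)) + (t\<^sup>2 / (4 * c\<^sup>2))\<^sup>2 / real (Nn n)) \<longlonglongrightarrow> 0 + 0"
    by (rule tendsto_add[OF tendsto_divide_0[OF tendsto_const filterlim_at_top_imp_at_infinity[OF Slim]]
          tendsto_divide_0[OF tendsto_const filterlim_at_top_imp_at_infinity[OF Nlim]]])
  then have "(\<lambda>n. 4 / 3 * \<bar>t\<bar> ^ 3 / c ^ 3 / sqrt (real (Nn n)) + (t\<^sup>2 / (4 * c\<^sup>2))\<^sup>2 / real (Nn n)) \<longlonglongrightarrow> 0"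
    by simp
  from Lim_null_comparison[OF always_eventually[OF allI[OF diff]] this]
  have d0: "(\<lambda>n. (\<Prod>i<Nn n. \<phi> n i) - (\<Prod>i<Nn n. e n i)) \<longlonglongrightarrow> 0" .
  have e: "(\<Prod>i<Nn n. e n i) = complex_of_real (exp (- (t\<^sup>2 / 2 * ((\<Sum>i<Nn n. 1 / (2 * (a n i)\<^sup>2)) / real (Nn n)))))" for n
  proof -
    have "(s n)\<^sup>2 = t\<^sup>2 / real (Nn n)" unfolding s_def using Npos[of n] by (simp add: power_divide)
    then have "(\<Sum>i<Nn n. - ((s n)\<^sup>2 / (4 * (a n i)\<^sup>2))) = - (t\<^sup>2 / 2 * ((\<Sum>i<Nn n. 1 / (2 * (a n i)\<^sup>2)) / real (Nn n)))"
      by (simp add: sum_negf sum_distrib_left sum_divide_distrib mult_ac)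
    then show ?thesis unfolding e_def of_real_prod[symmetric] by (simp add: exp_sum[symmetric])
  qed
  have "(\<lambda>n. exp (- (t\<^sup>2 / 2 * ((\<Sum>i<Nn n. 1 / (2 * (a n i)\<^sup>2)) / real (Nn n))))) \<longlonglongrightarrow> exp (- (t\<^sup>2 / 2 * w))"
    by (intro tendsto_exp tendsto_minus tendsto_mult tendsto_const var)
  then have "(\<lambda>n. \<Prod>i<Nn n. e n i) \<longlonglongrightarrow> complex_of_real (exp (- (t\<^sup>2 / 2 * w)))"
    unfolding e by (rule tendsto_of_real)
  from tendsto_add[OF d0 this]
  have p: "(\<lambda>n. \<Prod>i<Nn n. \<phi> n i) \<longlonglongrightarrow> complex_of_real (exp (- (t\<^sup>2 / 2 * w)))" by simp
  note d = mean[folded \<delta>_def]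
  have "(\<lambda>n. iexp (t * \<delta> n)) \<longlonglongrightarrow> iexp (t * 0)"
    by (rule tendsto_exp[OF tendsto_mult[OF tendsto_const tendsto_of_real[OF tendsto_mult[OF tendsto_const d]]]])
  from tendsto_mult[OF this p]
  show "(\<lambda>n. char (distr (gprod {..<Nn n} (a n)) borel (?Y n)) t) \<longlonglongrightarrow> char (centered_normal w) t"
    unfolding ch char_centered_normal[OF w] by (simp add: exp_of_real)
qed

lemma lipschitz_on_interval_if_deriv_bounded:
  fixes h h' :: "real \<Rightarrow> real"
  assumes d: "\<And>x. x \<in> {a..b} \<Longrightarrow> (h has_real_derivative h' x) (at x)"
    and b: "\<And>x. x \<in> {a..b} \<Longrightarrow> \<bar>h' x\<bar> \<le> L" and L: "L \<ge> 0"
  shows "L-lipschitz_on {a..b} h"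
proof (rule lipschitz_onI[OF _ L])
  fix x y assume xy: "x \<in> {a..b}" "y \<in> {a..b}"
  have "norm (h x - h y) \<le> L * norm (x - y)"
    by (rule field_differentiable_bound[of "{a..b}" h h' L])
       (use d b xy in \<open>auto intro: has_field_derivative_at_within\<close>)
  then show "dist (h x) (h y) \<le> L * dist x y" by (simp add: dist_norm)
qed

lemma has_real_derivative_Re:
  assumes "(g has_field_derivative D) (at (complex_of_real x))"
  shows "((\<lambda>x. Re (g (complex_of_real x))) has_real_derivative Re D) (at x)"
proof -
  have "((\<lambda>x. g (complex_of_real x)) has_vector_derivative D) (at x)"
    using has_vector_derivative_real_field[OF assms] by simp
  from bounded_linear.has_vector_derivative[OF bounded_linear_Re this]
  show ?thesis by (simp add: has_real_derivative_iff_has_vector_derivative)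
qed

text \<open>Derivatives of the extension pass to the real axis by taking real parts. The radius is
  at most \<tau> because the extension is tied to \<open>f\<close> at nonnegative reals
  only.\<close>

lemma holomorphic_extension_twice_differentiable:
  assumes h: "holomorphic_extension_near f {0..} {\<tau>}" and \<tau>: "\<tau> > 0"
  obtains r where "r > 0" "r \<le> \<tau>"
    "\<And>x. \<bar>x - \<tau>\<bar> < r \<Longrightarrow> (f has_real_derivative deriv f x) (at x)"
    "(deriv f has_real_derivative deriv (deriv f) \<tau>) (at \<tau>)"
proof -
  obtain W g where W: "open W" "complex_of_real \<tau> \<in> W" "g holomorphic_on W"
    and fg: "\<And>x. x \<ge> 0 \<Longrightarrow> complex_of_real x \<in> W \<Longrightarrow> g (complex_of_real x) = complex_of_real (f x)"
    using h unfolding holomorphic_extension_near_def by auto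
  obtain r0 where r0: "r0 > 0" "ball (complex_of_real \<tau>) r0 \<subseteq> W"
    using W open_contains_ball by blast
  define r where "r = min r0 \<tau>"
  have r: "r > 0" "r \<le> \<tau>" unfolding r_def using r0 \<tau> by auto
  have inW: "complex_of_real x \<in> W" if "\<bar>x - \<tau>\<bar> < r" for x
  proof -
    have "dist (complex_of_real \<tau>) (complex_of_real x) < r0"
      using that unfolding r_def dist_of_real by (simp add: dist_real_def abs_minus_commute)
    then show ?thesis using r0 by auto
  qed
  have eq: "f x = Re (g (complex_of_real x))" if "\<bar>x - \<tau>\<bar> < r" for x
  proof -
    have "x \<ge> 0" using that r by linarith
    then show ?thesis using fg[OF _ inW[OF that]] by simp
  qed
  have near: "open {x. \<bar>x - \<tau>\<bar> < r}"
    using open_ball[of \<tau> r] by (simp add: ball_def dist_real_def abs_minus_commute)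
  have f1: "(f has_real_derivative Re (deriv g (complex_of_real x))) (at x)" if x: "\<bar>x - \<tau>\<bar> < r" for x
  proof -
    have "((\<lambda>x. Re (g (complex_of_real x))) has_real_derivative Re (deriv g (complex_of_real x))) (at x)"
      by (rule has_real_derivative_Re[OF holomorphic_derivI[OF W(3,1) inW[OF x]]])
    then show ?thesis
      by (rule has_field_derivative_transform_within_open[OF _ near]) (use x eq in auto)
  qed
  have df: "deriv f x = Re (deriv g (complex_of_real x))" if "\<bar>x - \<tau>\<bar> < r" for x
    by (rule DERIV_imp_deriv[OF f1[OF that]])
  have f2: "(deriv f has_real_derivative Re (deriv (deriv g) (complex_of_real \<tau>))) (at \<tau>)"
  proof -
    have "((\<lambda>x. Re (deriv g (complex_of_real x))) has_real_derivative Re (deriv (deriv g) (complex_of_real \<tau>))) (at \<tau>)"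
      by (rule has_real_derivative_Re[OF holomorphic_derivI[OF holomorphic_deriv[OF W(3,1)] W(1,2)]])
    then show ?thesis
      by (rule has_field_derivative_transform_within_open[OF _ near]) (use r df in auto)
  qed
  show ?thesis
    by (rule that[OF r]) (use f1 df f2 DERIV_imp_deriv[OF f2] in auto)
qed

lemma expectation_exp_centered_normal:
  assumes "w \<ge> 0" "k \<ge> 0"
  shows "(LINT y|centered_normal w. exp (- (k * y\<^sup>2))) = 1 / sqrt (1 + 2 * k * w)"
proof -
  define c where "c = 1/2 + k * w"
  have c: "c > 0" unfolding c_def using assms by (simp add: add_pos_nonneg)
  have "(LINT y|centered_normal w. exp (- (k * y\<^sup>2))) = (LINT x|std_normal_distribution. exp (- (k * w * x\<^sup>2)))"
    unfolding centered_normal_def using assms by (subst integral_distr) (auto simp: power_mult_distrib mult_ac)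
  also have "\<dots> = (LINT x|lborel. std_normal_density x * exp (- (k * w * x\<^sup>2)))"
    by (subst integral_density) auto
  also have "\<dots> = enn2real (\<integral>\<^sup>+x. ennreal (std_normal_density x * exp (- (k * w * x\<^sup>2))) \<partial>lborel)"
    by (intro integral_eq_nn_integral) auto
  also have "(\<integral>\<^sup>+x. ennreal (std_normal_density x * exp (- (k * w * x\<^sup>2))) \<partial>lborel)
      = (\<integral>\<^sup>+x. ennreal (1 / sqrt (2 * pi)) * ennreal (exp (- c * (x - 0)\<^sup>2)) \<partial>lborel)"
  proof (intro nn_integral_cong)
    fix x :: real
    have "std_normal_density x * exp (- (k * w * x\<^sup>2)) = 1 / sqrt (2 * pi) * exp (- c * (x - 0)\<^sup>2)"
      unfolding std_normal_density_def c_def by (simp add: exp_add[symmetric] algebra_simps)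
    then show "ennreal (std_normal_density x * exp (- (k * w * x\<^sup>2))) = ennreal (1 / sqrt (2 * pi)) * ennreal (exp (- c * (x - 0)\<^sup>2))"
      by (simp add: ennreal_mult[symmetric])
  qed
  also have "\<dots> = ennreal (1 / sqrt (2 * pi)) * ennreal (sqrt (pi / c))"
    by (subst nn_integral_cmult) (simp_all add: nn_integral_gaussian[OF c, of 0, simplified])
  also have "\<dots> = ennreal (1 / sqrt (1 + 2 * k * w))"
  proof -
    have "1 / sqrt (2 * pi) * sqrt (pi / c) = sqrt (1 / (2 * pi) * (pi / c))" by (simp add: real_sqrt_mult real_sqrt_divide)
    also have "1 / (2 * pi) * (pi / c) = 1 / (1 + 2 * k * w)" unfolding c_def using c by (simp add: distrib_left)
    finally have "1 / sqrt (2 * pi) * sqrt (pi / c) = 1 / sqrt (1 + 2 * k * w)" by (simp add: real_sqrt_divide)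
    then show ?thesis using c by (simp add: ennreal_mult[symmetric])
  qed
  finally show ?thesis using assms by simp
qed

section \<open>Expansions away from the edge\<close>

context spherical_model begin

text \<open>Away from the edge nothing is singular: on the support enlarged by half the distance to
  \<gamma> all three functions are Lipschitz and, after a sign change of the logarithm, increasing.
  One constant serves every rigid spectrum.\<close>

lemma high_temp_sums:
  assumes g: "\<gamma> > Cp" and d: "d = (\<gamma> - Cp) / 2"
  obtains K where "K \<ge> 0" "\<And>N l. N \<ge> 1 \<Longrightarrow> real N powr (- 37/60) \<le> d \<Longrightarrow> rigid N l \<Longrightarrow>
    \<bar>(\<Sum>k=1..N. 1 / (\<gamma> - l k)) - real N * stieltjes \<gamma>\<bar> \<le> K * real N powr (23/60) \<and>
    \<bar>(\<Sum>k=1..N. 1 / (\<gamma> - l k)\<^sup>2) - real N * (LINT x|\<nu>. 1 / (\<gamma> - x)\<^sup>2)\<bar> \<le> K * real N powr (23/60) \<and>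
    \<bar>(\<Sum>k=1..N. ln (\<gamma> - l k)) - real N * (LINT x|\<nu>. ln (\<gamma> - x))\<bar> \<le> K * real N powr (23/60)"
proof -
  have d0: "d > 0" using g d by simp
  have far: "\<gamma> - x \<ge> d" if "x \<le> Cp + d" for x using that d by (simp add: field_simps)
  define B3 where "B3 = \<bar>ln d\<bar> + (\<gamma> - Cm)"
  have gen: "\<bar>(\<Sum>k=1..N. h (l k)) - real N * (LINT x|\<nu>. h x)\<bar> \<le> (3 * B + L) * real N powr (23/60)"
    if "\<And>x y. Cm \<le> x \<Longrightarrow> x \<le> y \<Longrightarrow> y < Cp \<Longrightarrow> h x \<le> h y" "h \<in> borel_measurable borel"
      "\<And>x. Cm \<le> x \<Longrightarrow> x < Cp \<Longrightarrow> \<bar>h x\<bar> \<le> B" "L-lipschitz_on {Cm - d..Cp + d} h" "B \<ge> 0"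
      "N \<ge> 1" "real N powr (- 37/60) \<le> d" "rigid N l" for h :: "real \<Rightarrow> real" and B L N l
  proof -
    have "\<bar>(\<Sum>k=1..N. h (l k)) - real N * (LINT x|\<nu>. h x)\<bar> \<le> 3 * B + L * real N powr (23/60)"
      by (rule rigid_sum_lipschitz[OF that(1-4,7,6,8)])
    moreover have "3 * B * 1 \<le> 3 * B * real N powr (23/60)"
      using that(5,6) by (intro mult_left_mono ge_one_powr_ge_zero) auto
    ultimately show ?thesis by (simp add: distrib_right)
  qed
  let ?K = "(3 * (1/d) + 1/d\<^sup>2) + (3 * (1/d\<^sup>2) + 2/d^3) + (3 * B3 + 1/d)"
  have B3: "B3 \<ge> 0" unfolding B3_def using Cm_less_Cp g by simp
  have pos: "3 * (1/d) + 1/d\<^sup>2 \<ge> 0" "3 * (1/d\<^sup>2) + 2/d^3 \<ge> 0" "3 * B3 + 1/d \<ge> 0"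
    using d0 B3 by auto
  have lip1: "(1/d\<^sup>2)-lipschitz_on {Cm - d..Cp + d} (\<lambda>x. 1 / (\<gamma> - x))"
  proof (rule lipschitz_on_interval_if_deriv_bounded[where h' = "\<lambda>x. 1 / (\<gamma> - x)\<^sup>2"])
    fix x assume "x \<in> {Cm - d..Cp + d}"
    then have x: "\<gamma> - x \<ge> d" using far by auto
    show "((\<lambda>x. 1 / (\<gamma> - x)) has_real_derivative 1 / (\<gamma> - x)\<^sup>2) (at x)"
      using x d0 by (auto intro!: derivative_eq_intros simp: power2_eq_square)
    show "\<bar>1 / (\<gamma> - x)\<^sup>2\<bar> \<le> 1/d\<^sup>2"
      using x d0 by (auto intro!: divide_left_mono power_mono mult_pos_pos)
  qed (use d0 in auto)
  have lip2: "(2/d^3)-lipschitz_on {Cm - d..Cp + d} (\<lambda>x. 1 / (\<gamma> - x)\<^sup>2)"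
  proof (rule lipschitz_on_interval_if_deriv_bounded[where h' = "\<lambda>x. 2 / (\<gamma> - x)^3"])
    fix x assume "x \<in> {Cm - d..Cp + d}"
    then have x: "\<gamma> - x \<ge> d" using far by auto
    have ne: "(\<gamma> - x) \<noteq> 0" using x d0 by auto
    have "((\<lambda>x. 1 / (\<gamma> - x)\<^sup>2) has_real_derivative (0 * (\<gamma> - x)\<^sup>2 - 1 * (2 * (\<gamma> - x) * (0 - 1))) / ((\<gamma> - x)\<^sup>2 * (\<gamma> - x)\<^sup>2)) (at x)"
      using ne by (auto intro!: derivative_eq_intros)
    also have "(0 * (\<gamma> - x)\<^sup>2 - 1 * (2 * (\<gamma> - x) * (0 - 1))) / ((\<gamma> - x)\<^sup>2 * (\<gamma> - x)\<^sup>2) = 2 / (\<gamma> - x)^3"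
    proof -
      have "(0 * y\<^sup>2 - 1 * (2 * y * (0 - 1))) / (y\<^sup>2 * y\<^sup>2) = 2 / y ^ 3" if "y \<noteq> 0" for y :: real
        using that by (simp add: power2_eq_square power3_eq_cube)
      from this[OF ne] show ?thesis .
    qed
    finally show "((\<lambda>x. 1 / (\<gamma> - x)\<^sup>2) has_real_derivative 2 / (\<gamma> - x)^3) (at x)" .
    have "d ^ 3 \<le> (\<gamma> - x) ^ 3" using x d0 by (intro power_mono) auto
    then show "\<bar>2 / (\<gamma> - x)^3\<bar> \<le> 2/d^3"
      using x d0 by (auto simp: abs_of_pos intro!: divide_left_mono mult_pos_pos)
  qed (use d0 in auto)
  have lip3: "(1/d)-lipschitz_on {Cm - d..Cp + d} (\<lambda>x. - ln (\<gamma> - x))"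
  proof (rule lipschitz_on_interval_if_deriv_bounded[where h' = "\<lambda>x. 1 / (\<gamma> - x)"])
    fix x assume "x \<in> {Cm - d..Cp + d}"
    then have x: "\<gamma> - x \<ge> d" using far by auto
    show "((\<lambda>x. - ln (\<gamma> - x)) has_real_derivative 1 / (\<gamma> - x)) (at x)"
      using x d0 by (auto intro!: derivative_eq_intros)
    show "\<bar>1 / (\<gamma> - x)\<bar> \<le> 1/d"
      using x d0 by (auto simp: abs_of_pos intro!: divide_left_mono mult_pos_pos)
  qed (use d0 in auto)
  show ?thesis
  proof (rule that[of ?K])
    fix N l assume N: "N \<ge> 1" "real N powr (- 37/60) \<le> d" "rigid N l"
    have P: "0 \<le> real N powr (23/60)" by simp
    have in_d: "\<gamma> - x \<ge> d" "\<gamma> - x > 0" "\<gamma> - x \<le> \<gamma> - Cm" if "Cm \<le> x" "x < Cp" for x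
      using that far[of x] d0 by auto
    have 1: "\<bar>(\<Sum>k=1..N. 1 / (\<gamma> - l k)) - real N * (LINT x|\<nu>. 1 / (\<gamma> - x))\<bar> \<le> (3 * (1/d) + 1/d\<^sup>2) * real N powr (23/60)"
    proof (rule gen[OF _ _ _ lip1 _ N])
      fix x y assume "Cm \<le> x" "x \<le> y" "y < Cp"
      then show "1 / (\<gamma> - x) \<le> 1 / (\<gamma> - y)" using g by (intro divide_left_mono mult_pos_pos) auto
    next
      fix x assume "Cm \<le> x" "x < Cp"
      then show "\<bar>1 / (\<gamma> - x)\<bar> \<le> 1/d" using in_d[of x] d0 by (auto intro!: divide_left_mono)
    qed (use d0 in auto)
    have 2: "\<bar>(\<Sum>k=1..N. 1 / (\<gamma> - l k)\<^sup>2) - real N * (LINT x|\<nu>. 1 / (\<gamma> - x)\<^sup>2)\<bar> \<le> (3 * (1/d\<^sup>2) + 2/d^3) * real N powr (23/60)"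
    proof (rule gen[OF _ _ _ lip2 _ N])
      fix x y assume "Cm \<le> x" "x \<le> y" "y < Cp"
      then show "1 / (\<gamma> - x)\<^sup>2 \<le> 1 / (\<gamma> - y)\<^sup>2" using g by (intro divide_left_mono mult_pos_pos power_mono) auto
    next
      fix x assume "Cm \<le> x" "x < Cp"
      then show "\<bar>1 / (\<gamma> - x)\<^sup>2\<bar> \<le> 1/d\<^sup>2" using in_d[of x] d0 by (auto intro!: divide_left_mono power_mono mult_pos_pos)
    qed (use d0 in auto)
    have 3: "\<bar>(\<Sum>k=1..N. - ln (\<gamma> - l k)) - real N * (LINT x|\<nu>. - ln (\<gamma> - x))\<bar> \<le> (3 * B3 + 1/d) * real N powr (23/60)"
    proof (rule gen[OF _ _ _ lip3 B3 N])
      fix x y assume "Cm \<le> x" "x \<le> y" "y < Cp"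
      then show "- ln (\<gamma> - x) \<le> - ln (\<gamma> - y)" using g by simp
    next
      fix x assume "Cm \<le> x" "x < Cp"
      note i = in_d[OF this]
      have "ln d \<le> ln (\<gamma> - x)" using i d0 by simp
      moreover have "ln (\<gamma> - x) < \<gamma> - x" using i by (intro ln_less_self)
      ultimately show "\<bar>- ln (\<gamma> - x)\<bar> \<le> B3" unfolding B3_def using i(3) Cm_less_Cp g by (simp add: abs_le_iff) linarith
    qed auto
    have lnb: "\<bar>(\<Sum>k=1..N. ln (\<gamma> - l k)) - real N * (LINT x|\<nu>. ln (\<gamma> - x))\<bar> \<le> (3 * B3 + 1/d) * real N powr (23/60)"
      using 3 unfolding sum_negf integral_minus by (simp add: abs_minus_commute)
    have "(3 * (1/d) + 1/d\<^sup>2) * real N powr (23/60) \<le> ?K * real N powr (23/60)"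
      "(3 * (1/d\<^sup>2) + 2/d^3) * real N powr (23/60) \<le> ?K * real N powr (23/60)"
      "(3 * B3 + 1/d) * real N powr (23/60) \<le> ?K * real N powr (23/60)"
      by (rule mult_right_mono[OF _ P], use pos in linarith)+
    then show "\<bar>(\<Sum>k=1..N. 1 / (\<gamma> - l k)) - real N * stieltjes \<gamma>\<bar> \<le> ?K * real N powr (23/60) \<and>
      \<bar>(\<Sum>k=1..N. 1 / (\<gamma> - l k)\<^sup>2) - real N * (LINT x|\<nu>. 1 / (\<gamma> - x)\<^sup>2)\<bar> \<le> ?K * real N powr (23/60) \<and>
      \<bar>(\<Sum>k=1..N. ln (\<gamma> - l k)) - real N * (LINT x|\<nu>. ln (\<gamma> - x))\<bar> \<le> ?K * real N powr (23/60)"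
      using 1 2 lnb unfolding stieltjes_def by (intro conjI) linarith+
  next
    show "0 \<le> ?K" using pos by linarith
  qed
qed

text \<open>The first derivative of the deficit vanishes at the maximiser, where
  \<open>deriv f\<close> equals \<open>z\<close>. One application of l'Hopital's rule then leaves
  the difference quotient of \<open>deriv f\<close> at that point.\<close>

lemma gap_fun_second_order:
  assumes \<tau>: "tau f z > 0" and h: "holomorphic_extension_near f {0..} {tau f z}"
  shows "((\<lambda>h. gap_fun z (tau f z + h) / h\<^sup>2) \<longlongrightarrow> deriv (deriv f) (tau f z) / 2) (at 0)"
proof -
  obtain r where r: "r > 0" "r \<le> tau f z"
    and f1: "\<And>x. \<bar>x - tau f z\<bar> < r \<Longrightarrow> (f has_real_derivative deriv f x) (at x)"
    and f2: "(deriv f has_real_derivative deriv (deriv f) (tau f z)) (at (tau f z))"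
    by (rule holomorphic_extension_twice_differentiable[OF h \<tau>]) blast
  have fz: "deriv f (tau f z) = z" by (rule DERIV_imp_deriv[OF derivative_at_tau[OF \<tau>]])
  have d: "((\<lambda>h. gap_fun z (tau f z + h)) has_real_derivative deriv f (tau f z + h) - z) (at h)" if "\<bar>h\<bar> < r" for h
  proof -
    have "((\<lambda>h. f (tau f z + h)) has_real_derivative deriv f (tau f z + h) * (0 + 1)) (at h)"
      by (rule DERIV_chain2[OF f1]) (use that in \<open>auto intro!: derivative_eq_intros\<close>)
    then show ?thesis unfolding gap_fun_def by (auto intro!: derivative_eq_intros)
  qed
  have near: "eventually (\<lambda>h. \<bar>h\<bar> < r) (at 0)"
    using r unfolding eventually_at by (intro exI[of _ r]) auto
  have "((\<lambda>h. (deriv f (tau f z + h) - deriv f (tau f z)) / h) \<longlongrightarrow> deriv (deriv f) (tau f z)) (at 0)"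
    using f2 by (simp add: DERIV_def)
  then have "((\<lambda>h. (deriv f (tau f z + h) - z) / h / 2) \<longlongrightarrow> deriv (deriv f) (tau f z) / 2) (at 0)"
    unfolding fz by (rule tendsto_divide[OF _ tendsto_const]) simp
  then have lim: "((\<lambda>h. (deriv f (tau f z + h) - z) / (2 * h)) \<longlongrightarrow> deriv (deriv f) (tau f z) / 2) (at 0)"
    by (simp add: mult.commute)
  show ?thesis
  proof (rule lhopital[where f' = "\<lambda>h. deriv f (tau f z + h) - z" and g' = "\<lambda>h. 2 * h"])
    have "isCont (\<lambda>h. gap_fun z (tau f z + h)) 0" using d[of 0] r by (intro DERIV_isCont) auto
    then show "((\<lambda>h. gap_fun z (tau f z + h)) \<longlongrightarrow> 0) (at 0)" unfolding isCont_def by (simp add: gap_fun_tau)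
    show "((\<lambda>h::real. h\<^sup>2) \<longlongrightarrow> 0) (at 0)" 
    proof -
      have "((\<lambda>h::real. h\<^sup>2) \<longlongrightarrow> 0\<^sup>2) (at 0)" by (intro tendsto_power tendsto_ident_at)
      then show ?thesis by simp
    qed
    show "eventually (\<lambda>h::real. h\<^sup>2 \<noteq> 0) (at 0)" "eventually (\<lambda>h::real. 2 * h \<noteq> 0) (at 0)"
      by (auto simp: eventually_at_filter)
    show "eventually (\<lambda>h. ((\<lambda>h. gap_fun z (tau f z + h)) has_real_derivative deriv f (tau f z + h) - z) (at h)) (at 0)"
      using near by (rule eventually_mono) (rule d)
    show "eventually (\<lambda>h::real. ((\<lambda>h. h\<^sup>2) has_real_derivative 2 * h) (at h)) (at 0)"
      by (intro always_eventually allI) (auto intro!: derivative_eq_intros)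
  qed (rule lim)
qed

end

section \<open>The high temperature regime\<close>

context spherical_model begin

definition bulk_energy :: real where
  "bulk_energy = \<beta> * V f \<gamma>h + 1/2 * ln (pi / \<beta>) - 1/2 * (LINT x|\<nu>. ln (\<gamma>h - x))"

text \<open>Minus the integral of the second derivative of ln (\<gamma>h - x), whence the opposite
  sign inside the logarithm of the theorem.\<close>

definition curvature :: real where "curvature = (LINT x|\<nu>. 1 / (\<gamma>h - x)\<^sup>2)"

lemma curvature_nonneg: "curvature \<ge> 0"
  unfolding curvature_def by (intro integral_nonneg_AE) simp

text \<open>The saddle point equation says that the mean of the radius R is \<tau> =
  \<open>tau f \<gamma>h\<close> up to o(N^(-1/2)). So Y = sqrt N (R - \<tau>) is asymptotically
  centred normal with variance curvature / (2 \<beta>^2), and N times the deficit behaves like half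
  of f''(\<tau>) times Y^2. The integrand depends on n, so weak convergence is not applied to it
  directly; a Skorohod coupling reduces the limit to dominated convergence.\<close>

lemma tilt_limit:
  fixes Nn :: "nat \<Rightarrow> nat" and l :: "nat \<Rightarrow> nat \<Rightarrow> real"
  assumes sub: "\<beta> * \<tau>c < beta_c \<nu> Cm Cp"
    and hol: "holomorphic_extension_near f {0..} {tau f \<gamma>h}"
    and Nn: "\<And>n. Nn n \<ge> 1" "filterlim Nn at_top sequentially"
    and small: "\<And>n. real (Nn n) powr (- 37/60) \<le> (\<gamma>h - Cp) / 2"
    and r: "\<And>n. rigid (Nn n) (l n)"
  shows "(\<lambda>n. tiltE (Nn n) \<gamma>h (l n))
    \<longlonglongrightarrow> 1 / sqrt (1 + deriv (deriv f) (tau f \<gamma>h) / (2 * \<beta>) * curvature)"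
    and "deriv (deriv f) (tau f \<gamma>h) \<ge> 0"
proof -
  obtain \<gamma> where \<gamma>: "\<gamma> = \<gamma>h" by blast
  define \<tau> where "\<tau> = tau f \<gamma>"
  define q where "q = deriv (deriv f) \<tau>"
  have g: "\<gamma> > Cp" using gamma_hat_gt[OF sub] unfolding \<gamma> .
  have eq: "\<beta> * \<tau> = stieltjes \<gamma> / 2"
    using gamma_hat_props(2)[OF less_imp_le[OF sub]] unfolding \<gamma> \<tau>_def .
  have "\<beta> * \<tau> > 0" unfolding eq using stieltjes_pos[of \<gamma>] g by simp
  then have tpos: "\<tau> > 0" using \<beta>_pos by (simp add: zero_less_mult_iff)
  note second = gap_fun_second_order[of \<gamma>, folded \<tau>_def, folded q_def, OF tpos hol[folded \<gamma>, folded \<tau>_def]]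
  have q0: "q \<ge> 0"
  proof -
    have "eventually (\<lambda>h::real. \<bar>h\<bar> < \<tau>) (at 0)"
      using tpos unfolding eventually_at by (intro exI[of _ \<tau>]) auto
    then have "eventually (\<lambda>h. gap_fun \<gamma> (\<tau> + h) / h\<^sup>2 \<ge> 0) (at 0)"
      by (rule eventually_mono) (auto intro!: divide_nonneg_nonneg gap_fun_nonneg)
    then have "q / 2 \<ge> 0" by (rule tendsto_lowerbound[OF second]) simp
    then show ?thesis by simp
  qed
  define d where "d = (\<gamma> - Cp) / 2"
  have d: "d > 0" using g unfolding d_def by simp
  obtain K where K: "K \<ge> 0" "\<And>N l. N \<ge> 1 \<Longrightarrow> real N powr (- 37/60) \<le> d \<Longrightarrow> rigid N l \<Longrightarrow>
    \<bar>(\<Sum>k=1..N. 1 / (\<gamma> - l k)) - real N * stieltjes \<gamma>\<bar> \<le> K * real N powr (23/60) \<and>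
    \<bar>(\<Sum>k=1..N. 1 / (\<gamma> - l k)\<^sup>2) - real N * (LINT x|\<nu>. 1 / (\<gamma> - x)\<^sup>2)\<bar> \<le> K * real N powr (23/60) \<and>
    \<bar>(\<Sum>k=1..N. ln (\<gamma> - l k)) - real N * (LINT x|\<nu>. ln (\<gamma> - x))\<bar> \<le> K * real N powr (23/60)"
    using high_temp_sums[OF g d_def] by metis
  define J where "J = (LINT x|\<nu>. 1 / (\<gamma> - x)\<^sup>2)"
  have J0: "J \<ge> 0" using curvature_nonneg unfolding J_def curvature_def \<gamma> .
  define a where "a n i = \<beta> * (\<gamma> - l n (Suc i))" for n i
  define N where "N n = real (Nn n)" for n
  have N0: "N n > 0" for n using Nn(1)[of n] unfolding N_def by simp
  have Nlim: "filterlim N at_top sequentially"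
    unfolding N_def by (rule filterlim_compose[OF filterlim_real_sequentially Nn(2)])
  have sm: "real (Nn n) powr (- 37/60) \<le> d" for n using small unfolding d_def \<gamma> .
  have la: "l n k < Cp + d" if "k \<in> {1..Nn n}" for n k
    using rigid_range(2)[OF r, of k n] sm[of n] that by auto
  have a: "\<beta> * d \<le> a n i" if "i < Nn n" for n i
  proof -
    have "d \<le> \<gamma> - l n (Suc i)" using la[of "Suc i" n] that unfolding d_def by (auto simp: field_simps)
    then show ?thesis unfolding a_def using \<beta>_pos by (intro mult_left_mono) auto
  qed
  have s1: "\<bar>(\<Sum>k=1..Nn n. 1 / (\<gamma> - l n k)) - N n * stieltjes \<gamma>\<bar> \<le> K * N n powr (23/60)"
    and s2: "\<bar>(\<Sum>k=1..Nn n. 1 / (\<gamma> - l n k)\<^sup>2) - N n * J\<bar> \<le> K * N n powr (23/60)" for n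
    using K(2)[OF Nn(1) sm r, of n] unfolding N_def J_def by blast+
  have powlim: "(\<lambda>n. K * N n powr (- p)) \<longlonglongrightarrow> 0" if "p > 0" for p
    using tendsto_mult[OF tendsto_const tendsto_neg_powr[OF _ Nlim, of "- p"], of K] that by simp
  \<comment> \<open>The error N^(23/60) of the inverse sum, divided by N and multiplied by sqrt N,
    is N^(-7/60).\<close>
  have mean: "(\<lambda>n. sqrt (real (Nn n)) * ((\<Sum>i<Nn n. 1 / (2 * a n i)) / real (Nn n) - \<tau>)) \<longlonglongrightarrow> 0"
  proof (rule Lim_null_comparison[OF always_eventually[OF allI]])
    fix n
    have "(\<Sum>i<Nn n. 1 / (2 * a n i)) = (\<Sum>k=1..Nn n. 1 / (\<gamma> - l n k)) / (2 * \<beta>)"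
      unfolding sum_shift_Suc[of "\<lambda>k. 1 / (\<gamma> - l n k)", symmetric] a_def sum_divide_distrib
      by (intro sum.cong refl) (simp add: mult_ac)
    moreover have "\<tau> = stieltjes \<gamma> / (2 * \<beta>)" using eq \<beta>_pos by (simp add: field_simps)
    ultimately have "(\<Sum>i<Nn n. 1 / (2 * a n i)) / N n - \<tau>
        = ((\<Sum>k=1..Nn n. 1 / (\<gamma> - l n k)) - N n * stieltjes \<gamma>) / (2 * \<beta> * N n)"
      using N0[of n] by (simp add: diff_divide_distrib)
    then have "\<bar>(\<Sum>i<Nn n. 1 / (2 * a n i)) / N n - \<tau>\<bar> \<le> K * N n powr (23/60) / (2 * \<beta> * N n)"
      using s1[of n] N0[of n] \<beta>_pos by (simp add: abs_divide abs_mult divide_right_mono)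
    then have "sqrt (N n) * \<bar>(\<Sum>i<Nn n. 1 / (2 * a n i)) / N n - \<tau>\<bar> \<le> sqrt (N n) * (K * N n powr (23/60) / (2 * \<beta> * N n))"
      using N0[of n] by (intro mult_left_mono) auto
    also have "\<dots> = K * (N n powr (1/2) * N n powr (23/60) * N n powr (- 1)) / (2 * \<beta>)"
      using N0[of n] by (simp add: powr_half_sqrt powr_minus_divide mult_ac)
    also have "\<dots> = K * N n powr (- (7/60)) / (2 * \<beta>)" by (simp only: powr_add[symmetric]) simp
    finally show "norm (sqrt (real (Nn n)) * ((\<Sum>i<Nn n. 1 / (2 * a n i)) / real (Nn n) - \<tau>)) \<le> K * N n powr (- (7/60)) / (2 * \<beta>)"
      using N0[of n] unfolding N_def by (simp add: abs_mult)
  next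
    show "(\<lambda>n. K * N n powr (- (7/60)) / (2 * \<beta>)) \<longlonglongrightarrow> 0"
      using tendsto_divide[OF powlim[of "7/60"] tendsto_const, of "2 * \<beta>"] \<beta>_pos by simp
  qed
  define w where "w = J / (2 * \<beta>\<^sup>2)"
  have w0: "w \<ge> 0" unfolding w_def using J0 by simp
  have var: "(\<lambda>n. (\<Sum>i<Nn n. 1 / (2 * (a n i)\<^sup>2)) / real (Nn n)) \<longlonglongrightarrow> w"
  proof (rule LIM_zero_cancel, rule Lim_null_comparison[OF always_eventually[OF allI]])
    fix n
    have "(\<Sum>i<Nn n. 1 / (2 * (a n i)\<^sup>2)) = (\<Sum>k=1..Nn n. 1 / (\<gamma> - l n k)\<^sup>2) / (2 * \<beta>\<^sup>2)"
      unfolding sum_shift_Suc[of "\<lambda>k. 1 / (\<gamma> - l n k)\<^sup>2", symmetric] a_def sum_divide_distrib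
      by (intro sum.cong refl) (simp add: power_mult_distrib)
    then have "(\<Sum>i<Nn n. 1 / (2 * (a n i)\<^sup>2)) / N n - w
        = ((\<Sum>k=1..Nn n. 1 / (\<gamma> - l n k)\<^sup>2) - N n * J) / (2 * \<beta>\<^sup>2 * N n)"
      unfolding w_def using N0[of n] by (simp add: diff_divide_distrib)
    then have "\<bar>(\<Sum>i<Nn n. 1 / (2 * (a n i)\<^sup>2)) / N n - w\<bar> \<le> K * N n powr (23/60) / (2 * \<beta>\<^sup>2 * N n)"
      using s2[of n] N0[of n] \<beta>_pos by (simp add: abs_divide abs_mult divide_right_mono)
    also have "\<dots> = K * (N n powr (23/60) * N n powr (- 1)) / (2 * \<beta>\<^sup>2)"
      using N0[of n] by (simp add: powr_minus_divide)
    also have "\<dots> = K * N n powr (- (37/60)) / (2 * \<beta>\<^sup>2)" by (simp only: powr_add[symmetric]) simp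
    finally show "norm ((\<Sum>i<Nn n. 1 / (2 * (a n i)\<^sup>2)) / real (Nn n) - w) \<le> K * N n powr (- (37/60)) / (2 * \<beta>\<^sup>2)"
      unfolding N_def by simp
  next
    show "(\<lambda>n. K * N n powr (- (37/60)) / (2 * \<beta>\<^sup>2)) \<longlonglongrightarrow> 0"
      using tendsto_divide[OF powlim[of "37/60"] tendsto_const, of "2 * \<beta>\<^sup>2"] \<beta>_pos by simp
  qed
  have bd: "\<beta> * d > 0" using \<beta>_pos d by simp
  let ?Y = "\<lambda>n v. sqrt (real (Nn n)) * ((\<Sum>i<Nn n. (v i)\<^sup>2) / real (Nn n) - \<tau>)"
  define D where "D n = distr (gprod {..<Nn n} (a n)) borel (?Y n)" for n
  have clt: "weak_conv_m D (centered_normal w)"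
    unfolding D_def by (rule gprod_clt[OF bd a Nn mean var w0])
  have P: "prob_space (gprod {..<Nn n} (a n))" for n
    by (rule prob_space_gprod) (use a[of _ n] bd in \<open>auto intro: less_le_trans\<close>)
  have Ym[measurable]: "?Y n \<in> borel_measurable (gprod {..<Nn n} (a n))" for n by measurable
  have Dd: "real_distribution (D n)" for n
    unfolding D_def by (rule prob_space.real_distribution_distr[OF P]) measurable
  \<comment> \<open>The integrand as a function of the rescaled variable. Truncation at 0 and
    \<open>f_ext\<close> make it measurable and bounded by 1 for every real \<open>y\<close>; at the
    values actually taken, the radius is nonnegative and the truncation has no effect.\<close>
  define \<Psi> where "\<Psi> n y = exp (- (\<beta> * N n * (V f \<gamma> - (max 0 (\<tau> + y / sqrt (N n)) * \<gamma> - f_ext (\<tau> + y / sqrt (N n))))))" for n y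
  have \<Psi>m[measurable]: "\<Psi> n \<in> borel_measurable borel" for n unfolding \<Psi>_def[abs_def] by measurable
  have \<Psi>gap: "\<Psi> n y = exp (- (\<beta> * N n * gap_fun \<gamma> (max 0 (\<tau> + y / sqrt (N n)))))" for n y
    unfolding \<Psi>_def gap_fun_def f_ext_def by simp
  have \<Psi>1: "\<bar>\<Psi> n y\<bar> \<le> 1" for n y
    unfolding \<Psi>gap using \<beta>_pos N0[of n] gap_fun_nonneg[of "max 0 (\<tau> + y / sqrt (N n))" \<gamma>] by simp
  have tilt: "tiltE (Nn n) \<gamma> (l n) = (LINT y|D n. \<Psi> n y)" for n
  proof -
    have "(LINT y|D n. \<Psi> n y) = (LINT v|gprod {..<Nn n} (a n). \<Psi> n (?Y n v))"
      unfolding D_def by (rule integral_distr) measurable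
    also have "\<dots> = tiltE (Nn n) \<gamma> (l n)"
      unfolding tiltE_def a_def[symmetric]
    proof (intro Bochner_Integration.integral_cong refl)
      fix v :: "nat \<Rightarrow> real"
      have "sqrt (N n) \<noteq> 0" using N0[of n] by simp
      then have "\<tau> + ?Y n v / sqrt (N n) = sphere_radius (Nn n) v"
        unfolding sphere_radius_def N_def by simp
      moreover have "max 0 (sphere_radius (Nn n) v) = sphere_radius (Nn n) v"
        using sphere_radius_nonneg[of "Nn n" v] by simp
      ultimately have "\<Psi> n (?Y n v) = exp (- (\<beta> * N n * gap_fun \<gamma> (sphere_radius (Nn n) v)))"
        unfolding \<Psi>gap by simp
      then show "\<Psi> n (?Y n v) = exp (- (\<beta> * real (Nn n) * gap_fun \<gamma> (sphere_radius (Nn n) v)))"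
        unfolding N_def .
    qed
    finally show ?thesis by simp
  qed
  \<comment> \<open>The second order quotient, completed at 0 by its limit, so that it is continuous
    there and \<open>gap_e\<close> holds without exception.\<close>
  define e where "e h = (if h = 0 then q / 2 else gap_fun \<gamma> (\<tau> + h) / h\<^sup>2)" for h
  have e0: "isCont e 0"
  proof -
    have "(e \<longlongrightarrow> q / 2) (at 0)"
      by (rule Lim_transform_eventually[OF second]) (auto simp: e_def eventually_at_filter)
    then show ?thesis unfolding isCont_def by (simp add: e_def)
  qed
  have gap_e: "gap_fun \<gamma> (\<tau> + h) = e h * h\<^sup>2" for h
    unfolding e_def \<tau>_def by (simp add: gap_fun_tau)
  have conv: "(\<lambda>n. \<Psi> n (y n)) \<longlonglongrightarrow> exp (- (\<beta> * q / 2 * y0\<^sup>2))" if y: "y \<longlonglongrightarrow> y0" for y y0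
  proof -
    have sqlim: "filterlim (\<lambda>n. sqrt (N n)) at_top sequentially"
      by (rule filterlim_compose[OF sqrt_at_top Nlim])
    have h0: "(\<lambda>n. y n / sqrt (N n)) \<longlonglongrightarrow> 0"
      by (rule tendsto_divide_0[OF y filterlim_at_top_imp_at_infinity[OF sqlim]])
    then have "(\<lambda>n. e (y n / sqrt (N n))) \<longlonglongrightarrow> e 0" by (rule isCont_tendsto_compose[OF e0])
    then have "(\<lambda>n. exp (- (\<beta> * (e (y n / sqrt (N n)) * (y n)\<^sup>2)))) \<longlonglongrightarrow> exp (- (\<beta> * (e 0 * y0\<^sup>2)))"
      by (rule tendsto_exp[OF tendsto_minus[OF tendsto_mult[OF tendsto_const tendsto_mult[OF _ tendsto_power[OF y]]]]])
    moreover have "- \<tau> < 0" using tpos by simp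
    from order_tendstoD(1)[OF h0 this]
    have "eventually (\<lambda>n. exp (- (\<beta> * (e (y n / sqrt (N n)) * (y n)\<^sup>2))) = \<Psi> n (y n)) sequentially"
    proof eventually_elim
      case (elim n)
      then have mx: "max 0 (\<tau> + y n / sqrt (N n)) = \<tau> + y n / sqrt (N n)" by simp
      have ev: "\<beta> * N n * (e (y n / sqrt (N n)) * (y n / sqrt (N n))\<^sup>2) = \<beta> * (e (y n / sqrt (N n)) * (y n)\<^sup>2)"
        using N0[of n] by (simp add: power_divide)
      show ?case unfolding \<Psi>gap mx gap_e ev ..
    qed
    ultimately have "(\<lambda>n. \<Psi> n (y n)) \<longlonglongrightarrow> exp (- (\<beta> * (e 0 * y0\<^sup>2)))" by (rule Lim_transform_eventually)
    moreover have "\<beta> * (e 0 * y0\<^sup>2) = \<beta> * q / 2 * y0\<^sup>2" by (simp add: e_def)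
    ultimately show ?thesis by simp
  qed
  have "\<exists> (\<Omega> :: real measure) (Ys :: nat \<Rightarrow> real \<Rightarrow> real) (Y :: real \<Rightarrow> real).
    prob_space \<Omega> \<and> (\<forall>n. Ys n \<in> measurable \<Omega> borel) \<and> (\<forall>n. distr \<Omega> borel (Ys n) = D n) \<and>
    Y \<in> measurable \<Omega> lborel \<and> distr \<Omega> borel Y = centered_normal w \<and>
    (\<forall>x \<in> space \<Omega>. (\<lambda>n. Ys n x) \<longlonglongrightarrow> Y x)"
    by (rule Skorohod[OF Dd real_distribution_centered_normal clt])
  then obtain \<Omega> :: "real measure" and Ys :: "nat \<Rightarrow> real \<Rightarrow> real" and Y :: "real \<Rightarrow> real"
    where O: "prob_space \<Omega>" and Ys[measurable]: "\<And>n. Ys n \<in> measurable \<Omega> borel"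
      and Yd: "\<And>n. distr \<Omega> borel (Ys n) = D n" and Y': "Y \<in> measurable \<Omega> lborel"
      and Yw: "distr \<Omega> borel Y = centered_normal w"
      and Yc: "\<And>x. x \<in> space \<Omega> \<Longrightarrow> (\<lambda>n. Ys n x) \<longlonglongrightarrow> Y x"
    by blast
  have Ym'[measurable]: "Y \<in> borel_measurable \<Omega>" using Y' by simp
  interpret \<Omega>: prob_space \<Omega> by (rule O)
  have "(\<lambda>n. LINT x|\<Omega>. \<Psi> n (Ys n x)) \<longlonglongrightarrow> (LINT x|\<Omega>. exp (- (\<beta> * q / 2 * (Y x)\<^sup>2)))"
  proof (rule integral_dominated_convergence[where w = "\<lambda>x. 1"])
    show "AE x in \<Omega>. (\<lambda>n. \<Psi> n (Ys n x)) \<longlonglongrightarrow> exp (- (\<beta> * q / 2 * (Y x)\<^sup>2))"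
      by (rule AE_I2) (rule conv[OF Yc])
    show "AE x in \<Omega>. norm (\<Psi> n (Ys n x)) \<le> 1" for n using \<Psi>1 by simp
  qed auto
  moreover have "(LINT x|\<Omega>. \<Psi> n (Ys n x)) = tiltE (Nn n) \<gamma> (l n)" for n
    unfolding tilt Yd[symmetric] by (rule integral_distr[symmetric]) measurable
  moreover have "(LINT x|\<Omega>. exp (- (\<beta> * q / 2 * (Y x)\<^sup>2))) = (LINT y|centered_normal w. exp (- (\<beta> * q / 2 * y\<^sup>2)))"
    unfolding Yw[symmetric] by (rule integral_distr[symmetric]) measurable
  moreover have "(LINT y|centered_normal w. exp (- (\<beta> * q / 2 * y\<^sup>2))) = 1 / sqrt (1 + 2 * (\<beta> * q / 2) * w)"
    by (rule expectation_exp_centered_normal[OF w0]) (use q0 \<beta>_pos in auto)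
  moreover have "2 * (\<beta> * q / 2) * w = q / (2 * \<beta>) * J"
    unfolding w_def using \<beta>_pos by (simp add: power2_eq_square)
  ultimately have "(\<lambda>n. tiltE (Nn n) \<gamma> (l n)) \<longlonglongrightarrow> 1 / sqrt (1 + q / (2 * \<beta>) * J)" by simp
  then show "(\<lambda>n. tiltE (Nn n) \<gamma>h (l n))
    \<longlonglongrightarrow> 1 / sqrt (1 + deriv (deriv f) (tau f \<gamma>h) / (2 * \<beta>) * curvature)"
    unfolding q_def J_def \<tau>_def curvature_def \<gamma> .
  show "deriv (deriv f) (tau f \<gamma>h) \<ge> 0" using q0 unfolding q_def \<tau>_def \<gamma> .
qed

end

section \<open>Convergence on events of high probability\<close>

lemma cmod_iexp_diff: "cmod (iexp x - iexp y) \<le> \<bar>x - y\<bar>"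
proof -
  have "iexp x - iexp y = iexp y * (iexp (x - y) - 1)"
    by (simp add: right_diff_distrib exp_add[symmetric])
  then have "cmod (iexp x - iexp y) = cmod (iexp (x - y) - 1)" by (simp add: norm_mult)
  also have "\<dots> \<le> \<bar>x - y\<bar>" using iexp_approx1[of "x - y" 0] by simp
  finally show ?thesis .
qed

lemma conv_in_prob_on_events:
  fixes P :: "nat \<Rightarrow> 'a measure" and X :: "nat \<Rightarrow> 'a \<Rightarrow> real"
  assumes P: "\<And>N. prob_space (P N)" and X: "\<And>N. X N \<in> borel_measurable (P N)"
    and G: "\<And>N. G N \<in> sets (P N)" "(\<lambda>N. measure (P N) (space (P N) - G N)) \<longlonglongrightarrow> 0"
    and c: "\<And>\<epsilon>. \<epsilon> > 0 \<Longrightarrow> \<forall>\<^sub>F N in sequentially. \<forall>\<omega>\<in>G N. \<bar>X N \<omega> - c\<bar> \<le> \<epsilon>"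
  shows "conv_in_prob P X c"
  unfolding conv_in_prob_def
proof (intro conjI allI impI X)
  fix \<epsilon> :: real assume e: "\<epsilon> > 0"
  show "(\<lambda>N. measure (P N) {\<omega> \<in> space (P N). \<bar>X N \<omega> - c\<bar> > \<epsilon>}) \<longlonglongrightarrow> 0"
  proof (rule tendsto_sandwich[OF _ _ tendsto_const G(2)])
    show "\<forall>\<^sub>F N in sequentially. 0 \<le> measure (P N) {\<omega> \<in> space (P N). \<bar>X N \<omega> - c\<bar> > \<epsilon>}" by simp
    show "\<forall>\<^sub>F N in sequentially. measure (P N) {\<omega> \<in> space (P N). \<bar>X N \<omega> - c\<bar> > \<epsilon>} \<le> measure (P N) (space (P N) - G N)"
      using c[OF e]
    proof eventually_elim
      case (elim N)
      interpret prob_space "P N" by (rule P)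
      show ?case
        by (rule finite_measure_mono) (use elim G(1)[of N] in \<open>auto simp: not_le[symmetric]\<close>)
    qed
  qed
qed

text \<open>At t the two integrands differ by at most |t| \<epsilon> on the event and by at most 2
  off it. The limit law is prescribed through its characteristic function, so the same lemma covers
  the Tracy-Widom law and an affine image of a Gaussian law.\<close>

lemma conv_in_distr_affine_on_events:
  fixes P :: "nat \<Rightarrow> 'a measure" and X Y :: "nat \<Rightarrow> 'a \<Rightarrow> real"
  assumes P: "\<And>N. prob_space (P N)" and X: "conv_in_distr P X \<mu>" and Y: "\<And>N. Y N \<in> borel_measurable (P N)"
    and G: "\<And>N. G N \<in> sets (P N)" "(\<lambda>N. measure (P N) (space (P N) - G N)) \<longlonglongrightarrow> 0"
    and c: "\<And>\<epsilon>. \<epsilon> > 0 \<Longrightarrow> \<forall>\<^sub>F N in sequentially. \<forall>\<omega>\<in>G N. \<bar>Y N \<omega> - (a * X N \<omega> + b)\<bar> \<le> \<epsilon>"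
    and \<mu>': "real_distribution \<mu>'" "\<And>t. char \<mu>' t = iexp (t * b) * char \<mu> (a * t)"
  shows "conv_in_distr P Y \<mu>'"
  unfolding conv_in_distr_def
proof (intro conjI allI Y \<mu>'(1))
  have Xm[measurable]: "\<And>N. X N \<in> borel_measurable (P N)" and mu: "real_distribution \<mu>"
    and wc: "weak_conv_m (\<lambda>N. distr (P N) borel (X N)) \<mu>"
    using X unfolding conv_in_distr_def by auto
  note [measurable] = Y
  show "weak_conv_m (\<lambda>N. distr (P N) borel (Y N)) \<mu>'"
  proof (rule levy_continuity[OF _ \<mu>'(1)])
    show "real_distribution (distr (P N) borel (Y N))" for N
      by (rule prob_space.real_distribution_distr[OF P]) (rule Y)
    have Xd: "real_distribution (distr (P N) borel (X N))" for N
      by (rule prob_space.real_distribution_distr[OF P]) (rule Xm)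
    fix t
    have x: "(\<lambda>N. iexp (t * b) * char (distr (P N) borel (X N)) (a * t)) \<longlonglongrightarrow> char \<mu>' t"
      unfolding \<mu>'(2) by (rule tendsto_mult[OF tendsto_const levy_continuity1[OF Xd mu wc]])
    have chX: "iexp (t * b) * char (distr (P N) borel (X N)) (a * t) = (LINT \<omega>|P N. iexp (t * (a * X N \<omega> + b)))" for N
    proof -
      have "char (distr (P N) borel (X N)) (a * t) = (LINT \<omega>|P N. iexp (a * t * X N \<omega>))"
        unfolding char_def by (subst integral_distr) auto
      then have "iexp (t * b) * char (distr (P N) borel (X N)) (a * t) = (LINT \<omega>|P N. iexp (t * b) * iexp (a * t * X N \<omega>))"
        by (simp only: Bochner_Integration.integral_mult_right_zero)
      also have "\<dots> = (LINT \<omega>|P N. iexp (t * (a * X N \<omega> + b)))"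
        by (intro Bochner_Integration.integral_cong refl) (simp add: exp_add[symmetric] algebra_simps)
      finally show ?thesis .
    qed
    have chY: "char (distr (P N) borel (Y N)) t = (LINT \<omega>|P N. iexp (t * Y N \<omega>))" for N
      unfolding char_def by (subst integral_distr) auto
    have bd: "cmod (char (distr (P N) borel (Y N)) t - iexp (t * b) * char (distr (P N) borel (X N)) (a * t))
        \<le> \<bar>t\<bar> * \<epsilon> + 2 * measure (P N) (space (P N) - G N)"
      if e: "\<epsilon> > 0" and good: "\<forall>\<omega>\<in>G N. \<bar>Y N \<omega> - (a * X N \<omega> + b)\<bar> \<le> \<epsilon>" for N \<epsilon>
    proof -
      interpret prob_space "P N" by (rule P)
      have ints: "integrable (P N) (\<lambda>\<omega>. iexp (t * Y N \<omega>))" "integrable (P N) (\<lambda>\<omega>. iexp (t * (a * X N \<omega> + b)))"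
        by (rule integrable_const_bound[where B = 1]; auto)+
      have "char (distr (P N) borel (Y N)) t - iexp (t * b) * char (distr (P N) borel (X N)) (a * t)
          = (LINT \<omega>|P N. iexp (t * Y N \<omega>) - iexp (t * (a * X N \<omega> + b)))"
        unfolding chX chY by (rule Bochner_Integration.integral_diff[OF ints, symmetric])
      also have "cmod \<dots> \<le> (LINT \<omega>|P N. cmod (iexp (t * Y N \<omega>) - iexp (t * (a * X N \<omega> + b))))"
        by (rule integral_norm_bound)
      also have "\<dots> \<le> (LINT \<omega>|P N. \<bar>t\<bar> * \<epsilon> + 2 * indicator (space (P N) - G N) \<omega>)"
      proof (rule integral_mono)
        show "integrable (P N) (\<lambda>\<omega>. cmod (iexp (t * Y N \<omega>) - iexp (t * (a * X N \<omega> + b))))"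
          by (rule integrable_norm[OF Bochner_Integration.integrable_diff[OF ints]])
        show "integrable (P N) (\<lambda>\<omega>. \<bar>t\<bar> * \<epsilon> + 2 * indicator (space (P N) - G N) \<omega>)"
          using G(1)[of N] by (intro Bochner_Integration.integrable_add integrable_mult_right integrable_const)
            (auto simp: emeasure_eq_measure)
        fix \<omega> assume w: "\<omega> \<in> space (P N)"
        show "cmod (iexp (t * Y N \<omega>) - iexp (t * (a * X N \<omega> + b))) \<le> \<bar>t\<bar> * \<epsilon> + 2 * indicator (space (P N) - G N) \<omega>"
        proof (cases "\<omega> \<in> G N")
          case True
          have "cmod (iexp (t * Y N \<omega>) - iexp (t * (a * X N \<omega> + b))) \<le> \<bar>t * Y N \<omega> - t * (a * X N \<omega> + b)\<bar>"
            by (rule cmod_iexp_diff)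
          also have "\<dots> = \<bar>t\<bar> * \<bar>Y N \<omega> - (a * X N \<omega> + b)\<bar>" by (simp only: right_diff_distrib[symmetric] abs_mult)
          also have "\<dots> \<le> \<bar>t\<bar> * \<epsilon>" using good True by (intro mult_left_mono) auto
          finally show ?thesis using True by simp
        next
          case False
          have "cmod (iexp (t * Y N \<omega>) - iexp (t * (a * X N \<omega> + b))) \<le> cmod (iexp (t * Y N \<omega>)) + cmod (iexp (t * (a * X N \<omega> + b)))"
            by (rule norm_triangle_ineq4)
          also have "\<dots> = 2" by simp
          finally show ?thesis using False w e by (simp add: add_increasing)
        qed
      qed
      also have "\<dots> = \<bar>t\<bar> * \<epsilon> + 2 * measure (P N) (space (P N) - G N)"
        using G(1)[of N] by (subst Bochner_Integration.integral_add) (auto simp: emeasure_eq_measure prob_space)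
      finally show ?thesis .
    qed
    have "(\<lambda>N. char (distr (P N) borel (Y N)) t - iexp (t * b) * char (distr (P N) borel (X N)) (a * t)) \<longlonglongrightarrow> 0"
    proof (rule tendstoI, unfold dist_norm diff_zero)
      fix r :: real assume r: "r > 0"
      define T where "T = \<bar>t\<bar> + 1"
      have T: "T > 0" "\<bar>t\<bar> \<le> T" unfolding T_def by auto
      define \<epsilon> where "\<epsilon> = r / (4 * T)"
      have e: "\<epsilon> > 0" unfolding \<epsilon>_def using r T by simp
      have "\<bar>t\<bar> * \<epsilon> \<le> T * \<epsilon>" using e T by (intro mult_right_mono) auto
      also have "\<dots> = r / 4" unfolding \<epsilon>_def using T by simp
      finally have te: "\<bar>t\<bar> * \<epsilon> \<le> r / 4" .
      have "r / 4 > 0" using r by simp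
      from order_tendstoD(2)[OF G(2) this] c[OF e]
      show "\<forall>\<^sub>F N in sequentially. cmod (char (distr (P N) borel (Y N)) t - iexp (t * b) * char (distr (P N) borel (X N)) (a * t)) < r"
      proof eventually_elim
        case (elim N)
        then show ?case using bd[OF e elim(2)] te r by linarith
      qed
    qed
    from tendsto_add[OF this x]
    show "(\<lambda>N. char (distr (P N) borel (Y N)) t) \<longlonglongrightarrow> char \<mu>' t" by simp
  qed
qed

lemma real_distribution_gaussian: "real_distribution (gaussian m v)"
proof -
  interpret real_distribution std_normal_distribution by (rule real_dist_normal_dist)
  show ?thesis unfolding gaussian_def by (rule real_distribution_distr) simp
qed

lemma char_gaussian:
  assumes "v \<ge> 0"
  shows "char (gaussian m v) t = iexp (t * m) * exp (- (t\<^sup>2 * v / 2))"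
proof -
  have "char (gaussian m v) t = (LINT z|std_normal_distribution. iexp (t * (m + sqrt v * z)))"
    unfolding gaussian_def char_def by (subst integral_distr) auto
  also have "\<dots> = (LINT z|std_normal_distribution. iexp (t * m) * iexp (t * sqrt v * z))"
    by (intro Bochner_Integration.integral_cong refl) (simp add: exp_add[symmetric] algebra_simps)
  also have "\<dots> = iexp (t * m) * char std_normal_distribution (t * sqrt v)"
    unfolding char_def by (rule Bochner_Integration.integral_mult_right_zero)
  finally show ?thesis using assms by (simp add: char_std_normal_distribution power_mult_distrib exp_of_real)
qed

text \<open>A union bound over the N indices; the decay exponent D = 2 beats their number and leaves
  1/N. The loss 1/20 is the one built into \<open>rigid\<close>.\<close>

lemma rigidity_event:
  assumes M: "random_symmetric_matrices P M" and r: "rigidity P M \<nu> Cp"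
  defines "G \<equiv> \<lambda>N. {\<omega> \<in> space (P N). \<forall>k\<in>{1..N}. \<bar>eig (M N \<omega>) k - classical_location \<nu> N k\<bar>
     \<le> real N powr (1/20) * (real (min k (N + 1 - k)) powr (- 1/3) * real N powr (- 2/3))}"
  shows "\<And>N. G N \<in> sets (P N)" "(\<lambda>N. measure (P N) (space (P N) - G N)) \<longlonglongrightarrow> 0"
proof -
  let ?X = "\<lambda>N k \<omega>. \<bar>eig (M N \<omega>) k - classical_location \<nu> N k\<bar>"
  let ?Y = "\<lambda>N k (\<omega>::'a). real (min k (N + 1 - k)) powr (- 1 / 3) * real N powr (- 2 / 3)"
  have sd: "stoch_dom P (\<lambda>N. {1..N}) ?X ?Y" using r unfolding rigidity_def by simp
  have Xm: "?X N k \<in> borel_measurable (P N)" if "k \<in> {1..N}" for N k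
    using sd that unfolding stoch_dom_def by blast
  show G: "G N \<in> sets (P N)" for N
  proof -
    have "{\<omega> \<in> space (P N). ?X N k \<omega> \<le> real N powr (1/20) * ?Y N k \<omega>} \<in> sets (P N)" if "k \<in> {1..N}" for k
      using Xm[OF that] by measurable
    then have "{\<omega> \<in> space (P N). \<forall>k\<in>{1..N}. ?X N k \<omega> \<le> real N powr (1/20) * ?Y N k \<omega>} \<in> sets (P N)"
      by (rule sets.sets_Collect_finite_All[OF _ finite_atLeastAtMost])
    then show ?thesis unfolding G_def .
  qed
  have ex: "\<exists>N0. \<forall>N\<ge>N0. \<forall>k\<in>{1..N}.
      measure (P N) {\<omega> \<in> space (P N). \<bar>?X N k \<omega>\<bar> > real N powr \<epsilon> * ?Y N k \<omega>} \<le> real N powr (- D)"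
    if "\<epsilon> > 0" "D > 0" for \<epsilon> D :: real
    using sd that unfolding stoch_dom_def by blast
  have p: "(0::real) < 1/20" "(0::real) < 2" by simp_all
  obtain N0 where N0: "\<forall>N\<ge>N0. \<forall>k\<in>{1..N}.
      measure (P N) {\<omega> \<in> space (P N). \<bar>?X N k \<omega>\<bar> > real N powr (1/20) * ?Y N k \<omega>} \<le> real N powr (- 2)"
    using ex[OF p] by blast
  have le: "measure (P N) (space (P N) - G N) \<le> 1 / real N" if N: "N \<ge> max N0 1" for N
  proof -
    interpret prob_space "P N" using M unfolding random_symmetric_matrices_def by blast
    define B where "B k = {\<omega> \<in> space (P N). \<bar>?X N k \<omega>\<bar> > real N powr (1/20) * ?Y N k \<omega>}" for k
    have Bm: "B k \<in> sets (P N)" if "k \<in> {1..N}" for k unfolding B_def using Xm[OF that] by measurable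
    have B2: "prob (B k) \<le> real N powr (- 2)" if "k \<in> {1..N}" for k
      unfolding B_def using N0 N that by (meson max.boundedE)
    have "space (P N) - G N \<subseteq> (\<Union>k\<in>{1..N}. B k)"
    proof
      fix \<omega> assume w: "\<omega> \<in> space (P N) - G N"
      then obtain k where k: "k \<in> {1..N}" "\<not> ?X N k \<omega> \<le> real N powr (1/20) * ?Y N k \<omega>"
        unfolding G_def by blast
      then have "\<omega> \<in> B k" using w unfolding B_def mem_Collect_eq abs_abs by (simp only: not_le Diff_iff)
      then show "\<omega> \<in> (\<Union>k\<in>{1..N}. B k)" using k(1) by blast
    qed
    then have "prob (space (P N) - G N) \<le> prob (\<Union>k\<in>{1..N}. B k)"
      by (rule finite_measure_mono) (rule sets.finite_UN[OF finite_atLeastAtMost Bm])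
    also have "\<dots> \<le> (\<Sum>k\<in>{1..N}. prob (B k))"
      by (rule finite_measure_subadditive_finite[OF finite_atLeastAtMost]) (use Bm in blast)
    also have "\<dots> \<le> (\<Sum>k\<in>{1..N}. real N powr (- 2))"
      by (rule sum_mono) (rule B2)
    also have "\<dots> = 1 / real N" using N by (simp add: powr_minus_divide power2_eq_square)
    finally show ?thesis .
  qed
  show "(\<lambda>N. measure (P N) (space (P N) - G N)) \<longlonglongrightarrow> 0"
  proof (rule tendsto_sandwich[OF _ _ tendsto_const lim_1_over_n])
    show "\<forall>\<^sub>F N in sequentially. measure (P N) (space (P N) - G N) \<le> 1 / of_nat N"
      using eventually_ge_at_top[of "max N0 1"] by (rule eventually_mono) (rule le)
  qed simp
qed

section \<open>Asymptotics of the free energy\<close>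

context spherical_model begin

lemma powr_le_eventually:
  assumes "d > 0" shows "\<forall>\<^sub>F N in sequentially. real N powr (- 37/60) \<le> d"
proof -
  have "(\<lambda>N. real N powr (- (37/60))) \<longlonglongrightarrow> 0" by (rule powr_neg_tendsto_0) simp
  from order_tendstoD(2)[OF this assms] show ?thesis by (rule eventually_mono) simp
qed

text \<open>Violations for arbitrarily large N would form a sequence of rigid spectra of growing
  size, to which \<open>tilt_limit\<close> applies. Uniformity over spectra is what permits
  inserting random eigenvalues, without any measurable choice.\<close>

lemma tilt_uniform_limit:
  assumes sub: "\<beta> * \<tau>c < beta_c \<nu> Cm Cp"
    and hol: "holomorphic_extension_near f {0..} {tau f \<gamma>h}" and \<epsilon>: "\<epsilon> > 0"
  shows "\<forall>\<^sub>F N in sequentially. \<forall>l. rigid N l \<longrightarrow>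
    \<bar>ln (tiltE N \<gamma>h l) + 1/2 * ln (1 + deriv (deriv f) (tau f \<gamma>h) / (2 * \<beta>) * curvature)\<bar> \<le> \<epsilon>"
proof (rule ccontr)
  define q where "q = deriv (deriv f) (tau f \<gamma>h) / (2 * \<beta>) * curvature"
  define bad where "bad N l \<longleftrightarrow> rigid N l \<and> \<not> \<bar>ln (tiltE N \<gamma>h l) + 1/2 * ln (1 + q)\<bar> \<le> \<epsilon>" for N l
  assume "\<not> (\<forall>\<^sub>F N in sequentially. \<forall>l. rigid N l \<longrightarrow>
    \<bar>ln (tiltE N \<gamma>h l) + 1/2 * ln (1 + deriv (deriv f) (tau f \<gamma>h) / (2 * \<beta>) * curvature)\<bar> \<le> \<epsilon>)"
  then have fr: "\<exists>N\<ge>n. \<exists>l. bad N l" for n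
    unfolding eventually_sequentially bad_def q_def by blast
  have d: "(\<gamma>h - Cp) / 2 > 0" using gamma_hat_gt[OF sub] by simp
  obtain n0 where n0: "\<And>N. N \<ge> n0 \<Longrightarrow> real N powr (- 37/60) \<le> (\<gamma>h - Cp) / 2"
    using powr_le_eventually[OF d] unfolding eventually_sequentially by blast
  have "\<forall>n. \<exists>Nl. fst Nl \<ge> max (max n n0) 1 \<and> bad (fst Nl) (snd Nl)"
    using fr by (metis fst_conv snd_conv)
  then obtain F where F: "\<And>n. fst (F n) \<ge> max (max n n0) 1 \<and> bad (fst (F n)) (snd (F n))"
    by metis
  define Nn where "Nn n = fst (F n)" for n
  define l where "l n = snd (F n)" for n
  have Nn: "Nn n \<ge> 1" "Nn n \<ge> n" "Nn n \<ge> n0" and b: "bad (Nn n) (l n)" for n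
    using F[of n] unfolding Nn_def l_def by auto
  have lim: "filterlim Nn at_top sequentially"
    by (rule filterlim_at_top_mono[OF filterlim_ident]) (use Nn in auto)
  have r: "rigid (Nn n) (l n)" for n using b unfolding bad_def by blast
  note T = tilt_limit[OF sub hol Nn(1) lim n0[OF Nn(3)] r, folded q_def]
  have q0: "q \<ge> 0" unfolding q_def using T(2) curvature_nonneg \<beta>_pos by simp
  have "(\<lambda>n. ln (tiltE (Nn n) \<gamma>h (l n))) \<longlonglongrightarrow> ln (1 / sqrt (1 + q))"
    by (rule tendsto_ln[OF T(1)]) (use q0 in auto)
  moreover have "ln (1 / sqrt (1 + q)) = - 1/2 * ln (1 + q)"
    using q0 by (simp add: ln_div ln_sqrt)
  ultimately have "(\<lambda>n. ln (tiltE (Nn n) \<gamma>h (l n))) \<longlonglongrightarrow> - 1/2 * ln (1 + q)" by simp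
  from eventually_happens'[OF sequentially_bot tendstoD[OF this \<epsilon>]]
  obtain n where "dist (ln (tiltE (Nn n) \<gamma>h (l n))) (- 1/2 * ln (1 + q)) < \<epsilon>" by blast
  moreover have "\<not> \<bar>ln (tiltE (Nn n) \<gamma>h (l n)) + 1/2 * ln (1 + q)\<bar> \<le> \<epsilon>"
    using b[of n] unfolding bad_def by blast
  ultimately show False unfolding dist_real_def by simp
qed

text \<open>Exact as soon as rigidity keeps the spectrum below \<open>\<gamma>h\<close>; the linear
  statistic is separated from the expectation, so that each can be treated by its own limit.\<close>

lemma logZ_bulk:
  assumes sub: "\<beta> * \<tau>c < beta_c \<nu> Cm Cp"
  shows "\<forall>\<^sub>F N in sequentially. \<forall>l. rigid N l \<longrightarrow>
    logZ N l = real N * bulk_energy - 1/2 * ((\<Sum>k=1..N. ln (\<gamma>h - l k)) - real N * (LINT x|\<nu>. ln (\<gamma>h - x)))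
      + ln (tiltE N \<gamma>h l)"
proof -
  have g: "\<gamma>h > Cp" by (rule gamma_hat_gt[OF sub])
  then have d: "(\<gamma>h - Cp) / 2 > 0" by simp
  show ?thesis
    using powr_le_eventually[OF d] eventually_ge_at_top[of 1]
  proof eventually_elim
    case (elim N)
    show ?case
    proof (intro allI impI)
      fix l assume r: "rigid N l"
      have l: "l k < \<gamma>h" if "k \<in> {1..N}" for k
      proof -
        have "1 \<le> k" "k \<le> N" using that by auto
        have *: "a < g" if "a < c + x" "x \<le> (g - c) / 2" "c < g" for a c x g :: real
        proof -
          have "2 * x \<le> g - c" using that(2) by simp
          then show ?thesis using that(1,3) by linarith
        qed
        show ?thesis by (rule *[OF rigid_range(2)[OF r \<open>1 \<le> k\<close> \<open>k \<le> N\<close>] elim(1) g])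
      qed
      have *: "b * n * v + n / 2 * q - 1/2 * S + t = n * (b * v + 1/2 * q - 1/2 * I) - 1/2 * (S - n * I) + t"
        for b n v q S t I :: real by (simp add: algebra_simps diff_divide_distrib)
      show "logZ N l = real N * bulk_energy - 1/2 * ((\<Sum>k=1..N. ln (\<gamma>h - l k)) - real N * (LINT x|\<nu>. ln (\<gamma>h - x)))
          + ln (tiltE N \<gamma>h l)"
        unfolding bulk_energy_def by (rule trans[OF logZ_tilt(3)[of N l \<gamma>h, OF elim(2) l] *])
    qed
  qed
qed

lemma bulk_free_energy:
  assumes sub: "\<beta> * \<tau>c < beta_c \<nu> Cm Cp"
    and hol: "holomorphic_extension_near f {0..} {tau f \<gamma>h}" and \<epsilon>: "\<epsilon> > 0"
  shows "\<forall>\<^sub>F N in sequentially. \<forall>l. good N l \<longrightarrow> \<bar>1 / real N * logZ N l - bulk_energy\<bar> \<le> \<epsilon>"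
proof -
  have g: "\<gamma>h > Cp" by (rule gamma_hat_gt[OF sub])
  obtain K where K: "K \<ge> 0" "\<And>N l. N \<ge> 1 \<Longrightarrow> real N powr (- 37/60) \<le> (\<gamma>h - Cp) / 2 \<Longrightarrow> rigid N l \<Longrightarrow>
    \<bar>(\<Sum>k=1..N. 1 / (\<gamma>h - l k)) - real N * stieltjes \<gamma>h\<bar> \<le> K * real N powr (23/60) \<and>
    \<bar>(\<Sum>k=1..N. 1 / (\<gamma>h - l k)\<^sup>2) - real N * (LINT x|\<nu>. 1 / (\<gamma>h - x)\<^sup>2)\<bar> \<le> K * real N powr (23/60) \<and>
    \<bar>(\<Sum>k=1..N. ln (\<gamma>h - l k)) - real N * (LINT x|\<nu>. ln (\<gamma>h - x))\<bar> \<le> K * real N powr (23/60)"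
    using high_temp_sums[OF g refl] by metis
  define c where "c = \<bar>1/2 * ln (1 + deriv (deriv f) (tau f \<gamma>h) / (2 * \<beta>) * curvature)\<bar> + 1"
  have "(\<lambda>N. K * real N powr (- (37/60)) + c * real N powr (- 1)) \<longlonglongrightarrow> K * 0 + c * 0"
    by (intro tendsto_add tendsto_mult tendsto_const powr_neg_tendsto_0) simp_all
  then have lim: "(\<lambda>N. K * real N powr (- (37/60)) + c * real N powr (- 1)) \<longlonglongrightarrow> 0" by simp
  have d: "(\<gamma>h - Cp) / 2 > 0" using g by simp
  have one: "(0::real) < 1" by simp
  show ?thesis
    using order_tendstoD(2)[OF lim \<epsilon>] powr_le_eventually[OF d] logZ_bulk[OF sub]
      tilt_uniform_limit[OF sub hol one] eventually_ge_at_top[of 1]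
  proof eventually_elim
    case (elim N)
    show ?case
    proof (intro allI impI)
      fix l assume "good N l"
      then have r: "rigid N l" unfolding good_def by simp
      define S where "S = (\<Sum>k=1..N. ln (\<gamma>h - l k)) - real N * (LINT x|\<nu>. ln (\<gamma>h - x))"
      define T where "T = ln (tiltE N \<gamma>h l)"
      have S: "\<bar>S\<bar> \<le> K * real N powr (23/60)" using K(2)[OF elim(5,2) r] unfolding S_def by blast
      have T: "\<bar>T\<bar> \<le> c" using elim(4) r unfolding T_def c_def by fastforce
      have N: "real N > 0" using elim(5) by simp
      have "logZ N l = real N * bulk_energy - 1/2 * S + T" using elim(3) r unfolding S_def T_def by blast
      moreover have "1 / n * (n * b - 1/2 * q + t) - b = (t - 1/2 * q) / n" if "n > 0" for n b q t :: real
        using that by (simp add: field_simps)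
      ultimately have "1 / real N * logZ N l - bulk_energy = (T - 1/2 * S) / real N"
        using N by (simp only:)
      then have "\<bar>1 / real N * logZ N l - bulk_energy\<bar> = \<bar>T - 1/2 * S\<bar> / real N" using N by simp
      also have "\<dots> \<le> (c + K * real N powr (23/60)) / real N"
        using S T N by (intro divide_right_mono) auto
      also have "\<dots> = K * (real N powr (23/60) * real N powr (- 1)) + c * real N powr (- 1)"
        using N by (simp add: add_divide_distrib powr_minus_divide)
      also have "real N powr (23/60) * real N powr (- 1) = real N powr (- (37/60))" by (simp only: powr_add[symmetric]) simp
      finally show "\<bar>1 / real N * logZ N l - bulk_energy\<bar> \<le> \<epsilon>" using elim(1) by linarith
    qed
  qed
qed

lemma top_eigenvalue_near_edge:
  assumes "good N l" "N \<ge> 1"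
  shows "\<bar>l 1 - Cp\<bar> \<le> (C + 3) * real N powr (- 37/60)"
proof -
  have r: "rigid N l" and top: "\<And>k. k \<in> {1..N} \<Longrightarrow> l k \<le> l 1" using assms unfolding good_def by auto
  have 1: "\<bar>l 1 + 1 / real N - Cp\<bar> \<le> (C + 2) * real N powr (- 37/60)"
    by (rule z_minus_edge[OF assms(2) r top])
  have "1 / real N = real N powr (- 1)" using assms(2) by (simp add: powr_minus_divide)
  also have "\<dots> \<le> real N powr (- 37/60)" using assms(2) by (intro powr_mono) auto
  finally have 2: "1 / real N \<le> real N powr (- 37/60)" .
  have "0 \<le> 1 / real N" by simp
  then show ?thesis using 1 2 unfolding distrib_right by linarith
qed

text \<open>The critical temperature is included: \<eta> is taken so small that its cost per site is
  at most \<epsilon> / 3. The term with \<open>edge_slope\<close> vanishes together with the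
  distance of \<open>l 1\<close> from the edge.\<close>

lemma edge_free_energy:
  assumes crit: "\<beta> * \<tau>c \<ge> beta_c \<nu> Cm Cp" and \<epsilon>: "\<epsilon> > 0"
  shows "\<forall>\<^sub>F N in sequentially. \<forall>l. good N l \<longrightarrow> \<bar>1 / real N * logZ N l - edge_energy\<bar> \<le> \<epsilon>"
proof -
  obtain L0 where L0: "L0 \<ge> 0" "\<And>\<eta>. \<eta> \<in> {0..1} \<Longrightarrow> stieltjes Cp / (2 * \<beta>) < \<tau>c + \<eta> \<Longrightarrow>
    (\<exists>K. \<forall>\<^sub>F N in sequentially. \<forall>l. good N l \<longrightarrow>
      logZ N l \<ge> real N * edge_energy + real N * edge_slope * (l 1 - Cp) - K * real N powr (1/4) - L0 * \<eta> * real N)"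
    using logZ_edge_lower by blast
  define T where "T = L0 + 1"
  have T: "T > 0" "L0 \<le> T" using L0(1) unfolding T_def by auto
  define \<eta> where "\<eta> = min 1 (\<epsilon> / (3 * T))"
  have eta: "\<eta> \<in> {0..1}" "\<eta> > 0" unfolding \<eta>_def using \<epsilon> T by auto
  have "L0 * \<eta> \<le> T * (\<epsilon> / (3 * T))"
    using L0(1) T eta unfolding \<eta>_def by (intro mult_mono) auto
  also have "\<dots> = \<epsilon> / 3" using T by simp
  finally have Le: "L0 * \<eta> \<le> \<epsilon> / 3" .
  have "stieltjes Cp / (2 * \<beta>) \<le> \<tau>c"
    using crit \<beta>_pos unfolding beta_c_eq by (simp add: pos_divide_le_eq mult_ac)
  then have "stieltjes Cp / (2 * \<beta>) < \<tau>c + \<eta>" using eta by linarith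
  from L0(2)[OF eta(1) this] obtain K1 where low: "\<forall>\<^sub>F N in sequentially. \<forall>l. good N l \<longrightarrow>
      logZ N l \<ge> real N * edge_energy + real N * edge_slope * (l 1 - Cp) - K1 * real N powr (1/4) - L0 * \<eta> * real N"
    by blast
  obtain K2 where up: "\<forall>\<^sub>F N in sequentially. \<forall>l. good N l \<longrightarrow>
    logZ N l \<le> real N * edge_energy + real N * edge_slope * (l 1 - Cp) + K2 * real N powr (1/4)"
    using logZ_edge_upper by blast
  define es where "es = \<bar>edge_slope\<bar>"
  have "(\<lambda>N. es * ((C + 3) * real N powr (- (37/60))) + (\<bar>K1\<bar> + \<bar>K2\<bar>) * real N powr (- (3/4))) \<longlonglongrightarrow> es * ((C + 3) * 0) + (\<bar>K1\<bar> + \<bar>K2\<bar>) * 0"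
    by (intro tendsto_add tendsto_mult tendsto_const powr_neg_tendsto_0) simp_all
  then have lim: "(\<lambda>N. es * ((C + 3) * real N powr (- (37/60))) + (\<bar>K1\<bar> + \<bar>K2\<bar>) * real N powr (- (3/4))) \<longlonglongrightarrow> 0" by simp
  have e3: "\<epsilon> / 3 > 0" using \<epsilon> by simp
  show ?thesis
    using order_tendstoD(2)[OF lim e3] low up eventually_ge_at_top[of 1]
  proof eventually_elim
    case (elim N)
    show ?case
    proof (intro allI impI)
      fix l assume g: "good N l"
      have N: "real N > 0" using elim(4) by simp
      define x where "x = edge_slope * (l 1 - Cp)"
      define y where "y = real N powr (1/4)"
      have "\<bar>x\<bar> \<le> es * ((C + 3) * real N powr (- 37/60))"
        unfolding x_def abs_mult es_def using top_eigenvalue_near_edge[OF g elim(4)] by (intro mult_left_mono) auto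
      then have x: "\<bar>x\<bar> \<le> es * ((C + 3) * real N powr (- (37/60)))" by simp
      have y: "y / real N = real N powr (- (3/4))"
      proof -
        have "y / real N = real N powr (1/4) * real N powr (- 1)" using N unfolding y_def by (simp add: powr_minus_divide)
        also have "\<dots> = real N powr (- (3/4))" by (simp only: powr_add[symmetric]) simp
        finally show ?thesis .
      qed
      have y0: "y / real N \<ge> 0" unfolding y by simp
      have lo: "real N * edge_energy + real N * x - K1 * y - L0 * \<eta> * real N \<le> logZ N l"
        and hi: "logZ N l \<le> real N * edge_energy + real N * x + K2 * y"
        using elim(2,3) g unfolding x_def y_def by (simp_all add: mult.assoc)
      have "1 / real N * (real N * edge_energy + real N * x - K1 * y - L0 * \<eta> * real N) \<le> 1 / real N * logZ N l"
        using lo N by (intro mult_left_mono) auto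
      moreover have "1 / real N * (real N * edge_energy + real N * x - K1 * y - L0 * \<eta> * real N)
          = edge_energy + x - K1 * (y / real N) - L0 * \<eta>"
        using N by (simp add: field_simps)
      ultimately have lo': "edge_energy + x - K1 * (y / real N) - L0 * \<eta> \<le> 1 / real N * logZ N l" by simp
      have "1 / real N * logZ N l \<le> 1 / real N * (real N * edge_energy + real N * x + K2 * y)"
        using hi N by (intro mult_left_mono) auto
      also have "\<dots> = edge_energy + x + K2 * (y / real N)" using N by (simp add: field_simps)
      finally have hi': "1 / real N * logZ N l \<le> edge_energy + x + K2 * (y / real N)" .
      have k: "K1 * (y / real N) \<le> \<bar>K1\<bar> * (y / real N)" "K2 * (y / real N) \<le> \<bar>K2\<bar> * (y / real N)"
        "0 \<le> \<bar>K1\<bar> * (y / real N)" "0 \<le> \<bar>K2\<bar> * (y / real N)"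
        by (rule mult_right_mono[OF abs_ge_self y0] mult_nonneg_nonneg[OF abs_ge_zero y0])+
      have s: "es * ((C + 3) * real N powr (- (37/60))) + \<bar>K1\<bar> * (y / real N) + \<bar>K2\<bar> * (y / real N) < \<epsilon> / 3"
        using elim(1) unfolding y by (simp add: distrib_right)
      show "\<bar>1 / real N * logZ N l - edge_energy\<bar> \<le> \<epsilon>"
        using lo' hi' k s x Le \<epsilon> unfolding abs_le_iff by linarith
    qed
  qed
qed

text \<open>Strict inequality allows \<eta> = 0 in \<open>logZ_edge_lower\<close>. The error N^(1/4)
  of \<open>logZ\<close>, divided by N and rescaled by N^(2/3), becomes N^(-1/12), and division by
  \<open>edge_slope\<close> leaves the rescaled top eigenvalue with coefficient 1.\<close>

lemma edge_fluctuation: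
  assumes sup: "\<beta> * \<tau>c > beta_c \<nu> Cm Cp" and \<epsilon>: "\<epsilon> > 0"
  shows "\<forall>\<^sub>F N in sequentially. \<forall>l. good N l \<longrightarrow>
    \<bar>(s * pi * real N) powr (2/3) / (\<beta> * \<tau>c - beta_c \<nu> Cm Cp) * (1 / real N * logZ N l - edge_energy)
      - (s * pi) powr (2/3) * real N powr (2/3) * (l 1 - Cp)\<bar> \<le> \<epsilon>"
proof -
  obtain L0 where L0: "L0 \<ge> 0" "\<And>\<eta>. \<eta> \<in> {0..1} \<Longrightarrow> stieltjes Cp / (2 * \<beta>) < \<tau>c + \<eta> \<Longrightarrow>
    (\<exists>K. \<forall>\<^sub>F N in sequentially. \<forall>l. good N l \<longrightarrow>
      logZ N l \<ge> real N * edge_energy + real N * edge_slope * (l 1 - Cp) - K * real N powr (1/4) - L0 * \<eta> * real N)"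
    using logZ_edge_lower by blast
  have slope: "edge_slope = \<beta> * \<tau>c - beta_c \<nu> Cm Cp" unfolding edge_slope_def beta_c_eq by simp
  have sp: "edge_slope > 0" unfolding slope using sup by simp
  have "stieltjes Cp / (2 * \<beta>) < \<tau>c + 0"
    using sup \<beta>_pos unfolding beta_c_eq by (simp add: pos_divide_less_eq mult_ac)
  from L0(2)[OF _ this] obtain K1 where low: "\<forall>\<^sub>F N in sequentially. \<forall>l. good N l \<longrightarrow>
      logZ N l \<ge> real N * edge_energy + real N * edge_slope * (l 1 - Cp) - K1 * real N powr (1/4) - L0 * 0 * real N"
    by auto
  obtain K2 where up: "\<forall>\<^sub>F N in sequentially. \<forall>l. good N l \<longrightarrow>
    logZ N l \<le> real N * edge_energy + real N * edge_slope * (l 1 - Cp) + K2 * real N powr (1/4)"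
    using logZ_edge_upper by blast
  define K where "K = \<bar>K1\<bar> + \<bar>K2\<bar>"
  define c where "c = (s * pi) powr (2/3) / edge_slope"
  have c0: "c \<ge> 0" unfolding c_def using sp by simp
  have "(\<lambda>N. c * K * real N powr (- (1/12))) \<longlonglongrightarrow> c * K * 0"
    by (intro tendsto_mult tendsto_const powr_neg_tendsto_0) simp
  then have lim: "(\<lambda>N. c * K * real N powr (- (1/12))) \<longlonglongrightarrow> 0" by simp
  show ?thesis
    using order_tendstoD(2)[OF lim \<epsilon>] low up eventually_ge_at_top[of 1]
  proof eventually_elim
    case (elim N)
    show ?case
    proof (intro allI impI)
      fix l assume g: "good N l"
      have N: "real N > 0" using elim(4) by simp
      define X where "X = logZ N l - (real N * edge_energy + real N * edge_slope * (l 1 - Cp))"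
      have lo: "- (K1 * real N powr (1/4)) \<le> X" and hi: "X \<le> K2 * real N powr (1/4)"
      proof -
        have "real N * edge_energy + real N * edge_slope * (l 1 - Cp) - K1 * real N powr (1/4) - L0 * 0 * real N \<le> logZ N l"
          using elim(2) g by blast
        then show "- (K1 * real N powr (1/4)) \<le> X" unfolding X_def mult_zero_right mult_zero_left by linarith
        have "logZ N l \<le> real N * edge_energy + real N * edge_slope * (l 1 - Cp) + K2 * real N powr (1/4)"
          using elim(3) g by blast
        then show "X \<le> K2 * real N powr (1/4)" unfolding X_def by linarith
      qed
      have "K1 * real N powr (1/4) \<le> \<bar>K1\<bar> * real N powr (1/4)" "K2 * real N powr (1/4) \<le> \<bar>K2\<bar> * real N powr (1/4)"
        "0 \<le> \<bar>K1\<bar> * real N powr (1/4)" "0 \<le> \<bar>K2\<bar> * real N powr (1/4)"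
        by (auto intro!: mult_right_mono)
      then have X: "\<bar>X\<bar> \<le> K * real N powr (1/4)" using lo hi unfolding K_def distrib_right abs_le_iff by linarith
      have "(s * pi * real N) powr (2/3) = (s * pi) powr (2/3) * real N powr (2/3)"
        using s_pos by (subst powr_mult) auto
      then have "(s * pi * real N) powr (2/3) / edge_slope = c * real N powr (2/3)" unfolding c_def by simp
      moreover have "1 / real N * logZ N l - edge_energy = X / real N + edge_slope * (l 1 - Cp)"
        unfolding X_def using N by (simp add: field_simps)
      moreover have "c * real N powr (2/3) * (edge_slope * (l 1 - Cp)) = (s * pi) powr (2/3) * real N powr (2/3) * (l 1 - Cp)"
        unfolding c_def using sp by simp
      ultimately have e1: "(s * pi * real N) powr (2/3) / (\<beta> * \<tau>c - beta_c \<nu> Cm Cp) * (1 / real N * logZ N l - edge_energy)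
          - (s * pi) powr (2/3) * real N powr (2/3) * (l 1 - Cp) = c * real N powr (2/3) * (X / real N)"
        unfolding slope[symmetric] by (simp add: distrib_left)
      have e2: "\<bar>c * real N powr (2/3) * (X / real N)\<bar> = c * real N powr (2/3) * (\<bar>X\<bar> / real N)"
        using c0 N by (simp add: abs_mult)
      have e3: "c * real N powr (2/3) * (\<bar>X\<bar> / real N) \<le> c * real N powr (2/3) * (K * real N powr (1/4) / real N)"
        using c0 X N by (intro mult_left_mono divide_right_mono) auto
      have e4: "c * real N powr (2/3) * (K * real N powr (1/4) / real N)
          = c * K * (real N powr (2/3) * real N powr (1/4) * real N powr (- 1))"
        using N by (simp add: powr_minus_divide mult_ac)
      have e5: "real N powr (2/3) * real N powr (1/4) * real N powr (- 1) = real N powr (- (1/12))"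
        by (simp only: powr_add[symmetric]) simp
      show "\<bar>(s * pi * real N) powr (2/3) / (\<beta> * \<tau>c - beta_c \<nu> Cm Cp) * (1 / real N * logZ N l - edge_energy)
          - (s * pi) powr (2/3) * real N powr (2/3) * (l 1 - Cp)\<bar> \<le> \<epsilon>"
        unfolding e1 by (rule order.trans[OF eq_refl[OF e2] order.trans[OF e3[unfolded e4 e5] less_imp_le[OF elim(1)]]])
    qed
  qed
qed

lemma measurable_free_energy:
  assumes M: "random_symmetric_matrices P M"
  shows "(\<lambda>\<omega>. free_energy f \<beta> (M N \<omega>)) \<in> borel_measurable (P N)"
proof -
  have ent[measurable]: "(\<lambda>\<omega>. M N \<omega> $$ (i, j)) \<in> borel_measurable (P N)" if "i < N" "j < N" for i j
    using M that unfolding random_symmetric_matrices_def by blast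
  have car: "M N \<omega> \<in> carrier_mat N N" if "\<omega> \<in> space (P N)" for \<omega>
    using M that unfolding random_symmetric_matrices_def by blast
  interpret L: sigma_finite_measure "lebN N"
    by (rule lborel_product.sigma_finite) simp
  let ?g = "\<lambda>\<omega> v. exp (\<beta> * (\<Sum>i<N. \<Sum>j<N. M N \<omega> $$ (i, j) * v i * v j)
     - \<beta> * real N * f_ext (1 / real N * (\<Sum>i<N. (v i)\<^sup>2)))"
  have "(\<lambda>\<omega>. 1 / real N * ln (LINT v|lebN N. ?g \<omega> v)) \<in> borel_measurable (P N)"
  proof -
    have "(\<lambda>(\<omega>, v). ?g \<omega> v) \<in> borel_measurable (P N \<Otimes>\<^sub>M lebN N)"
      unfolding split_beta by measurable
    from L.borel_measurable_lebesgue_integral[OF this] show ?thesis by measurable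
  qed
  moreover have "free_energy f \<beta> (M N \<omega>) = 1 / real N * ln (LINT v|lebN N. ?g \<omega> v)" if "\<omega> \<in> space (P N)" for \<omega>
  proof -
    have dim: "dim_row (M N \<omega>) = N" using car[OF that] by simp
    have "f_ext (1 / real N * (\<Sum>i<N. (v i)\<^sup>2)) = f (1 / real N * (\<Sum>i<N. (v i)\<^sup>2))" for v :: "nat \<Rightarrow> real"
      using f_ext_eq[OF sphere_radius_nonneg[of N v]] unfolding sphere_radius_def .
    then show ?thesis unfolding free_energy_def Let_def dim by simp
  qed
  ultimately show ?thesis by (subst measurable_cong) auto
qed

end

lemma second_derivative_ln_diff:
  fixes \<phi> :: "real \<Rightarrow> real"
  assumes "open U" "x \<in> U" "x < g" and \<phi>: "\<And>y. y \<in> U \<Longrightarrow> \<phi> y = ln (g - y)"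
  shows "deriv (deriv \<phi>) x = - (1 / (g - x)\<^sup>2)"
proof -
  define W where "W = U \<inter> {..<g}"
  have W: "open W" "x \<in> W" unfolding W_def using assms by auto
  have d1: "deriv \<phi> y = - (1 / (g - y))" if "y \<in> W" for y
  proof (rule DERIV_imp_deriv, rule has_field_derivative_transform_within_open[OF _ W(1) that])
    show "((\<lambda>y. ln (g - y)) has_field_derivative - (1 / (g - y))) (at y)"
      using that unfolding W_def by (auto intro!: derivative_eq_intros)
    show "ln (g - z) = \<phi> z" if "z \<in> W" for z using that \<phi> unfolding W_def by simp
  qed
  show ?thesis
  proof (rule DERIV_imp_deriv, rule has_field_derivative_transform_within_open[OF _ W])
    show "((\<lambda>y. - (1 / (g - y))) has_field_derivative - (1 / (g - x)\<^sup>2)) (at x)"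
      using assms(3) by (auto intro!: derivative_eq_intros simp: power2_eq_square divide_simps)
    show "- (1 / (g - z)) = deriv \<phi> z" if "z \<in> W" for z using d1[OF that] by simp
  qed
qed

section \<open>From deterministic spectra to the random matrix\<close>

context spherical_model begin

definition rigid_event :: "(nat \<Rightarrow> 'a measure) \<Rightarrow> (nat \<Rightarrow> 'a \<Rightarrow> real mat) \<Rightarrow> nat \<Rightarrow> 'a set" where
  "rigid_event P M N = {\<omega> \<in> space (P N). rigid N (eig (M N \<omega>))}"

lemma rigid_event_prob:
  assumes "random_symmetric_matrices P M" "rigidity P M \<nu> Cp"
  shows "rigid_event P M N \<in> sets (P N)" "(\<lambda>N. measure (P N) (space (P N) - rigid_event P M N)) \<longlonglongrightarrow> 0"
  unfolding rigid_event_def rigid_def by (rule rigidity_event[OF assms])+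

lemma rigid_event_good:
  assumes M: "random_symmetric_matrices P M" and w: "\<omega> \<in> rigid_event P M N"
  shows "good N (eig (M N \<omega>))" "free_energy f \<beta> (M N \<omega>) = 1 / real N * logZ N (eig (M N \<omega>))"
proof -
  have r: "rigid N (eig (M N \<omega>))" and "\<omega> \<in> space (P N)" using w unfolding rigid_event_def by auto
  then have A: "M N \<omega> \<in> carrier_mat N N" "transpose_mat (M N \<omega>) = M N \<omega>"
    using M unfolding random_symmetric_matrices_def by auto
  show "good N (eig (M N \<omega>))"
    unfolding good_def using r char_poly_eig(2)[OF A, of 1] by auto
  show "free_energy f \<beta> (M N \<omega>) = 1 / real N * logZ N (eig (M N \<omega>))"
    by (rule free_energy_diagonal[OF A])
qed

lemma limit_free_energy_bulk:
  assumes "\<beta> * \<tau>c \<le> beta_c \<nu> Cm Cp" shows "limit_free_energy f \<nu> Cm Cp \<beta> = bulk_energy"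
proof -
  have "(LINT x:{Cm..Cp}|\<nu>. ln (g - x)) = (LINT x|\<nu>. ln (g - x))" for g
    by (rule set_integral_support) simp
  then show ?thesis using assms unfolding limit_free_energy_def beta_star_cases bulk_energy_def by simp
qed

text \<open>At equality the saddle point is \<open>Cp\<close> itself and the two formulas coincide,
  so the edge form is valid on the closed range.\<close>

lemma limit_free_energy_edge:
  assumes "\<beta> * \<tau>c \<ge> beta_c \<nu> Cm Cp" shows "limit_free_energy f \<nu> Cm Cp \<beta> = edge_energy"
proof (cases "\<beta> * \<tau>c = beta_c \<nu> Cm Cp")
  case True
  show ?thesis
    unfolding limit_free_energy_bulk[OF eq_refl[OF True]] bulk_energy_def edge_energy_def
    by (simp only: gamma_hat_critical[OF True])
next
  case False
  have "(LINT x:{Cm..Cp}|\<nu>. ln (Cp - x)) = (LINT x|\<nu>. ln (Cp - x))"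
    by (rule set_integral_support) simp
  then show ?thesis using assms False unfolding limit_free_energy_def beta_star_cases edge_energy_def by simp
qed

lemma free_energy_law_of_large_numbers:
  assumes M: "random_symmetric_matrices P M" and r: "rigidity P M \<nu> Cp"
    and hol: "holomorphic_extension_near f {0..} {saddle f \<nu> Cm Cp \<beta>}"
  shows "conv_in_prob P (\<lambda>N \<omega>. free_energy f \<beta> (M N \<omega>)) (limit_free_energy f \<nu> Cm Cp \<beta>)"
proof (rule conv_in_prob_on_events[OF _ measurable_free_energy[OF M] rigid_event_prob[OF M r]])
  show "prob_space (P N)" for N using M unfolding random_symmetric_matrices_def by blast
  fix \<epsilon> :: real assume e: "\<epsilon> > 0"
  have "\<forall>\<^sub>F N in sequentially. \<forall>l. good N l \<longrightarrow> \<bar>1 / real N * logZ N l - limit_free_energy f \<nu> Cm Cp \<beta>\<bar> \<le> \<epsilon>"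
  proof (cases "\<beta> * \<tau>c < beta_c \<nu> Cm Cp")
    case True
    then have "holomorphic_extension_near f {0..} {tau f \<gamma>h}"
      using hol unfolding saddle_def beta_star_cases by simp
    from bulk_free_energy[OF True this e] show ?thesis
      unfolding limit_free_energy_bulk[OF less_imp_le[OF True]] .
  next
    case False
    then have c: "\<beta> * \<tau>c \<ge> beta_c \<nu> Cm Cp" by simp
    show ?thesis using edge_free_energy[OF c e] unfolding limit_free_energy_edge[OF c] .
  qed
  then show "\<forall>\<^sub>F N in sequentially. \<forall>\<omega>\<in>rigid_event P M N. \<bar>free_energy f \<beta> (M N \<omega>) - limit_free_energy f \<nu> Cm Cp \<beta>\<bar> \<le> \<epsilon>"
    by eventually_elim (use rigid_event_good[OF M] in auto)
qed

lemma free_energy_tracy_widom: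
  assumes M: "random_symmetric_matrices P M" and r: "rigidity P M \<nu> Cp"
    and tw: "tracy_widom_limit P M Cp s" and sup: "\<beta> * \<tau>c > beta_c \<nu> Cm Cp"
  shows "conv_in_distr P (\<lambda>N \<omega>. (s * pi * real N) powr (2 / 3) / (\<beta> * \<tau>c - beta_c \<nu> Cm Cp)
    * (free_energy f \<beta> (M N \<omega>) - limit_free_energy f \<nu> Cm Cp \<beta>)) TW1"
proof (rule conv_in_distr_affine_on_events[OF _ tw[unfolded tracy_widom_limit_def] _ rigid_event_prob[OF M r],
      where a = 1 and b = 0])
  note [measurable] = measurable_free_energy[OF M]
  show "prob_space (P N)" for N using M unfolding random_symmetric_matrices_def by blast
  show "(\<lambda>\<omega>. (s * pi * real N) powr (2 / 3) / (\<beta> * \<tau>c - beta_c \<nu> Cm Cp)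
    * (free_energy f \<beta> (M N \<omega>) - limit_free_energy f \<nu> Cm Cp \<beta>)) \<in> borel_measurable (P N)" for N
    by measurable
  show "real_distribution TW1" using tw unfolding tracy_widom_limit_def conv_in_distr_def by blast
  show "char TW1 t = iexp (t * 0) * char TW1 (1 * t)" for t by simp
  fix \<epsilon> :: real assume e: "\<epsilon> > 0"
  show "\<forall>\<^sub>F N in sequentially. \<forall>\<omega>\<in>rigid_event P M N.
    \<bar>(s * pi * real N) powr (2 / 3) / (\<beta> * \<tau>c - beta_c \<nu> Cm Cp)
      * (free_energy f \<beta> (M N \<omega>) - limit_free_energy f \<nu> Cm Cp \<beta>)
     - (1 * ((s * pi) powr (2 / 3) * real N powr (2 / 3) * (eig (M N \<omega>) 1 - Cp)) + 0)\<bar> \<le> \<epsilon>"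
    using edge_fluctuation[OF sup e]
  proof eventually_elim
    case (elim N)
    show ?case
      unfolding limit_free_energy_edge[OF less_imp_le[OF sup]] mult_1 add_0_right
      using elim rigid_event_good[OF M] by metis
  qed
qed

text \<open>By \<open>logZ_bulk\<close> the scaled difference is -1/2 times the linear statistic of
  the logarithm plus a term with a deterministic limit, which is the affine situation with factor
  -1/2. The factor 1/4 in the variance is its square.\<close>

lemma free_energy_gaussian:
  assumes M: "random_symmetric_matrices P M" and r: "rigidity P M \<nu> Cp"
    and ls: "linear_statistics P M \<nu> Cm Cp Mean Var" and sub: "\<beta> * \<tau>c < beta_c \<nu> Cm Cp"
    and hol: "holomorphic_extension_near f {0..} {tau f \<gamma>h}"
    and \<phi>: "test_fun Cm Cp \<phi>" and U: "open U" "{Cm..Cp} \<subseteq> U" "\<And>x. x \<in> U \<Longrightarrow> \<phi> x = ln (\<gamma>h - x)"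
  shows "conv_in_distr P (\<lambda>N \<omega>. real N * (free_energy f \<beta> (M N \<omega>) - limit_free_energy f \<nu> Cm Cp \<beta>))
    (gaussian (- 1 / 2 * Mean \<phi> - 1 / 2 * ln (1 - deriv (deriv f) (tau f \<gamma>h) / (2 * \<beta>)
        * (LINT x:{Cm..Cp}|\<nu>. deriv (deriv \<phi>) x))) (1 / 4 * Var \<phi>))"
proof -
  have g: "\<gamma>h > Cp" by (rule gamma_hat_gt[OF sub])
  define L where "L = ln (1 + deriv (deriv f) (tau f \<gamma>h) / (2 * \<beta>) * curvature)"
  have "(LINT x:{Cm..Cp}|\<nu>. deriv (deriv \<phi>) x) = (LINT x:{Cm..Cp}|\<nu>. - (1 / (\<gamma>h - x)\<^sup>2))"
    using second_derivative_ln_diff[OF U(1) _ _ U(3)] U(2) g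
    by (intro set_lebesgue_integral_cong) auto
  also have "\<dots> = (LINT x|\<nu>. - (1 / (\<gamma>h - x)\<^sup>2))" by (rule set_integral_support) simp
  also have "\<dots> = - curvature" unfolding curvature_def by (rule integral_minus)
  finally have curv: "(LINT x:{Cm..Cp}|\<nu>. deriv (deriv \<phi>) x) = - curvature" .
  have "(LINT x:{Cm..Cp}|\<nu>. \<phi> x) = (LINT x:{Cm..Cp}|\<nu>. ln (\<gamma>h - x))"
    using U(2,3) by (intro set_lebesgue_integral_cong) auto
  also have "\<dots> = (LINT x|\<nu>. ln (\<gamma>h - x))" by (rule set_integral_support) simp
  finally have int: "(LINT x:{Cm..Cp}|\<nu>. \<phi> x) = (LINT x|\<nu>. ln (\<gamma>h - x))" .
  \<comment> \<open>A collar of uniform width around the support inside \<open>U\<close>. Rigid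
    eigenvalues lie in it for large N, and there \<phi> is the logarithm.\<close>
  obtain e where e: "e > 0" "(\<Union>x\<in>{Cm..Cp}. cball x e) \<subseteq> U"
    using compact_subset_open_imp_cball_epsilon_subset[OF compact_Icc U(1,2)] by blast
  have inU: "y \<in> U" if "Cm - e < y" "y < Cp + e" for y
  proof -
    have "max Cm (min Cp y) \<in> {Cm..Cp}" "y \<in> cball (max Cm (min Cp y)) e"
      using that e(1) Cm_less_Cp by (auto simp: dist_real_def)
    then show ?thesis using e(2) by blast
  qed
  have v: "Var \<phi> \<ge> 0" and X: "conv_in_distr P
      (\<lambda>N \<omega>. (\<Sum>i=1..N. \<phi> (eig (M N \<omega>) i)) - real N * (LINT x|\<nu>. ln (\<gamma>h - x))) (gaussian (Mean \<phi>) (Var \<phi>))"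
    using ls \<phi> unfolding linear_statistics_def int[symmetric] by auto
  have mean: "- 1 / 2 * Mean \<phi> - 1 / 2 * ln (1 - deriv (deriv f) (tau f \<gamma>h) / (2 * \<beta>) * - curvature)
      = - 1/2 * Mean \<phi> + - 1/2 * L" unfolding L_def by simp
  show ?thesis
    unfolding curv mean
  proof (rule conv_in_distr_affine_on_events[OF _ X _ rigid_event_prob[OF M r], where a = "- 1/2" and b = "- 1/2 * L"])
    note [measurable] = measurable_free_energy[OF M]
    show "prob_space (P N)" for N using M unfolding random_symmetric_matrices_def by blast
    show "(\<lambda>\<omega>. real N * (free_energy f \<beta> (M N \<omega>) - limit_free_energy f \<nu> Cm Cp \<beta>)) \<in> borel_measurable (P N)" for N
      by measurable
    show "real_distribution (gaussian (- 1/2 * Mean \<phi> + - 1/2 * L) (1 / 4 * Var \<phi>))"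
      by (rule real_distribution_gaussian)
    fix t
    have "iexp (t * (- 1/2 * Mean \<phi> + - 1/2 * L)) = iexp (t * (- 1/2 * L)) * iexp ((- 1/2 * t) * Mean \<phi>)"
      by (simp add: exp_add[symmetric] algebra_simps)
    moreover have "t\<^sup>2 * (1 / 4 * Var \<phi>) = (- 1/2 * t)\<^sup>2 * Var \<phi>" by (simp add: power2_eq_square)
    ultimately show "char (gaussian (- 1/2 * Mean \<phi> + - 1/2 * L) (1 / 4 * Var \<phi>)) t
        = iexp (t * (- 1/2 * L)) * char (gaussian (Mean \<phi>) (Var \<phi>)) (- 1/2 * t)"
      using v by (simp only: char_gaussian mult.assoc)
  next
    fix \<epsilon> :: real assume e0: "\<epsilon> > 0"
    show "\<forall>\<^sub>F N in sequentially. \<forall>\<omega>\<in>rigid_event P M N.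
      \<bar>real N * (free_energy f \<beta> (M N \<omega>) - limit_free_energy f \<nu> Cm Cp \<beta>)
        - (- 1/2 * ((\<Sum>i=1..N. \<phi> (eig (M N \<omega>) i)) - real N * (LINT x|\<nu>. ln (\<gamma>h - x))) + - 1/2 * L)\<bar> \<le> \<epsilon>"
      using powr_le_eventually[OF e(1)] logZ_bulk[OF sub] tilt_uniform_limit[OF sub hol e0] eventually_ge_at_top[of 1]
    proof eventually_elim
      case (elim N)
      show ?case
      proof
        fix \<omega> assume w: "\<omega> \<in> rigid_event P M N"
        define l where "l = eig (M N \<omega>)"
        have l: "rigid N l" and F: "free_energy f \<beta> (M N \<omega>) = 1 / real N * logZ N l"
          using rigid_event_good[OF M w] unfolding good_def l_def by auto
        have "(\<Sum>i=1..N. \<phi> (l i)) = (\<Sum>i=1..N. ln (\<gamma>h - l i))"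
        proof (rule sum.cong[OF refl])
          fix i assume "i \<in> {1..N}"
          then have "Cm - real N powr (- 37/60) < l i" "l i < Cp + real N powr (- 37/60)"
            using rigid_range[OF l, of i] by auto
          then show "\<phi> (l i) = ln (\<gamma>h - l i)" using elim(1) by (intro U(3) inU) linarith+
        qed
        moreover have "logZ N l = real N * bulk_energy - 1/2 * ((\<Sum>k=1..N. ln (\<gamma>h - l k)) - real N * (LINT x|\<nu>. ln (\<gamma>h - x)))
            + ln (tiltE N \<gamma>h l)" using elim(2) l by blast
        moreover have "n * (1 / n * (n * b - 1/2 * q + t) - b) - (- 1/2 * q + - 1/2 * L) = t + 1/2 * L"
          if "n > 0" for n b q t :: real using that by (simp add: field_simps)
        moreover have "\<bar>ln (tiltE N \<gamma>h l) + 1/2 * L\<bar> \<le> \<epsilon>" using elim(3) l unfolding L_def by blast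
        moreover have "real N > 0" using elim(4) by simp
        ultimately show "\<bar>real N * (free_energy f \<beta> (M N \<omega>) - limit_free_energy f \<nu> Cm Cp \<beta>)
          - (- 1/2 * ((\<Sum>i=1..N. \<phi> (eig (M N \<omega>) i)) - real N * (LINT x|\<nu>. ln (\<gamma>h - x))) + - 1/2 * L)\<bar> \<le> \<epsilon>"
          unfolding F limit_free_energy_bulk[OF less_imp_le[OF sub]] l_def[symmetric] by (simp only:)
      qed
    qed
  qed
qed

end

theorem theorem1p9:
  fixes P :: "nat \<Rightarrow> 'a measure"
    and M :: "nat \<Rightarrow> 'a \<Rightarrow> real mat"
    and \<nu> :: "real measure"
    and Cm Cp s :: real
    and Mean Var :: "(real \<Rightarrow> real) \<Rightarrow> real"
    and f :: "real \<Rightarrow> real"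
    and \<beta> :: real
  assumes "random_symmetric_matrices P M"
    and "regularity_of_measure P M \<nu> Cm Cp s"
    and "rigidity P M \<nu> Cp"
    and "linear_statistics P M \<nu> Cm Cp Mean Var"
    and "tracy_widom_limit P M Cp s"
    and "strongly_convex_on {0..} f"
    and "C1_on_nonneg f"
    and "filterlim (\<lambda>x. f x / x) at_top at_top"
    and "\<beta> > 0"
    and "holomorphic_extension_near f {0..} {saddle f \<nu> Cm Cp \<beta>}"
  shows
    "conv_in_prob P (\<lambda>N \<omega>. free_energy f \<beta> (M N \<omega>)) (limit_free_energy f \<nu> Cm Cp \<beta>)
     \<and> (ereal \<beta> < beta_star f \<nu> Cm Cp \<longrightarrow>
          (\<forall>\<phi> U. test_fun Cm Cp \<phi> \<and> open U \<and> {Cm..Cp} \<subseteq> U \<and>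
                 (\<forall>x\<in>U. \<phi> x = ln (gamma_hat f \<nu> Cm Cp \<beta> - x)) \<longrightarrow>
             conv_in_distr P
               (\<lambda>N \<omega>. real N * (free_energy f \<beta> (M N \<omega>) - limit_free_energy f \<nu> Cm Cp \<beta>))
               (gaussian
                 (- 1 / 2 * Mean \<phi>
                  - 1 / 2 * ln (1 - deriv (deriv f) (tau f (gamma_hat f \<nu> Cm Cp \<beta>)) / (2 * \<beta>)
                                    * (LINT x:{Cm..Cp}|\<nu>. deriv (deriv \<phi>) x)))
                 (1 / 4 * Var \<phi>))))
     \<and> (ereal \<beta> > beta_star f \<nu> Cm Cp \<longrightarrow>
          conv_in_distr P
            (\<lambda>N \<omega>. (s * pi * real N) powr (2 / 3) / (\<beta> * tau f Cp - beta_c \<nu> Cm Cp)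
                     * (free_energy f \<beta> (M N \<omega>) - limit_free_energy f \<nu> Cm Cp \<beta>))
            TW1)"
proof -
  from conjunct2[OF assms(3)[unfolded rigidity_def]]
  obtain C where C: "C > 1" "\<forall>N. \<forall>k\<in>{1..N}.
        inverse C * real k powr (2 / 3) * real N powr (- 2 / 3) \<le> Cp - classical_location \<nu> N k \<and>
        Cp - classical_location \<nu> N k \<le> C * real k powr (2 / 3) * real N powr (- 2 / 3)"
    by (elim exE conjE) (rule that)
  interpret edge_law \<nu> Cm Cp s
    by (rule edge_law.intro) (rule conjunct1[OF assms(2)[unfolded regularity_of_measure_def]])
  interpret spherical_model \<nu> Cm Cp s C f \<beta>
  proof unfold_locales
    show "1 < C" by (rule C(1))
    show "inverse C * real k powr (2 / 3) * real N powr (- 2 / 3) \<le> Cp - classical_location \<nu> N k \<and>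
        Cp - classical_location \<nu> N k \<le> C * real k powr (2 / 3) * real N powr (- 2 / 3)"
      if "1 \<le> k" "k \<le> N" for N k
      by (rule bspec[OF spec[OF C(2)]]) (use that in simp)
  qed (rule assms)+
  show ?thesis
  proof (intro conjI impI allI)
    show "conv_in_prob P (\<lambda>N \<omega>. free_energy f \<beta> (M N \<omega>)) (limit_free_energy f \<nu> Cm Cp \<beta>)"
      by (rule free_energy_law_of_large_numbers[OF assms(1,3,10)])
  next
    fix \<phi> U
    assume lt: "ereal \<beta> < beta_star f \<nu> Cm Cp"
      and \<phi>: "test_fun Cm Cp \<phi> \<and> open U \<and> {Cm..Cp} \<subseteq> U \<and> (\<forall>x\<in>U. \<phi> x = ln (\<gamma>h - x))"
    have hol: "holomorphic_extension_near f {0..} {tau f \<gamma>h}"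
      using assms(10) unfolding saddle_def if_P[OF lt] .
    have sub: "\<beta> * \<tau>c < beta_c \<nu> Cm Cp" using lt unfolding beta_star_cases .
    have \<phi>': "test_fun Cm Cp \<phi>" "open U" "{Cm..Cp} \<subseteq> U" "\<And>x. x \<in> U \<Longrightarrow> \<phi> x = ln (\<gamma>h - x)"
      using \<phi> by blast+
    show "conv_in_distr P
       (\<lambda>N \<omega>. real N * (free_energy f \<beta> (M N \<omega>) - limit_free_energy f \<nu> Cm Cp \<beta>))
       (gaussian
         (- 1 / 2 * Mean \<phi>
          - 1 / 2 * ln (1 - deriv (deriv f) (tau f \<gamma>h) / (2 * \<beta>)
                            * (LINT x:{Cm..Cp}|\<nu>. deriv (deriv \<phi>) x)))
         (1 / 4 * Var \<phi>))"
      by (rule free_energy_gaussian[OF assms(1,3,4) sub hol \<phi>'])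
  next
    assume "beta_star f \<nu> Cm Cp < ereal \<beta>"
    then have sup: "\<beta> * \<tau>c > beta_c \<nu> Cm Cp"
      unfolding not_le[symmetric] beta_star_cases .
    show "conv_in_distr P
       (\<lambda>N \<omega>. (s * pi * real N) powr (2 / 3) / (\<beta> * \<tau>c - beta_c \<nu> Cm Cp)
          * (free_energy f \<beta> (M N \<omega>) - limit_free_energy f \<nu> Cm Cp \<beta>)) TW1"
      by (rule free_energy_tracy_widom[OF assms(1,3,5) sup])
  qed
qed

end
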